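(* Let $P(D)=\sum_{|\alpha|\le m}a_\alpha D^\alpha$ be a differential operator with constant coefficients on $\mathbf R^d$ and let $f\in\mathscr D'(\mathbf R^d)$. Then, for $s\in[1/2,1)$, $$WF_s(P(D)f)\subset WF_s(f)\subset WF(s,P,f)\cup\operatorname{Char}(P).$$
   Context: Notation: $\langle\xi\rangle=(1+|\xi|^2)^{1/2}$; $\mathbf N$ denotes the nonnegative integers and $\mathbf Z_+$ the positive integers; $D^\alpha=(-i)^{|\alpha|}\partial^\alpha$; the Fourier transform is $(\mathcal Ff)(\xi)=\widehat f(\xi)=(2\pi)^{-d/2}\int f(x)e^{-i\langle x,\xi\rangle}dx$, extended to $\mathscr S'(\mathbf R^d)$. For $x_0\in\mathbf R^d$ and $N\in\mathbf Z_+$, $E_{x_0,N}(x)=e^{-|x-x_0|^2/(4N)}$. An open cone is an open subset of $\mathbf R^d\setminus\{0\}$ invariant under multiplication by positive reals. The convention $0^0=1$ is used. Relation: for distributions $f,g$ defined near $x_0$, $f\sim_{x_0}g$ means that $f=g$ in an open neighborhood of $x_0$. Wave-front set: let $s\in[1/2,1)$ and $f\in\mathscr D'(\mathbf R^d)$. A point $(x_0,\xi_0)\in\mathbf R^d\times(\mathbf R^d\setminus\{0\})$ is a Gevrey regular point of order $s$ for $f$ if there exist $g\in\mathscr S'(\mathbf R^d)$, an open cone $\Gamma$ containing $\xi_0$, $C>0$ and $N_0\in\mathbf Z_+$ such that $f\sim_{x_0}g$ and, for every integer $N\ge N_0$, $|(\mathcal F(g\,E_{x_0,N}))(\xi)|\le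 C^{n+1}n^{sn}\langle\xi\rangle^{-n}$ for all $\xi\in\Gamma$ and all $n\in\mathbf N$ with $n\le N$. The set $WF_s(f)$ is the complement in $\mathbf R^d\times(\mathbf R^d\setminus\{0\})$ of the set of Gevrey regular points of order $s$ for $f$. Characteristic set: $P_m(\xi)=\sum_{|\alpha|=m}a_\alpha\xi^\alpha$ is the principal symbol of $P(D)$ and $\operatorname{Char}(P)=\{(x,\xi)\in\mathbf R^d\times(\mathbf R^d\setminus\{0\}) : P_m(\xi)=0\}$. The set $WF(s,P,f)$: $\operatorname{Reg}(s,P,f)$ consists of all $(x_0,\xi_0)\in\mathbf R^d\times(\mathbf R^d\setminus\{0\})$ such that for some $g\in\mathscr S'(\mathbf R^d)$ the following hold: (1) $f\sim_{x_0}g$ and $\|\widehat g(\xi)\langle\xi\rangle^{-M}\|_{L^\infty}<\infty$ for some $M>0$; (2) for some open conical neighborhood $\Gamma$ of $\xi_0$, some $N_0\in\mathbf Z_+$ and some $C>0$, for every integer $N\ge N_0$, $|(\mathcal F((P(D)g)\,E_{x_0,N}))(\xi)|\le C^{n+1}n^{sn}\langle\xi\rangle^{-n}$ for all $\xi\in\Gamma$ and all $n\in\mathbf N$ with $n\le N$. Then $WF(s,P,f)$ is the complement of $\operatorname{Reg}(s,P,f)$ in $\mathbf R^d\times(\mathbf R^d\setminus\{0\})$. *)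

theory Defs
  imports "HOL-Analysis.Analysis"
begin

section \<open>Multi-indices and smooth functions\<close>

type_synonym 'n multi_index = "'n \<Rightarrow> nat"

type_synonym 'n cfun = "real ^ 'n \<Rightarrow> complex"

definition mi_size :: "('n::finite) multi_index \<Rightarrow> nat" where
  "mi_size \<alpha> = (\<Sum>i\<in>UNIV. \<alpha> i)"

definition monomial :: "('n::finite) multi_index \<Rightarrow> real ^ 'n \<Rightarrow> real" where
  "monomial \<alpha> x = (\<Prod>i\<in>UNIV. (x $ i) ^ \<alpha> i)"

definition partial_deriv :: "'n::finite \<Rightarrow> 'n cfun \<Rightarrow> 'n cfun" where
  "partial_deriv i f x = vector_derivative (\<lambda>t. f (x + t *\<^sub>R axis i 1)) (at 0)"

text \<open>All iterated partial derivatives, in every order, exist and are (Frechet) differentiable,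
  hence continuous: this is \<open>C\<^sup>\<infinity>(R\<^sup>d)\<close>.\<close>
definition smooth :: "('n::finite) cfun \<Rightarrow> bool" where
  "smooth f \<longleftrightarrow> (\<forall>js x. foldr partial_deriv js f differentiable (at x))"

text \<open>An enumeration of the coordinates. It only fixes the order in which the partial derivatives
  are taken in \<open>\<partial>\<^sup>\<alpha>\<close>, which is immaterial for smooth functions.\<close>
definition coords :: "('n::finite) list" where
  "coords = (SOME js. distinct js \<and> set js = UNIV)"

definition mi_deriv :: "('n::finite) multi_index \<Rightarrow> 'n cfun \<Rightarrow> 'n cfun" where
  "mi_deriv \<alpha> f = foldr (\<lambda>i. partial_deriv i ^^ \<alpha> i) coords f"

definition D_deriv :: "('n::finite) multi_index \<Rightarrow> 'n cfun \<Rightarrow> 'n cfun" where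
  "D_deriv \<alpha> f x = (- \<i>) ^ mi_size \<alpha> * mi_deriv \<alpha> f x"

definition supp :: "('n::finite) cfun \<Rightarrow> (real ^ 'n) set" where
  "supp f = closure {x. f x \<noteq> 0}"

definition test_functions :: "('n::finite) cfun set" where
  "test_functions = {\<phi>. smooth \<phi> \<and> compact (supp \<phi>)}"

definition schwartz_functions :: "('n::finite) cfun set" where
  "schwartz_functions =
     {\<phi>. smooth \<phi> \<and> (\<forall>\<alpha> \<beta>. bounded (range (\<lambda>x. monomial \<alpha> x *\<^sub>R mi_deriv \<beta> \<phi> x)))}"


section \<open>Distributions\<close>

text \<open>A distribution is represented by a functional on all functions, of which only the values on
  test functions (respectively, on Schwartz functions) matter; every operation and relation below
  looks at those values only.\<close>
type_synonym 'n functional = "'n cfun \<Rightarrow> complex"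

definition linear_functional_on :: "('n::finite) cfun set \<Rightarrow> 'n functional \<Rightarrow> bool" where
  "linear_functional_on V u \<longleftrightarrow>
     (\<forall>\<phi>\<in>V. \<forall>\<psi>\<in>V. u (\<lambda>x. \<phi> x + \<psi> x) = u \<phi> + u \<psi>) \<and>
     (\<forall>\<phi>\<in>V. \<forall>c. u (\<lambda>x. c * \<phi> x) = c * u \<phi>)"

definition distributions :: "('n::finite) functional set" where
  "distributions = {u. linear_functional_on test_functions u \<and>
     (\<forall>K. compact K \<longrightarrow> (\<exists>C k. \<forall>\<phi>\<in>test_functions. supp \<phi> \<subseteq> K \<longrightarrow>
        cmod (u \<phi>) \<le> C * (\<Sum>\<alpha> | mi_size \<alpha> \<le> k. SUP x. cmod (mi_deriv \<alpha> \<phi> x))))}"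

definition tempered_distributions :: "('n::finite) functional set" where
  "tempered_distributions = {u. linear_functional_on schwartz_functions u \<and>
     (\<exists>C k. \<forall>\<phi>\<in>schwartz_functions.
        cmod (u \<phi>) \<le> C * (\<Sum>\<alpha> | mi_size \<alpha> \<le> k. \<Sum>\<beta> | mi_size \<beta> \<le> k.
                              SUP x. cmod (monomial \<alpha> x *\<^sub>R mi_deriv \<beta> \<phi> x)))}"

definition locally_equal :: "real ^ 'n \<Rightarrow> ('n::finite) functional \<Rightarrow> 'n functional \<Rightarrow> bool" where
  "locally_equal x0 f g \<longleftrightarrow>
     (\<exists>U. open U \<and> x0 \<in> U \<and> (\<forall>\<phi>\<in>test_functions. supp \<phi> \<subseteq> U \<longrightarrow> f \<phi> = g \<phi>))"

text \<open>The distribution \<open>u\<close> is the function \<open>h\<close>.\<close>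
definition is_function :: "('n::finite) functional \<Rightarrow> 'n cfun \<Rightarrow> bool" where
  "is_function u h \<longleftrightarrow> h \<in> borel_measurable lborel \<and>
     (\<forall>\<phi>\<in>schwartz_functions. has_bochner_integral lborel (\<lambda>x. h x * \<phi> x) (u \<phi>))"

definition mult_dist :: "('n::finite) functional \<Rightarrow> 'n cfun \<Rightarrow> 'n functional" where
  "mult_dist u e \<phi> = u (\<lambda>x. e x * \<phi> x)"

definition D_dist :: "('n::finite) multi_index \<Rightarrow> 'n functional \<Rightarrow> 'n functional" where
  "D_dist \<alpha> u \<phi> = (- 1) ^ mi_size \<alpha> * u (D_deriv \<alpha> \<phi>)"

definition fourier_fun :: "('n::finite) cfun \<Rightarrow> 'n cfun" where
  "fourier_fun \<phi> \<xi> = of_real ((2 * pi) powr (- real CARD('n) / 2)) *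
     (LINT x|lborel. \<phi> x * exp (- \<i> * of_real (x \<bullet> \<xi>)))"

definition fourier :: "('n::finite) functional \<Rightarrow> 'n functional" where
  "fourier u \<phi> = u (fourier_fun \<phi>)"


section \<open>Constant coefficient differential operators\<close>

text \<open>An operator \<open>P(D) = \<Sum>\<^sub>|\<^sub>\<alpha>\<^sub>|\<^sub>\<le>\<^sub>m a\<^sub>\<alpha> D\<^sup>\<alpha>\<close> is given by the pair of \<open>m\<close> and the family \<open>a\<close>;
  the values of \<open>a\<close> on multi-indices of size greater than \<open>m\<close> are ignored.\<close>
definition PD :: "nat \<Rightarrow> (('n::finite) multi_index \<Rightarrow> complex) \<Rightarrow> 'n functional \<Rightarrow> 'n functional" where
  "PD m a u \<phi> = (\<Sum>\<alpha> | mi_size \<alpha> \<le> m. a \<alpha> * D_dist \<alpha> u \<phi>)"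

definition principal_symbol :: "nat \<Rightarrow> (('n::finite) multi_index \<Rightarrow> complex) \<Rightarrow> 'n cfun" where
  "principal_symbol m a \<xi> = (\<Sum>\<alpha> | mi_size \<alpha> = m. a \<alpha> * of_real (monomial \<alpha> \<xi>))"

definition Char_set ::
  "nat \<Rightarrow> (('n::finite) multi_index \<Rightarrow> complex) \<Rightarrow> ((real ^ 'n) \<times> (real ^ 'n)) set" where
  "Char_set m a = {(x, \<xi>). \<xi> \<noteq> 0 \<and> principal_symbol m a \<xi> = 0}"


section \<open>Wave-front sets\<close>

definition jap :: "real ^ 'n::finite \<Rightarrow> real" where
  "jap \<xi> = sqrt (1 + (norm \<xi>)\<^sup>2)"

definition gauss :: "real ^ 'n::finite \<Rightarrow> nat \<Rightarrow> 'n cfun" where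
  "gauss x0 N x = of_real (exp (- (norm (x - x0))\<^sup>2 / (4 * real N)))"

definition open_cone :: "(real ^ 'n::finite) set \<Rightarrow> bool" where
  "open_cone \<Gamma> \<longleftrightarrow> open \<Gamma> \<and> 0 \<notin> \<Gamma> \<and> (\<forall>\<xi>\<in>\<Gamma>. \<forall>t>0. t *\<^sub>R \<xi> \<in> \<Gamma>)"

text \<open>\<open>n\<^sup>s\<^sup>n\<close> with the convention \<open>0\<^sup>0 = 1\<close>; note that \<open>0 powr 0 = 0\<close> in HOL.\<close>
definition gevrey_weight :: "real \<Rightarrow> nat \<Rightarrow> real" where
  "gevrey_weight s n = (if n = 0 then 1 else real n powr (s * real n))"

text \<open>The pointwise values of the Fourier transform of \<open>u E\<^sub>x\<^sub>0\<^sub>,\<^sub>N\<close> are those of the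
  (necessarily unique) continuous function \<open>h\<close> which it is.\<close>
definition gevrey_decay ::
  "real \<Rightarrow> ('n::finite) functional \<Rightarrow> real ^ 'n \<Rightarrow> real ^ 'n \<Rightarrow> bool" where
  "gevrey_decay s u x0 \<xi>0 \<longleftrightarrow>
     (\<exists>\<Gamma> C N0. open_cone \<Gamma> \<and> \<xi>0 \<in> \<Gamma> \<and> C > 0 \<and> N0 > 0 \<and>
        (\<forall>N\<ge>N0. \<exists>h. continuous_on UNIV h \<and> is_function (fourier (mult_dist u (gauss x0 N))) h \<and>
           (\<forall>\<xi>\<in>\<Gamma>. \<forall>n\<le>N. cmod (h \<xi>) \<le> C ^ (n + 1) * gevrey_weight s n / jap \<xi> ^ n)))"

definition gevrey_regular ::
  "real \<Rightarrow> ('n::finite) functional \<Rightarrow> real ^ 'n \<Rightarrow> real ^ 'n \<Rightarrow> bool" where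
  "gevrey_regular s f x0 \<xi>0 \<longleftrightarrow>
     (\<exists>g\<in>tempered_distributions. locally_equal x0 f g \<and> gevrey_decay s g x0 \<xi>0)"

definition WF :: "real \<Rightarrow> ('n::finite) functional \<Rightarrow> ((real ^ 'n) \<times> (real ^ 'n)) set" where
  "WF s f = {(x0, \<xi>0). \<xi>0 \<noteq> 0 \<and> \<not> gevrey_regular s f x0 \<xi>0}"

text \<open>The Fourier transform of \<open>g\<close> is a function \<open>h\<close> such that \<open>h(\<xi>) \<langle>\<xi>\<rangle>\<^sup>-\<^sup>M\<close> is
  essentially bounded.\<close>
definition fourier_poly_bounded :: "('n::finite) functional \<Rightarrow> bool" where
  "fourier_poly_bounded g \<longleftrightarrow>
     (\<exists>h M B. M > 0 \<and> is_function (fourier g) h \<and>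
        (AE \<xi> in lborel. cmod (h \<xi>) * jap \<xi> powr (- M) \<le> B))"

definition Reg_P ::
  "real \<Rightarrow> nat \<Rightarrow> (('n::finite) multi_index \<Rightarrow> complex) \<Rightarrow> 'n functional \<Rightarrow>
   ((real ^ 'n) \<times> (real ^ 'n)) set" where
  "Reg_P s m a f = {(x0, \<xi>0). \<xi>0 \<noteq> 0 \<and>
     (\<exists>g\<in>tempered_distributions. locally_equal x0 f g \<and> fourier_poly_bounded g \<and>
        gevrey_decay s (PD m a g) x0 \<xi>0)}"

definition WF_P ::
  "real \<Rightarrow> nat \<Rightarrow> (('n::finite) multi_index \<Rightarrow> complex) \<Rightarrow> 'n functional \<Rightarrow>
   ((real ^ 'n) \<times> (real ^ 'n)) set" where
  "WF_P s m a f = {(x0, \<xi>0). \<xi>0 \<noteq> 0} - Reg_P s m a f"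

end

(* Write E_N for the Gaussian of parameter N centred at x0. Since E_N is the product of two copies of
   E_2N, the Fourier transform H_N of u E_N is the convolution of H_2N with a modulated heat kernel
   of width about N^(-1/2); if the Fourier transform h of u is a function, H_N is the same kind of
   Gaussian average of h. Decay in a cone is propagated through these averages by means of the weight
   max(1, distance to the complement of the cone): it is comparable to the Japanese bracket on
   smaller cones and varies slowly, and exchanging its k-th power at two points costs only
   exp(k^2 / 4N) under the kernel, which is harmless for k of the order of N.

   For a derivative of u, H_N is replaced by a combination of first moments of H_2N. Outside the cone
   H_2N is bounded by a power of N only, which the kernel absorbs at points whose distance from the
   complement of the cone is bounded below, and finite differences of H_N handle the points near the
   origin.

   If P is elliptic at xi0, multiplication of h by a coordinate commutes with the average up to a
   first moment of averages with parameter 2N. Hence P(xi) times the average of h is the average of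
   P h, which decays by hypothesis, plus terms of order at most m - 1 in xi; dividing by P(xi) gains
   one factor 1 / |xi|, and induction on the decay order proves the decay of the average of h. *)
theory Submission
  imports Defs "HOL-Probability.Probability" "HOL-Complex_Analysis.Complex_Analysis"
begin

text \<open>The constant of a decay estimate is fixed before \<open>N\<close>, whereas temperedness
  bounds the Fourier transform of \<open>u\<close> times a Gaussian only by powers of
  \<open>N\<close> and of the frequency. Two devices remove these powers. A power \<open>p\<close>
  of the bracket is paid for by using the decay order \<open>n + p\<close> in place of
  \<open>n\<close>: averaging refers from \<open>N\<close> back to \<open>2 * N\<close>, where
  orders up to \<open>2 * N\<close> are at hand, and a fixed shift of the order changes the Gevrey
  weight by a geometric factor only. At low frequencies a power of \<open>N\<close> is beaten by the
  width of the kernel: a first moment of the kernel is its derivative divided by a multiple of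
  \<open>N\<close>, so a difference formula with step \<open>1 / N\<close> produces it without any
  division, and a formula of high order leaves a remainder smaller than the given power of
  \<open>N\<close>.

  The weight is 1 off the cone, so that an estimate in a cone becomes one on the whole space. This
  closes the induction on the decay order without narrowing the cone at each step; the passage to a
  narrower cone happens once, when the weight is finally compared with the bracket.\<close>

section \<open>Calculus of partial derivatives\<close>

text \<open>Words in the coordinates replace multi-indices, so that an induction removes one
  derivative at a time. Reordering a word, which rests on the symmetry of second derivatives, is
  settled in \<open>pdl_mset_cong\<close>.\<close>

definition pdl :: "('n::finite) list \<Rightarrow> 'n cfun \<Rightarrow> 'n cfun" where
  "pdl js f = foldr partial_deriv js f"

lemma pdl_Nil [simp]: "pdl [] f = f"
  and pdl_Cons [simp]: "pdl (j # js) f = partial_deriv j (pdl js f)"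
  and pdl_append: "pdl (js @ ks) f = pdl js (pdl ks f)"
  by (simp_all add: pdl_def)

lemma has_vector_derivative_along_line:
  fixes f :: "'a::real_normed_vector \<Rightarrow> 'b::real_normed_vector"
  assumes "(f has_derivative f') (at (x + t *\<^sub>R v))"
  shows "((\<lambda>s. f (x + s *\<^sub>R v)) has_vector_derivative f' v) (at t)"
proof -
  interpret bounded_linear f' using assms has_derivative_bounded_linear by blast
  have "((\<lambda>s. x + s *\<^sub>R v) has_derivative (\<lambda>s. s *\<^sub>R v)) (at t)"
    by (auto intro!: derivative_eq_intros)
  from has_derivative_compose [OF this assms]
  show ?thesis unfolding has_vector_derivative_def by (simp add: scaleR)
qed

lemma partial_deriv_eq:
  assumes "(f has_derivative f') (at x)"
  shows "partial_deriv i f x = f' (axis i 1)"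
  unfolding partial_deriv_def
  by (rule vector_derivative_at, rule has_vector_derivative_along_line) (use assms in simp)

lemma has_vector_derivative_partial_deriv:
  assumes "f differentiable (at (x + t *\<^sub>R axis i 1))"
  shows "((\<lambda>s. f (x + s *\<^sub>R axis i 1)) has_vector_derivative
    partial_deriv i f (x + t *\<^sub>R axis i 1)) (at t)"
proof -
  obtain f' where f': "(f has_derivative f') (at (x + t *\<^sub>R axis i 1))"
    using assms differentiable_def by blast
  show ?thesis
    using has_vector_derivative_along_line [OF f'] partial_deriv_eq [OF f'] by simp
qed

lemma partial_deriv_const [simp]: "partial_deriv i (\<lambda>x. c) = (\<lambda>x. 0)"
  by (rule ext, subst partial_deriv_eq) (auto intro: derivative_eq_intros)

lemma partial_deriv_add:
  assumes "f differentiable (at x)" "g differentiable (at x)"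
  shows "partial_deriv i (\<lambda>x. f x + g x) x = partial_deriv i f x + partial_deriv i g x"
proof -
  obtain f' g' where d: "(f has_derivative f') (at x)" "(g has_derivative g') (at x)"
    using assms differentiable_def by blast
  show ?thesis
    using partial_deriv_eq [OF has_derivative_add [OF d]] partial_deriv_eq [OF d(1)]
      partial_deriv_eq [OF d(2)] by simp
qed

lemma partial_deriv_mult:
  assumes "f differentiable (at x)" "g differentiable (at x)"
  shows "partial_deriv i (\<lambda>x. f x * g x) x = f x * partial_deriv i g x + partial_deriv i f x * g x"
proof -
  obtain f' g' where d: "(f has_derivative f') (at x)" "(g has_derivative g') (at x)"
    using assms differentiable_def by blast
  show ?thesis
    using partial_deriv_eq [OF has_derivative_mult [OF d]] partial_deriv_eq [OF d(1)]
      partial_deriv_eq [OF d(2)] by simp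
qed

lemma smooth_pdl: "smooth f \<longleftrightarrow> (\<forall>js x. pdl js f differentiable (at x))"
  by (simp add: smooth_def pdl_def)

lemma smooth_differentiable: "smooth f \<Longrightarrow> f differentiable (at x)"
  using smooth_pdl [of f] pdl_Nil by metis

lemma smooth_partial_deriv: "smooth f \<Longrightarrow> smooth (partial_deriv i f)"
  unfolding smooth_pdl by (metis pdl_append pdl_Cons pdl_Nil)

lemma smooth_pdl_closed: "smooth f \<Longrightarrow> smooth (pdl js f)"
  by (induction js) (auto simp: smooth_partial_deriv)

lemma smooth_continuous: "smooth f \<Longrightarrow> continuous_on A f"
  using smooth_differentiable differentiable_imp_continuous_within
  by (metis continuous_at_imp_continuous_on)

text \<open>A coinduction principle: iterated derivatives are never computed, a set stable under
  partial derivatives is exhibited instead. \<open>schwartz_coinduct\<close> and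
  \<open>moderate_coinduct\<close> follow the same scheme.\<close>

lemma smooth_coinduct:
  assumes "\<And>f x. f \<in> X \<Longrightarrow> f differentiable (at x)"
    and "\<And>f i. f \<in> X \<Longrightarrow> partial_deriv i f \<in> X"
    and "f \<in> X"
  shows "smooth f"
proof -
  have "pdl js f \<in> X" for js by (induction js) (auto simp: assms)
  then show ?thesis unfolding smooth_pdl using assms(1) by blast
qed

lemma smooth_const [simp]: "smooth (\<lambda>x. c)"
  by (rule smooth_coinduct [where X = "range (\<lambda>c x. c)"]) auto

text \<open>The Leibniz rule leads out of the products but not out of their finite sums. This is
  therefore the stable set for products of smooth functions and for Schwartz times moderate
  functions.\<close>

inductive_set sum_prod :: "('n::finite) cfun set \<Rightarrow> 'n cfun set \<Rightarrow> 'n cfun set" for A B where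
  prod: "f \<in> A \<Longrightarrow> g \<in> B \<Longrightarrow> (\<lambda>x. f x * g x) \<in> sum_prod A B"
| add: "f \<in> sum_prod A B \<Longrightarrow> g \<in> sum_prod A B \<Longrightarrow> (\<lambda>x. f x + g x) \<in> sum_prod A B"

lemma sum_prod_partial_deriv:
  assumes A: "\<And>f. f \<in> A \<Longrightarrow> smooth f" "\<And>f i. f \<in> A \<Longrightarrow> partial_deriv i f \<in> A"
    and B: "\<And>f. f \<in> B \<Longrightarrow> smooth f" "\<And>f i. f \<in> B \<Longrightarrow> partial_deriv i f \<in> B"
    and h: "h \<in> sum_prod A B"
  shows "(\<forall>x. h differentiable (at x)) \<and> partial_deriv i h \<in> sum_prod A B"
  using h
proof induction
  case (prod f g)
  have d: "f differentiable (at x)" "g differentiable (at x)" for x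
    using prod A(1) B(1) smooth_differentiable by blast+
  have "partial_deriv i (\<lambda>x. f x * g x) = (\<lambda>x. f x * partial_deriv i g x + partial_deriv i f x * g x)"
    using partial_deriv_mult [OF d] by blast
  then show ?case
    using d prod A B by (auto intro!: sum_prod.intros differentiable_mult)
next
  case (add f g)
  have "partial_deriv i (\<lambda>x. f x + g x) = (\<lambda>x. partial_deriv i f x + partial_deriv i g x)"
    using partial_deriv_add add by blast
  then show ?case using add by (auto intro!: sum_prod.intros)
qed

lemma sum_prod_smooth: "h \<in> sum_prod (Collect smooth) (Collect smooth) \<Longrightarrow> smooth h"
  by (rule smooth_coinduct [where X = "sum_prod (Collect smooth) (Collect smooth)"])
    (use sum_prod_partial_deriv [of "Collect smooth" "Collect smooth"] smooth_partial_deriv in auto)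

lemma smooth_mult: "smooth f \<Longrightarrow> smooth g \<Longrightarrow> smooth (\<lambda>x. f x * g x)"
  by (rule sum_prod_smooth, rule sum_prod.prod) auto

lemma partial_deriv_smooth_add:
  "smooth f \<Longrightarrow> smooth g \<Longrightarrow>
    partial_deriv i (\<lambda>x. f x + g x) = (\<lambda>x. partial_deriv i f x + partial_deriv i g x)"
  using partial_deriv_add smooth_differentiable by blast

lemma partial_deriv_smooth_mult:
  "smooth f \<Longrightarrow> smooth g \<Longrightarrow>
    partial_deriv i (\<lambda>x. f x * g x) = (\<lambda>x. f x * partial_deriv i g x + partial_deriv i f x * g x)"
  using partial_deriv_mult smooth_differentiable by blast

section \<open>Symmetry of second partial derivatives\<close>

lemma mixed_derivatives_equal:
  fixes F A B C D :: "real \<Rightarrow> real \<Rightarrow> real"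
  assumes A: "\<And>s t. ((\<lambda>s. F s t) has_real_derivative A s t) (at s)"
    and B: "\<And>s t. ((\<lambda>t. F s t) has_real_derivative B s t) (at t)"
    and C: "\<And>s t. ((\<lambda>t. A s t) has_real_derivative C s t) (at t)"
    and D: "\<And>s t. ((\<lambda>s. B s t) has_real_derivative D s t) (at s)"
    and cont: "isCont (\<lambda>p. C (fst p) (snd p)) (0,0)" "isCont (\<lambda>p. D (fst p) (snd p)) (0,0)"
  shows "C 0 0 = D 0 0"
proof (rule ccontr)
  assume ne: "C 0 0 \<noteq> D 0 0"
  define e where "e = \<bar>C 0 0 - D 0 0\<bar> / 2"
  have e: "e > 0" using ne by (simp add: e_def)
  obtain d1 where d1: "d1 > 0" "\<And>p. dist p (0,0) < d1 \<Longrightarrow> dist (C (fst p) (snd p)) (C 0 0) < e"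
    using cont(1) e unfolding continuous_at_eps_delta by (metis fst_conv snd_conv)
  obtain d2 where d2: "d2 > 0" "\<And>p. dist p (0,0) < d2 \<Longrightarrow> dist (D (fst p) (snd p)) (D 0 0) < e"
    using cont(2) e unfolding continuous_at_eps_delta by (metis fst_conv snd_conv)
  define h where "h = min d1 d2 / 4"
  have h: "h > 0" using d1 d2 by (simp add: h_def)
  have dist: "dist (s,t) (0,0::real) < min d1 d2" if "0 < s" "s < h" "0 < t" "t < h" for s t :: real
  proof -
    have "dist (s,t) (0,0) \<le> \<bar>s\<bar> + \<bar>t\<bar>"
      unfolding dist_prod_def by (simp add: sqrt_sum_squares_le_sum_abs)
    also have "\<dots> < min d1 d2" using that h by (auto simp: h_def)
    finally show ?thesis .
  qed
  \<comment> \<open>The second difference of \<open>F\<close> over the square of side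
    \<open>h\<close> is evaluated by the mean value theorem in either order: it is
    \<open>h^2\<close> times a value of \<open>C\<close> and also \<open>h^2\<close> times a value
    of \<open>D\<close>, at points so near the origin that each differs by less than
    \<open>e\<close>, half the assumed gap, from its value there.\<close>
  have "\<exists>s. s > 0 \<and> s < h \<and> (F h h - F h 0) - (F 0 h - F 0 0) = (h - 0) * (A s h - A s 0)"
    by (rule MVT2 [OF h]) (auto intro!: derivative_eq_intros A)
  then obtain s where s: "s > 0" "s < h" "(F h h - F h 0) - (F 0 h - F 0 0) = h * (A s h - A s 0)"
    by auto
  have "\<exists>t. t > 0 \<and> t < h \<and> A s h - A s 0 = (h - 0) * C s t"
    by (rule MVT2 [OF h]) (auto intro!: derivative_eq_intros C)
  then obtain t where t: "t > 0" "t < h" "A s h - A s 0 = h * C s t" by auto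
  have "\<exists>t. t > 0 \<and> t < h \<and> (F h h - F 0 h) - (F h 0 - F 0 0) = (h - 0) * (B h t - B 0 t)"
    by (rule MVT2 [OF h]) (auto intro!: derivative_eq_intros B)
  then obtain t' where t': "t' > 0" "t' < h" "(F h h - F 0 h) - (F h 0 - F 0 0) = h * (B h t' - B 0 t')"
    by auto
  have "\<exists>s. s > 0 \<and> s < h \<and> B h t' - B 0 t' = (h - 0) * D s t'"
    by (rule MVT2 [OF h]) (auto intro!: derivative_eq_intros D)
  then obtain s' where s': "s' > 0" "s' < h" "B h t' - B 0 t' = h * D s' t'" by auto
  have "h * (h * C s t) = h * (h * D s' t')"
    using s(3) t'(3) unfolding t(3) s'(3) by linarith
  then have "C s t = D s' t'" using h by simp
  moreover have "dist (C s t) (C 0 0) < e" using d1(2) [of "(s,t)"] dist s t by simp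
  moreover have "dist (D s' t') (D 0 0) < e" using d2(2) [of "(s',t')"] dist s' t' by simp
  ultimately show False unfolding e_def dist_real_def by (auto simp: abs_if split: if_splits)
qed

lemma partial_deriv_commute:
  assumes "smooth f"
  shows "partial_deriv i (partial_deriv j f) = partial_deriv j (partial_deriv i f)"
proof
  fix x
  define X where "X = (\<lambda>s t. x + s *\<^sub>R axis i (1::real) + t *\<^sub>R axis j 1)"
  \<comment> \<open>The mean value theorem is real, so it is applied to real and imaginary parts; a
    general bounded linear \<open>L\<close> treats both at once.\<close>
  have *: "bounded_linear L \<Longrightarrow>
     L (partial_deriv j (partial_deriv i f) x) = L (partial_deriv i (partial_deriv j f) x)"
    for L :: "complex \<Rightarrow> real"
  proof -
    assume L: "bounded_linear L"
    have ds: "((\<lambda>s. L (g (X s t))) has_real_derivative L (partial_deriv i g (X s t))) (at s)"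
      if "smooth g" for g s t
    proof -
      have "((\<lambda>s. g ((x + t *\<^sub>R axis j 1) + s *\<^sub>R axis i 1)) has_vector_derivative
        partial_deriv i g ((x + t *\<^sub>R axis j 1) + s *\<^sub>R axis i 1)) (at s)"
        by (rule has_vector_derivative_partial_deriv) (rule smooth_differentiable [OF that])
      from bounded_linear.has_vector_derivative [OF L this] show ?thesis
        by (simp add: X_def has_real_derivative_iff_has_vector_derivative algebra_simps)
    qed
    have dt: "((\<lambda>t. L (g (X s t))) has_real_derivative L (partial_deriv j g (X s t))) (at t)"
      if "smooth g" for g s t
    proof -
      have "((\<lambda>t. g ((x + s *\<^sub>R axis i 1) + t *\<^sub>R axis j 1)) has_vector_derivative
        partial_deriv j g ((x + s *\<^sub>R axis i 1) + t *\<^sub>R axis j 1)) (at t)"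
        by (rule has_vector_derivative_partial_deriv) (rule smooth_differentiable [OF that])
      from bounded_linear.has_vector_derivative [OF L this] show ?thesis
        by (simp add: X_def has_real_derivative_iff_has_vector_derivative algebra_simps)
    qed
    have cont: "isCont (\<lambda>p. L (g (X (fst p) (snd p)))) (0,0)" if "smooth g" for g
    proof -
      have "continuous_on UNIV (\<lambda>p. X (fst p) (snd p))"
        unfolding X_def by (intro continuous_intros)
      then have "continuous_on UNIV (\<lambda>p. L (g (X (fst p) (snd p))))"
        by (intro bounded_linear.continuous_on [OF L] continuous_on_compose2 [OF smooth_continuous [OF that, of UNIV]])
          auto
      then show ?thesis by (simp add: continuous_on_eq_continuous_at)
    qed
    have s1: "smooth (partial_deriv k f)" "smooth (partial_deriv k (partial_deriv l f))" for k l
      by (simp_all add: assms smooth_partial_deriv)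
    have "L (partial_deriv j (partial_deriv i f) (X 0 0)) = L (partial_deriv i (partial_deriv j f) (X 0 0))"
      by (rule mixed_derivatives_equal [where C = "\<lambda>s t. L (partial_deriv j (partial_deriv i f) (X s t))"
          and D = "\<lambda>s t. L (partial_deriv i (partial_deriv j f) (X s t))",
          OF ds dt dt ds cont cont]) (rule assms s1)+
    then show ?thesis by (simp add: X_def)
  qed
  show "partial_deriv i (partial_deriv j f) x = partial_deriv j (partial_deriv i f) x"
    using *[OF bounded_linear_Re] *[OF bounded_linear_Im] by (simp add: complex_eq_iff)
qed

lemma pdl_partial_deriv_commute:
  "smooth f \<Longrightarrow> pdl js (partial_deriv j f) = partial_deriv j (pdl js f)"
  by (induction js) (auto simp: partial_deriv_commute smooth_pdl_closed)

lemma pdl_mset_cong: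
  assumes "smooth f" "mset js = mset ks"
  shows "pdl js f = pdl ks f"
  using assms(2)
proof (induction js arbitrary: ks)
  case (Cons j js)
  have "j \<in> set ks" using Cons.prems by (metis list.set_intros(1) mset_eq_setD)
  then obtain as bs where ks: "ks = as @ j # bs" by (meson split_list)
  then have "mset js = mset (as @ bs)" using Cons.prems by simp
  from Cons.IH [OF this] show ?case
    by (simp add: ks pdl_append pdl_partial_deriv_commute smooth_pdl_closed assms)
qed simp

section \<open>Multi-indices as words in the coordinates\<close>

definition mi_list :: "('n::finite) multi_index \<Rightarrow> 'n list" where
  "mi_list \<alpha> = concat (map (\<lambda>i. replicate (\<alpha> i) i) coords)"

lemma coords: "distinct (coords :: ('n::finite) list)" "set (coords :: ('n::finite) list) = UNIV"
proof -
  have "\<exists>js :: 'n list. distinct js \<and> set js = UNIV"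
    using finite_distinct_list [of "UNIV :: 'n set"] by auto
  from someI_ex [OF this] show "distinct (coords :: 'n list)" "set (coords :: 'n list) = UNIV"
    by (simp_all add: coords_def)
qed

lemma mi_deriv_eq_pdl: "mi_deriv \<alpha> f = pdl (mi_list \<alpha>) f"
proof -
  have [simp]: "foldr partial_deriv (replicate k i) g = (partial_deriv i ^^ k) g" for k and i :: 'a and g
    by (induction k) auto
  have "foldr (\<lambda>i. partial_deriv i ^^ \<alpha> i) js f = pdl (concat (map (\<lambda>i. replicate (\<alpha> i) i) js)) f" for js
    by (induction js) (auto simp: pdl_def)
  then show ?thesis by (simp add: mi_deriv_def mi_list_def)
qed

lemma length_mi_list: "length (mi_list \<alpha>) = mi_size \<alpha>"
  using sum_list_distinct_conv_sum_set [OF coords(1), of \<alpha>]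
  by (simp add: mi_list_def length_concat o_def mi_size_def coords)

lemma count_mi_list: "count_list (mi_list \<alpha>) i = \<alpha> i"
proof -
  have [simp]: "count_list (replicate n j) i = (if i = j then n else 0)" for n j
    by (induction n) auto
  have "count_list (concat (map (\<lambda>i. replicate (\<alpha> i) i) js)) i = (if i \<in> set js then \<alpha> i else 0)"
    if "distinct js" for js
    using that by (induction js) auto
  then show ?thesis by (simp add: mi_list_def coords)
qed

lemma pdl_eq_mi_deriv:
  assumes "smooth f"
  shows "pdl js f = mi_deriv (count_list js) f"
proof -
  have "mset (mi_list (count_list js)) = mset js"
    by (rule multiset_eqI) (metis count_mi_list count_mset)
  then show ?thesis using pdl_mset_cong [OF assms] by (metis mi_deriv_eq_pdl)
qed

lemma mi_size_count_list: "mi_size (count_list js) = length js"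
  by (metis length_mi_list count_mi_list count_mset multiset_eqI size_mset)

lemma monomial_eq_prod_list: "monomial \<alpha> x = prod_list (map (\<lambda>i. x $ i) (mi_list \<alpha>))"
proof -
  have [simp]: "prod_list (replicate n y) = y ^ n" for n and y :: real
    by (induction n) auto
  have "prod_list (map (\<lambda>i. x $ i) (concat (map (\<lambda>i. replicate (\<alpha> i) i) js)))
      = prod_list (map (\<lambda>i. (x $ i) ^ \<alpha> i) js)" for js
    by (induction js) auto
  then show ?thesis
    using prod.distinct_set_conv_list [OF coords(1), of "\<lambda>i. (x $ i) ^ \<alpha> i"]
    by (simp add: monomial_def mi_list_def coords)
qed

lemma mi_le_size: "\<alpha> i \<le> mi_size \<alpha>"
  unfolding mi_size_def by (rule member_le_sum) auto

lemma finite_mi_size: "finite {\<alpha> :: ('n::finite) multi_index. mi_size \<alpha> \<le> k}"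
proof (rule finite_subset)
  show "{\<alpha> :: 'n multi_index. mi_size \<alpha> \<le> k} \<subseteq> (UNIV \<rightarrow>\<^sub>E {..k})"
    unfolding PiE_UNIV_domain using mi_le_size order_trans by fast
  show "finite ((UNIV :: 'n set) \<rightarrow>\<^sub>E {..k})" by (rule finite_PiE) auto
qed

lemma finite_mi_size_eq: "finite {\<alpha> :: ('n::finite) multi_index. mi_size \<alpha> = k}"
  by (rule finite_subset [OF _ finite_mi_size [of k]]) auto

section \<open>Schwartz functions and tempered distributions\<close>

lemma power_add_one_le: "0 \<le> a \<Longrightarrow> (1 + a) ^ k \<le> 2 ^ k * (1 + a ^ k)" for a :: real
proof -
  assume a: "0 \<le> a"
  have "(1 + a) ^ k \<le> (2 * max 1 a) ^ k" using a by (intro power_mono) auto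
  also have "\<dots> = 2 ^ k * max 1 a ^ k" by (simp add: power_mult_distrib)
  also have "max 1 a ^ k \<le> 1 + a ^ k" using a by (auto simp: max_def)
  finally show ?thesis by simp
qed

lemma power_le_fact_exp: "0 \<le> z \<Longrightarrow> z ^ k \<le> fact k * exp z" for z :: real
proof -
  assume z: "0 \<le> z"
  have "(\<Sum>n\<in>{k}. z ^ n /\<^sub>R fact n) \<le> exp z"
    unfolding sums_unique [OF exp_converges [of z]]
    using z by (intro sum_le_suminf sums_summable [OF exp_converges]) auto
  then show ?thesis by (simp add: field_simps)
qed

text \<open>Completing the square bounds \<open>z\<close> by
  \<open>1 / (4 * \<epsilon>) + \<epsilon> * z^2\<close>, and an exponential dominates every power.
  \<open>gse_decay\<close> and \<open>gaussian_pointwise\<close> absorb their polynomial factors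
  into a Gaussian in this way.\<close>

lemma power_one_plus_le_exp_square:
  fixes \<epsilon> :: real
  assumes "\<epsilon> > 0"
  shows "\<exists>C>0. \<forall>z\<ge>0. (1 + z) ^ k \<le> C * exp (\<epsilon> * z\<^sup>2)"
proof (intro exI conjI allI impI)
  show "fact k * exp (1 + 1 / (4 * \<epsilon>)) > (0::real)" by simp
  fix z :: real assume z: "z \<ge> 0"
  have "0 \<le> (2 * \<epsilon> * z - 1)\<^sup>2 / (4 * \<epsilon>)" using assms by simp
  also have "\<dots> = \<epsilon> * z\<^sup>2 - z + 1 / (4 * \<epsilon>)"
    using assms by (simp add: power2_eq_square field_simps)
  finally have "1 + z \<le> (1 + 1 / (4 * \<epsilon>)) + \<epsilon> * z\<^sup>2" by simp
  then have *: "exp (1 + z) \<le> exp (1 + 1 / (4 * \<epsilon>)) * exp (\<epsilon> * z\<^sup>2)"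
    by (simp flip: exp_add)
  have "(1 + z) ^ k \<le> fact k * exp (1 + z)" using z by (intro power_le_fact_exp) simp
  also have "\<dots> \<le> fact k * (exp (1 + 1 / (4 * \<epsilon>)) * exp (\<epsilon> * z\<^sup>2))"
    using * by (intro mult_left_mono) auto
  finally show "(1 + z) ^ k \<le> fact k * exp (1 + 1 / (4 * \<epsilon>)) * exp (\<epsilon> * z\<^sup>2)"
    by (simp only: mult.assoc)
qed

section \<open>Monomial weights and powers of the norm\<close>

lemma abs_monomial_le: "\<bar>monomial \<alpha> x\<bar> \<le> (1 + norm x) ^ mi_size \<alpha>"
proof -
  have "\<bar>monomial \<alpha> x\<bar> = (\<Prod>i\<in>UNIV. \<bar>x $ i\<bar> ^ \<alpha> i)"
    by (simp add: monomial_def abs_prod power_abs)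
  also have "\<dots> \<le> (\<Prod>i\<in>UNIV. (1 + norm x) ^ \<alpha> i)"
    by (intro prod_mono conjI power_mono order_trans [OF component_le_norm_cart [of x]]) auto
  also have "\<dots> = (1 + norm x) ^ mi_size \<alpha>"
    by (simp add: mi_size_def power_sum)
  finally show ?thesis .
qed

definition pure_power :: "'n::finite \<Rightarrow> nat \<Rightarrow> 'n multi_index" where
  "pure_power i k = (\<lambda>j. if j = i then k else 0)"

lemma mi_size_pure_power [simp]: "mi_size (pure_power i k) = k"
  by (simp add: mi_size_def pure_power_def)

lemma monomial_pure_power [simp]: "monomial (pure_power i k) x = (x $ i) ^ k"
proof -
  have "monomial (pure_power i k) x = (\<Prod>j\<in>UNIV. if j = i then (x $ i) ^ k else 1)"
    unfolding monomial_def by (rule prod.cong) (auto simp: pure_power_def)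
  then show ?thesis by simp
qed

lemma mi_size_zero [simp]: "mi_size (\<lambda>_. 0) = 0"
  by (simp add: mi_size_def)

lemma monomial_zero [simp]: "monomial (\<lambda>_. 0) x = 1"
  by (simp add: monomial_def)

text \<open>The norm is at most \<open>CARD('n)\<close> times the largest coordinate, so that
  monomials in a single variable suffice to control it. This converts the monomial seminorms of the
  definitions into radial ones.\<close>

lemma norm_power_le_pure_powers:
  fixes x :: "real ^ 'n::finite"
  shows "(1 + norm x) ^ k \<le> 2 ^ k * (1 + real CARD('n) ^ k * (\<Sum>i\<in>UNIV. \<bar>(x $ i) ^ k\<bar>))"
proof -
  obtain i where i: "\<And>j. \<bar>x $ j\<bar> \<le> \<bar>x $ i\<bar>"
  proof -
    have fin: "finite (range (\<lambda>j. \<bar>x $ j\<bar>))" "range (\<lambda>j. \<bar>x $ j\<bar>) \<noteq> {}" by auto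
    obtain i where "Max (range (\<lambda>j. \<bar>x $ j\<bar>)) = \<bar>x $ i\<bar>" using Max_in [OF fin] by blast
    then have "\<bar>x $ j\<bar> \<le> \<bar>x $ i\<bar>" for j using Max_ge [OF fin(1), of "\<bar>x $ j\<bar>"] by simp
    then show ?thesis by (rule that)
  qed
  have "norm x \<le> (\<Sum>j\<in>UNIV. \<bar>x $ j\<bar>)" by (rule norm_le_l1_cart)
  also have "\<dots> \<le> real CARD('n) * \<bar>x $ i\<bar>"
    using sum_bounded_above [of UNIV "\<lambda>j. \<bar>x $ j\<bar>"] i by simp
  finally have "norm x ^ k \<le> (real CARD('n) * \<bar>x $ i\<bar>) ^ k" by (intro power_mono) auto
  also have "\<dots> = real CARD('n) ^ k * \<bar>(x $ i) ^ k\<bar>" by (simp add: power_mult_distrib power_abs)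
  also have "\<dots> \<le> real CARD('n) ^ k * (\<Sum>i\<in>UNIV. \<bar>(x $ i) ^ k\<bar>)"
    by (intro mult_left_mono member_le_sum) auto
  finally have "norm x ^ k \<le> real CARD('n) ^ k * (\<Sum>i\<in>UNIV. \<bar>(x $ i) ^ k\<bar>)" .
  then show ?thesis
    by (intro order_trans [OF power_add_one_le]) (auto intro!: mult_left_mono)
qed

section \<open>Rapidly decreasing and polynomially bounded functions\<close>

definition rapid :: "('n::finite) cfun \<Rightarrow> bool" where
  "rapid f \<longleftrightarrow> (\<forall>k. \<exists>B. \<forall>x. (1 + norm x) ^ k * cmod (f x) \<le> B)"

text \<open>Radial weights pass through products and convolutions more easily than monomials do. One
  direction rests on \<open>norm_power_le_pure_powers\<close>, the other on
  \<open>abs_monomial_le\<close>.\<close>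

lemma schwartz_iff: "\<phi> \<in> schwartz_functions \<longleftrightarrow> smooth \<phi> \<and> (\<forall>js. rapid (pdl js \<phi>))"
proof safe
  assume \<phi>: "\<phi> \<in> schwartz_functions"
  then show s: "smooth \<phi>" by (simp add: schwartz_functions_def)
  fix js
  show "rapid (pdl js \<phi>)"
    unfolding rapid_def
  proof
    fix k
    define \<psi> where "\<psi> = mi_deriv (count_list js) \<phi>"
    have "\<exists>B. \<forall>x. cmod (monomial \<alpha> x *\<^sub>R \<psi> x) \<le> B" for \<alpha>
      using \<phi> unfolding schwartz_functions_def \<psi>_def bounded_iff by auto
    then obtain B where B: "\<And>\<alpha> x. \<bar>monomial \<alpha> x\<bar> * cmod (\<psi> x) \<le> B \<alpha>"
      by (metis norm_scaleR)
    have "(1 + norm x) ^ k * cmod (\<psi> x) \<le>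
        2 ^ k * (B (\<lambda>_. 0) + real CARD('a) ^ k * (\<Sum>i\<in>UNIV. B (pure_power i k)))" for x
    proof -
      have "(1 + norm x) ^ k * cmod (\<psi> x) \<le>
        (2 ^ k * (1 + real CARD('a) ^ k * (\<Sum>i\<in>UNIV. \<bar>(x $ i) ^ k\<bar>))) * cmod (\<psi> x)"
        by (intro mult_right_mono norm_power_le_pure_powers) auto
      also have "\<dots> = 2 ^ k * (\<bar>monomial (\<lambda>_. 0) x\<bar> * cmod (\<psi> x)
          + real CARD('a) ^ k * (\<Sum>i\<in>UNIV. \<bar>monomial (pure_power i k) x\<bar> * cmod (\<psi> x)))"
        by (simp add: algebra_simps sum_distrib_left)
      also have "\<dots> \<le> 2 ^ k * (B (\<lambda>_. 0) + real CARD('a) ^ k * (\<Sum>i\<in>UNIV. B (pure_power i k)))"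
        by (intro mult_left_mono add_mono sum_mono B) auto
      finally show ?thesis .
    qed
    then show "\<exists>B. \<forall>x. (1 + norm x) ^ k * cmod (pdl js \<phi> x) \<le> B"
      using pdl_eq_mi_deriv [OF s] unfolding \<psi>_def by metis
  qed
next
  assume s: "smooth \<phi>" and r: "\<forall>js. rapid (pdl js \<phi>)"
  have "bounded (range (\<lambda>x. monomial \<alpha> x *\<^sub>R mi_deriv \<beta> \<phi> x))" for \<alpha> \<beta>
  proof -
    obtain B where "\<And>x. (1 + norm x) ^ mi_size \<alpha> * cmod (mi_deriv \<beta> \<phi> x) \<le> B"
      using r unfolding rapid_def mi_deriv_eq_pdl by metis
    then have "cmod (monomial \<alpha> x *\<^sub>R mi_deriv \<beta> \<phi> x) \<le> B" for x
      using mult_right_mono [OF abs_monomial_le, of "cmod (mi_deriv \<beta> \<phi> x)" \<alpha> x]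
      by (auto intro: order_trans)
    then show ?thesis unfolding bounded_iff by auto
  qed
  then show "\<phi> \<in> schwartz_functions" using s by (simp add: schwartz_functions_def)
qed

lemma schwartz_smooth: "\<phi> \<in> schwartz_functions \<Longrightarrow> smooth \<phi>"
  by (simp add: schwartz_iff)

lemma schwartz_rapid: "\<phi> \<in> schwartz_functions \<Longrightarrow> rapid \<phi>"
  using schwartz_iff pdl_Nil by metis

lemma schwartz_partial_deriv: "\<phi> \<in> schwartz_functions \<Longrightarrow> partial_deriv i \<phi> \<in> schwartz_functions"
  unfolding schwartz_iff using smooth_partial_deriv pdl_append [of _ "[i]" \<phi>] by (metis pdl_Cons pdl_Nil)

lemma schwartz_pdl: "\<phi> \<in> schwartz_functions \<Longrightarrow> pdl js \<phi> \<in> schwartz_functions"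
  by (induction js) (auto simp: schwartz_partial_deriv)

lemma rapid_add:
  assumes "rapid f" "rapid g" shows "rapid (\<lambda>x. f x + g x)"
  unfolding rapid_def
proof
  fix k
  obtain A B where AB: "\<And>x. (1 + norm x) ^ k * cmod (f x) \<le> A" "\<And>x. (1 + norm x) ^ k * cmod (g x) \<le> B"
    using assms unfolding rapid_def by metis
  have "(1 + norm x) ^ k * cmod (f x + g x) \<le> A + B" for x
  proof -
    have "(1 + norm x) ^ k * cmod (f x + g x) \<le> (1 + norm x) ^ k * (cmod (f x) + cmod (g x))"
      by (intro mult_left_mono norm_triangle_ineq) auto
    then show ?thesis using AB [of x] by (simp add: distrib_left)
  qed
  then show "\<exists>B. \<forall>x. (1 + norm x) ^ k * cmod (f x + g x) \<le> B" by blast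
qed

definition poly_bounded :: "('n::finite) cfun \<Rightarrow> bool" where
  "poly_bounded f \<longleftrightarrow> (\<exists>B k. \<forall>x. cmod (f x) \<le> B * (1 + norm x) ^ k)"

lemma rapid_mult:
  assumes "rapid f" "poly_bounded g" shows "rapid (\<lambda>x. f x * g x)"
  unfolding rapid_def
proof
  fix k
  obtain C l where C: "\<And>x. cmod (g x) \<le> C * (1 + norm x) ^ l"
    using assms unfolding poly_bounded_def by metis
  obtain A where A: "\<And>x. (1 + norm x) ^ (k + l) * cmod (f x) \<le> A"
    using assms unfolding rapid_def by metis
  have "(1 + norm x) ^ k * cmod (f x * g x) \<le> A * \<bar>C\<bar>" for x
  proof -
    have "cmod (g x) \<le> \<bar>C\<bar> * (1 + norm x) ^ l"
      by (rule order_trans [OF C]) (auto intro!: mult_right_mono)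
    then have "(1 + norm x) ^ k * (cmod (f x) * cmod (g x)) \<le>
        (1 + norm x) ^ k * (cmod (f x) * (\<bar>C\<bar> * (1 + norm x) ^ l))"
      by (intro mult_left_mono) auto
    also have "\<dots> = ((1 + norm x) ^ (k + l) * cmod (f x)) * \<bar>C\<bar>" by (simp add: power_add)
    also have "\<dots> \<le> A * \<bar>C\<bar>" by (intro mult_right_mono A) auto
    finally show ?thesis by (simp add: norm_mult)
  qed
  then show "\<exists>B. \<forall>x. (1 + norm x) ^ k * cmod (f x * g x) \<le> B" by blast
qed

lemma schwartz_coinduct:
  assumes "\<And>f x. f \<in> X \<Longrightarrow> f differentiable (at x)"
    and "\<And>f i. f \<in> X \<Longrightarrow> partial_deriv i f \<in> X"
    and "\<And>f. f \<in> X \<Longrightarrow> rapid f"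
    and "f \<in> X"
  shows "f \<in> schwartz_functions"
proof -
  have "pdl js f \<in> X" for js by (induction js) (auto simp: assms)
  then show ?thesis unfolding schwartz_iff using smooth_coinduct [of X f] assms by blast
qed

text \<open>The multipliers of the Schwartz space, commonly written O_M; the degree of growth may
  depend on the derivative.\<close>

definition moderate :: "('n::finite) cfun set" where
  "moderate = {f. smooth f \<and> (\<forall>js. poly_bounded (pdl js f))}"

lemma moderate_coinduct:
  assumes "\<And>f x. f \<in> X \<Longrightarrow> f differentiable (at x)"
    and "\<And>f i. f \<in> X \<Longrightarrow> partial_deriv i f \<in> X"
    and "\<And>f. f \<in> X \<Longrightarrow> poly_bounded f"
    and "f \<in> X"
  shows "f \<in> moderate"
proof -
  have "pdl js f \<in> X" for js by (induction js) (auto simp: assms)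
  then show ?thesis unfolding moderate_def using smooth_coinduct [of X f] assms by blast
qed

lemma moderate_partial_deriv: "f \<in> moderate \<Longrightarrow> partial_deriv i f \<in> moderate"
  unfolding moderate_def mem_Collect_eq using smooth_partial_deriv pdl_append [of _ "[i]" f]
  by (metis pdl_Cons pdl_Nil)

lemma moderateD: "f \<in> moderate \<Longrightarrow> smooth f" "f \<in> moderate \<Longrightarrow> poly_bounded f"
  unfolding moderate_def by (auto dest: spec [of _ "[]"])

lemma schwartz_sum_prod: "h \<in> sum_prod schwartz_functions moderate \<Longrightarrow> h \<in> schwartz_functions"
proof (rule schwartz_coinduct [where X = "sum_prod schwartz_functions moderate"])
  fix f :: "'a cfun" and x i
  assume f: "f \<in> sum_prod schwartz_functions moderate"
  show "f differentiable (at x)" "partial_deriv i f \<in> sum_prod schwartz_functions moderate"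
    using sum_prod_partial_deriv [OF _ _ _ _ f] schwartz_smooth schwartz_partial_deriv moderateD
      moderate_partial_deriv by blast+
  show "rapid f" using f
    by induction (auto intro: rapid_mult rapid_add schwartz_rapid moderateD)
qed

lemma schwartz_mult:
  "\<phi> \<in> schwartz_functions \<Longrightarrow> f \<in> moderate \<Longrightarrow> (\<lambda>x. \<phi> x * f x) \<in> schwartz_functions"
  by (rule schwartz_sum_prod, rule sum_prod.prod)

lemma moderate_const [simp]: "(\<lambda>x. c) \<in> moderate"
proof (rule moderate_coinduct [where X = "range (\<lambda>c x. c)"])
  show "poly_bounded f" if "f \<in> range (\<lambda>c x. c)" for f :: "'a cfun"
    using that unfolding poly_bounded_def by (metis mult.right_neutral order_refl power_0 rangeE)
qed auto

lemma schwartz_add: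
  assumes "\<phi> \<in> schwartz_functions" "\<psi> \<in> schwartz_functions"
  shows "(\<lambda>x. \<phi> x + \<psi> x) \<in> schwartz_functions"
  using sum_prod.add [OF sum_prod.prod sum_prod.prod, OF assms(1) moderate_const assms(2) moderate_const, of 1 1]
  by (auto dest: schwartz_sum_prod)

lemma schwartz_cmult:
  "\<phi> \<in> schwartz_functions \<Longrightarrow> (\<lambda>x. c * \<phi> x) \<in> schwartz_functions"
  using schwartz_mult [OF _ moderate_const, of \<phi> c] by (simp add: mult.commute)

lemma coord_has_derivative: "((\<lambda>x. complex_of_real (x $ i)) has_derivative (\<lambda>v. of_real (v $ i))) (at x)"
  by (auto intro!: derivative_eq_intros bounded_linear_imp_has_derivative bounded_linear_compose [OF bounded_linear_of_real] bounded_linear_vec_nth)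

lemma moderate_coord: "(\<lambda>x. complex_of_real (x $ i)) \<in> moderate"
proof (rule moderate_coinduct [where X = "insert (\<lambda>x. complex_of_real (x $ i)) (range (\<lambda>c x. c))"])
  fix f :: "'a cfun" and x j
  assume f: "f \<in> insert (\<lambda>x. complex_of_real (x $ i)) (range (\<lambda>c x. c))"
  then show "f differentiable (at x)"
    using differentiableI [OF coord_has_derivative] by auto
  show "partial_deriv j f \<in> insert (\<lambda>x. complex_of_real (x $ i)) (range (\<lambda>c x. c))"
  proof -
    have "partial_deriv j (\<lambda>x. complex_of_real (x $ i)) = (\<lambda>x. of_real (axis j 1 $ i))"
      using partial_deriv_eq [OF coord_has_derivative] by blast
    then show ?thesis using f by auto
  qed
  have "poly_bounded (\<lambda>x. complex_of_real (x $ i))"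
    unfolding poly_bounded_def
    by (intro exI [of _ 1]) (auto intro!: order_trans [OF component_le_norm_cart])
  then show "poly_bounded f"
    using f moderateD(2) [OF moderate_const] by blast
qed auto

lemma schwartz_coord_mult:
  "\<phi> \<in> schwartz_functions \<Longrightarrow> (\<lambda>x. of_real (x $ i) * \<phi> x) \<in> schwartz_functions"
  using schwartz_mult [OF _ moderate_coord, of \<phi> i] by (simp add: mult.commute)

text \<open>A relation between a function and a number takes the place of a norm, so that no
  supremum has to be shown finite first. The same \<open>k\<close> limits the weight and the
  derivatives.\<close>

definition schwartz_bound :: "nat \<Rightarrow> ('n::finite) cfun \<Rightarrow> real \<Rightarrow> bool" where
  "schwartz_bound k \<phi> B \<longleftrightarrow>
    (\<forall>js x. length js \<le> k \<longrightarrow> (1 + norm x) ^ k * cmod (pdl js \<phi> x) \<le> B)"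

lemma tempered_iff:
  fixes u :: "('n::finite) functional"
  shows "u \<in> tempered_distributions \<longleftrightarrow> linear_functional_on schwartz_functions u \<and>
    (\<exists>C\<ge>0. \<exists>k. \<forall>\<phi>\<in>schwartz_functions. \<forall>B. schwartz_bound k \<phi> B \<longrightarrow> cmod (u \<phi>) \<le> C * B)"
    (is "_ \<longleftrightarrow> _ \<and> ?R")
proof -
  define T where "T = (\<lambda>\<phi> \<alpha> \<beta>. SUP x. cmod (monomial \<alpha> x *\<^sub>R mi_deriv \<beta> \<phi> (x :: real ^ 'n)))"
  define M :: "nat \<Rightarrow> 'n multi_index set" where "M = (\<lambda>k. {\<alpha>. mi_size \<alpha> \<le> k})"
  have fin [simp]: "finite (M k)" for k unfolding M_def by (rule finite_mi_size)
  have bdd: "bdd_above (range (\<lambda>x. cmod (monomial \<alpha> x *\<^sub>R mi_deriv \<beta> \<phi> x)))"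
    if \<phi>S: "\<phi> \<in> schwartz_functions" for \<phi> :: "'n cfun" and \<alpha> \<beta>
  proof -
    obtain a where "\<And>x. cmod (monomial \<alpha> x *\<^sub>R mi_deriv \<beta> \<phi> x) \<le> a"
      using \<phi>S unfolding schwartz_functions_def bounded_iff by blast
    then show ?thesis by (intro bdd_aboveI2)
  qed
  have T_ge: "cmod (monomial \<alpha> x *\<^sub>R mi_deriv \<beta> \<phi> x) \<le> T \<phi> \<alpha> \<beta>"
    if "\<phi> \<in> schwartz_functions" for \<phi> \<alpha> \<beta> x
    unfolding T_def by (rule cSUP_upper [OF _ bdd [OF that]]) auto
  have T_nonneg: "0 \<le> T \<phi> \<alpha> \<beta>" if "\<phi> \<in> schwartz_functions" for \<phi> \<alpha> \<beta>
    using T_ge [OF that, of \<alpha> undefined \<beta>] norm_ge_zero order_trans by blast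
  have "(\<exists>C k. \<forall>\<phi>\<in>schwartz_functions. cmod (u \<phi>) \<le> C * (\<Sum>\<alpha>\<in>M k. \<Sum>\<beta>\<in>M k. T \<phi> \<alpha> \<beta>)) \<longleftrightarrow> ?R"
  proof safe
    fix C k assume C: "\<forall>\<phi>\<in>schwartz_functions. cmod (u \<phi>) \<le> C * (\<Sum>\<alpha>\<in>M k. \<Sum>\<beta>\<in>M k. T \<phi> \<alpha> \<beta>)"
    \<comment> \<open>The constant of the definition may be negative, hence the absolute value; the
      two cardinalities count the terms of the double sum.\<close>
    have "cmod (u \<phi>) \<le> (\<bar>C\<bar> * (real (card (M k)) * real (card (M k)))) * B"
      if \<phi>: "\<phi> \<in> schwartz_functions" and B: "schwartz_bound k \<phi> B" for \<phi> B
    proof -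
      have TB: "T \<phi> \<alpha> \<beta> \<le> B" if "\<alpha> \<in> M k" "\<beta> \<in> M k" for \<alpha> \<beta>
        unfolding T_def
      proof (rule cSUP_least)
        fix x :: "real ^ 'n"
        have "\<bar>monomial \<alpha> x\<bar> \<le> (1 + norm x) ^ k"
          using that by (intro order_trans [OF abs_monomial_le] power_increasing) (auto simp: M_def)
        then have "cmod (monomial \<alpha> x *\<^sub>R mi_deriv \<beta> \<phi> x) \<le> (1 + norm x) ^ k * cmod (pdl (mi_list \<beta>) \<phi> x)"
          by (simp add: mi_deriv_eq_pdl mult_right_mono)
        also have "\<dots> \<le> B"
          using B that unfolding schwartz_bound_def by (simp add: length_mi_list M_def)
        finally show "cmod (monomial \<alpha> x *\<^sub>R mi_deriv \<beta> \<phi> x) \<le> B" .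
      qed auto
      have "(\<Sum>\<alpha>\<in>M k. \<Sum>\<beta>\<in>M k. T \<phi> \<alpha> \<beta>) \<le> (\<Sum>\<alpha>\<in>M k. \<Sum>\<beta>\<in>M k. B)"
        by (intro sum_mono TB)
      then have "\<bar>C\<bar> * (\<Sum>\<alpha>\<in>M k. \<Sum>\<beta>\<in>M k. T \<phi> \<alpha> \<beta>) \<le> \<bar>C\<bar> * (\<Sum>\<alpha>\<in>M k. \<Sum>\<beta>\<in>M k. B)"
        by (intro mult_left_mono) auto
      moreover have "C * (\<Sum>\<alpha>\<in>M k. \<Sum>\<beta>\<in>M k. T \<phi> \<alpha> \<beta>) \<le> \<bar>C\<bar> * (\<Sum>\<alpha>\<in>M k. \<Sum>\<beta>\<in>M k. T \<phi> \<alpha> \<beta>)"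
        by (intro mult_right_mono sum_nonneg T_nonneg \<phi>) auto
      ultimately show ?thesis using bspec [OF C \<phi>] by (simp add: mult.assoc)
    qed
    then show ?R by (intro exI [of _ "\<bar>C\<bar> * (real (card (M k)) * real (card (M k)))"]) auto
  next
    fix C k assume C0: "C \<ge> 0" and C: "\<forall>\<phi>\<in>schwartz_functions. \<forall>B. schwartz_bound k \<phi> B \<longrightarrow> cmod (u \<phi>) \<le> C * B"
    \<comment> \<open>The constant of \<open>norm_power_le_pure_powers\<close> once every monomial
      seminorm has been replaced by their total \<open>Z\<close>.\<close>
    define D where "D = 2 ^ k * (1 + real CARD('n) ^ k * real CARD('n))"
    have "cmod (u \<phi>) \<le> (C * D) * (\<Sum>\<alpha>\<in>M k. \<Sum>\<beta>\<in>M k. T \<phi> \<alpha> \<beta>)" if \<phi>: "\<phi> \<in> schwartz_functions" for \<phi>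
    proof -
      define Z where "Z = (\<Sum>\<alpha>\<in>M k. \<Sum>\<beta>\<in>M k. T \<phi> \<alpha> \<beta>)"
      have TZ: "T \<phi> \<alpha> \<beta> \<le> Z" if "\<alpha> \<in> M k" "\<beta> \<in> M k" for \<alpha> \<beta>
      proof -
        have "T \<phi> \<alpha> \<beta> \<le> (\<Sum>\<beta>\<in>M k. T \<phi> \<alpha> \<beta>)"
          using that by (intro member_le_sum T_nonneg \<phi>) auto
        also have "\<dots> \<le> Z" unfolding Z_def
          using that by (intro member_le_sum [where f = "\<lambda>\<alpha>. (\<Sum>\<beta>\<in>M k. T \<phi> \<alpha> \<beta>)"] sum_nonneg T_nonneg \<phi>) auto
        finally show ?thesis .
      qed
      have "(1 + norm x) ^ k * cmod (pdl js \<phi> x) \<le> D * Z" if js: "length js \<le> k" for js x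
      proof -
        define \<beta> where "\<beta> = count_list js"
        have \<beta>: "\<beta> \<in> M k" using js by (simp add: \<beta>_def M_def mi_size_count_list)
        define y where "y = cmod (pdl js \<phi> x)"
        have y: "\<bar>monomial \<alpha> x\<bar> * y \<le> Z" if "\<alpha> \<in> M k" for \<alpha>
          using T_ge [OF \<phi>, of \<alpha> x \<beta>] TZ [OF that \<beta>]
          by (simp add: y_def \<beta>_def pdl_eq_mi_deriv [OF schwartz_smooth [OF \<phi>]])
        have "(1 + norm x) ^ k * y \<le> (2 ^ k * (1 + real CARD('n) ^ k * (\<Sum>i\<in>UNIV. \<bar>(x $ i) ^ k\<bar>))) * y"
          by (intro mult_right_mono norm_power_le_pure_powers) (auto simp: y_def)
        also have "\<dots> = 2 ^ k * (\<bar>monomial (\<lambda>_. 0) x\<bar> * y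
          + real CARD('n) ^ k * (\<Sum>i\<in>UNIV. \<bar>monomial (pure_power i k) x\<bar> * y))"
          by (simp add: algebra_simps sum_distrib_left)
        also have "\<dots> \<le> 2 ^ k * (Z + real CARD('n) ^ k * (\<Sum>i\<in>(UNIV::'n set). Z))"
          by (intro mult_left_mono add_mono sum_mono y) (auto simp: M_def)
        also have "\<dots> = D * Z" by (simp add: D_def algebra_simps)
        finally show ?thesis by (simp add: y_def)
      qed
      then have "schwartz_bound k \<phi> (D * Z)" unfolding schwartz_bound_def by blast
      then show ?thesis using C \<phi> by (simp add: Z_def mult.assoc)
    qed
    then show "\<exists>C k. \<forall>\<phi>\<in>schwartz_functions. cmod (u \<phi>) \<le> C * (\<Sum>\<alpha>\<in>M k. \<Sum>\<beta>\<in>M k. T \<phi> \<alpha> \<beta>)" by blast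
  qed
  then show ?thesis unfolding tempered_distributions_def T_def M_def by auto
qed

section \<open>Tempered distributions under derivatives and linear combinations\<close>

lemma tempered_partial_deriv:
  assumes "u \<in> tempered_distributions"
  shows "(\<lambda>\<phi>. u (partial_deriv i \<phi>)) \<in> tempered_distributions"
proof -
  obtain C k where lin: "linear_functional_on schwartz_functions u" and C: "C \<ge> 0"
    "\<And>\<phi> B. \<phi> \<in> schwartz_functions \<Longrightarrow> schwartz_bound k \<phi> B \<Longrightarrow> cmod (u \<phi>) \<le> C * B"
    using assms unfolding tempered_iff by blast
  have "schwartz_bound k (partial_deriv i \<phi>) B" if "schwartz_bound (Suc k) \<phi> B" for \<phi> B
    unfolding schwartz_bound_def
  proof safe
    fix js :: "'a list" and x :: "real ^ 'a" assume js: "length js \<le> k"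
    have "(1 + norm x) ^ k * cmod (pdl (js @ [i]) \<phi> x) \<le> (1 + norm x) ^ Suc k * cmod (pdl (js @ [i]) \<phi> x)"
      by (intro mult_right_mono power_increasing) auto
    also have "\<dots> \<le> B"
      using that js unfolding schwartz_bound_def by (metis length_append_singleton Suc_le_mono)
    finally show "(1 + norm x) ^ k * cmod (pdl js (partial_deriv i \<phi>) x) \<le> B"
      by (simp add: pdl_append)
  qed
  then have "cmod (u (partial_deriv i \<phi>)) \<le> C * B" if "schwartz_bound (Suc k) \<phi> B" "\<phi> \<in> schwartz_functions" for \<phi> B
    using C that schwartz_partial_deriv by blast
  moreover have "linear_functional_on schwartz_functions (\<lambda>\<phi>. u (partial_deriv i \<phi>))"
    using lin unfolding linear_functional_on_def
    by (simp add: partial_deriv_smooth_add partial_deriv_smooth_mult schwartz_smooth schwartz_partial_deriv)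
  ultimately show ?thesis unfolding tempered_iff using C(1) by blast
qed

lemma tempered_add:
  assumes "u \<in> tempered_distributions" "v \<in> tempered_distributions"
  shows "(\<lambda>\<phi>. u \<phi> + v \<phi>) \<in> tempered_distributions"
proof -
  obtain C k where lu: "linear_functional_on schwartz_functions u" and C: "C \<ge> 0"
    "\<And>\<phi> B. \<phi> \<in> schwartz_functions \<Longrightarrow> schwartz_bound k \<phi> B \<Longrightarrow> cmod (u \<phi>) \<le> C * B"
    using assms(1) unfolding tempered_iff by blast
  obtain D l where lv: "linear_functional_on schwartz_functions v" and D: "D \<ge> 0"
    "\<And>\<phi> B. \<phi> \<in> schwartz_functions \<Longrightarrow> schwartz_bound l \<phi> B \<Longrightarrow> cmod (v \<phi>) \<le> D * B"
    using assms(2) unfolding tempered_iff by blast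
  have mono: "schwartz_bound p \<phi> B" if "schwartz_bound q \<phi> B" "p \<le> q" for p q and \<phi> :: "'a cfun" and B
    unfolding schwartz_bound_def
  proof safe
    fix js :: "'a list" and x :: "real ^ 'a" assume js: "length js \<le> p"
    have "(1 + norm x) ^ p * cmod (pdl js \<phi> x) \<le> (1 + norm x) ^ q * cmod (pdl js \<phi> x)"
      using that by (intro mult_right_mono power_increasing) auto
    also have "\<dots> \<le> B" using that js unfolding schwartz_bound_def by auto
    finally show "(1 + norm x) ^ p * cmod (pdl js \<phi> x) \<le> B" .
  qed
  have "cmod (u \<phi> + v \<phi>) \<le> (C + D) * B" if "\<phi> \<in> schwartz_functions" "schwartz_bound (max k l) \<phi> B" for \<phi> B
    using C(2) [OF that(1) mono [OF that(2)]] D(2) [OF that(1) mono [OF that(2)]]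
      norm_triangle_ineq [of "u \<phi>" "v \<phi>"] by (simp add: distrib_right)
  moreover have "linear_functional_on schwartz_functions (\<lambda>\<phi>. u \<phi> + v \<phi>)"
    using lu lv unfolding linear_functional_on_def by (simp add: algebra_simps)
  ultimately show ?thesis unfolding tempered_iff using C(1) D(1) by (meson add_nonneg_nonneg)
qed

lemma tempered_cmult:
  assumes "u \<in> tempered_distributions"
  shows "(\<lambda>\<phi>. c * u \<phi>) \<in> tempered_distributions"
proof -
  obtain C k where lin: "linear_functional_on schwartz_functions u" and C: "C \<ge> 0"
    "\<And>\<phi> B. \<phi> \<in> schwartz_functions \<Longrightarrow> schwartz_bound k \<phi> B \<Longrightarrow> cmod (u \<phi>) \<le> C * B"
    using assms unfolding tempered_iff by blast
  have "cmod (c * u \<phi>) \<le> (cmod c * C) * B" if "schwartz_bound k \<phi> B" "\<phi> \<in> schwartz_functions" for \<phi> B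
    using mult_left_mono [OF C(2) [OF that(2,1)], of "cmod c"] by (simp add: norm_mult mult.assoc)
  moreover have "linear_functional_on schwartz_functions (\<lambda>\<phi>. c * u \<phi>)"
    using lin unfolding linear_functional_on_def by (simp add: algebra_simps)
  ultimately show ?thesis unfolding tempered_iff using C(1) by (meson mult_nonneg_nonneg norm_ge_zero)
qed

section \<open>Gaussians\<close>

text \<open>A Gaussian times the character of the Fourier transform. The width is a real number
  because products have widths such as \<open>N * l / (N + l)\<close>, see
  \<open>gauss_mult_gse\<close>.\<close>

definition gse :: "real ^ 'n::finite \<Rightarrow> real \<Rightarrow> real ^ 'n \<Rightarrow> 'n cfun" where
  "gse x0 l \<xi> x = exp (complex_of_real (- (norm (x - x0))\<^sup>2 / (4 * l)) - \<i> * of_real (x \<bullet> \<xi>))"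

lemma has_derivative_exp_complex:
  "(f has_derivative f') (at x) \<Longrightarrow> ((\<lambda>x. exp (f x :: complex)) has_derivative (\<lambda>v. exp (f x) * f' v)) (at x)"
  by (rule has_derivative_compose [OF _ has_field_derivative_imp_has_derivative [OF DERIV_exp], unfolded o_def])

lemma norm_gse: "cmod (gse x0 l \<xi> x) = exp (- (norm (x - x0))\<^sup>2 / (4 * l))"
  by (simp add: gse_def norm_exp_eq_Re)

lemma gauss_eq_gse: "gauss x0 N = gse x0 (real N) 0"
  by (simp add: gauss_def gse_def fun_eq_iff flip: exp_of_real)

lemma gse_has_derivative:
  "(gse x0 l \<xi> has_derivative
    (\<lambda>v. gse x0 l \<xi> x * (of_real (- ((x - x0) \<bullet> v) / (2 * l)) - \<i> * of_real (v \<bullet> \<xi>)))) (at x)"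
proof -
  have "((\<lambda>x. complex_of_real (- ((x - x0) \<bullet> (x - x0)) / (4 * l)) - \<i> * of_real (x \<bullet> \<xi>)) has_derivative
    (\<lambda>v. (of_real (- ((x - x0) \<bullet> v) / (2 * l)) - \<i> * of_real (v \<bullet> \<xi>)))) (at x)"
    by (cases "l = 0") (auto intro!: derivative_eq_intros simp: inner_commute fun_eq_iff field_simps)
  from has_derivative_exp_complex [OF this] show ?thesis
    unfolding gse_def power2_norm_eq_inner by simp
qed

text \<open>Derivatives of \<open>gse\<close> produce the coefficients \<open>1 / l\<close> and
  \<open>\<xi>\<close>, and its decay depends on \<open>l\<close> itself; one quantity dominates all
  three.\<close>

definition par_size :: "real \<times> (real ^ 'n::finite) \<Rightarrow> real" where
  "par_size p = 1 + norm (snd p) + 1 / fst p + fst p"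

lemma par_size_ge_1: "fst p > 0 \<Longrightarrow> 1 \<le> par_size p"
  by (simp add: par_size_def)

text \<open>Polynomials in \<open>x\<close> whose coefficients grow at most polynomially in \<open>par_size p\<close>,
  where the parameter \<open>p = (l, \<xi>)\<close> is that of \<open>gse x0 l \<xi>\<close>.\<close>
inductive_set par_poly :: "(real \<times> (real ^ 'n::finite) \<Rightarrow> 'n cfun) set" where
  const: "(\<And>p. fst p > 0 \<Longrightarrow> cmod (c p) \<le> C * par_size p) \<Longrightarrow> (\<lambda>p x. c p) \<in> par_poly"
| coord: "(\<lambda>p x. complex_of_real (x $ i)) \<in> par_poly"
| add: "q \<in> par_poly \<Longrightarrow> r \<in> par_poly \<Longrightarrow> (\<lambda>p x. q p x + r p x) \<in> par_poly"
| mult: "q \<in> par_poly \<Longrightarrow> r \<in> par_poly \<Longrightarrow> (\<lambda>p x. q p x * r p x) \<in> par_poly"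

lemma par_poly_const: "(\<lambda>p x. c) \<in> par_poly"
proof (rule par_poly.const)
  show "cmod c \<le> cmod c * par_size p" if "fst p > 0" for p :: "real \<times> (real ^ 'a)"
    using mult_left_mono [OF par_size_ge_1 [OF that], of "cmod c"] by simp
qed

lemma par_poly_partial_deriv:
  assumes "q \<in> par_poly"
  shows "(\<forall>p x. q p differentiable (at x)) \<and> (\<lambda>p. partial_deriv i (q p)) \<in> par_poly"
  using assms
proof induction
  case (const c C)
  show ?case using par_poly_const [of 0] by simp
next
  case (coord j)
  have "partial_deriv i (\<lambda>x. complex_of_real (x $ j)) = (\<lambda>x. of_real (axis i 1 $ j))"
    using partial_deriv_eq [OF coord_has_derivative] by blast
  then show ?case using par_poly_const differentiableI [OF coord_has_derivative] by auto
next
  case (add q r)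
  then have "partial_deriv i (\<lambda>x. q p x + r p x) = (\<lambda>x. partial_deriv i (q p) x + partial_deriv i (r p) x)" for p
    using partial_deriv_add by blast
  then show ?case using add par_poly.add by auto
next
  case (mult q r)
  then have "partial_deriv i (\<lambda>x. q p x * r p x)
      = (\<lambda>x. q p x * partial_deriv i (r p) x + partial_deriv i (q p) x * r p x)" for p
    using partial_deriv_mult by blast
  moreover have "(\<lambda>p x. q p x * partial_deriv i (r p) x + partial_deriv i (q p) x * r p x) \<in> par_poly"
    using mult by (intro par_poly.add par_poly.mult) auto
  ultimately show ?case using mult by (simp add: differentiable_mult)
qed

lemma par_poly_bound:
  assumes "q \<in> par_poly"
  shows "\<exists>C\<ge>0. \<exists>k. \<forall>p x. fst p > 0 \<longrightarrow> cmod (q p x) \<le> C * (par_size p * (1 + norm x)) ^ k"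
  using assms
proof induction
  case (const c C)
  have "cmod (c p) \<le> \<bar>C\<bar> * (par_size p * (1 + norm x)) ^ 1" if "fst p > 0" for p and x :: "real ^ 'a"
  proof -
    have "cmod (c p) \<le> \<bar>C\<bar> * par_size p"
      using const that par_size_ge_1 [OF that]
      by (intro order_trans [OF const [OF that]] mult_right_mono) auto
    also have "\<dots> \<le> \<bar>C\<bar> * (par_size p * (1 + norm x))"
      using par_size_ge_1 [OF that] by (intro mult_left_mono) (auto simp: distrib_left)
    finally show ?thesis by simp
  qed
  then show ?case by (meson abs_ge_zero)
next
  case (coord i)
  have "cmod (complex_of_real (x $ i)) \<le> 1 * (par_size p * (1 + norm x)) ^ 1" if "fst p > 0" for p and x :: "real ^ 'a"
  proof -
    have "\<bar>x $ i\<bar> \<le> 1 * (1 + norm x)" by (rule order_trans [OF component_le_norm_cart]) simp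
    also have "\<dots> \<le> par_size p * (1 + norm x)"
      using par_size_ge_1 [OF that] by (intro mult_right_mono) auto
    finally show ?thesis by simp
  qed
  then show ?case by (meson zero_le_one)
next
  case (add q r)
  obtain C k where C: "C \<ge> 0" "\<And>p x. fst p > 0 \<Longrightarrow> cmod (q p x) \<le> C * (par_size p * (1 + norm x)) ^ k"
    using add.IH(1) by blast
  obtain D l where D: "D \<ge> 0" "\<And>p x. fst p > 0 \<Longrightarrow> cmod (r p x) \<le> D * (par_size p * (1 + norm x)) ^ l"
    using add.IH(2) by blast
  have "cmod (q p x + r p x) \<le> (C + D) * (par_size p * (1 + norm x)) ^ (max k l)" if p: "fst p > 0" for p x
  proof -
    have 1: "1 \<le> par_size p * (1 + norm x)"
      using mult_mono [OF par_size_ge_1 [OF p], of 1 "1 + norm x"] par_size_ge_1 [OF p] by simp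
    have "cmod (q p x + r p x) \<le> C * (par_size p * (1 + norm x)) ^ k + D * (par_size p * (1 + norm x)) ^ l"
      by (rule order_trans [OF norm_triangle_ineq add_mono]) (use C D p in auto)
    also have "\<dots> \<le> C * (par_size p * (1 + norm x)) ^ max k l + D * (par_size p * (1 + norm x)) ^ max k l"
      using C D 1 by (intro add_mono mult_left_mono power_increasing) auto
    finally show ?thesis by (simp add: distrib_right)
  qed
  then show ?case using C(1) D(1) by (meson add_nonneg_nonneg)
next
  case (mult q r)
  obtain C k where C: "C \<ge> 0" "\<And>p x. fst p > 0 \<Longrightarrow> cmod (q p x) \<le> C * (par_size p * (1 + norm x)) ^ k"
    using mult.IH(1) by blast
  obtain D l where D: "D \<ge> 0" "\<And>p x. fst p > 0 \<Longrightarrow> cmod (r p x) \<le> D * (par_size p * (1 + norm x)) ^ l"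
    using mult.IH(2) by blast
  have "cmod (q p x * r p x) \<le> (C * D) * (par_size p * (1 + norm x)) ^ (k + l)" if p: "fst p > 0" for p x
  proof -
    have "cmod (q p x) * cmod (r p x) \<le> (C * (par_size p * (1 + norm x)) ^ k) * (D * (par_size p * (1 + norm x)) ^ l)"
      using C D p par_size_ge_1 [OF p] by (intro mult_mono) auto
    then show ?thesis by (simp add: norm_mult power_add mult_ac)
  qed
  then show ?case using C(1) D(1) by (meson mult_nonneg_nonneg)
qed

lemma partial_deriv_gse:
  "partial_deriv i (gse x0 l \<xi>) =
    (\<lambda>x. (of_real (x0 $ i / (2 * l)) + of_real (x $ i) * of_real (- 1 / (2 * l)) + - \<i> * of_real (\<xi> $ i)) * gse x0 l \<xi> x)"
  by (rule ext, subst partial_deriv_eq [OF gse_has_derivative])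
    (simp add: inner_axis inner_axis' algebra_simps add_divide_distrib diff_divide_distrib)

lemma gse_coefficient:
  "(\<lambda>p x. of_real (x0 $ i / (2 * fst p)) + of_real (x $ i) * of_real (- 1 / (2 * fst p)) + - \<i> * of_real (snd p $ i)) \<in> par_poly"
proof (intro par_poly.add par_poly.mult par_poly.coord)
  have *: "1 / fst p \<le> par_size p" if "fst p > 0" for p :: "real \<times> (real ^ 'a)"
    using that by (simp add: par_size_def)
  show "(\<lambda>(p :: real \<times> (real ^ 'a)) x. complex_of_real (x0 $ i / (2 * fst p))) \<in> par_poly"
  proof (rule par_poly.const)
    fix p :: "real \<times> (real ^ 'a)" assume p: "fst p > 0"
    show "cmod (complex_of_real (x0 $ i / (2 * fst p))) \<le> \<bar>x0 $ i\<bar> / 2 * par_size p"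
      using mult_left_mono [OF * [OF p], of "\<bar>x0 $ i\<bar> / 2"] p by (simp del: of_real_divide)
  qed
  show "(\<lambda>(p :: real \<times> (real ^ 'a)) x. complex_of_real (- 1 / (2 * fst p))) \<in> par_poly"
  proof (rule par_poly.const)
    fix p :: "real \<times> (real ^ 'a)" assume p: "fst p > 0"
    show "cmod (complex_of_real (- 1 / (2 * fst p))) \<le> 1 / 2 * par_size p"
      using mult_left_mono [OF * [OF p], of "1 / 2"] p by (simp del: of_real_divide)
  qed
  show "(\<lambda>(p :: real \<times> (real ^ 'a)) x. - \<i>) \<in> par_poly" by (rule par_poly_const)
  show "(\<lambda>(p :: real \<times> (real ^ 'a)) x. complex_of_real (snd p $ i)) \<in> par_poly"
  proof (rule par_poly.const)
    fix p :: "real \<times> (real ^ 'a)" assume p: "fst p > 0"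
    have "\<bar>snd p $ i\<bar> \<le> norm (snd p)" by (rule component_le_norm_cart)
    also have "\<dots> \<le> par_size p" using p by (simp add: par_size_def)
    finally show "cmod (complex_of_real (snd p $ i)) \<le> 1 * par_size p" by simp
  qed
qed

lemma par_poly_gse_partial_deriv:
  assumes "q \<in> par_poly"
  shows "\<exists>r\<in>par_poly. \<forall>p. partial_deriv i (\<lambda>x. q p x * gse x0 (fst p) (snd p) x) = (\<lambda>x. r p x * gse x0 (fst p) (snd p) x)"
proof -
  define c where "c = (\<lambda>p x. of_real (x0 $ i / (2 * fst p)) + of_real (x $ i) * of_real (- 1 / (2 * fst p))
    + - \<i> * complex_of_real (snd p $ i))"
  have c: "c \<in> par_poly" unfolding c_def by (rule gse_coefficient)
  have "partial_deriv i (\<lambda>x. q p x * gse x0 (fst p) (snd p) x) =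
    (\<lambda>x. (q p x * c p x + partial_deriv i (q p) x) * gse x0 (fst p) (snd p) x)" for p
  proof
    fix x
    have "q p differentiable (at x)" using par_poly_partial_deriv [OF assms] by blast
    then show "partial_deriv i (\<lambda>x. q p x * gse x0 (fst p) (snd p) x) x =
      (q p x * c p x + partial_deriv i (q p) x) * gse x0 (fst p) (snd p) x"
      by (simp only: partial_deriv_mult differentiableI [OF gse_has_derivative] partial_deriv_gse c_def)
        (simp add: algebra_simps)
  qed
  moreover have "(\<lambda>p x. q p x * c p x + partial_deriv i (q p) x) \<in> par_poly"
    using par_poly_partial_deriv [OF assms] assms c by (intro par_poly.add par_poly.mult) auto
  ultimately show ?thesis by (intro bexI [where x = "\<lambda>p x. q p x * c p x + partial_deriv i (q p) x"]) auto
qed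

text \<open>The quantifiers matter: a single \<open>q\<close> serves all parameters, so that its
  bound is polynomial in width and frequency together.\<close>

lemma pdl_gse: "\<exists>q\<in>par_poly. \<forall>p. pdl js (gse x0 (fst p) (snd p)) = (\<lambda>x. q p x * gse x0 (fst p) (snd p) x)"
proof (induction js)
  case Nil
  show ?case by (rule bexI [OF _ par_poly_const [of 1]]) simp
next
  case (Cons j js)
  then obtain q where "q \<in> par_poly" "\<And>p. pdl js (gse x0 (fst p) (snd p)) = (\<lambda>x. q p x * gse x0 (fst p) (snd p) x)"
    by blast
  then show ?case using par_poly_gse_partial_deriv [of q j x0] by simp
qed

lemma gse_decay:
  "\<exists>C\<ge>0. \<forall>p x. fst p > 0 \<longrightarrow> (1 + norm x) ^ k * cmod (gse x0 (fst p) (snd p) x) \<le> C * par_size p ^ k"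
proof -
  obtain C :: real where C0: "C > 0" and "\<forall>z\<ge>0. (1 + z) ^ k \<le> C * exp (1 * z\<^sup>2)"
    using power_one_plus_le_exp_square [OF zero_less_one] by blast
  then have C: "C > 0" "\<And>z. z \<ge> 0 \<Longrightarrow> (1 + z) ^ k \<le> C * exp (z\<^sup>2)" by auto
  have "(1 + norm x) ^ k * cmod (gse x0 l \<xi> x) \<le> (2 ^ k * (1 + norm x0) ^ k) * C * par_size (l, \<xi>) ^ k"
    if l: "l > 0" for l \<xi> x
  proof -
    define y where "y = norm (x - x0)"
    \<comment> \<open>In this variable the Gaussian is \<open>exp (- z^2)\<close>, whatever its
      width.\<close>
    define z where "z = y / (2 * sqrt l)"
    have z: "z \<ge> 0" "z\<^sup>2 = y\<^sup>2 / (4 * l)" using l by (auto simp: z_def y_def power_divide power_mult_distrib)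
    have "norm x \<le> norm x0 + y" unfolding y_def by norm
    moreover have "0 \<le> norm x0 * y" by (simp add: y_def)
    ultimately have xy: "1 + norm x \<le> (1 + norm x0) * (1 + y)" by (simp add: algebra_simps)
    have y_le: "1 + y \<le> 2 * par_size (l, \<xi>) * (1 + z)"
    proof -
      \<comment> \<open>The arithmetic-geometric mean inequality replaces \<open>2 * sqrt l\<close>
        by \<open>1 + l\<close>, which \<open>par_size\<close> controls.\<close>
      have "0 \<le> (sqrt l - 1)\<^sup>2" by simp
      then have sl: "2 * sqrt l \<le> 1 + l" using l by (simp add: power2_diff)
      have "y = 2 * sqrt l * z" using l by (simp add: z_def)
      also have "\<dots> \<le> (1 + l) * z" using sl z by (intro mult_right_mono) auto
      finally have "1 + y \<le> (1 + l) * (1 + z)" using l by (simp add: algebra_simps)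
      also have "\<dots> \<le> (2 * par_size (l, \<xi>)) * (1 + z)"
        using z l by (intro mult_right_mono) (auto simp: par_size_def)
      finally show ?thesis .
    qed
    have "(1 + norm x0) * (1 + y) \<le> (1 + norm x0) * (2 * par_size (l, \<xi>) * (1 + z))"
      by (rule mult_left_mono [OF y_le]) simp
    with xy
    have "1 + norm x \<le> (1 + norm x0) * (2 * par_size (l, \<xi>) * (1 + z))" by linarith
    then have "(1 + norm x) ^ k \<le> ((1 + norm x0) * (2 * par_size (l, \<xi>) * (1 + z))) ^ k"
      by (intro power_mono) auto
    also have "\<dots> = (2 ^ k * (1 + norm x0) ^ k) * par_size (l, \<xi>) ^ k * (1 + z) ^ k"
      by (simp add: power_mult_distrib)
    also have "\<dots> \<le> (2 ^ k * (1 + norm x0) ^ k) * par_size (l, \<xi>) ^ k * (C * exp (y\<^sup>2 / (4 * l)))"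
      using C(2) [OF z(1)] z(2) l by (intro mult_left_mono) (auto simp: par_size_def)
    finally have "(1 + norm x) ^ k * exp (- y\<^sup>2 / (4 * l)) \<le>
      (2 ^ k * (1 + norm x0) ^ k) * par_size (l, \<xi>) ^ k * (C * exp (y\<^sup>2 / (4 * l))) * exp (- y\<^sup>2 / (4 * l))"
      by (intro mult_right_mono) auto
    also have "\<dots> = (2 ^ k * (1 + norm x0) ^ k) * C * par_size (l, \<xi>) ^ k"
      by (simp add: mult_ac exp_minus_inverse [symmetric] flip: exp_add)
    finally show ?thesis by (simp add: norm_gse y_def)
  qed
  then show ?thesis using C(1)
    by (intro exI [of _ "(2 ^ k * (1 + norm x0) ^ k) * C"]) auto
qed

lemma pdl_gse_bound:
  "\<exists>C\<ge>0. \<exists>m. \<forall>l \<xi> x. l > 0 \<longrightarrow> (1 + norm x) ^ k * cmod (pdl js (gse x0 l \<xi>) x) \<le> C * par_size (l, \<xi>) ^ m"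
proof -
  obtain q where q: "q \<in> par_poly" "\<And>p. pdl js (gse x0 (fst p) (snd p)) = (\<lambda>x. q p x * gse x0 (fst p) (snd p) x)"
    using pdl_gse by blast
  obtain C m where C: "C \<ge> 0" "\<And>p x. fst p > 0 \<Longrightarrow> cmod (q p x) \<le> C * (par_size p * (1 + norm x)) ^ m"
    using par_poly_bound [OF q(1)] by blast
  obtain D where D: "D \<ge> 0" "\<And>p x. fst p > 0 \<Longrightarrow>
      (1 + norm x) ^ (k + m) * cmod (gse x0 (fst p) (snd p) x) \<le> D * par_size p ^ (k + m)"
    using gse_decay [of "k + m" x0] by blast
  have "(1 + norm x) ^ k * cmod (pdl js (gse x0 (fst p) (snd p)) x) \<le> (C * D) * par_size p ^ (m + (k + m))"
    if p: "fst p > 0" for p x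
  proof -
    have "(1 + norm x) ^ k * cmod (pdl js (gse x0 (fst p) (snd p)) x) =
        (1 + norm x) ^ k * (cmod (q p x) * cmod (gse x0 (fst p) (snd p) x))"
      by (simp add: q norm_mult)
    also have "\<dots> \<le> (1 + norm x) ^ k * ((C * (par_size p * (1 + norm x)) ^ m) * cmod (gse x0 (fst p) (snd p) x))"
      using C(2) [OF p, of x] by (intro mult_left_mono mult_right_mono) auto
    also have "\<dots> = C * par_size p ^ m * ((1 + norm x) ^ (k + m) * cmod (gse x0 (fst p) (snd p) x))"
      by (simp add: power_mult_distrib power_add mult_ac)
    also have "\<dots> \<le> C * par_size p ^ m * (D * par_size p ^ (k + m))"
      using D(2) [OF p, of x] C(1) par_size_ge_1 [OF p] by (intro mult_left_mono) auto
    finally show ?thesis by (simp add: power_add mult_ac)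
  qed
  from this [of "(_, _)"] show ?thesis using C(1) D(1)
    by (intro exI [of _ "C * D"] conjI exI [of _ "m + (k + m)"]) auto
qed

lemma gse_schwartz: "l > 0 \<Longrightarrow> gse x0 l \<xi> \<in> schwartz_functions"
proof -
  assume l: "l > 0"
  have "pdl js (gse x0 l \<xi>) differentiable (at x)" for js x
  proof -
    obtain q where q: "q \<in> par_poly" "\<And>p. pdl js (gse x0 (fst p) (snd p)) = (\<lambda>x. q p x * gse x0 (fst p) (snd p) x)"
      using pdl_gse by blast
    show ?thesis
      using q(2) [of "(l, \<xi>)"] par_poly_partial_deriv [OF q(1)] differentiableI [OF gse_has_derivative]
      by (auto intro!: differentiable_mult)
  qed
  then have "smooth (gse x0 l \<xi>)" by (simp add: smooth_pdl)
  then show ?thesis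
    using pdl_gse_bound l unfolding schwartz_iff rapid_def by meson
qed

lemma gse_schwartz_bound:
  "\<exists>C\<ge>0. \<exists>m. \<forall>l \<xi>. l > 0 \<longrightarrow> schwartz_bound k (gse x0 l \<xi>) (C * par_size (l, \<xi>) ^ m)"
proof -
  have "\<exists>C\<ge>0. \<exists>m. \<forall>l \<xi> x. l > 0 \<longrightarrow> (1 + norm x) ^ k * cmod (pdl js (gse x0 l \<xi>) x) \<le> C * par_size (l, \<xi>) ^ m" for js
    by (rule pdl_gse_bound)
  then obtain C m where C: "\<And>js. C js \<ge> 0"
    "\<And>js l \<xi> x. l > 0 \<Longrightarrow> (1 + norm x) ^ k * cmod (pdl js (gse x0 l \<xi>) x) \<le> C js * par_size (l, \<xi>) ^ m js"
    by metis
  define J where "J = {js :: 'a list. length js \<le> k}"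
  have J: "finite J" using finite_lists_length_le [of "UNIV :: 'a set" k] by (simp add: J_def)
  define M where "M = sum m J"
  have "schwartz_bound k (gse x0 l \<xi>) (sum C J * par_size (l, \<xi>) ^ M)" if l: "l > 0" for l \<xi>
    unfolding schwartz_bound_def
  proof safe
    fix js :: "'a list" and x :: "real ^ 'a" assume "length js \<le> k"
    then have js: "js \<in> J" by (simp add: J_def)
    have 1: "1 \<le> par_size (l, \<xi>)" using l by (simp add: par_size_ge_1)
    have "(1 + norm x) ^ k * cmod (pdl js (gse x0 l \<xi>) x) \<le> C js * par_size (l, \<xi>) ^ m js" by (rule C(2) [OF l])
    also have "\<dots> \<le> sum C J * par_size (l, \<xi>) ^ M"
    proof (intro mult_mono power_increasing)
      show "C js \<le> sum C J" using js J C(1) by (intro member_le_sum) auto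
      show "m js \<le> M" unfolding M_def using js J by (intro member_le_sum) auto
    qed (use 1 C(1) in \<open>auto intro: sum_nonneg\<close>)
    finally show "(1 + norm x) ^ k * cmod (pdl js (gse x0 l \<xi>) x) \<le> sum C J * par_size (l, \<xi>) ^ M" .
  qed
  then show ?thesis using C(1) by (intro exI [of _ "sum C J"]) (auto intro: sum_nonneg)
qed

text \<open>Up to \<open>fourier_const\<close>, the value \<open>u (gse x0 l \<xi>)\<close> is the
  Fourier transform at \<open>\<xi>\<close> of \<open>u\<close> times a Gaussian. Here the order of
  a tempered distribution becomes a power of the frequency and of the width.\<close>

lemma tempered_gse_bound:
  assumes "u \<in> tempered_distributions"
  shows "\<exists>C\<ge>0. \<exists>m. \<forall>l \<xi>. l > 0 \<longrightarrow> cmod (u (gse x0 l \<xi>)) \<le> C * par_size (l, \<xi>) ^ m"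
proof -
  obtain C k where C: "C \<ge> 0"
    "\<And>\<phi> B. \<phi> \<in> schwartz_functions \<Longrightarrow> schwartz_bound k \<phi> B \<Longrightarrow> cmod (u \<phi>) \<le> C * B"
    using assms unfolding tempered_iff by blast
  obtain D m where D: "D \<ge> 0" "\<And>l \<xi>. l > 0 \<Longrightarrow> schwartz_bound k (gse x0 l \<xi>) (D * par_size (l, \<xi>) ^ m)"
    using gse_schwartz_bound [of k x0] by blast
  have "cmod (u (gse x0 l \<xi>)) \<le> (C * D) * par_size (l, \<xi>) ^ m" if "l > 0" for l \<xi>
    using C(2) [OF gse_schwartz [OF that] D(2) [OF that]] by (simp add: mult.assoc)
  then show ?thesis using C(1) D(1) by (intro exI [of _ "C * D"]) auto
qed

section \<open>Integration lemmas\<close>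

lemma lborel_translate:
  "(\<lambda>x::'a::euclidean_space. x + c) \<in> lborel \<rightarrow>\<^sub>M borel"
  "distr lborel borel (\<lambda>x. x + c) = (lborel :: 'a::euclidean_space measure)"
  using lborel_distr_plus [of c] by (simp_all add: add.commute [of _ c])

lemma lborel_integrable_translate:
  fixes f :: "'a::euclidean_space \<Rightarrow> 'b::{banach, second_countable_topology}"
  assumes "integrable lborel f"
  shows "integrable lborel (\<lambda>x. f (x + c))"
  using assms integrable_distr_eq [OF lborel_translate(1), of f c] lborel_translate(2) [of c] by auto

lemma lborel_integral_translate:
  fixes f :: "'a::euclidean_space \<Rightarrow> 'b::{banach, second_countable_topology}"
  shows "(LINT x|lborel. f (x + c)) = (LINT x|lborel. f x)"
proof (cases "integrable lborel f")
  case True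
  then show ?thesis
    using integral_distr [OF lborel_translate(1), of f c] lborel_translate(2) [of c] by auto
next
  case False
  then have "\<not> integrable lborel (\<lambda>x. f (x + c))"
    using lborel_integrable_translate [of "\<lambda>x. f (x + c)" "- c"] by auto
  then show ?thesis using False by (simp add: not_integrable_integral_eq)
qed

lemma
  fixes f :: "'a::euclidean_space \<Rightarrow> real \<Rightarrow> 'b::{real_normed_field, banach, second_countable_topology}"
  assumes f: "\<And>b. b \<in> Basis \<Longrightarrow> integrable lborel (f b)"
  shows lborel_integrable_prod: "integrable lborel (\<lambda>x. \<Prod>b\<in>Basis. f b (x \<bullet> b))"
    and lborel_integral_prod: "(LINT x|lborel. (\<Prod>b\<in>Basis. f b (x \<bullet> b))) = (\<Prod>b\<in>Basis. (LINT x|lborel. f b x))"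
proof -
  interpret product_sigma_finite "\<lambda>_::'a. lborel :: real measure" ..
  have m: "(\<lambda>f. \<Sum>b\<in>Basis. f b *\<^sub>R b) \<in> (\<Pi>\<^sub>M b\<in>(Basis::'a set). lborel) \<rightarrow>\<^sub>M borel" by measurable
  have [measurable]: "\<And>b. b \<in> Basis \<Longrightarrow> f b \<in> borel_measurable borel"
    using f borel_measurable_integrable by fastforce
  have mf: "(\<lambda>x. \<Prod>b\<in>Basis. f b (x \<bullet> b)) \<in> borel_measurable borel" by measurable
  have eq: "(\<Prod>b\<in>Basis. f b ((\<Sum>c\<in>Basis. x c *\<^sub>R c) \<bullet> b)) = (\<Prod>b\<in>Basis. f b (x b))" for x
    by (intro prod.cong) auto
  show "integrable lborel (\<lambda>x. \<Prod>b\<in>Basis. f b (x \<bullet> b))"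
    unfolding lborel_eq [where 'a = 'a]
    by (subst integrable_distr_eq [OF m mf]) (simp add: eq product_integrable_prod f)
  show "(LINT x|lborel. (\<Prod>b\<in>Basis. f b (x \<bullet> b))) = (\<Prod>b\<in>Basis. (LINT x|lborel. f b x))"
    unfolding lborel_eq [where 'a = 'a]
    by (subst integral_distr [OF m mf]) (simp add: eq product_integral_prod f)
qed

text \<open>Every coordinate receives a factor \<open>(1 + norm x)^2\<close>, which is at least one
  plus its square; the majorant is a product of one-dimensional Cauchy densities up to
  normalization.\<close>

lemma integrable_inverse_norm_power:
  "integrable lborel (\<lambda>x :: real ^ 'n::finite. 1 / (1 + norm x) ^ (2 * CARD('n)))"
proof -
  have 1: "integrable lborel (\<lambda>x::real. inverse (1 + x\<^sup>2))"
    using integrable_inverse_1_plus_square by (simp add: set_integrable_def)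
  have 2: "integrable lborel (\<lambda>x :: real ^ 'n. \<Prod>b\<in>Basis. inverse (1 + (x \<bullet> b)\<^sup>2))"
    by (rule lborel_integrable_prod [OF 1])
  show ?thesis
  proof (rule Bochner_Integration.integrable_bound [OF 2])
    show "(\<lambda>x :: real ^ 'n. 1 / (1 + norm x) ^ (2 * CARD('n))) \<in> borel_measurable lborel" by measurable
    have "1 / (1 + norm x) ^ (2 * CARD('n)) \<le> (\<Prod>b\<in>Basis. inverse (1 + (x \<bullet> b)\<^sup>2))" for x :: "real ^ 'n"
    proof -
      have "1 / (1 + norm x) ^ (2 * CARD('n)) = (\<Prod>b\<in>(Basis :: (real ^ 'n) set). inverse ((1 + norm x)\<^sup>2))"
        by (simp add: divide_inverse power_inverse flip: power_mult)
      also have "\<dots> \<le> (\<Prod>b\<in>Basis. inverse (1 + (x \<bullet> b)\<^sup>2))"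
      proof (intro prod_mono conjI le_imp_inverse_le)
        fix b :: "real ^ 'n" assume b: "b \<in> Basis"
        have "(x \<bullet> b)\<^sup>2 \<le> (norm x)\<^sup>2" by (metis Basis_le_norm [OF b] abs_le_square_iff abs_norm_cancel)
        also have "1 + (norm x)\<^sup>2 \<le> (1 + norm x)\<^sup>2" by (simp add: power2_sum)
        finally show "1 + (x \<bullet> b)\<^sup>2 \<le> (1 + norm x)\<^sup>2" by simp
        show "0 < 1 + (x \<bullet> b)\<^sup>2" by (simp add: add_pos_nonneg)
      qed simp
      finally show ?thesis .
    qed
    then show "AE x in lborel. norm (1 / (1 + norm (x :: real ^ 'n)) ^ (2 * CARD('n))) \<le> norm (\<Prod>b\<in>Basis. inverse (1 + (x \<bullet> b)\<^sup>2))"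
      by (intro AE_I2) (auto intro!: order_trans [OF _ abs_ge_self])
  qed
qed

lemma rapid_integrable:
  assumes r: "rapid f" and m: "f \<in> borel_measurable borel"
  shows "integrable lborel (\<lambda>x. (1 + norm x) ^ k * cmod (f x))"
proof -
  define p where "p = 2 * CARD('a)"
  obtain B where B: "\<And>x. (1 + norm x) ^ (k + p) * cmod (f x) \<le> B"
    using r unfolding rapid_def by blast
  show ?thesis
  proof (rule Bochner_Integration.integrable_bound)
    show "integrable lborel (\<lambda>x :: real ^ 'a. B * (1 / (1 + norm x) ^ p))"
      unfolding p_def by (intro integrable_mult_right integrable_inverse_norm_power)
    show "(\<lambda>x. (1 + norm x) ^ k * cmod (f x)) \<in> borel_measurable lborel" using m by measurable
    have "(1 + norm x) ^ k * cmod (f x) \<le> B * (1 / (1 + norm x) ^ p)" for x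
      using B [of x] by (simp add: pos_le_divide_eq add_pos_nonneg power_add mult_ac)
    then show "AE x in lborel. norm ((1 + norm x) ^ k * cmod (f x)) \<le> norm (B * (1 / (1 + norm x) ^ p))"
      by (intro AE_I2) (simp add: order_trans [OF _ abs_ge_self] del: times_divide_eq_right)
  qed
qed

lemma schwartz_measurable: "\<phi> \<in> schwartz_functions \<Longrightarrow> \<phi> \<in> borel_measurable borel"
  using schwartz_smooth smooth_continuous by (intro borel_measurable_continuous_onI) blast

lemma schwartz_integrable_weight:
  "\<phi> \<in> schwartz_functions \<Longrightarrow> integrable lborel (\<lambda>x. (1 + norm x) ^ k * cmod (\<phi> x))"
  by (intro rapid_integrable schwartz_rapid schwartz_measurable)

lemma schwartz_integrable: "\<phi> \<in> schwartz_functions \<Longrightarrow> integrable lborel \<phi>"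
  by (rule integrable_norm_cancel)
    (use schwartz_integrable_weight [of \<phi> 0] schwartz_measurable [of \<phi>] in simp_all)

text \<open>Differentiation under the integral sign. By the mean value inequality on segments, the
  bound on \<open>L\<close> near \<open>x0\<close> yields the majorant \<open>2 * B\<close> of the
  remainders divided by the increment. Dominated convergence is a statement on sequences, hence the
  passage to \<open>X\<close>.\<close>

lemma has_derivative_integral:
  fixes f :: "'a::euclidean_space \<Rightarrow> 'b \<Rightarrow> complex"
  assumes der: "\<And>x y. ((\<lambda>x. f x y) has_derivative L x y) (at x)"
    and bound: "\<And>x y v. dist x x0 < 1 \<Longrightarrow> cmod (L x y v) \<le> B y * norm v"
    and B: "integrable M B"
    and int: "\<And>x. integrable M (f x)"
    and meas: "\<And>v. (\<lambda>y. L x0 y v) \<in> borel_measurable M"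
  shows "((\<lambda>x. LINT y|M. f x y) has_derivative (\<lambda>v. LINT y|M. L x0 y v)) (at x0)"
proof -
  have bl: "bounded_linear (L x y)" for x y using der has_derivative_bounded_linear by blast
  have B0: "0 \<le> B y" for y
    using order_trans [OF norm_ge_zero bound [of x0 y "SOME b. b \<in> Basis"]] SOME_Basis by simp
  have intL: "integrable M (\<lambda>y. L x0 y v)" for v
  proof (rule Bochner_Integration.integrable_bound)
    show "integrable M (\<lambda>y. B y * norm v)" using B by simp
    show "AE y in M. cmod (L x0 y v) \<le> norm (B y * norm v)"
      using bound [of x0 _ v] by (intro AE_I2) (auto intro!: order_trans [OF _ abs_ge_self] simp del: abs_mult norm_mult abs_norm_cancel)
  qed (rule meas)
  have lin: "bounded_linear (\<lambda>v. LINT y|M. L x0 y v)"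
  proof (rule bounded_linear_intro)
    fix u v :: 'a and r :: real
    interpret bounded_linear "L x0 y" for y by (rule bl)
    show "(LINT y|M. L x0 y (u + v)) = (LINT y|M. L x0 y u) + (LINT y|M. L x0 y v)"
      using intL by (simp add: add)
    show "(LINT y|M. L x0 y (r *\<^sub>R v)) = r *\<^sub>R (LINT y|M. L x0 y v)"
      by (simp add: scaleR)
    have "cmod (LINT y|M. L x0 y v) \<le> (LINT y|M. B y * norm v)"
      using bound [of x0 _ v] B intL by (intro order_trans [OF integral_norm_bound] integral_mono) auto
    then show "norm (LINT y|M. L x0 y v) \<le> norm v * (LINT y|M. B y)" by (simp add: mult.commute)
  qed
  have "((\<lambda>x. norm ((LINT y|M. f x y) - (LINT y|M. f x0 y) - (LINT y|M. L x0 y (x - x0))) / norm (x - x0))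
    \<longlongrightarrow> 0) (at x0)"
    unfolding tendsto_at_iff_sequentially o_def
  proof (intro allI impI)
    fix X :: "nat \<Rightarrow> 'a" assume X: "\<forall>i. X i \<in> UNIV - {x0}" "X \<longlonglongrightarrow> x0"
    define g where "g = (\<lambda>n y. (f (X n) y - f x0 y - L x0 y (X n - x0)) /\<^sub>R norm (X n - x0))"
    have ev: "\<forall>\<^sub>F n in sequentially. dist (X n) x0 < 1" using X(2) by (simp add: tendstoD)
    then obtain n0 where n0: "\<And>n. n \<ge> n0 \<Longrightarrow> dist (X n) x0 < 1"
      unfolding eventually_sequentially by blast
    have "(\<lambda>n. LINT y|M. g (n + n0) y) \<longlonglongrightarrow> (LINT y|M. 0)"
    proof (rule integral_dominated_convergence)
      show "integrable M (\<lambda>y. 2 * B y)" using B by simp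
      show "(\<lambda>y. g (n + n0) y) \<in> borel_measurable M" for n
        unfolding g_def using int intL by (intro borel_measurable_integrable) auto
      show "AE y in M. (\<lambda>n. g (n + n0) y) \<longlonglongrightarrow> 0"
      proof (rule AE_I2)
        fix y
        have "((\<lambda>x. norm (f x y - f x0 y - L x0 y (x - x0)) / norm (x - x0)) \<longlongrightarrow> 0) (at x0)"
          using der [of y x0] unfolding has_derivative_iff_norm by blast
        then have "(\<lambda>n. norm (f (X n) y - f x0 y - L x0 y (X n - x0)) / norm (X n - x0)) \<longlonglongrightarrow> 0"
          using X unfolding tendsto_at_iff_sequentially o_def by blast
        then have "(\<lambda>n. norm (g n y)) \<longlonglongrightarrow> 0" by (simp add: g_def divide_inverse mult.commute)
        then have "(\<lambda>n. g n y) \<longlonglongrightarrow> 0" by (rule tendsto_norm_zero_cancel)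
        then show "(\<lambda>n. g (n + n0) y) \<longlonglongrightarrow> 0" by (rule LIMSEQ_ignore_initial_segment)
      qed
      show "AE y in M. cmod (g (n + n0) y) \<le> 2 * B y" for n
      proof (rule AE_I2)
        fix y
        let ?x = "X (n + n0)"
        have d: "dist ?x x0 < 1" by (rule n0) simp
        have ne: "norm (?x - x0) > 0" using X(1) by simp
        have on: "onorm (L x y) \<le> B y" if "dist x x0 < 1" for x
          using bound [OF that] by (intro onorm_bound B0) auto
        have seg: "x \<in> closed_segment x0 ?x \<Longrightarrow> dist x x0 < 1" for x
          using d dist_in_closed_segment [of x x0 ?x] by (simp add: dist_commute)
        have "cmod (f ?x y - f x0 y) \<le> B y * norm (?x - x0)"
          by (rule differentiable_bound [of "closed_segment x0 ?x" "\<lambda>x. f x y" "\<lambda>x. L x y"])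
            (auto intro: has_derivative_at_withinI der on seg)
        moreover have "cmod (L x0 y (?x - x0)) \<le> B y * norm (?x - x0)" by (rule bound) simp
        ultimately have "cmod (f ?x y - f x0 y - L x0 y (?x - x0)) \<le> (2 * B y) * norm (?x - x0)"
          using norm_triangle_ineq4 [of "f ?x y - f x0 y" "L x0 y (?x - x0)"] by simp
        then have "cmod (f ?x y - f x0 y - L x0 y (?x - x0)) / norm (?x - x0) \<le> 2 * B y"
          using ne by (simp add: pos_divide_le_eq)
        then show "cmod (g (n + n0) y) \<le> 2 * B y" by (simp add: g_def divide_inverse mult.commute)
      qed
    qed simp
    then have "(\<lambda>n. LINT y|M. g n y) \<longlonglongrightarrow> 0" by (simp add: LIMSEQ_offset)
    then have "(\<lambda>n. norm (LINT y|M. g n y)) \<longlonglongrightarrow> 0" by (rule tendsto_norm_zero)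
    moreover have "norm (LINT y|M. g n y) =
      norm ((LINT y|M. f (X n) y) - (LINT y|M. f x0 y) - (LINT y|M. L x0 y (X n - x0))) / norm (X n - x0)" for n
      unfolding g_def using int intL by (simp add: divide_inverse mult.commute)
    ultimately show "(\<lambda>n. norm ((LINT y|M. f (X n) y) - (LINT y|M. f x0 y) - (LINT y|M. L x0 y (X n - x0))) / norm (X n - x0)) \<longlonglongrightarrow> 0"
      by simp
  qed
  then show ?thesis unfolding has_derivative_iff_norm using lin by blast
qed

lemma integrable_convolution:
  fixes f g :: "real ^ 'n::finite \<Rightarrow> real"
  assumes f: "integrable lborel f" and g: "integrable lborel g"
  shows "integrable (lborel \<Otimes>\<^sub>M lborel) (\<lambda>(x, y). f x * g (y - x))"
proof (rule lborel_pair.Fubini_integrable)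
  have [measurable]: "f \<in> borel_measurable borel" "g \<in> borel_measurable borel"
    using f g borel_measurable_integrable by fastforce+
  show "(\<lambda>(x, y). f x * g (y - x)) \<in> borel_measurable (lborel \<Otimes>\<^sub>M lborel)" by measurable
  have gi: "integrable lborel (\<lambda>y. g (y - x))" for x
    using lborel_integrable_translate [OF g, of "- x"] by simp
  have "(LINT y|lborel. norm (case (x, y) of (x, y) \<Rightarrow> f x * g (y - x))) = \<bar>f x\<bar> * (LINT y|lborel. \<bar>g y\<bar>)" for x
    using lborel_integral_translate [of "\<lambda>y. \<bar>g y\<bar>" "- x"] by (simp add: abs_mult)
  then show "integrable lborel (\<lambda>x. LINT y|lborel. norm (case (x, y) of (x, y) \<Rightarrow> f x * g (y - x)))"
    using f by simp
  show "AE x in lborel. integrable lborel (\<lambda>y. case (x, y) of (x, y) \<Rightarrow> f x * g (y - x))"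
    using gi by simp
qed

section \<open>The Fourier transform of Schwartz functions\<close>

abbreviation fourier_const :: "'n::finite itself \<Rightarrow> complex" where
  "fourier_const _ \<equiv> of_real ((2 * pi) powr (- real CARD('n) / 2))"

lemma has_derivative_eq_sum_partial_deriv:
  fixes f :: "('n::finite) cfun"
  assumes "(f has_derivative f') (at x)"
  shows "f' v = (\<Sum>i\<in>UNIV. of_real (v $ i) * partial_deriv i f x)"
proof -
  interpret bounded_linear f' using assms has_derivative_bounded_linear by blast
  have "v = (\<Sum>i\<in>UNIV. (v $ i) *\<^sub>R axis i 1)" using basis_expansion [of v] by (simp add: scalar_mult_eq_scaleR)
  then have "f' v = (\<Sum>i\<in>UNIV. f' ((v $ i) *\<^sub>R axis i 1))" by (metis sum)
  also have "\<dots> = (\<Sum>i\<in>UNIV. (v $ i) *\<^sub>R f' (axis i 1))" by (simp only: scaleR)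
  finally show ?thesis by (simp add: partial_deriv_eq [OF assms] scaleR_conv_of_real)
qed

lemma smooth_has_derivative:
  "smooth f \<Longrightarrow> (f has_derivative (\<lambda>v. \<Sum>i\<in>UNIV. of_real (v $ i) * partial_deriv i f x)) (at x)"
  using smooth_differentiable [of f x] has_derivative_eq_sum_partial_deriv
  unfolding differentiable_def by (metis (no_types, lifting) ext)

lemma fourier_integrable:
  assumes "\<phi> \<in> schwartz_functions"
  shows "integrable lborel (\<lambda>x. \<phi> x * exp (- \<i> * of_real (x \<bullet> \<xi>)))"
proof (rule Bochner_Integration.integrable_bound)
  show "integrable lborel \<phi>" by (rule schwartz_integrable [OF assms])
  have [measurable]: "\<phi> \<in> borel_measurable borel" by (rule schwartz_measurable [OF assms])
  show "(\<lambda>x. \<phi> x * exp (- \<i> * of_real (x \<bullet> \<xi>))) \<in> borel_measurable lborel" by measurable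
qed (simp add: norm_mult)

lemma fourier_fun_has_derivative:
  assumes \<phi>: "\<phi> \<in> schwartz_functions"
  shows "(fourier_fun \<phi> has_derivative
    (\<lambda>v. fourier_const TYPE('n) * (LINT x|lborel. \<phi> x * (exp (- \<i> * of_real (x \<bullet> \<xi>)) * (- \<i> * of_real (x \<bullet> v))))))
    (at (\<xi> :: real ^ 'n::finite))"
proof -
  have [measurable]: "\<phi> \<in> borel_measurable borel" by (rule schwartz_measurable [OF \<phi>])
  have "((\<lambda>\<xi>. LINT x|lborel. \<phi> x * exp (- \<i> * of_real (x \<bullet> \<xi>))) has_derivative
    (\<lambda>v. LINT x|lborel. \<phi> x * (exp (- \<i> * of_real (x \<bullet> \<xi>)) * (- \<i> * of_real (x \<bullet> v))))) (at \<xi>)"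
  proof (rule has_derivative_integral)
    fix \<eta> x :: "real ^ 'n"
    show "((\<lambda>\<xi>. \<phi> x * exp (- \<i> * of_real (x \<bullet> \<xi>))) has_derivative
      (\<lambda>v. \<phi> x * (exp (- \<i> * of_real (x \<bullet> \<eta>)) * (- \<i> * of_real (x \<bullet> v))))) (at \<eta>)"
      by (intro has_derivative_mult_right has_derivative_exp_complex)
        (auto intro!: derivative_eq_intros)
  next
    fix \<eta> x v :: "real ^ 'n"
    have "cmod (\<phi> x * (exp (- \<i> * of_real (x \<bullet> \<eta>)) * (- \<i> * of_real (x \<bullet> v)))) = cmod (\<phi> x) * \<bar>x \<bullet> v\<bar>"
      by (simp add: norm_mult)
    also have "\<dots> \<le> cmod (\<phi> x) * ((1 + norm x) * norm v)"
      by (intro mult_left_mono order_trans [OF Cauchy_Schwarz_ineq2] mult_right_mono) auto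
    finally show "cmod (\<phi> x * (exp (- \<i> * of_real (x \<bullet> \<eta>)) * (- \<i> * of_real (x \<bullet> v))))
      \<le> ((1 + norm x) ^ 1 * cmod (\<phi> x)) * norm v" by (simp add: mult_ac)
  qed (use schwartz_integrable_weight [OF \<phi>, of 1] fourier_integrable [OF \<phi>] in simp_all)
  from has_derivative_mult_right [OF this, of "fourier_const TYPE('n)"]
  show ?thesis unfolding fourier_fun_def [abs_def] .
qed

lemma partial_deriv_fourier_fun:
  assumes "\<phi> \<in> schwartz_functions"
  shows "partial_deriv i (fourier_fun \<phi>) = fourier_fun (\<lambda>x. - \<i> * (of_real (x $ i) * \<phi> x))"
  by (rule ext, subst partial_deriv_eq [OF fourier_fun_has_derivative [OF assms]])
    (simp add: fourier_fun_def inner_axis mult_ac)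

text \<open>Bounded derivatives suffice. Where membership in the Schwartz space is required, the
  transform comes multiplied by a Gaussian, so its own rapid decay, which would take integrations by
  parts, is never invoked.\<close>

lemma fourier_fun_moderate:
  assumes "\<phi> \<in> schwartz_functions" shows "fourier_fun \<phi> \<in> moderate"
proof (rule moderate_coinduct [where X = "fourier_fun ` schwartz_functions"])
  fix f :: "'a cfun" and x i
  assume "f \<in> fourier_fun ` schwartz_functions"
  then obtain \<psi> where \<psi>: "\<psi> \<in> schwartz_functions" and f: "f = fourier_fun \<psi>" by blast
  show "f differentiable (at x)" unfolding f by (rule differentiableI [OF fourier_fun_has_derivative [OF \<psi>]])
  show "partial_deriv i f \<in> fourier_fun ` schwartz_functions"
    unfolding f partial_deriv_fourier_fun [OF \<psi>] by (intro imageI schwartz_cmult schwartz_coord_mult \<psi>)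
  have "cmod (f x) \<le> (cmod (fourier_const TYPE('a)) * (LINT x|lborel. cmod (\<psi> x))) * (1 + norm x) ^ 0" for x
  proof -
    have "cmod (LINT y|lborel. \<psi> y * exp (- \<i> * of_real (y \<bullet> x))) \<le> (LINT y|lborel. cmod (\<psi> y * exp (- \<i> * of_real (y \<bullet> x))))"
      by (rule integral_norm_bound)
    then show ?thesis unfolding f fourier_fun_def norm_mult by (simp add: norm_mult mult_left_mono)
  qed
  then show "poly_bounded f" unfolding poly_bounded_def by blast
qed (use assms in auto)

lemma pdl_fourier_fun:
  assumes "\<phi> \<in> schwartz_functions"
  shows "(\<lambda>x. of_real (prod_list (map (\<lambda>i. x $ i) js)) * \<phi> x) \<in> schwartz_functions \<and>
    pdl js (fourier_fun \<phi>) = fourier_fun (\<lambda>x. (- \<i>) ^ length js * (of_real (prod_list (map (\<lambda>i. x $ i) js)) * \<phi> x))"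
  using assms
\<comment> \<open>\<open>pdl\<close> applies the last letter of the word first. Its factor is
  absorbed into the test function, hence the generalization over \<open>\<phi>\<close>.\<close>
proof (induction js arbitrary: \<phi> rule: rev_induct)
  case Nil
  then show ?case by simp
next
  case (snoc i js)
  have 1: "(\<lambda>x. of_real (x $ i) * \<phi> x) \<in> schwartz_functions" by (rule schwartz_coord_mult [OF snoc.prems])
  have 2: "(\<lambda>x. - \<i> * (of_real (x $ i) * \<phi> x)) \<in> schwartz_functions" by (rule schwartz_cmult [OF 1])
  have "pdl (js @ [i]) (fourier_fun \<phi>) = pdl js (fourier_fun (\<lambda>x. - \<i> * (of_real (x $ i) * \<phi> x)))"
    by (simp add: pdl_append partial_deriv_fourier_fun [OF snoc.prems])
  also have "\<dots> = fourier_fun (\<lambda>x. (- \<i>) ^ length js * (of_real (prod_list (map (\<lambda>i. x $ i) js)) * (- \<i> * (of_real (x $ i) * \<phi> x))))"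
    using snoc.IH [OF 2] by blast
  finally show ?case using snoc.IH [OF 1] by (simp add: mult_ac)
qed

section \<open>The heat kernel and Gaussian convolutions\<close>

text \<open>The heat kernel at time \<open>1 / (4 * l)\<close>: large \<open>l\<close> means strong
  concentration, on a length of order \<open>1 / sqrt l\<close>.\<close>

definition heat :: "real \<Rightarrow> real ^ 'n::finite \<Rightarrow> real" where
  "heat l t = sqrt (l / pi) ^ CARD('n) * exp (- l * (norm t)\<^sup>2)"

lemma heat_nonneg [simp]: "l \<ge> 0 \<Longrightarrow> heat l t \<ge> 0"
  by (simp add: heat_def)

lemma heat_minus [simp]: "heat l (- t) = heat l t"
  by (simp add: heat_def)

lemma heat_measurable [measurable]: "heat l \<in> borel_measurable borel"
  unfolding heat_def by measurable

text \<open>The characteristic function of the standard normal distribution, after the substitution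
  that multiplies the variable by \<open>sqrt (2 * l)\<close>.\<close>

lemma gaussian_fourier_real:
  fixes y :: real
  assumes l: "l > 0"
  shows "has_bochner_integral lborel (\<lambda>t. exp (complex_of_real (- l * t\<^sup>2) - \<i> * of_real (t * y)))
    (of_real (sqrt (pi / l) * exp (- y\<^sup>2 / (4 * l))))"
proof -
  define c where "c = sqrt (2 * l)"
  have c: "c > 0" "c\<^sup>2 = 2 * l" using l by (auto simp: c_def)
  have c': "(complex_of_real c)\<^sup>2 = 2 * of_real l"
    using c(2) by (metis of_real_mult of_real_numeral of_real_power)
  define f where "f = (\<lambda>x. std_normal_density x *\<^sub>R iexp (- y / c * x))"
  have "integrable lborel (\<lambda>x. std_normal_density x)" by simp
  then have f: "integrable lborel f"
    unfolding f_def by (rule Bochner_Integration.integrable_bound) auto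
  have "(LINT x|lborel. f x) = char std_normal_distribution (- y / c)"
    unfolding char_def f_def by (subst integral_density) auto
  also have "\<dots> = of_real (exp (- y\<^sup>2 / (4 * l)))"
    using l by (simp add: char_std_normal_distribution power_divide c)
  finally have If: "(LINT x|lborel. f x) = of_real (exp (- y\<^sup>2 / (4 * l)))" .
  have f': "f (c * t) = of_real (1 / sqrt (2 * pi)) * exp (complex_of_real (- l * t\<^sup>2) - \<i> * of_real (t * y))" for t
    using c(1) by (simp add: c' f_def std_normal_density_def power_mult_distrib scaleR_conv_of_real exp_diff exp_minus
        field_simps flip: exp_of_real)
  have i: "integrable lborel (\<lambda>t. f (c * t))"
    using lborel_integrable_real_affine [OF f, of c 0] c by simp
  have v: "of_real (exp (- y\<^sup>2 / (4 * l))) = c *\<^sub>R (LINT t|lborel. f (c * t))"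
    using lborel_integral_real_affine [of c f 0] c If by simp
  have "integrable lborel (\<lambda>t. of_real (sqrt (2 * pi)) * f (c * t))" using i by simp
  then have I: "integrable lborel (\<lambda>t. exp (complex_of_real (- l * t\<^sup>2) - \<i> * of_real (t * y)))"
    by (simp add: f' flip: mult.assoc of_real_mult)
  have one: "c * (1 / sqrt (2 * pi)) * sqrt (pi / l) = 1"
    unfolding c_def using l by (simp add: real_sqrt_mult real_sqrt_divide field_simps)
  have v': "of_real (exp (- y\<^sup>2 / (4 * l))) =
    of_real (c * (1 / sqrt (2 * pi))) * (LINT t|lborel. exp (complex_of_real (- l * t\<^sup>2) - \<i> * of_real (t * y)))"
    using v unfolding f' by (simp add: scaleR_conv_of_real)
  have "(LINT t|lborel. exp (complex_of_real (- l * t\<^sup>2) - \<i> * of_real (t * y)))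
    = of_real (c * (1 / sqrt (2 * pi)) * sqrt (pi / l)) * (LINT t|lborel. exp (complex_of_real (- l * t\<^sup>2) - \<i> * of_real (t * y)))"
    unfolding one by simp
  also have "\<dots> = of_real (sqrt (pi / l)) * of_real (exp (- y\<^sup>2 / (4 * l)))"
    unfolding v' of_real_mult by (simp only: mult_ac)
  finally have "(LINT t|lborel. exp (complex_of_real (- l * t\<^sup>2) - \<i> * of_real (t * y)))
    = of_real (sqrt (pi / l)) * of_real (exp (- y\<^sup>2 / (4 * l)))" .
  then show ?thesis using I by (simp add: has_bochner_integral_iff)
qed

text \<open>The modulation moves the centre of the Gaussian on the other side of the Fourier
  transform from the origin to \<open>x0\<close>, see \<open>kern_fourier\<close>.\<close>

definition kern :: "real ^ 'n::finite \<Rightarrow> real \<Rightarrow> 'n cfun" where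
  "kern x0 l t = of_real (heat l t) * exp (\<i> * of_real (x0 \<bullet> t))"

lemma norm_kern: "l \<ge> 0 \<Longrightarrow> cmod (kern x0 l t) = heat l t"
  by (simp add: kern_def norm_mult norm_exp_eq_Re)

lemma kern_minus: "kern x0 l (- t) = kern (- x0) l t"
  by (simp add: kern_def)

text \<open>A translated kernel is again a Gaussian wave packet, with position and frequency
  exchanged and the width inverted. This makes it a Schwartz function without further
  estimates.\<close>

lemma kern_eq_gse:
  assumes "l > 0"
  shows "kern x0 l (\<eta> - \<xi>) =
    of_real (sqrt (l / pi) ^ CARD('n)) * exp (- \<i> * of_real (x0 \<bullet> \<xi>)) * gse \<xi> (1 / (4 * l)) (- x0) (\<eta> :: real ^ 'n::finite)"
  by (simp add: kern_def heat_def gse_def inner_diff_right inner_commute algebra_simps flip: exp_of_real exp_add)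

lemma kern_schwartz: "l > 0 \<Longrightarrow> (\<lambda>\<eta>. kern x0 l (\<eta> - \<xi>)) \<in> schwartz_functions"
  by (simp only: kern_eq_gse, rule schwartz_cmult, rule gse_schwartz) simp

lemma kern_schwartz0: "l > 0 \<Longrightarrow> kern x0 l \<in> schwartz_functions"
  using kern_schwartz [of l x0 0] by simp

lemma kern_measurable [measurable]: "kern x0 l \<in> borel_measurable borel"
  unfolding kern_def by measurable

lemma heat_weight_integrable: "l > 0 \<Longrightarrow> integrable lborel (\<lambda>t. (1 + norm t) ^ k * heat l t)"
  using schwartz_integrable_weight [OF kern_schwartz0, of l k 0] by (simp add: norm_kern)

lemma heat_integrable: "l > 0 \<Longrightarrow> integrable lborel (heat l)"
  using heat_weight_integrable [of l 0] by simp

lemma kern_fourier: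
  fixes x :: "real ^ 'n::finite"
  assumes l: "l > 0"
  shows "(LINT t|lborel. kern x0 l t * exp (- \<i> * of_real (t \<bullet> x))) = gse x0 l 0 x"
proof -
  define y where "y = x - x0"
  define f where "f = (\<lambda>(b :: real ^ 'n) t. exp (complex_of_real (- l * t\<^sup>2) - \<i> * of_real (t * (y \<bullet> b))))"
  have f: "has_bochner_integral lborel (f b) (of_real (sqrt (pi / l) * exp (- (y \<bullet> b)\<^sup>2 / (4 * l))))" for b
    unfolding f_def by (rule gaussian_fourier_real [OF l])
  have prod: "(\<Prod>b\<in>Basis. f b (t \<bullet> b)) = exp (complex_of_real (- l * (norm t)\<^sup>2) - \<i> * of_real (t \<bullet> y))" for t
  proof -
    have "(\<Prod>b\<in>Basis. f b (t \<bullet> b)) =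
      exp (\<Sum>b\<in>Basis. complex_of_real (- l * (t \<bullet> b)\<^sup>2) - \<i> * of_real ((t \<bullet> b) * (y \<bullet> b)))"
      unfolding f_def by (rule exp_sum [symmetric]) simp
    also have "(\<Sum>b\<in>Basis. complex_of_real (- l * (t \<bullet> b)\<^sup>2) - \<i> * of_real ((t \<bullet> b) * (y \<bullet> b)))
      = complex_of_real (- l * (\<Sum>b\<in>Basis. (t \<bullet> b) * (t \<bullet> b))) - \<i> * of_real (\<Sum>b\<in>Basis. (t \<bullet> b) * (y \<bullet> b))"
      by (simp add: sum_subtractf sum_distrib_left sum_negf power2_eq_square)
    also have "\<dots> = complex_of_real (- l * (norm t)\<^sup>2) - \<i> * of_real (t \<bullet> y)"
      by (simp only: power2_norm_eq_inner euclidean_inner [of t t] euclidean_inner [of t y])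
    finally show ?thesis .
  qed
  have "(LINT t|lborel. (\<Prod>b\<in>Basis. f b (t \<bullet> b))) = (\<Prod>b\<in>Basis. (LINT t|lborel. f b t))"
    by (rule lborel_integral_prod) (use f has_bochner_integral_iff in blast)
  also have "\<dots> = (\<Prod>b\<in>Basis. of_real (sqrt (pi / l) * exp (- (y \<bullet> b)\<^sup>2 / (4 * l))))"
    using f by (intro prod.cong refl) (simp add: has_bochner_integral_iff)
  also have "\<dots> = of_real (sqrt (pi / l) ^ CARD('n) * exp (\<Sum>b\<in>Basis. - (y \<bullet> b)\<^sup>2 / (4 * l)))"
    by (simp add: prod.distrib exp_sum flip: of_real_prod of_real_mult of_real_power)
  also have "(\<Sum>b\<in>Basis. - (y \<bullet> b)\<^sup>2 / (4 * l)) = - (norm y)\<^sup>2 / (4 * l)"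
    by (simp only: power2_norm_eq_inner euclidean_inner [of y y])
      (simp add: sum_divide_distrib sum_negf power2_eq_square)
  finally have I: "(LINT t|lborel. exp (complex_of_real (- l * (norm t)\<^sup>2) - \<i> * of_real (t \<bullet> y)))
    = of_real (sqrt (pi / l) ^ CARD('n) * exp (- (norm y)\<^sup>2 / (4 * l)))"
    by (simp only: prod)
  have "kern x0 l t * exp (- \<i> * of_real (t \<bullet> x)) =
      of_real (sqrt (l / pi) ^ CARD('n)) * exp (complex_of_real (- l * (norm t)\<^sup>2) - \<i> * of_real (t \<bullet> y))" for t
    by (simp add: kern_def heat_def y_def inner_diff_right inner_commute algebra_simps flip: exp_of_real exp_add)
  then have "(LINT t|lborel. kern x0 l t * exp (- \<i> * of_real (t \<bullet> x))) =
    of_real (sqrt (l / pi) ^ CARD('n)) * of_real (sqrt (pi / l) ^ CARD('n) * exp (- (norm y)\<^sup>2 / (4 * l)))"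
    by (simp only: integral_mult_right_zero I)
  also have "\<dots> = of_real ((sqrt (l / pi) * sqrt (pi / l)) ^ CARD('n) * exp (- (norm y)\<^sup>2 / (4 * l)))"
    by (simp add: power_mult_distrib)
  also have "sqrt (l / pi) * sqrt (pi / l) = 1" using l by (simp flip: real_sqrt_mult)
  finally show ?thesis by (simp add: gse_def y_def flip: exp_of_real)
qed

lemma heat_integral: "l > 0 \<Longrightarrow> (LINT t|lborel. heat l (t :: real ^ 'n::finite)) = 1"
proof -
  assume l: "l > 0"
  have "complex_of_real (LINT t|lborel. heat l (t :: real ^ 'n)) = 1"
    using kern_fourier [OF l, of "0 :: real ^ 'n" 0] by (simp add: kern_def gse_def)
  then show ?thesis by (simp only: of_real_eq_1_iff)
qed

text \<open>Testing a transform against a translated kernel means testing the distribution itself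
  against a wave packet. Pointwise values of transforms become accessible in this way.\<close>

lemma fourier_fun_kern:
  assumes l: "l > 0"
  shows "fourier_fun (\<lambda>\<eta>. kern x0 l (\<eta> - \<xi>)) x = fourier_const TYPE('n) * gse x0 l \<xi> (x :: real ^ 'n::finite)"
proof -
  have "(LINT \<eta>|lborel. kern x0 l (\<eta> - \<xi>) * exp (- \<i> * of_real (\<eta> \<bullet> x))) =
    (LINT t|lborel. kern x0 l ((t + \<xi>) - \<xi>) * exp (- \<i> * of_real ((t + \<xi>) \<bullet> x)))"
    by (rule lborel_integral_translate [symmetric])
  also have "\<dots> = (LINT t|lborel. exp (- \<i> * of_real (\<xi> \<bullet> x)) * (kern x0 l t * exp (- \<i> * of_real (t \<bullet> x))))"
    by (simp add: inner_add_left algebra_simps exp_add exp_diff exp_minus field_simps)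
  also have "\<dots> = exp (- \<i> * of_real (\<xi> \<bullet> x)) * gse x0 l 0 x"
    by (simp only: integral_mult_right_zero kern_fourier [OF l])
  also have "\<dots> = gse x0 l \<xi> x"
    unfolding gse_def
    by (subst exp_add [symmetric], rule arg_cong [of _ _ exp]) (simp add: inner_commute [of \<xi> x])
  finally show ?thesis by (simp add: fourier_fun_def)
qed

section \<open>Averages of Schwartz functions against the kernel\<close>

definition conv :: "real ^ 'n::finite \<Rightarrow> real \<Rightarrow> 'n cfun \<Rightarrow> 'n cfun" where
  "conv x0 l \<phi> \<eta> = (LINT \<xi>|lborel. kern x0 l (\<eta> - \<xi>) * \<phi> \<xi>)"

text \<open>Here the variable sits in \<open>\<phi>\<close>, so that derivatives fall on
  \<open>\<phi>\<close> and the kernel stays fixed.\<close>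

lemma conv_eq: "conv x0 l \<phi> \<eta> = (LINT t|lborel. kern (- x0) l t * \<phi> (\<eta> + t))"
  unfolding conv_def
  using lborel_integral_translate [of "\<lambda>\<xi>. kern x0 l (\<eta> - \<xi>) * \<phi> \<xi>" \<eta>]
  by (simp add: kern_minus add.commute)

lemma conv_has_derivative:
  assumes l: "l > 0" and \<phi>: "\<phi> \<in> schwartz_functions"
  shows "(conv x0 l \<phi> has_derivative (\<lambda>v. LINT t|lborel. kern (- x0) l t *
    (\<Sum>i\<in>UNIV. of_real (v $ i) * partial_deriv i \<phi> (\<eta> + t)))) (at \<eta>)"
proof -
  have m [measurable]: "\<phi> \<in> borel_measurable borel" "partial_deriv i \<phi> \<in> borel_measurable borel" for i
    using \<phi> schwartz_measurable schwartz_partial_deriv by blast+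
  have "\<exists>B. \<forall>x. cmod (partial_deriv i \<phi> x) \<le> B" for i
    using schwartz_rapid [OF schwartz_partial_deriv [OF \<phi>, of i]] unfolding rapid_def
    by (metis mult_1 power_0)
  then obtain B where B: "\<And>i x. cmod (partial_deriv i \<phi> x) \<le> B i" by metis
  obtain B0 where B0: "\<And>x. cmod (\<phi> x) \<le> B0"
    using schwartz_rapid [OF \<phi>] unfolding rapid_def by (metis mult_1 power_0)
  show ?thesis
    unfolding conv_eq [abs_def]
  proof (rule has_derivative_integral [where B = "\<lambda>t. heat l t * sum B UNIV"])
    fix \<eta> t v
    have "((\<lambda>x. \<phi> (x + t)) has_derivative (\<lambda>v. \<Sum>i\<in>UNIV. of_real (v $ i) * partial_deriv i \<phi> (\<eta> + t))) (at \<eta>)"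
      by (rule has_derivative_compose [of "\<lambda>x. x + t" "\<lambda>x. x" \<eta> UNIV \<phi>, unfolded o_def])
        (auto intro!: derivative_eq_intros smooth_has_derivative schwartz_smooth \<phi>)
    then show "((\<lambda>x. kern (- x0) l t * \<phi> (x + t)) has_derivative
        (\<lambda>v. kern (- x0) l t * (\<Sum>i\<in>UNIV. of_real (v $ i) * partial_deriv i \<phi> (\<eta> + t)))) (at \<eta>)"
      by (rule has_derivative_mult_right)
    have "cmod (\<Sum>i\<in>UNIV. of_real (v $ i) * partial_deriv i \<phi> (\<eta> + t)) \<le> (\<Sum>i\<in>UNIV. norm v * B i)"
      by (rule order_trans [OF norm_sum])
        (auto intro!: sum_mono mult_mono B component_le_norm_cart simp: norm_mult)
    from mult_left_mono [OF this, of "heat l t"] l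
    show "cmod (kern (- x0) l t * (\<Sum>i\<in>UNIV. of_real (v $ i) * partial_deriv i \<phi> (\<eta> + t)))
        \<le> (heat l t * sum B UNIV) * norm v"
      by (simp add: norm_mult norm_kern sum_distrib_right [symmetric] mult_ac)
    show "integrable lborel (\<lambda>t :: real ^ 'a. heat l t * sum B UNIV)"
      by (intro integrable_mult_left heat_integrable l)
    show "integrable lborel (\<lambda>t. kern (- x0) l t * \<phi> (\<eta> + t))"
    proof (rule Bochner_Integration.integrable_bound)
      show "integrable lborel (\<lambda>t :: real ^ 'a. heat l t * B0)"
        by (intro integrable_mult_left heat_integrable l)
      show "AE t in lborel. cmod (kern (- x0) l t * \<phi> (\<eta> + t)) \<le> norm (heat l t * B0)"
        using l B0 by (intro AE_I2) (auto simp: norm_mult norm_kern abs_mult intro!: mult_left_mono order_trans [OF _ abs_ge_self])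
    qed measurable
    show "(\<lambda>t. kern (- x0) l t * (\<Sum>i\<in>UNIV. of_real (v $ i) * partial_deriv i \<phi> (\<eta> + t))) \<in> borel_measurable lborel"
      by measurable
  qed
qed

lemma partial_deriv_conv:
  assumes l: "l > 0" and \<phi>: "\<phi> \<in> schwartz_functions"
  shows "partial_deriv i (conv x0 l \<phi>) = conv x0 l (partial_deriv i \<phi>)"
proof
  fix \<eta>
  have "(\<Sum>j\<in>UNIV. of_real (axis i 1 $ j) * partial_deriv j \<phi> (\<eta> + t)) = partial_deriv i \<phi> (\<eta> + t)" for t
    by (simp add: axis_def if_distrib [of of_real] if_distrib [of "\<lambda>x. x * _"] cong: if_cong)
  then show "partial_deriv i (conv x0 l \<phi>) \<eta> = conv x0 l (partial_deriv i \<phi>) \<eta>"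
    by (subst partial_deriv_eq [OF conv_has_derivative [OF l \<phi>]]) (simp add: conv_eq)
qed

lemma one_plus_norm_triangle: "(1 + norm (x + y)) ^ k \<le> (1 + norm x) ^ k * (1 + norm y) ^ k"
  for x y :: "'a::real_normed_vector"
proof -
  have "1 + norm (x + y) \<le> 1 + norm x + norm y + norm x * norm y"
    using norm_triangle_ineq [of x y] by (simp add: add_increasing2)
  also have "\<dots> = (1 + norm x) * (1 + norm y)" by (simp add: algebra_simps)
  finally show ?thesis by (metis power_mono power_mult_distrib add_nonneg_nonneg norm_ge_zero zero_le_one)
qed

lemma conv_rapid:
  assumes l: "l > 0" and \<phi>: "\<phi> \<in> schwartz_functions"
  shows "rapid (conv x0 l \<phi>)"
  unfolding rapid_def
proof
  fix k
  have m [measurable]: "\<phi> \<in> borel_measurable borel" by (rule schwartz_measurable [OF \<phi>])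
  obtain B where B: "\<And>x. (1 + norm x) ^ k * cmod (\<phi> x) \<le> B"
    using schwartz_rapid [OF \<phi>] unfolding rapid_def by metis
  define I where "I = (LINT t :: real ^ 'a|lborel. ((1 + norm t) ^ k * heat l t) * B :: real)"
  have "(1 + norm \<eta>) ^ k * cmod (conv x0 l \<phi> \<eta>) \<le> I" for \<eta>
  proof -
    have i: "integrable lborel (\<lambda>t :: real ^ 'a. ((1 + norm t) ^ k * heat l t) * B)"
      by (intro integrable_mult_left heat_weight_integrable l)
    have le: "cmod (of_real ((1 + norm \<eta>) ^ k) * (kern (- x0) l t * \<phi> (\<eta> + t))) \<le> ((1 + norm t) ^ k * heat l t) * B" for t
    proof -
      have "(1 + norm \<eta>) ^ k \<le> (1 + norm t) ^ k * (1 + norm (\<eta> + t)) ^ k"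
        using one_plus_norm_triangle [of "\<eta> + t" "- t" k] by (simp add: mult.commute)
      then have "(1 + norm \<eta>) ^ k * (heat l t * cmod (\<phi> (\<eta> + t))) \<le>
        ((1 + norm t) ^ k * (1 + norm (\<eta> + t)) ^ k) * (heat l t * cmod (\<phi> (\<eta> + t)))"
        using l by (intro mult_right_mono) auto
      also have "\<dots> = ((1 + norm t) ^ k * heat l t) * ((1 + norm (\<eta> + t)) ^ k * cmod (\<phi> (\<eta> + t)))"
        by (simp add: mult_ac)
      also have "\<dots> \<le> ((1 + norm t) ^ k * heat l t) * B"
        using l by (intro mult_left_mono B) auto
      finally show ?thesis using l
        by (simp add: norm_mult norm_kern del: of_real_power of_real_add)
    qed
    have "(1 + norm \<eta>) ^ k * cmod (conv x0 l \<phi> \<eta>) =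
      cmod (LINT t|lborel. of_real ((1 + norm \<eta>) ^ k) * (kern (- x0) l t * \<phi> (\<eta> + t)))"
      by (simp add: conv_eq norm_mult del: of_real_power of_real_add)
    also have "\<dots> \<le> (LINT t|lborel. cmod (of_real ((1 + norm \<eta>) ^ k) * (kern (- x0) l t * \<phi> (\<eta> + t))))"
      by (rule integral_norm_bound)
    also have "\<dots> \<le> I"
      unfolding I_def
    proof (rule integral_mono [OF _ i le])
      show "integrable lborel (\<lambda>t. cmod (of_real ((1 + norm \<eta>) ^ k) * (kern (- x0) l t * \<phi> (\<eta> + t))))"
      proof (rule Bochner_Integration.integrable_bound [OF i _ AE_I2])
        show "norm (cmod (of_real ((1 + norm \<eta>) ^ k) * (kern (- x0) l t * \<phi> (\<eta> + t)))) \<le>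
          norm (((1 + norm t) ^ k * heat l t) * B)" for t
          using order_trans [OF le [of t] abs_ge_self] by (simp only: real_norm_def abs_norm_cancel)
      qed measurable
    qed
    finally show ?thesis .
  qed
  then show "\<exists>B. \<forall>x. (1 + norm x) ^ k * cmod (conv x0 l \<phi> x) \<le> B" by blast
qed

lemma conv_schwartz:
  assumes l: "l > 0" and \<phi>: "\<phi> \<in> schwartz_functions"
  shows "conv x0 l \<phi> \<in> schwartz_functions"
proof (rule schwartz_coinduct [where X = "conv x0 l ` schwartz_functions"])
  fix f :: "'a cfun" and x i
  assume "f \<in> conv x0 l ` schwartz_functions"
  then obtain \<psi> where \<psi>: "\<psi> \<in> schwartz_functions" and f: "f = conv x0 l \<psi>" by blast
  show "f differentiable (at x)"
    unfolding f by (rule differentiableI [OF conv_has_derivative [OF l \<psi>]])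
  show "partial_deriv i f \<in> conv x0 l ` schwartz_functions"
    unfolding f partial_deriv_conv [OF l \<psi>] by (intro imageI schwartz_partial_deriv \<psi>)
  show "rapid f" unfolding f by (rule conv_rapid [OF l \<psi>])
qed (use \<phi> in auto)

lemma kern_weight_integrable_pair:
  assumes l: "l > 0" and \<phi>: "\<phi> \<in> schwartz_functions"
    and h [measurable]: "h \<in> borel_measurable borel" and hB: "\<And>\<eta>. cmod (h \<eta>) \<le> B * (1 + norm \<eta>) ^ k"
  shows "integrable (lborel \<Otimes>\<^sub>M lborel) (\<lambda>(\<xi>, \<eta>). h \<eta> * (kern x0 l (\<eta> - \<xi>) * \<phi> \<xi>))"
proof (rule Bochner_Integration.integrable_bound)
  have [measurable]: "\<phi> \<in> borel_measurable borel" by (rule schwartz_measurable [OF \<phi>])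
  let ?f = "\<lambda>\<xi>. B * ((1 + norm \<xi>) ^ k * cmod (\<phi> \<xi>))" and ?g = "\<lambda>t :: real ^ 'a. (1 + norm t) ^ k * heat l t"
  show "integrable (lborel \<Otimes>\<^sub>M lborel) (\<lambda>(\<xi>, \<eta>). ?f \<xi> * ?g (\<eta> - \<xi>))"
    by (intro integrable_convolution integrable_mult_right schwartz_integrable_weight \<phi> heat_weight_integrable l)
  show "(\<lambda>(\<xi>, \<eta>). h \<eta> * (kern x0 l (\<eta> - \<xi>) * \<phi> \<xi>)) \<in> borel_measurable (lborel \<Otimes>\<^sub>M lborel)" by measurable
  have B: "B \<ge> 0" using order_trans [OF norm_ge_zero hB [of 0]] by simp
  have "cmod (h \<eta> * (kern x0 l (\<eta> - \<xi>) * \<phi> \<xi>)) \<le> ?f \<xi> * ?g (\<eta> - \<xi>)" for \<xi> \<eta>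
  proof -
    have "cmod (h \<eta>) \<le> B * ((1 + norm \<xi>) ^ k * (1 + norm (\<eta> - \<xi>)) ^ k)"
      using hB [of \<eta>] mult_left_mono [OF one_plus_norm_triangle [of \<xi> "\<eta> - \<xi>" k] B] by simp
    then have "cmod (h \<eta>) * (heat l (\<eta> - \<xi>) * cmod (\<phi> \<xi>)) \<le>
      (B * ((1 + norm \<xi>) ^ k * (1 + norm (\<eta> - \<xi>)) ^ k)) * (heat l (\<eta> - \<xi>) * cmod (\<phi> \<xi>))"
      using l by (intro mult_right_mono) auto
    then show ?thesis using l by (simp add: norm_mult norm_kern mult_ac)
  qed
  then show "AE x in lborel \<Otimes>\<^sub>M lborel. norm (case x of (\<xi>, \<eta>) \<Rightarrow> h \<eta> * (kern x0 l (\<eta> - \<xi>) * \<phi> \<xi>)) \<le>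
      norm (case x of (\<xi>, \<eta>) \<Rightarrow> ?f \<xi> * ?g (\<eta> - \<xi>))"
    by (intro AE_I2) (auto intro!: order_trans [OF _ abs_ge_self] simp del: norm_mult abs_mult)
qed

lemma fourier_fun_conv:
  assumes l: "l > 0" and \<phi>: "\<phi> \<in> schwartz_functions"
  shows "fourier_fun (conv x0 l \<phi>) x = gse x0 l 0 x * fourier_fun \<phi> x"
proof -
  define F where "F = (\<lambda>\<xi> \<eta>. exp (- \<i> * of_real (\<eta> \<bullet> x)) * (kern x0 l (\<eta> - \<xi>) * \<phi> \<xi>))"
  have "integrable (lborel \<Otimes>\<^sub>M lborel) (\<lambda>(\<xi>, \<eta>). F \<xi> \<eta>)"
    unfolding F_def by (rule kern_weight_integrable_pair [OF l \<phi>, where B = 1 and k = 0]) auto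
  then have "(LINT \<eta>|lborel. LINT \<xi>|lborel. F \<xi> \<eta>) = (LINT \<xi>|lborel. LINT \<eta>|lborel. F \<xi> \<eta>)"
    by (rule lborel_pair.Fubini_integral)
  moreover have "(LINT \<xi>|lborel. F \<xi> \<eta>) = conv x0 l \<phi> \<eta> * exp (- \<i> * of_real (\<eta> \<bullet> x))" for \<eta>
    by (simp add: F_def conv_def mult.commute)
  moreover have "(LINT \<eta>|lborel. F \<xi> \<eta>) = gse x0 l 0 x * (\<phi> \<xi> * exp (- \<i> * of_real (\<xi> \<bullet> x)))" for \<xi>
  proof -
    have "(LINT \<eta>|lborel. F \<xi> \<eta>) = (LINT t|lborel. F \<xi> (t + \<xi>))"
      by (rule lborel_integral_translate [symmetric])
    also have "\<dots> = (LINT t|lborel. (\<phi> \<xi> * exp (- \<i> * of_real (\<xi> \<bullet> x))) * (kern x0 l t * exp (- \<i> * of_real (t \<bullet> x))))"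
      by (simp add: F_def inner_add_left algebra_simps exp_add exp_diff exp_minus field_simps)
    also have "\<dots> = (\<phi> \<xi> * exp (- \<i> * of_real (\<xi> \<bullet> x))) * gse x0 l 0 x"
      by (simp only: integral_mult_right_zero kern_fourier [OF l])
    finally show ?thesis by (simp add: mult_ac)
  qed
  ultimately show ?thesis by (simp add: fourier_fun_def)
qed

text \<open>Fubini moves the average from the test function to \<open>h\<close>. The right-hand side
  is the form in which functionals are given, the left-hand side exhibits the function that
  represents them.\<close>

lemma conv_duality:
  assumes l: "l > 0" and \<phi>: "\<phi> \<in> schwartz_functions"
    and h [measurable]: "h \<in> borel_measurable borel" and hB: "\<And>\<eta>. cmod (h \<eta>) \<le> B * (1 + norm \<eta>) ^ k"
  shows "has_bochner_integral lborel (\<lambda>\<xi>. (LINT \<eta>|lborel. h \<eta> * kern x0 l (\<eta> - \<xi>)) * \<phi> \<xi>)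
    (LINT \<eta>|lborel. h \<eta> * conv x0 l \<phi> \<eta>)"
proof -
  have i: "integrable (lborel \<Otimes>\<^sub>M lborel) (\<lambda>(\<xi>, \<eta>). h \<eta> * (kern x0 l (\<eta> - \<xi>) * \<phi> \<xi>))"
    by (rule kern_weight_integrable_pair [OF l \<phi> h hB])
  have eq: "(LINT \<eta>|lborel. h \<eta> * (kern x0 l (\<eta> - \<xi>) * \<phi> \<xi>)) = (LINT \<eta>|lborel. h \<eta> * kern x0 l (\<eta> - \<xi>)) * \<phi> \<xi>" for \<xi>
    by (simp flip: mult.assoc)
  have "integrable lborel (\<lambda>\<xi>. LINT \<eta>|lborel. h \<eta> * (kern x0 l (\<eta> - \<xi>) * \<phi> \<xi>))"
    using lborel_pair.integrable_fst' [OF i] by simp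
  moreover have "(LINT \<xi>|lborel. LINT \<eta>|lborel. h \<eta> * (kern x0 l (\<eta> - \<xi>) * \<phi> \<xi>))
    = (LINT \<eta>|lborel. h \<eta> * conv x0 l \<phi> \<eta>)"
    using lborel_pair.Fubini_integral [OF i] by (simp add: conv_def)
  ultimately show ?thesis unfolding eq by (simp add: has_bochner_integral_iff)
qed

section \<open>Distributions whose Fourier transform is a function\<close>

text \<open>The Gaussian average of a function on the frequency side. If \<open>h\<close> is the
  transform of \<open>u\<close>, it is the transform of \<open>u\<close> times a Gaussian
  (\<open>is_function_gauss\<close>).\<close>

definition kint :: "real ^ 'n::finite \<Rightarrow> 'n cfun \<Rightarrow> real \<Rightarrow> 'n cfun" where
  "kint x0 h l \<xi> = (LINT \<eta>|lborel. h \<eta> * kern x0 l (\<eta> - \<xi>))"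

lemma kern_integrable:
  assumes l: "l > 0" and h [measurable]: "h \<in> borel_measurable borel" and p: "poly_bounded h"
  shows "integrable lborel (\<lambda>\<eta>. h \<eta> * kern x0 l (\<eta> - \<xi>))"
proof -
  obtain B k where B: "\<And>\<eta>. cmod (h \<eta>) \<le> B * (1 + norm \<eta>) ^ k" using p unfolding poly_bounded_def by blast
  have i: "integrable lborel (\<lambda>\<eta>. B * ((1 + norm \<eta>) ^ k * cmod (kern x0 l (\<eta> - \<xi>))))"
    by (intro integrable_mult_right schwartz_integrable_weight kern_schwartz l)
  show ?thesis
  proof (rule Bochner_Integration.integrable_bound [OF i _ AE_I2])
    show "cmod (h \<eta> * kern x0 l (\<eta> - \<xi>)) \<le> norm (B * ((1 + norm \<eta>) ^ k * cmod (kern x0 l (\<eta> - \<xi>))))" for \<eta>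
      using mult_right_mono [OF B [of \<eta>], of "cmod (kern x0 l (\<eta> - \<xi>))"]
      by (auto simp: norm_mult mult.assoc intro: order_trans [OF _ abs_ge_self] simp del: abs_mult)
  qed measurable
qed

lemma heat_integrable_abs:
  assumes l: "l > 0" and h: "h \<in> borel_measurable borel" and p: "poly_bounded h"
  shows "integrable lborel (\<lambda>\<eta>. cmod (h \<eta>) * heat l (\<eta> - \<xi>))"
  using integrable_norm [OF kern_integrable [OF assms, of 0 \<xi>]] l by (simp add: norm_mult norm_kern)

text \<open>The inequality \<open>|t|^2 \<le> 2 * |t - s|^2 + 2 * |s|^2\<close> costs half of the
  exponent and provides one integrable majorant for all shifts of length at most 1, as dominated
  convergence needs.\<close>

lemma heat_shift_le:
  fixes t s :: "real ^ 'n::finite"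
  assumes l: "l > 0" and s: "norm s \<le> 1"
  shows "heat l (t - s) \<le> exp l * sqrt 2 ^ CARD('n) * heat (l / 2) t"
proof -
  have "(norm t)\<^sup>2 \<le> (norm (t - s) + norm s)\<^sup>2"
    by (intro power_mono) (use norm_triangle_ineq [of "t - s" s] in auto)
  also have "\<dots> \<le> 2 * (norm (t - s))\<^sup>2 + 2 * (norm s)\<^sup>2"
    using zero_le_power2 [of "norm (t - s) - norm s"] by (simp add: power2_sum power2_diff)
  also have "\<dots> \<le> 2 * (norm (t - s))\<^sup>2 + 2" using s power_le_one [of "norm s" 2] by simp
  finally have "l * (norm t)\<^sup>2 \<le> l * (2 * (norm (t - s))\<^sup>2 + 2)" using l by (intro mult_left_mono) auto
  then have "- l * (norm (t - s))\<^sup>2 \<le> l + (- (l / 2) * (norm t)\<^sup>2)" by (simp add: algebra_simps)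
  then have "exp (- l * (norm (t - s))\<^sup>2) \<le> exp l * exp (- (l / 2) * (norm t)\<^sup>2)"
    by (metis exp_add exp_le_cancel_iff)
  moreover have "sqrt (l / pi) = sqrt 2 * sqrt (l / 2 / pi)" by (simp flip: real_sqrt_mult)
  ultimately show ?thesis
    using l by (simp add: heat_def power_mult_distrib mult_left_mono mult.assoc mult.left_commute [of "exp l"])
qed

lemma kint_continuous:
  assumes l: "l > 0" and h [measurable]: "h \<in> borel_measurable borel" and p: "poly_bounded h"
  shows "continuous_on UNIV (kint x0 h l)"
proof -
  have "(kint x0 h l \<circ> X) \<longlonglongrightarrow> kint x0 h l \<xi>" if X: "X \<longlonglongrightarrow> \<xi>" for X \<xi>
  proof -
    obtain n0 where n0: "\<And>n. n \<ge> n0 \<Longrightarrow> dist (X n) \<xi> < 1"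
      using metric_LIMSEQ_D [OF X zero_less_one] by blast
    define c where "c = exp l * sqrt 2 ^ CARD('a)"
    have "(\<lambda>n. LINT \<eta>|lborel. h \<eta> * kern x0 l (\<eta> - X (n + n0))) \<longlonglongrightarrow> (LINT \<eta>|lborel. h \<eta> * kern x0 l (\<eta> - \<xi>))"
    proof (rule integral_dominated_convergence)
      show "integrable lborel (\<lambda>\<eta>. c * (cmod (h \<eta>) * heat (l / 2) (\<eta> - \<xi>)))"
        using heat_integrable_abs [of "l / 2" h \<xi>] l h p by (intro integrable_mult_right) auto
      show "AE \<eta> in lborel. cmod (h \<eta> * kern x0 l (\<eta> - X (n + n0))) \<le> c * (cmod (h \<eta>) * heat (l / 2) (\<eta> - \<xi>))" for n
      proof (rule AE_I2)
        fix \<eta>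
        have "norm (X (n + n0) - \<xi>) \<le> 1" using n0 [of "n + n0"] by (simp add: dist_norm)
        from heat_shift_le [OF l this, of "\<eta> - \<xi>"]
        have "heat l (\<eta> - X (n + n0)) \<le> c * heat (l / 2) (\<eta> - \<xi>)" by (simp add: c_def)
        from mult_left_mono [OF this, of "cmod (h \<eta>)"] l
        show "cmod (h \<eta> * kern x0 l (\<eta> - X (n + n0))) \<le> c * (cmod (h \<eta>) * heat (l / 2) (\<eta> - \<xi>))"
          by (simp add: norm_mult norm_kern mult_ac)
      qed
      have "isCont (kern x0 l) t" for t
        using smooth_differentiable [OF schwartz_smooth [OF kern_schwartz0 [OF l]]]
        by (rule differentiable_imp_continuous_within)
      then show "AE \<eta> in lborel. (\<lambda>n. h \<eta> * kern x0 l (\<eta> - X (n + n0))) \<longlonglongrightarrow> h \<eta> * kern x0 l (\<eta> - \<xi>)"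
        by (intro AE_I2 tendsto_mult tendsto_const isCont_tendsto_compose [of _ "kern x0 l"] tendsto_diff
            LIMSEQ_ignore_initial_segment X)
    qed measurable
    then show ?thesis unfolding o_def kint_def by (rule LIMSEQ_offset)
  qed
  then show ?thesis by (simp add: continuous_on_sequentially)
qed

text \<open>Of the exponent \<open>l\<close>, the part \<open>l - 1\<close> is spent on the distance
  \<open>d\<close>. The part 1 is kept for integrability, because \<open>kint_limit\<close> has no
  growth bound for the other factor.\<close>

lemma heat_tail_le:
  fixes t :: "real ^ 'n::finite"
  assumes "l \<ge> 1" "d \<ge> 0" "norm t \<ge> d"
  shows "heat l t \<le> sqrt l ^ CARD('n) * exp (- (l - 1) * d\<^sup>2) * heat 1 t"
proof -
  have "(l - 1) * d\<^sup>2 \<le> (l - 1) * (norm t)\<^sup>2" using assms by (intro mult_left_mono power_mono) auto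
  then have "exp (- l * (norm t)\<^sup>2) \<le> exp (- (l - 1) * d\<^sup>2) * exp (- 1 * (norm t)\<^sup>2)"
    by (simp add: algebra_simps flip: exp_add)
  then have "sqrt (l / pi) ^ CARD('n) * exp (- l * (norm t)\<^sup>2) \<le>
    sqrt (l / pi) ^ CARD('n) * (exp (- (l - 1) * d\<^sup>2) * exp (- 1 * (norm t)\<^sup>2))"
    using assms by (intro mult_left_mono) auto
  then show ?thesis by (simp add: heat_def real_sqrt_divide power_divide mult_ac)
qed

lemma heat_tail_tendsto: "d > 0 \<Longrightarrow> (\<lambda>n. sqrt (real n) ^ k * exp (- (real n - 1) * d\<^sup>2)) \<longlonglongrightarrow> 0"
proof -
  assume d: "d > 0"
  define a where "a = d\<^sup>2"
  have a: "a > 0" using d by (simp add: a_def)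
  have "((\<lambda>x::real. x ^ k / exp x) \<longlongrightarrow> 0) at_top" by (rule tendsto_power_div_exp_0)
  moreover have "filterlim (\<lambda>n. a * real n) at_top sequentially"
    using a by (intro filterlim_tendsto_pos_mult_at_top [OF tendsto_const _ filterlim_real_sequentially])
  ultimately have "(\<lambda>n. (a * real n) ^ k / exp (a * real n)) \<longlonglongrightarrow> 0" by (rule filterlim_compose)
  then have "(\<lambda>n. (exp a / a ^ k) * ((a * real n) ^ k / exp (a * real n))) \<longlonglongrightarrow> (exp a / a ^ k) * 0"
    by (intro tendsto_mult tendsto_const)
  moreover have "(exp a / a ^ k) * ((a * real n) ^ k / exp (a * real n)) = real n ^ k * exp (- (real n - 1) * a)" for n
    using a by (simp add: power_mult_distrib exp_diff exp_minus algebra_simps divide_inverse)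
  ultimately have lim: "(\<lambda>n. real n ^ k * exp (- (real n - 1) * a)) \<longlonglongrightarrow> 0" by simp
  show ?thesis
  proof (rule tendsto_sandwich [OF _ _ tendsto_const lim])
    show "\<forall>\<^sub>F n in sequentially. sqrt (real n) ^ k * exp (- (real n - 1) * d\<^sup>2) \<le> real n ^ k * exp (- (real n - 1) * a)"
      unfolding a_def
    proof (rule eventually_sequentiallyI [of 1])
      fix n :: nat assume "1 \<le> n"
      then have "sqrt (real n) \<le> real n" by (intro real_le_lsqrt) (auto simp: self_le_power)
      then show "sqrt (real n) ^ k * exp (- (real n - 1) * d\<^sup>2) \<le> real n ^ k * exp (- (real n - 1) * d\<^sup>2)"
        by (intro mult_right_mono power_mono) auto
    qed
  qed auto
qed

text \<open>The kernels form an approximate identity. Continuity settles the points near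
  \<open>\<xi>\<close>; the remaining ones are compared with the fixed kernel \<open>heat 1\<close>,
  against which \<open>h\<close> is integrable by hypothesis.\<close>

lemma kint_limit:
  assumes cont: "continuous_on UNIV h"
    and int: "\<And>\<phi>. \<phi> \<in> schwartz_functions \<Longrightarrow> integrable lborel (\<lambda>\<eta>. h \<eta> * \<phi> \<eta>)"
  shows "(\<lambda>n. kint x0 h (real n) \<xi>) \<longlonglongrightarrow> h (\<xi> :: real ^ 'n::finite)"
proof -
  have [measurable]: "h \<in> borel_measurable borel" using cont by (rule borel_measurable_continuous_onI)
  \<comment> \<open>With the modulation moved into \<open>g\<close>, the kernel is a positive
    function of integral 1, and \<open>g\<close> still agrees with \<open>h\<close> at
    \<open>\<xi>\<close>.\<close>
  define g where "g = (\<lambda>\<eta>. h \<eta> * exp (\<i> * of_real (x0 \<bullet> (\<eta> - \<xi>))))"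
  have g_cont: "continuous_on UNIV g" unfolding g_def by (intro continuous_intros cont)
  have [measurable]: "g \<in> borel_measurable borel" using g_cont by (rule borel_measurable_continuous_onI)
  have kg: "h \<eta> * kern x0 l (\<eta> - \<xi>) = g \<eta> * of_real (heat l (\<eta> - \<xi>))" for l \<eta>
    by (simp add: kern_def g_def mult_ac)
  have gint: "integrable lborel (\<lambda>\<eta>. g \<eta> * of_real (heat l (\<eta> - \<xi>)))" if "l > 0" for l
    using int [OF kern_schwartz [OF that], of x0 \<xi>] by (simp only: kg)
  have hint: "integrable lborel (\<lambda>\<eta>. heat l (\<eta> - \<xi>))" if "l > 0" for l
    using lborel_integrable_translate [OF heat_integrable [OF that], of "- \<xi>"] by simp
  have h1: "(LINT \<eta>|lborel. heat l (\<eta> - \<xi>)) = 1" if "l > 0" for l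
    using lborel_integral_translate [of "heat l" "- \<xi>"] heat_integral [OF that] by simp
  define A where "A = (LINT \<eta>|lborel. cmod (g \<eta> - g \<xi>) * heat 1 (\<eta> - \<xi>))"
  have dint: "integrable lborel (\<lambda>\<eta>. cmod (g \<eta> - g \<xi>) * heat l (\<eta> - \<xi>))" if "l > 0" for l
  proof -
    have "integrable lborel (\<lambda>\<eta>. g \<eta> * of_real (heat l (\<eta> - \<xi>)) - g \<xi> * of_real (heat l (\<eta> - \<xi>)))"
      using gint [OF that] hint [OF that] by (intro Bochner_Integration.integrable_diff integrable_mult_right integrable_of_real)
    from integrable_norm [OF this] show ?thesis
      using that by (simp add: norm_mult flip: left_diff_distrib)
  qed
  show ?thesis
  proof (rule LIMSEQ_I)
    fix r :: real assume r: "r > 0"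
    obtain d where d: "d > 0" "\<And>\<eta>. dist \<eta> \<xi> < d \<Longrightarrow> dist (g \<eta>) (g \<xi>) < r / 2"
      using g_cont r unfolding continuous_on_iff by (meson UNIV_I half_gt_zero)
    define c where "c = (\<lambda>n. sqrt (real n) ^ CARD('n) * exp (- (real n - 1) * d\<^sup>2))"
    have "(\<lambda>n. c n * A) \<longlonglongrightarrow> 0 * A" unfolding c_def by (intro tendsto_mult tendsto_const heat_tail_tendsto d)
    then obtain n0 where n0: "\<And>n. n \<ge> n0 \<Longrightarrow> norm (c n * A) < r / 2"
      using LIMSEQ_D [of "\<lambda>n. c n * A" 0 "r / 2"] r by auto
    have "norm (kint x0 h (real n) \<xi> - h \<xi>) < r" if n: "n \<ge> max 1 n0" for n
    proof -
      have n': "real n > 0" "real n \<ge> 1" using n by auto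
      have "kint x0 h (real n) \<xi> - h \<xi> = (LINT \<eta>|lborel. g \<eta> * of_real (heat n (\<eta> - \<xi>))) - (LINT \<eta>|lborel. g \<xi> * of_real (heat n (\<eta> - \<xi>)))"
        using h1 [OF n'(1)] by (simp add: kint_def kg) (simp add: g_def)
      also have "\<dots> = (LINT \<eta>|lborel. g \<eta> * of_real (heat n (\<eta> - \<xi>)) - g \<xi> * of_real (heat n (\<eta> - \<xi>)))"
        using gint [OF n'(1)] hint [OF n'(1)] by (intro Bochner_Integration.integral_diff [symmetric] integrable_mult_right integrable_of_real)
      finally have "norm (kint x0 h (real n) \<xi> - h \<xi>) \<le>
        (LINT \<eta>|lborel. norm (g \<eta> * of_real (heat n (\<eta> - \<xi>)) - g \<xi> * of_real (heat n (\<eta> - \<xi>))))"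
        by (simp only: integral_norm_bound)
      also have "\<dots> = (LINT \<eta>|lborel. cmod (g \<eta> - g \<xi>) * heat n (\<eta> - \<xi>))"
        by (simp add: norm_mult flip: left_diff_distrib)
      also have "\<dots> \<le> (LINT \<eta>|lborel. r / 2 * heat n (\<eta> - \<xi>) + c n * (cmod (g \<eta> - g \<xi>) * heat 1 (\<eta> - \<xi>)))"
      proof (rule integral_mono)
        show "integrable lborel (\<lambda>\<eta>. r / 2 * heat n (\<eta> - \<xi>) + c n * (cmod (g \<eta> - g \<xi>) * heat 1 (\<eta> - \<xi>)))"
          by (intro Bochner_Integration.integrable_add integrable_mult_right hint dint n') auto
        fix \<eta>
        show "cmod (g \<eta> - g \<xi>) * heat n (\<eta> - \<xi>) \<le> r / 2 * heat n (\<eta> - \<xi>) + c n * (cmod (g \<eta> - g \<xi>) * heat 1 (\<eta> - \<xi>))"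
        proof (cases "dist \<eta> \<xi> < d")
          case True
          then have "cmod (g \<eta> - g \<xi>) * heat n (\<eta> - \<xi>) \<le> r / 2 * heat n (\<eta> - \<xi>)"
            using d(2) [OF True] n' by (intro mult_right_mono) (auto simp: dist_norm)
          moreover have "0 \<le> c n * (cmod (g \<eta> - g \<xi>) * heat 1 (\<eta> - \<xi>))" using n' by (simp add: c_def)
          ultimately show ?thesis by simp
        next
          case False
          then have "heat n (\<eta> - \<xi>) \<le> c n * heat 1 (\<eta> - \<xi>)"
            unfolding c_def using d(1) n' by (intro heat_tail_le) (auto simp: dist_norm)
          from mult_left_mono [OF this, of "cmod (g \<eta> - g \<xi>)"]
          have "cmod (g \<eta> - g \<xi>) * heat n (\<eta> - \<xi>) \<le> c n * (cmod (g \<eta> - g \<xi>) * heat 1 (\<eta> - \<xi>))"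
            by (simp add: mult_ac)
          moreover have "0 \<le> r / 2 * heat n (\<eta> - \<xi>)" using n' r by simp
          ultimately show ?thesis by simp
        qed
      qed (rule dint [OF n'(1)])
      also have "\<dots> = r / 2 + c n * A"
        using hint [OF n'(1)] dint [of 1] h1 [OF n'(1)]
        by (subst Bochner_Integration.integral_add) (auto simp: A_def)
      also have "\<dots> < r" using n0 [of n] n by auto
      finally show ?thesis .
    qed
    then show "\<exists>no. \<forall>n\<ge>no. norm (kint x0 h (real n) \<xi> - h \<xi>) < r" by blast
  qed
qed

lemma is_functionD:
  assumes "is_function u h"
  shows "h \<in> borel_measurable borel"
    and "\<phi> \<in> schwartz_functions \<Longrightarrow> integrable lborel (\<lambda>x. h x * \<phi> x)"
    and "\<phi> \<in> schwartz_functions \<Longrightarrow> (LINT x|lborel. h x * \<phi> x) = u \<phi>"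
  using assms unfolding is_function_def by (auto simp: has_bochner_integral_iff)

lemma is_function_kint:
  assumes "is_function u h" "l > 0"
  shows "kint x0 h l \<xi> = u (\<lambda>\<eta>. kern x0 l (\<eta> - \<xi>))"
  unfolding kint_def by (rule is_functionD(3) [OF assms(1) kern_schwartz [OF assms(2)]])

text \<open>The functional determines all averages of the function, and these converge to it. The
  pointwise values that occur in \<open>gevrey_decay\<close> are thereby well defined.\<close>

lemma is_function_unique:
  assumes "is_function u h" "is_function u k" "continuous_on UNIV h" "continuous_on UNIV k"
  shows "h = k"
proof
  fix \<xi>
  have lim: "(\<lambda>n. kint 0 h (real n) \<xi>) \<longlonglongrightarrow> h \<xi>" "(\<lambda>n. kint 0 k (real n) \<xi>) \<longlonglongrightarrow> k \<xi>"
    using assms is_functionD(2) by (intro kint_limit; blast)+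
  have "\<forall>\<^sub>F n in sequentially. kint 0 h (real n) \<xi> = kint 0 k (real n) \<xi>"
    using is_function_kint [OF assms(1)] is_function_kint [OF assms(2)]
    by (intro eventually_sequentiallyI [of 1]) auto
  then have "(\<lambda>n. kint 0 k (real n) \<xi>) \<longlonglongrightarrow> h \<xi>"
    using lim(1) by (simp add: tendsto_cong)
  then show "h \<xi> = k \<xi>" using lim(2) by (rule LIMSEQ_unique)
qed

text \<open>The reciprocals of the widths add up.\<close>

lemma gauss_mult_gse:
  assumes "N > 0" "l > 0"
  shows "gauss x0 N x * gse x0 l \<xi> x = gse x0 (real N * l / (real N + l)) \<xi> x"
proof -
  have "- (norm (x - x0))\<^sup>2 / (4 * real N) + - (norm (x - x0))\<^sup>2 / (4 * l) = - (norm (x - x0))\<^sup>2 / (4 * (real N * l / (real N + l)))"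
    using assms by (simp add: field_simps)
  then have "complex_of_real (- (norm (x - x0))\<^sup>2 / (4 * (real N * l / (real N + l)))) =
    of_real (- (norm (x - x0))\<^sup>2 / (4 * real N)) + of_real (- (norm (x - x0))\<^sup>2 / (4 * l))"
    by (metis of_real_add)
  then show ?thesis
    unfolding gauss_eq_gse gse_def exp_add [symmetric] by (simp only:) (simp add: algebra_simps)
qed

lemma gauss_half: "N > 0 \<Longrightarrow> gauss x0 N x = gauss x0 (2 * N) x * gauss x0 (2 * N) x"
  by (simp add: gauss_def flip: of_real_mult exp_add)

text \<open>The value at \<open>\<xi>\<close> is the limit of averages, and the \<open>n\<close>-th
  average is, up to a constant, \<open>u\<close> on a wave packet of width
  \<open>N * n / (N + n)\<close>. For \<open>n \<ge> N\<close> this width lies between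
  \<open>1 / 2\<close> and \<open>N\<close>, so the bound does not depend on \<open>n\<close> and
  survives the limit.\<close>

lemma tempered_pointwise_bound:
  assumes u: "u \<in> tempered_distributions"
  shows "\<exists>B\<ge>0. \<exists>m. \<forall>N h \<xi>. N > 0 \<longrightarrow> continuous_on UNIV h \<longrightarrow> is_function (fourier (mult_dist u (gauss x0 N))) h \<longrightarrow>
    cmod (h \<xi>) \<le> B * (real N * (1 + norm \<xi>)) ^ m"
proof -
  obtain C m where C: "C \<ge> 0" "\<And>l \<xi>. l > 0 \<Longrightarrow> cmod (u (gse x0 l \<xi>)) \<le> C * par_size (l, \<xi>) ^ m"
    using tempered_gse_bound [OF u] by blast
  have lin: "u (\<lambda>x. c * \<phi> x) = c * u \<phi>" if "\<phi> \<in> schwartz_functions" for c \<phi>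
    using u that unfolding tempered_distributions_def linear_functional_on_def by auto
  define F :: real where "F = cmod (fourier_const TYPE('a))"
  have "cmod (h \<xi>) \<le> (F * C * 4 ^ m) * (real N * (1 + norm \<xi>)) ^ m"
    if N: "N > 0" and h: "continuous_on UNIV h" "is_function (fourier (mult_dist u (gauss x0 N))) h" for N h \<xi>
  proof (rule Lim_bounded [where M = N])
    show "(\<lambda>n. cmod (kint x0 h (real n) \<xi>)) \<longlonglongrightarrow> cmod (h \<xi>)"
      by (intro tendsto_norm kint_limit h is_functionD(2) [OF h(2)])
    show "\<forall>n\<ge>N. cmod (kint x0 h (real n) \<xi>) \<le> (F * C * 4 ^ m) * (real N * (1 + norm \<xi>)) ^ m"
    proof (intro allI impI)
      fix n assume n: "n \<ge> N"
      have n0: "real n > 0" using n N by simp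
      define l where "l = real N * real n / (real N + real n)"
      have l: "l > 0" using n N by (simp add: l_def)
      have l1: "l \<le> real N" using n N by (simp add: l_def field_simps)
      have l2: "1 / l \<le> 2"
      proof -
        have "real N + real n \<le> real N * real n + real N * real n"
          using n N by (intro add_mono) (simp_all add: mult_ge1_I)
        then show ?thesis using n N by (simp add: l_def field_simps)
      qed
      have "par_size (l, \<xi>) \<le> 1 + norm \<xi> + 2 + real N" using l1 l2 by (simp add: par_size_def)
      also have "\<dots> \<le> 4 * (real N * (1 + norm \<xi>))"
      proof -
        have "1 * norm \<xi> \<le> real N * norm \<xi>" using N by (intro mult_right_mono) auto
        moreover have "1 \<le> real N" "0 \<le> real N * norm \<xi>" using N by auto
        moreover have "4 * (real N * (1 + norm \<xi>)) = 4 * real N + 4 * (real N * norm \<xi>)"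
          by (simp add: algebra_simps)
        ultimately show ?thesis by linarith
      qed
      finally have ps: "par_size (l, \<xi>) ^ m \<le> (4 * (real N * (1 + norm \<xi>))) ^ m"
        using l by (intro power_mono) (auto simp: par_size_def)
      have "kint x0 h (real n) \<xi> = u (\<lambda>x. gauss x0 N x * (fourier_const TYPE('a) * gse x0 (real n) \<xi> x))"
        by (simp add: is_function_kint [OF h(2) n0] fourier_def mult_dist_def fourier_fun_kern [OF n0, abs_def])
      also have "\<dots> = u (\<lambda>x. fourier_const TYPE('a) * gse x0 l \<xi> x)"
        unfolding l_def gauss_mult_gse [OF N n0, symmetric] by (simp only: mult_ac)
      also have "\<dots> = fourier_const TYPE('a) * u (gse x0 l \<xi>)" by (rule lin [OF gse_schwartz [OF l]])
      finally have "cmod (kint x0 h (real n) \<xi>) = F * cmod (u (gse x0 l \<xi>))" by (simp add: F_def norm_mult)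
      also have "\<dots> \<le> F * (C * (4 * (real N * (1 + norm \<xi>))) ^ m)"
        using C(2) [OF l, of \<xi>] mult_left_mono [OF ps C(1)] by (intro mult_left_mono) (auto simp: F_def)
      also have "\<dots> = (F * C * 4 ^ m) * (real N * (1 + norm \<xi>)) ^ m" by (simp only: power_mult_distrib mult_ac)
      finally show "cmod (kint x0 h (real n) \<xi>) \<le> (F * C * 4 ^ m) * (real N * (1 + norm \<xi>)) ^ m" .
    qed
  qed
  then show ?thesis using C(1) by (intro exI [of _ "F * C * 4 ^ m"]) (auto simp: F_def)
qed

text \<open>The convolution theorem turns the Gaussian factor into an average of the test function,
  and duality moves this average onto \<open>h\<close>.\<close>

lemma is_function_gauss:
  assumes L: "is_function (fourier L) h" and p: "poly_bounded h" and N: "N > 0"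
  shows "is_function (fourier (mult_dist L (gauss x0 N))) (kint x0 h N)"
  unfolding is_function_def
proof
  have h: "h \<in> borel_measurable borel" using is_functionD(1) [OF L] .
  have N': "real N > 0" using N by simp
  show "kint x0 h N \<in> borel_measurable lborel"
    using borel_measurable_continuous_onI [OF kint_continuous [OF N' h p]] by simp
  obtain B k where B: "\<And>\<eta>. cmod (h \<eta>) \<le> B * (1 + norm \<eta>) ^ k" using p unfolding poly_bounded_def by blast
  show "\<forall>\<phi>\<in>schwartz_functions. has_bochner_integral lborel (\<lambda>\<xi>. kint x0 h N \<xi> * \<phi> \<xi>) (fourier (mult_dist L (gauss x0 N)) \<phi>)"
  proof
    fix \<phi> :: "'a cfun" assume \<phi>: "\<phi> \<in> schwartz_functions"
    have "fourier (mult_dist L (gauss x0 N)) \<phi> = fourier L (conv x0 N \<phi>)"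
      by (simp add: fourier_def mult_dist_def gauss_eq_gse fourier_fun_conv [OF N' \<phi>, abs_def] flip: fourier_fun_conv)
    also have "\<dots> = (LINT \<eta>|lborel. h \<eta> * conv x0 N \<phi> \<eta>)"
      by (rule is_functionD(3) [OF L conv_schwartz [OF N' \<phi>], symmetric])
    finally show "has_bochner_integral lborel (\<lambda>\<xi>. kint x0 h N \<xi> * \<phi> \<xi>) (fourier (mult_dist L (gauss x0 N)) \<phi>)"
      unfolding kint_def using conv_duality [OF N' \<phi> h B] by simp
  qed
qed

lemma fourier_fun_add:
  assumes "\<phi> \<in> schwartz_functions" "\<psi> \<in> schwartz_functions"
  shows "fourier_fun (\<lambda>x. \<phi> x + \<psi> x) \<xi> = fourier_fun \<phi> \<xi> + fourier_fun \<psi> \<xi>"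
  using fourier_integrable [OF assms(1)] fourier_integrable [OF assms(2)]
  by (simp add: fourier_fun_def distrib_right distrib_left)

lemma fourier_fun_cmult: "fourier_fun (\<lambda>x. c * \<phi> x) \<xi> = c * fourier_fun \<phi> \<xi>"
  by (simp add: fourier_fun_def mult.assoc mult.left_commute)

lemma poly_bounded_coord_mult:
  assumes "poly_bounded h"
  shows "poly_bounded (\<lambda>x. of_real (x $ j) * h x)"
proof -
  obtain B k where B: "\<And>\<eta>. cmod (h \<eta>) \<le> B * (1 + norm \<eta>) ^ k" using assms unfolding poly_bounded_def by blast
  have "cmod (of_real (x $ j) * h x) \<le> B * (1 + norm x) ^ Suc k" for x
  proof -
    have "\<bar>x $ j\<bar> * cmod (h x) \<le> (1 + norm x) * (B * (1 + norm x) ^ k)"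
      by (intro mult_mono B order_trans [OF component_le_norm_cart]) auto
    then show ?thesis by (simp add: norm_mult mult_ac)
  qed
  then show ?thesis unfolding poly_bounded_def by blast
qed

text \<open>Differentiating the Gaussian would bring in a factor linear in \<open>x\<close>. If
  \<open>E\<close> is the Gaussian of parameter \<open>2 * N\<close>, then \<open>E * E\<close> is
  that of parameter \<open>N\<close>, and the product rule for \<open>E\<close> times the transform
  of \<open>\<phi>\<close> eliminates the derivative of \<open>E\<close>. What remains is
  \<open>E\<close> times a Fourier transform, to which the hypothesis on \<open>h\<close>
  applies.\<close>

lemma is_function_gauss_partial_deriv:
  fixes j :: "'n::finite"
  assumes L: "is_function (fourier (mult_dist u (gauss x0 (2 * N)))) h" and p: "poly_bounded h" and N: "N > 0"
  shows "is_function (fourier (mult_dist (\<lambda>\<phi>. u (partial_deriv j \<phi>)) (gauss x0 N)))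
    (\<lambda>\<xi>. - \<i> * (2 * kint x0 (\<lambda>\<eta>. of_real (\<eta> $ j) * h \<eta>) (2 * real N) \<xi> - of_real (\<xi> $ j) * kint x0 h (2 * real N) \<xi>))"
    (is "is_function _ ?H")
  unfolding is_function_def
proof
  define l where "l = 2 * real N"
  have l: "l > 0" using N by (simp add: l_def)
  have h [measurable]: "h \<in> borel_measurable borel" using is_functionD(1) [OF L] .
  let ?hj = "\<lambda>\<eta>. of_real (\<eta> $ j) * h \<eta>"
  have hj [measurable]: "?hj \<in> borel_measurable borel" by measurable
  note pj = poly_bounded_coord_mult [OF p, of j]
  have [measurable]: "kint x0 h l \<in> borel_measurable borel" "kint x0 ?hj l \<in> borel_measurable borel"
    by (intro borel_measurable_continuous_onI kint_continuous l h p hj pj)+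
  show "?H \<in> borel_measurable lborel" unfolding l_def [symmetric] by measurable
  define E where "E = gauss x0 (2 * N)"
  have E: "E = gse x0 l 0" by (simp add: E_def gauss_eq_gse l_def)
  have sE: "smooth E" unfolding E by (rule schwartz_smooth [OF gse_schwartz [OF l]])
  obtain B k where B: "\<And>\<eta>. cmod (h \<eta>) \<le> B * (1 + norm \<eta>) ^ k" using p unfolding poly_bounded_def by blast
  obtain Bj kj where Bj: "\<And>\<eta>. cmod (?hj \<eta>) \<le> Bj * (1 + norm \<eta>) ^ kj" using pj unfolding poly_bounded_def by blast
  show "\<forall>\<phi>\<in>schwartz_functions. has_bochner_integral lborel (\<lambda>\<xi>. ?H \<xi> * \<phi> \<xi>)
    (fourier (mult_dist (\<lambda>\<phi>. u (partial_deriv j \<phi>)) (gauss x0 N)) \<phi>)"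
  proof
    fix \<phi> :: "'n cfun" assume \<phi>: "\<phi> \<in> schwartz_functions"
    have \<phi>j: "(\<lambda>x. of_real (x $ j) * \<phi> x) \<in> schwartz_functions" by (rule schwartz_coord_mult [OF \<phi>])
    define A where "A = conv x0 l \<phi>"
    define A' where "A' = conv x0 l (\<lambda>x. of_real (x $ j) * \<phi> x)"
    have A: "A \<in> schwartz_functions" "A' \<in> schwartz_functions"
      unfolding A_def A'_def by (intro conv_schwartz l \<phi> \<phi>j)+
    have Aj: "(\<lambda>x. of_real (x $ j) * A x) \<in> schwartz_functions" by (rule schwartz_coord_mult [OF A(1)])
    \<comment> \<open>Chosen so that its transform is \<open>2 * partial_deriv j (fourier_fun A) - E
      * partial_deriv j (fourier_fun \<phi>)\<close>. Each derivative of a transform contributes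
      \<open>- \<i>\<close> and a coordinate, which in the second term stands inside the
      average.\<close>
    define \<Psi> where "\<Psi> = (\<lambda>\<eta>. (- 2 * \<i>) * (of_real (\<eta> $ j) * A \<eta>) + \<i> * A' \<eta>)"
    have \<Psi>: "\<Psi> \<in> schwartz_functions"
      unfolding \<Psi>_def by (intro schwartz_add schwartz_cmult Aj A)
    have FA: "fourier_fun A = (\<lambda>x. E x * fourier_fun \<phi> x)"
      "fourier_fun A' = (\<lambda>x. E x * fourier_fun (\<lambda>x. of_real (x $ j) * \<phi> x) x)"
      unfolding A_def A'_def E using fourier_fun_conv [OF l \<phi>] fourier_fun_conv [OF l \<phi>j] by blast+
    have s\<phi>: "smooth (fourier_fun \<phi>)" "smooth (fourier_fun A)"
      using fourier_fun_moderate moderateD(1) \<phi> A by blast+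
    have d1: "partial_deriv j (fourier_fun A) x = - \<i> * fourier_fun (\<lambda>x. of_real (x $ j) * A x) x" for x
      unfolding partial_deriv_fourier_fun [OF A(1)] by (rule fourier_fun_cmult)
    have d2: "partial_deriv j (fourier_fun \<phi>) x = - \<i> * fourier_fun (\<lambda>x. of_real (x $ j) * \<phi> x) x" for x
      unfolding partial_deriv_fourier_fun [OF \<phi>] by (rule fourier_fun_cmult)
    have d3: "partial_deriv j (fourier_fun A) x = E x * partial_deriv j (fourier_fun \<phi>) x + partial_deriv j E x * fourier_fun \<phi> x" for x
      unfolding FA(1) partial_deriv_smooth_mult [OF sE s\<phi>(1)] ..
    have "(\<lambda>x. gauss x0 N x * fourier_fun \<phi> x) = (\<lambda>x. E x * fourier_fun A x)"
      unfolding FA(1) E_def by (simp add: gauss_half [OF N] mult.assoc)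
    then have "partial_deriv j (\<lambda>x. gauss x0 N x * fourier_fun \<phi> x) x =
        E x * partial_deriv j (fourier_fun A) x + partial_deriv j E x * fourier_fun A x" for x
      by (simp add: partial_deriv_smooth_mult [OF sE s\<phi>(2)])
    also have "\<dots> x = E x * (2 * partial_deriv j (fourier_fun A) x - E x * partial_deriv j (fourier_fun \<phi>) x)" for x
      using d3 [of x] by (simp add: FA(1) algebra_simps)
    also have "\<dots> x = E x * fourier_fun \<Psi> x" for x
    proof -
      have "fourier_fun \<Psi> x = (- 2 * \<i>) * fourier_fun (\<lambda>x. of_real (x $ j) * A x) x + \<i> * fourier_fun A' x"
        unfolding \<Psi>_def 
        by (subst fourier_fun_add) (rule schwartz_cmult Aj A | simp only: fourier_fun_cmult)+
      then have "2 * partial_deriv j (fourier_fun A) x - E x * partial_deriv j (fourier_fun \<phi>) x = fourier_fun \<Psi> x"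
        by (simp add: d1 d2 FA(2) algebra_simps)
      then show ?thesis by simp
    qed
    finally have "partial_deriv j (\<lambda>x. gauss x0 N x * fourier_fun \<phi> x) = (\<lambda>x. E x * fourier_fun \<Psi> x)" by blast
    then have "fourier (mult_dist (\<lambda>\<phi>. u (partial_deriv j \<phi>)) (gauss x0 N)) \<phi> = fourier (mult_dist u (gauss x0 (2 * N))) \<Psi>"
      by (simp add: fourier_def mult_dist_def E_def)
    also have "\<dots> = (LINT \<eta>|lborel. h \<eta> * \<Psi> \<eta>)" by (rule is_functionD(3) [OF L \<Psi>, symmetric])
    also have "\<dots> = (LINT \<eta>|lborel. (- 2 * \<i>) * (?hj \<eta> * A \<eta>) + \<i> * (h \<eta> * A' \<eta>))"
      unfolding \<Psi>_def by (simp add: algebra_simps)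
    also have "\<dots> = (- 2 * \<i>) * (LINT \<eta>|lborel. ?hj \<eta> * A \<eta>) + \<i> * (LINT \<eta>|lborel. h \<eta> * A' \<eta>)"
    proof -
      have "integrable lborel (\<lambda>\<eta>. h \<eta> * (of_real (\<eta> $ j) * A \<eta>))" "integrable lborel (\<lambda>\<eta>. h \<eta> * A' \<eta>)"
        using is_functionD(2) [OF L] Aj A(2) by blast+
      then have "integrable lborel (\<lambda>\<eta>. ?hj \<eta> * A \<eta>)" "integrable lborel (\<lambda>\<eta>. h \<eta> * A' \<eta>)"
        by (simp_all only: mult_ac)
      then show ?thesis
        by (simp only: Bochner_Integration.integral_add integrable_mult_right integral_mult_right_zero)
    qed
    finally have eq: "fourier (mult_dist (\<lambda>\<phi>. u (partial_deriv j \<phi>)) (gauss x0 N)) \<phi> =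
      (- 2 * \<i>) * (LINT \<eta>|lborel. ?hj \<eta> * A \<eta>) + \<i> * (LINT \<eta>|lborel. h \<eta> * A' \<eta>)" .
    have "has_bochner_integral lborel (\<lambda>\<xi>. (- 2 * \<i>) * (kint x0 ?hj l \<xi> * \<phi> \<xi>) + \<i> * (kint x0 h l \<xi> * (of_real (\<xi> $ j) * \<phi> \<xi>)))
      ((- 2 * \<i>) * (LINT \<eta>|lborel. ?hj \<eta> * A \<eta>) + \<i> * (LINT \<eta>|lborel. h \<eta> * A' \<eta>))"
      unfolding kint_def A_def A'_def
      by (intro has_bochner_integral_add has_bochner_integral_mult_right conv_duality [OF l \<phi> hj Bj] conv_duality [OF l \<phi>j h B])
    then show "has_bochner_integral lborel (\<lambda>\<xi>. ?H \<xi> * \<phi> \<xi>)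
      (fourier (mult_dist (\<lambda>\<phi>. u (partial_deriv j \<phi>)) (gauss x0 N)) \<phi>)"
      unfolding eq l_def [symmetric] by (simp add: algebra_simps)
  qed
qed

section \<open>Gevrey weights, cone weights and Gaussian estimates\<close>

text \<open>The natural number \<open>n ^ n\<close> is 1 at \<open>n = 0\<close>, so this form
  removes the case distinction.\<close>

lemma gevrey_weight_eq: "gevrey_weight s n = real (n ^ n) powr s"
proof (cases "n = 0")
  case False
  then have "real (n ^ n) powr s = (real n powr real n) powr s" by (simp add: powr_realpow)
  then show ?thesis using False by (simp add: gevrey_weight_def powr_powr mult.commute)
qed (simp add: gevrey_weight_def)

lemma self_power_ge_1: "1 \<le> n ^ n" for n :: nat
  by (cases "n = 0") auto

lemma gevrey_weight_ge_1: "0 \<le> s \<Longrightarrow> 1 \<le> gevrey_weight s n"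
  unfolding gevrey_weight_eq using of_nat_mono [OF self_power_ge_1 [of n], where 'a = real]
  by (intro ge_one_powr_ge_zero) simp_all

lemma gevrey_weight_Suc: "0 \<le> s \<Longrightarrow> gevrey_weight s n \<le> gevrey_weight s (Suc n)"
proof -
  assume s: "0 \<le> s"
  have "n ^ n \<le> Suc n ^ n" by (rule power_mono) auto
  also have "\<dots> \<le> Suc n ^ Suc n" by (rule power_increasing) auto
  finally show ?thesis
    unfolding gevrey_weight_eq by (intro powr_mono2 s) (simp_all only: of_nat_le_iff of_nat_0_le_iff)
qed

text \<open>Since \<open>(n + p)^n \<le> n^n * exp p\<close> and
  \<open>(n + p)^p \<le> fact p * exp (n + p)\<close>, a fixed shift of the order costs a geometric
  factor. This allows giving up \<open>p\<close> orders of decay in exchange for a power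
  \<open>p\<close> of the bracket.\<close>

lemma gevrey_weight_add:
  assumes s: "0 \<le> s" "s \<le> 1"
  shows "\<exists>D\<ge>1. \<forall>n. gevrey_weight s (n + p) \<le> D ^ (n + 1) * gevrey_weight s n"
proof -
  define D :: real where "D = fact p * exp (2 * real p) * exp 1"
  have f1: "1 \<le> fact p * exp (2 * real p)"
    using mult_mono [of 1 "fact p" 1 "exp (2 * real p)"] by (simp add: fact_ge_1)
  have D1: "fact p * exp (2 * real p) \<le> D" unfolding D_def using f1 by (simp add: mult_le_cancel_left1)
  have De: "exp 1 \<le> D" unfolding D_def using f1 by (simp add: mult_le_cancel_right1)
  have D: "D \<ge> 1" using f1 D1 by linarith
  have "gevrey_weight s (n + p) \<le> D ^ (n + 1) * gevrey_weight s n" for n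
  proof -
    have "real ((n + p) ^ n) \<le> real (n ^ n) * exp (real p)"
    proof (cases "n = 0")
      case False
      have "(1 + real p / real n) ^ n \<le> exp (real p / real n) ^ n"
        by (intro power_mono exp_ge_add_one_self) auto
      also have "\<dots> = exp (real p)" using False by (simp flip: exp_of_nat_mult)
      finally have "real n ^ n * (1 + real p / real n) ^ n \<le> real n ^ n * exp (real p)"
        by (intro mult_left_mono) auto
      moreover have "real n ^ n * (1 + real p / real n) ^ n = real ((n + p) ^ n)"
        using False by (simp add: distrib_left flip: power_mult_distrib)
      ultimately show ?thesis by simp
    qed simp
    moreover have "real ((n + p) ^ p) \<le> fact p * exp (real (n + p))"
      using power_le_fact_exp [of "real (n + p)" p] by simp
    ultimately have "real ((n + p) ^ n) * real ((n + p) ^ p) \<le> (real (n ^ n) * exp (real p)) * (fact p * exp (real (n + p)))"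
      by (intro mult_mono) auto
    also have "\<dots> = (fact p * exp (2 * real p)) * exp 1 ^ n * real (n ^ n)"
    proof -
      have "exp 1 ^ n = exp (real n)" using exp_of_nat_mult [of n "1::real"] by simp
      moreover have "exp (2 * real p) = exp (real p) * exp (real p)" by (simp only: mult_2 exp_add)
      ultimately show ?thesis by (simp only: of_nat_add exp_add mult_ac)
    qed
    also have "\<dots> \<le> D * D ^ n * real (n ^ n)"
      using D1 De D by (intro mult_right_mono mult_mono power_mono) auto
    finally have "real ((n + p) ^ (n + p)) \<le> D ^ (n + 1) * real (n ^ n)"
      by (simp add: power_add)
    then have "gevrey_weight s (n + p) \<le> (D ^ (n + 1) * real (n ^ n)) powr s"
      unfolding gevrey_weight_eq using s by (intro powr_mono2) auto
    also have "\<dots> = (D ^ (n + 1)) powr s * gevrey_weight s n"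
      unfolding gevrey_weight_eq using D by (subst powr_mult) auto
    also have "\<dots> \<le> (D ^ (n + 1)) powr 1 * gevrey_weight s n"
      using D s one_le_power [OF D, of "n + 1"] gevrey_weight_ge_1 [OF s(1), of n]
      by (intro mult_right_mono powr_mono) auto
    finally show ?thesis using D by simp
  qed
  then show ?thesis using D by blast
qed

lemma absorb_power:
  fixes a b :: real
  assumes "a \<ge> 1" "b \<ge> 1"
  shows "a * b ^ (n + p) \<le> (a * b ^ (p + 1)) ^ (n + 1)"
proof -
  have "n + p \<le> (p + 1) * (n + 1)" by simp
  then have "b ^ (n + p) \<le> (b ^ (p + 1)) ^ (n + 1)"
    unfolding power_mult [symmetric] using assms by (intro power_increasing) auto
  moreover have "a \<le> a ^ (n + 1)" using assms self_le_power [of a "n + 1"] by simp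
  ultimately show ?thesis
    unfolding power_mult_distrib using assms by (intro mult_mono) auto
qed

section \<open>The bracket and the weight of a cone\<close>

lemma jap_ge_1: "1 \<le> jap \<xi>"
  by (simp add: jap_def)

lemma jap_pos: "0 < jap \<xi>"
  using jap_ge_1 [of \<xi>] by linarith

lemma norm_le_jap: "norm \<xi> \<le> jap \<xi>"
  unfolding jap_def by (rule real_le_rsqrt) simp

lemma jap_le: "jap \<xi> \<le> 1 + norm \<xi>"
  unfolding jap_def by (rule real_le_lsqrt) (simp_all add: power2_sum)

lemma jap_measurable [measurable]: "jap \<in> borel_measurable borel"
  unfolding jap_def by measurable

text \<open>A Peetre-type inequality, which transports powers of the bracket through an
  average.\<close>

lemma jap_triangle: "jap \<zeta> \<le> jap \<xi> * (1 + norm (\<zeta> - \<xi>))"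
proof -
  have "norm \<zeta> \<le> norm \<xi> + norm (\<zeta> - \<xi>)" by norm
  then have "jap \<zeta> \<le> sqrt ((1 + 0)\<^sup>2 + (norm \<xi> + norm (\<zeta> - \<xi>))\<^sup>2)"
    unfolding jap_def by (intro real_sqrt_le_mono) (auto intro!: power_mono)
  also have "\<dots> \<le> jap \<xi> + norm (\<zeta> - \<xi>)"
    using real_sqrt_sum_squares_triangle_ineq [of 1 0 "norm \<xi>" "norm (\<zeta> - \<xi>)"] by (simp add: jap_def)
  also have "\<dots> \<le> jap \<xi> * (1 + norm (\<zeta> - \<xi>))"
    using mult_right_mono [OF jap_ge_1 [of \<xi>], of "norm (\<zeta> - \<xi>)"] by (simp add: distrib_left)
  finally show ?thesis .
qed

definition cone_weight :: "(real ^ 'n::finite) set \<Rightarrow> real ^ 'n \<Rightarrow> real" where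
  "cone_weight \<Gamma> \<xi> = max 1 (infdist \<xi> (- \<Gamma>))"

lemma cone_weight_ge_1: "1 \<le> cone_weight \<Gamma> \<xi>"
  by (simp add: cone_weight_def)

lemma cone_weight_pos: "0 < cone_weight \<Gamma> \<xi>"
  using cone_weight_ge_1 [of \<Gamma> \<xi>] by linarith

text \<open>The distance to a set is 1-Lipschitz; because the weight is at least 1, the additive
  estimate becomes the multiplicative one needed for powers.\<close>

lemma cone_weight_triangle: "cone_weight \<Gamma> \<xi> \<le> cone_weight \<Gamma> \<zeta> * (1 + norm (\<zeta> - \<xi>))"
proof -
  have "infdist \<xi> (- \<Gamma>) \<le> infdist \<zeta> (- \<Gamma>) + norm (\<zeta> - \<xi>)"
    using infdist_triangle [of \<xi> "- \<Gamma>" \<zeta>] by (simp add: dist_norm norm_minus_commute)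
  also have "\<dots> \<le> cone_weight \<Gamma> \<zeta> + norm (\<zeta> - \<xi>)" by (simp add: cone_weight_def)
  finally have "cone_weight \<Gamma> \<xi> \<le> cone_weight \<Gamma> \<zeta> + 1 * norm (\<zeta> - \<xi>)"
    using add_mono [OF cone_weight_ge_1 [of \<Gamma> \<zeta>] norm_ge_zero [of "\<zeta> - \<xi>"]]
    by (simp add: cone_weight_def [of \<Gamma> \<xi>])
  also have "\<dots> \<le> cone_weight \<Gamma> \<zeta> + cone_weight \<Gamma> \<zeta> * norm (\<zeta> - \<xi>)"
    by (intro add_left_mono mult_right_mono cone_weight_ge_1) simp
  finally show ?thesis by (simp add: distrib_left)
qed

lemma cone_weight_outside: "\<xi> \<notin> \<Gamma> \<Longrightarrow> cone_weight \<Gamma> \<xi> = 1"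
  by (simp add: cone_weight_def)

lemma cone_weight_le_jap: "0 \<notin> \<Gamma> \<Longrightarrow> cone_weight \<Gamma> \<xi> \<le> jap \<xi>"
  unfolding cone_weight_def
  using infdist_le [of 0 "- \<Gamma>" \<xi>] norm_le_jap [of \<xi>] jap_ge_1 [of \<xi>] by auto

lemma jap_le_cone_weight:
  assumes "c > 0" "c * norm \<xi> \<le> infdist \<xi> (- \<Gamma>)"
  shows "jap \<xi> \<le> (1 + 1 / c) * cone_weight \<Gamma> \<xi>"
proof -
  have "norm \<xi> \<le> 1 / c * cone_weight \<Gamma> \<xi>"
    using assms by (simp add: cone_weight_def field_simps max_def)
  then have "1 + norm \<xi> \<le> cone_weight \<Gamma> \<xi> + 1 / c * cone_weight \<Gamma> \<xi>"
    using cone_weight_ge_1 [of \<Gamma> \<xi>] by linarith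
  then show ?thesis using jap_le [of \<xi>] by (simp add: algebra_simps)
qed

text \<open>With \<open>\<tau> = sqrt N * norm (\<zeta> - \<xi>)\<close> the kernel supplies
  \<open>exp (- 2 * \<tau>^2)\<close>. Exchanging the \<open>j\<close>-th power of the weight at the
  two points spends one \<open>\<tau>^2\<close>, by
  \<open>j * t \<le> j^2 / (4 * N) + N * t^2\<close> with \<open>t\<close> the distance; the
  polynomial factors spend half of a \<open>\<tau>^2\<close>. The remaining half is the integrable
  kernel \<open>heat (N / 2)\<close>.\<close>

lemma gaussian_pointwise:
  fixes w :: "real ^ 'n::finite \<Rightarrow> real"
  assumes w1: "\<And>\<xi>. 1 \<le> w \<xi>" and w: "\<And>\<xi> \<zeta>. w \<xi> \<le> w \<zeta> * (1 + norm (\<zeta> - \<xi>))"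
  shows "\<exists>K>0. \<forall>N\<ge>1. \<forall>p\<le>M. \<forall>j \<xi> \<zeta>. jap \<zeta> ^ p / w \<zeta> ^ j * (1 + sqrt N * norm (\<zeta> - \<xi>)) ^ q * heat (2 * N) (\<zeta> - \<xi>)
    \<le> K * exp ((real j)\<^sup>2 / (4 * N)) * (jap \<xi> ^ p / w \<xi> ^ j) * heat (N / 2) (\<zeta> - \<xi>)"
proof -
  obtain C :: real where C: "C > 0" "\<forall>z\<ge>0. (1 + z) ^ (M + q) \<le> C * exp (1 / 2 * z\<^sup>2)"
    using power_one_plus_le_exp_square [of "1 / 2"] by (meson half_gt_zero zero_less_one)
  have "jap \<zeta> ^ p / w \<zeta> ^ j * (1 + sqrt N * norm (\<zeta> - \<xi>)) ^ q * heat (2 * N) (\<zeta> - \<xi>)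
    \<le> (C * 2 ^ CARD('n)) * exp ((real j)\<^sup>2 / (4 * N)) * (jap \<xi> ^ p / w \<xi> ^ j) * heat (N / 2) (\<zeta> - \<xi>)"
    if N: "N \<ge> 1" and p: "p \<le> M" for N :: real and p j \<xi> \<zeta>
  proof -
    define t where "t = norm (\<zeta> - \<xi>)"
    define \<tau> where "\<tau> = sqrt N * t"
    have t: "t \<ge> 0" "t \<le> \<tau>" and \<tau>: "\<tau> \<ge> 0" "\<tau>\<^sup>2 = N * t\<^sup>2"
      using N mult_right_mono [of 1 "sqrt N" t] by (auto simp: t_def \<tau>_def power_mult_distrib)
    have wp: "w \<xi> > 0" for \<xi> using w1 [of \<xi>] by linarith
    have 1: "jap \<zeta> ^ p \<le> jap \<xi> ^ p * (1 + \<tau>) ^ M"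
    proof -
      have "jap \<zeta> ^ p \<le> (jap \<xi> * (1 + t)) ^ p"
        unfolding t_def by (intro power_mono jap_triangle less_imp_le [OF jap_pos])
      also have "\<dots> \<le> jap \<xi> ^ p * (1 + \<tau>) ^ p"
        unfolding power_mult_distrib using t jap_pos [of \<xi>] by (intro mult_left_mono power_mono) auto
      also have "\<dots> \<le> jap \<xi> ^ p * (1 + \<tau>) ^ M"
        using \<tau> p jap_pos [of \<xi>] by (intro mult_left_mono power_increasing) auto
      finally show ?thesis .
    qed
    have 2: "1 / w \<zeta> ^ j \<le> exp ((real j)\<^sup>2 / (4 * N)) * exp (\<tau>\<^sup>2) * (1 / w \<xi> ^ j)"
    proof -
      have "w \<xi> ^ j \<le> (w \<zeta> * (1 + t)) ^ j"
        unfolding t_def using wp [of \<xi>] by (intro power_mono w) auto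
      also have "\<dots> \<le> w \<zeta> ^ j * exp t ^ j"
        unfolding power_mult_distrib using wp [of \<zeta>] t exp_ge_add_one_self [of t]
        by (intro mult_left_mono power_mono) auto
      also have "exp t ^ j = exp (real j * t)" by (simp add: exp_of_nat_mult)
      also have "exp (real j * t) \<le> exp ((real j)\<^sup>2 / (4 * N) + \<tau>\<^sup>2)"
      proof -
        have "0 \<le> (real j - 2 * N * t)\<^sup>2 / (4 * N)" using N by simp
        also have "\<dots> = (real j)\<^sup>2 / (4 * N) + N * t\<^sup>2 - real j * t"
          using N by (simp add: power2_eq_square field_simps)
        finally show ?thesis by (simp add: \<tau>(2))
      qed
      finally have "w \<xi> ^ j \<le> w \<zeta> ^ j * (exp ((real j)\<^sup>2 / (4 * N)) * exp (\<tau>\<^sup>2))"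
        using wp [of \<zeta>] by (simp add: exp_add)
      then show ?thesis using wp [of \<zeta>] wp [of \<xi>] by (simp add: field_simps)
    qed
    have 3: "heat (2 * N) (\<zeta> - \<xi>) = sqrt (2 * N / pi) ^ CARD('n) * exp (- 2 * \<tau>\<^sup>2)"
      by (simp add: heat_def \<tau>(2) t_def)
    have 4: "sqrt (2 * N / pi) ^ CARD('n) * exp (- 1 / 2 * \<tau>\<^sup>2) = 2 ^ CARD('n) * heat (N / 2) (\<zeta> - \<xi>)"
    proof -
      have "2 * N / pi = 4 * (N / 2 / pi)" by simp
      then have "sqrt (2 * N / pi) = 2 * sqrt (N / 2 / pi)" by (simp only: real_sqrt_mult real_sqrt_four)
      then show ?thesis by (simp add: heat_def \<tau>(2) t_def power_mult_distrib)
    qed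
    have "jap \<zeta> ^ p / w \<zeta> ^ j * (1 + \<tau>) ^ q = jap \<zeta> ^ p * (1 / w \<zeta> ^ j) * (1 + \<tau>) ^ q" by simp
    also have "\<dots> \<le> (jap \<xi> ^ p * (1 + \<tau>) ^ M) * (exp ((real j)\<^sup>2 / (4 * N)) * exp (\<tau>\<^sup>2) * (1 / w \<xi> ^ j)) * (1 + \<tau>) ^ q"
      using \<tau> wp jap_pos [of \<xi>] jap_pos [of \<zeta>]
      by (intro mult_right_mono mult_mono [OF 1 2]) (auto simp: less_imp_le)
    also have "\<dots> = exp ((real j)\<^sup>2 / (4 * N)) * (jap \<xi> ^ p / w \<xi> ^ j) * exp (\<tau>\<^sup>2) * (1 + \<tau>) ^ (M + q)"
      by (simp add: power_add mult_ac)
    also have "\<dots> \<le> exp ((real j)\<^sup>2 / (4 * N)) * (jap \<xi> ^ p / w \<xi> ^ j) * exp (\<tau>\<^sup>2) * (C * exp (1 / 2 * \<tau>\<^sup>2))"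
      using C(2) \<tau>(1) wp jap_pos [of \<xi>] by (intro mult_left_mono) (auto simp: less_imp_le)
    finally have "jap \<zeta> ^ p / w \<zeta> ^ j * (1 + \<tau>) ^ q * heat (2 * N) (\<zeta> - \<xi>) \<le>
      (exp ((real j)\<^sup>2 / (4 * N)) * (jap \<xi> ^ p / w \<xi> ^ j) * exp (\<tau>\<^sup>2) * (C * exp (1 / 2 * \<tau>\<^sup>2))) * heat (2 * N) (\<zeta> - \<xi>)"
      using N by (intro mult_right_mono) auto
    also have "\<dots> = exp ((real j)\<^sup>2 / (4 * N)) * (jap \<xi> ^ p / w \<xi> ^ j) * C *
        (sqrt (2 * N / pi) ^ CARD('n) * (exp (\<tau>\<^sup>2) * exp (1 / 2 * \<tau>\<^sup>2) * exp (- 2 * \<tau>\<^sup>2)))"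
      unfolding 3 by (simp only: mult_ac)
    also have "exp (\<tau>\<^sup>2) * exp (1 / 2 * \<tau>\<^sup>2) * exp (- 2 * \<tau>\<^sup>2) = exp (- 1 / 2 * \<tau>\<^sup>2)"
      unfolding exp_add [symmetric] by simp
    finally show ?thesis unfolding 4 by (simp add: t_def \<tau>_def mult_ac)
  qed
  then show ?thesis using C(1) by (intro exI [of _ "C * 2 ^ CARD('n)"]) auto
qed

text \<open>Records that \<open>K\<close> is uniform in \<open>N\<close>, \<open>p\<close>,
  \<open>j\<close>, the point and \<open>g\<close>. In applications \<open>g\<close> is a function
  with a known weighted bound times the kernel and a moment factor of degree at most
  \<open>q\<close>.\<close>

definition gaussian_bound :: "(real ^ 'n::finite \<Rightarrow> real) \<Rightarrow> nat \<Rightarrow> nat \<Rightarrow> real \<Rightarrow> bool" where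
  "gaussian_bound w M q K \<longleftrightarrow> (\<forall>N\<ge>1. \<forall>p\<le>M. \<forall>j \<xi> A. \<forall>g :: 'n cfun. A \<ge> 0 \<longrightarrow>
    (\<forall>\<zeta>. cmod (g \<zeta>) \<le> A * (jap \<zeta> ^ p / w \<zeta> ^ j) * (1 + sqrt N * norm (\<zeta> - \<xi>)) ^ q * heat (2 * N) (\<zeta> - \<xi>)) \<longrightarrow>
    cmod (LINT \<zeta>|lborel. g \<zeta>) \<le> K * exp ((real j)\<^sup>2 / (4 * N)) * A * (jap \<xi> ^ p / w \<xi> ^ j))"

lemmas gaussian_boundD = gaussian_bound_def [THEN iffD1, rule_format]

lemma gaussian_estimate:
  fixes w :: "real ^ 'n::finite \<Rightarrow> real"
  assumes w1: "\<And>\<xi>. 1 \<le> w \<xi>" and w: "\<And>\<xi> \<zeta>. w \<xi> \<le> w \<zeta> * (1 + norm (\<zeta> - \<xi>))"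
  shows "\<exists>K>0. gaussian_bound w M q K"
proof -
  obtain K where K: "K > 0" "\<And>N p j \<xi> \<zeta>. N \<ge> 1 \<Longrightarrow> p \<le> M \<Longrightarrow>
    jap \<zeta> ^ p / w \<zeta> ^ j * (1 + sqrt N * norm (\<zeta> - \<xi>)) ^ q * heat (2 * N) (\<zeta> - \<xi>)
    \<le> K * exp ((real j)\<^sup>2 / (4 * N)) * (jap \<xi> ^ p / w \<xi> ^ j) * heat (N / 2) (\<zeta> - \<xi>)"
    using gaussian_pointwise [OF w1 w, of M q] by blast
  have "cmod (LINT \<zeta>|lborel. g \<zeta>) \<le> K * exp ((real j)\<^sup>2 / (4 * N)) * A * (jap \<xi> ^ p / w \<xi> ^ j)"
    if N: "N \<ge> 1" and p: "p \<le> M" and A: "A \<ge> 0"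
      and g: "\<And>\<zeta>. cmod (g \<zeta>) \<le> A * (jap \<zeta> ^ p / w \<zeta> ^ j) * (1 + sqrt N * norm (\<zeta> - \<xi>)) ^ q * heat (2 * N) (\<zeta> - \<xi>)"
    for N p j \<xi> A and g :: "'n cfun"
  proof (cases "integrable lborel g")
    case True
    define c where "c = K * exp ((real j)\<^sup>2 / (4 * N)) * A * (jap \<xi> ^ p / w \<xi> ^ j)"
    have le: "cmod (g \<zeta>) \<le> c * heat (N / 2) (\<zeta> - \<xi>)" for \<zeta>
      using order_trans [OF g [of \<zeta>, unfolded mult.assoc] mult_left_mono [OF K(2) [OF N p, of \<zeta> j \<xi>, unfolded mult.assoc] A]]
      by (simp add: c_def mult_ac)
    have N2: "N / 2 > 0" using N by simp
    have "cmod (LINT \<zeta>|lborel. g \<zeta>) \<le> (LINT \<zeta>|lborel. c * heat (N / 2) (\<zeta> - \<xi>))"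
      using True lborel_integrable_translate [OF heat_integrable [OF N2], of "- \<xi>"]
      by (intro order_trans [OF integral_norm_bound] integral_mono le) auto
    also have "\<dots> = c"
      using lborel_integral_translate [of "heat (N / 2)" "- \<xi>"] heat_integral [OF N2, where 'n = 'n] by simp
    finally show ?thesis unfolding c_def .
  next
    \<comment> \<open>A function that is not integrable has integral 0, so the bound holds trivially
      and integrability need not be assumed of \<open>g\<close>.\<close>
    case False
    have "w \<xi> > 0" using w1 [of \<xi>] by linarith
    then show ?thesis
      using False K(1) A jap_pos [of \<xi>] by (simp add: not_integrable_integral_eq)
  qed
  then have "gaussian_bound w M q K" by (simp add: gaussian_bound_def)
  then show ?thesis using K(1) by blast
qed

section \<open>Elliptic regularity on the Fourier side\<close>

lemma lborel_integral_reflect: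
  fixes f :: "'a::euclidean_space \<Rightarrow> 'b::{banach, second_countable_topology}"
  assumes [measurable]: "f \<in> borel_measurable borel"
  shows "(LINT x|lborel. f (- x)) = (LINT x|lborel. f x)"
proof -
  have "lborel = density (distr lborel borel (\<lambda>x::'a. 0 + (- 1) *\<^sub>R x)) (\<lambda>_. ennreal (\<bar>- 1\<bar> ^ DIM('a)))"
    by (rule lborel_affine) simp
  then have "(lborel :: 'a measure) = distr lborel borel uminus" by (simp add: density_1)
  then have "(LINT x|lborel. f x) = (LINT x|distr lborel borel uminus. f x)" by simp
  also have "\<dots> = (LINT x|lborel. f (- x))" by (rule integral_distr) simp_all
  finally show ?thesis ..
qed

text \<open>The parallelogram law in the exponent. As a function of \<open>\<zeta>\<close>, the
  product of the two kernels is a narrower kernel centred at the midpoint: the semigroup property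
  before integration.\<close>

lemma heat_product:
  fixes \<eta> \<xi> \<zeta> :: "real ^ 'n::finite"
  assumes l: "l > 0"
  shows "heat (2 * l) (\<eta> - \<zeta>) * heat (2 * l) (\<zeta> - \<xi>) = heat l (\<eta> - \<xi>) * heat (4 * l) (\<zeta> - (1/2) *\<^sub>R (\<eta> + \<xi>))"
proof -
  have "2 * ((\<eta> - \<zeta>) \<bullet> (\<eta> - \<zeta>)) + 2 * ((\<zeta> - \<xi>) \<bullet> (\<zeta> - \<xi>)) =
    (\<eta> - \<xi>) \<bullet> (\<eta> - \<xi>) + 4 * ((\<zeta> - (1/2) *\<^sub>R (\<eta> + \<xi>)) \<bullet> (\<zeta> - (1/2) *\<^sub>R (\<eta> + \<xi>)))"
    by (simp add: inner_diff_left inner_diff_right inner_add_left inner_add_right inner_commute algebra_simps)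
  then have "2 * (norm (\<eta> - \<zeta>))\<^sup>2 + 2 * (norm (\<zeta> - \<xi>))\<^sup>2 = (norm (\<eta> - \<xi>))\<^sup>2 + 4 * (norm (\<zeta> - (1/2) *\<^sub>R (\<eta> + \<xi>)))\<^sup>2"
    by (simp only: power2_norm_eq_inner)
  then have "l * (2 * (norm (\<eta> - \<zeta>))\<^sup>2 + 2 * (norm (\<zeta> - \<xi>))\<^sup>2) = l * ((norm (\<eta> - \<xi>))\<^sup>2 + 4 * (norm (\<zeta> - (1/2) *\<^sub>R (\<eta> + \<xi>)))\<^sup>2)"
    by simp
  then have e: "exp (- (2 * l) * (norm (\<eta> - \<zeta>))\<^sup>2) * exp (- (2 * l) * (norm (\<zeta> - \<xi>))\<^sup>2) =
    exp (- l * (norm (\<eta> - \<xi>))\<^sup>2) * exp (- (4 * l) * (norm (\<zeta> - (1/2) *\<^sub>R (\<eta> + \<xi>)))\<^sup>2)"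
    by (simp add: algebra_simps flip: exp_add)
  have "(2 * l / pi) * (2 * l / pi) = (l / pi) * (4 * l / pi)" by simp
  then have "sqrt (2 * l / pi) * sqrt (2 * l / pi) = sqrt (l / pi) * sqrt (4 * l / pi)"
    by (simp only: real_sqrt_mult [symmetric])
  then have c: "sqrt (2 * l / pi) ^ CARD('n) * sqrt (2 * l / pi) ^ CARD('n) = sqrt (l / pi) ^ CARD('n) * sqrt (4 * l / pi) ^ CARD('n)"
    by (metis power_mult_distrib)
  have "heat (2 * l) (\<eta> - \<zeta>) * heat (2 * l) (\<zeta> - \<xi>) = (sqrt (2 * l / pi) ^ CARD('n) * sqrt (2 * l / pi) ^ CARD('n)) *
    (exp (- (2 * l) * (norm (\<eta> - \<zeta>))\<^sup>2) * exp (- (2 * l) * (norm (\<zeta> - \<xi>))\<^sup>2))"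
    by (simp only: heat_def mult_ac)
  then show ?thesis unfolding c e by (simp only: heat_def mult_ac)
qed

lemma kern_product:
  assumes "l > 0"
  shows "kern x0 (2 * l) (\<eta> - \<zeta>) * kern x0 (2 * l) (\<zeta> - \<xi>) =
    kern x0 l (\<eta> - \<xi>) * of_real (heat (4 * l) (\<zeta> - (1/2) *\<^sub>R (\<eta> + \<xi>)))"
proof -
  have "kern x0 (2 * l) (\<eta> - \<zeta>) * kern x0 (2 * l) (\<zeta> - \<xi>) =
    of_real (heat (2 * l) (\<eta> - \<zeta>) * heat (2 * l) (\<zeta> - \<xi>)) * exp (\<i> * of_real (x0 \<bullet> (\<eta> - \<zeta>)) + \<i> * of_real (x0 \<bullet> (\<zeta> - \<xi>)))"
    by (simp add: kern_def exp_add mult_ac)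
  also have "\<i> * of_real (x0 \<bullet> (\<eta> - \<zeta>)) + \<i> * of_real (x0 \<bullet> (\<zeta> - \<xi>)) = \<i> * complex_of_real (x0 \<bullet> (\<eta> - \<xi>))"
    by (simp add: inner_diff_right algebra_simps)
  finally show ?thesis unfolding heat_product [OF assms] kern_def by (simp only: of_real_mult mult_ac)
qed

lemma conv_kern:
  assumes l: "l > 0"
  shows "conv x0 (2 * l) (\<lambda>\<zeta>. kern x0 (2 * l) (\<zeta> - \<xi>)) \<eta> = kern x0 l (\<eta> - \<xi>)"
proof -
  have "(LINT \<zeta>|lborel. heat (4 * l) (\<zeta> - (1/2) *\<^sub>R (\<eta> + \<xi>))) = 1"
    using lborel_integral_translate [of "heat (4 * l)" "- (1/2) *\<^sub>R (\<eta> + \<xi>)"] heat_integral [of "4 * l", where 'n = 'a] l by simp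
  then show ?thesis
    unfolding conv_def kern_product [OF l] by (simp flip: of_real_eq_1_iff)
qed

lemma coord_heat_integral:
  assumes l: "l > 0"
  shows "integrable lborel (\<lambda>t :: real ^ 'n::finite. t $ j * heat l t)" "(LINT t|lborel. (t :: real ^ 'n) $ j * heat l t) = 0"
proof -
  show "integrable lborel (\<lambda>t :: real ^ 'n. t $ j * heat l t)"
  proof (rule Bochner_Integration.integrable_bound [OF heat_weight_integrable [OF l, of 1] _ AE_I2])
    show "norm ((t :: real ^ 'n) $ j * heat l t) \<le> norm ((1 + norm t) ^ 1 * heat l t)" for t
      using l order_trans [OF component_le_norm_cart [of t j], of "1 + norm t"]
      by (simp add: abs_mult mult_right_mono)
  qed measurable
  have "(LINT t|lborel. (t :: real ^ 'n) $ j * heat l t) = (LINT t|lborel. ((- t) :: real ^ 'n) $ j * heat l (- t))"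
    by (rule lborel_integral_reflect [symmetric]) measurable
  then show "(LINT t|lborel. (t :: real ^ 'n) $ j * heat l t) = 0" by simp
qed

text \<open>In \<open>\<zeta>\<close> the product of the kernels is centred at the midpoint of
  \<open>\<eta>\<close> and \<open>\<xi>\<close>, so the mean of \<open>\<zeta> - \<xi>\<close> is
  half of \<open>\<eta> - \<xi>\<close>. The factor 2 compensates for that, and the odd part
  integrates to 0.\<close>

lemma conv_coord_kern:
  assumes l: "l > 0"
  shows "conv x0 (2 * l) (\<lambda>\<zeta>. of_real (2 * (\<zeta> - \<xi>) $ j) * kern x0 (2 * l) (\<zeta> - \<xi>)) \<eta> = of_real ((\<eta> - \<xi>) $ j) * kern x0 l (\<eta> - \<xi>)"
proof -
  define c where "c = (1/2) *\<^sub>R (\<eta> + \<xi>)"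
  have l4: "4 * l > 0" using l by simp
  have "(LINT \<zeta>|lborel. 2 * (\<zeta> - \<xi>) $ j * heat (4 * l) (\<zeta> - c)) = (LINT t|lborel. 2 * (t + c - \<xi>) $ j * heat (4 * l) t)"
    using lborel_integral_translate [of "\<lambda>\<zeta>. 2 * (\<zeta> - \<xi>) $ j * heat (4 * l) (\<zeta> - c)" c] by simp
  also have "\<dots> = (LINT t|lborel. 2 * (t $ j * heat (4 * l) t) + (\<eta> - \<xi>) $ j * heat (4 * l) t)"
    by (rule arg_cong [of _ _ "integral\<^sup>L lborel"]) (simp add: c_def fun_eq_iff algebra_simps)
  also have "\<dots> = 2 * (LINT t|lborel. (t :: real ^ 'a) $ j * heat (4 * l) t) + (\<eta> - \<xi>) $ j * (LINT t|lborel. heat (4 * l) (t :: real ^ 'a))"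
    by (subst Bochner_Integration.integral_add)
      (intro integrable_mult_right coord_heat_integral heat_integrable l4 | simp only: integral_mult_right_zero)+
  finally have I: "(LINT \<zeta>|lborel. 2 * (\<zeta> - \<xi>) $ j * heat (4 * l) (\<zeta> - c)) = (\<eta> - \<xi>) $ j"
    by (simp only: coord_heat_integral(2) [OF l4] heat_integral [OF l4])
  have "kern x0 (2 * l) (\<eta> - \<zeta>) * (of_real (2 * (\<zeta> - \<xi>) $ j) * kern x0 (2 * l) (\<zeta> - \<xi>)) =
    kern x0 l (\<eta> - \<xi>) * of_real (2 * (\<zeta> - \<xi>) $ j * heat (4 * l) (\<zeta> - c))" for \<zeta>
    using kern_product [OF l, of x0 \<eta> \<zeta> \<xi>] by (simp add: c_def algebra_simps)
  then have "conv x0 (2 * l) (\<lambda>\<zeta>. of_real (2 * (\<zeta> - \<xi>) $ j) * kern x0 (2 * l) (\<zeta> - \<xi>)) \<eta> =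
    kern x0 l (\<eta> - \<xi>) * of_real (LINT \<zeta>|lborel. 2 * (\<zeta> - \<xi>) $ j * heat (4 * l) (\<zeta> - c))"
    unfolding conv_def by (simp only: integral_mult_right_zero integral_complex_of_real)
  then show ?thesis unfolding I by (simp add: mult.commute)
qed

lemma coord_kern_schwartz:
  assumes l: "l > 0"
  shows "(\<lambda>\<zeta>. of_real (2 * (\<zeta> - \<xi>) $ j) * kern x0 l (\<zeta> - \<xi>)) \<in> schwartz_functions"
proof -
  have "(\<lambda>\<zeta>. 2 * (of_real (\<zeta> $ j) * kern x0 l (\<zeta> - \<xi>)) + (- 2 * of_real (\<xi> $ j)) * kern x0 l (\<zeta> - \<xi>)) \<in> schwartz_functions"
    by (intro schwartz_add schwartz_cmult schwartz_coord_mult kern_schwartz l)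
  then show ?thesis by (simp add: algebra_simps)
qed

text \<open>The counterpart of \<open>gauss_half\<close> on the Fourier side.\<close>

lemma kint_half:
  assumes l: "l > 0" and h: "h \<in> borel_measurable borel" and p: "poly_bounded h"
  shows "kint x0 h l \<xi> = (LINT \<zeta>|lborel. kint x0 h (2 * l) \<zeta> * kern x0 (2 * l) (\<zeta> - \<xi>))"
proof -
  obtain B k where B: "\<And>\<eta>. cmod (h \<eta>) \<le> B * (1 + norm \<eta>) ^ k" using p unfolding poly_bounded_def by blast
  have l2: "2 * l > 0" using l by simp
  show ?thesis
    using conv_duality [OF l2 kern_schwartz [OF l2, of x0 \<xi>] h B, of x0]
    by (simp add: has_bochner_integral_iff kint_def conv_kern [OF l])
qed

lemma kint_coord:
  assumes l: "l > 0" and h: "h \<in> borel_measurable borel" and p: "poly_bounded h"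
  shows "kint x0 (\<lambda>\<eta>. of_real (\<eta> $ j) * h \<eta>) l \<xi> = of_real (\<xi> $ j) * kint x0 h l \<xi> +
    (LINT \<zeta>|lborel. kint x0 h (2 * l) \<zeta> * (of_real (2 * (\<zeta> - \<xi>) $ j) * kern x0 (2 * l) (\<zeta> - \<xi>)))"
proof -
  obtain B k where B: "\<And>\<eta>. cmod (h \<eta>) \<le> B * (1 + norm \<eta>) ^ k" using p unfolding poly_bounded_def by blast
  have l2: "2 * l > 0" using l by simp
  have hj: "(\<lambda>\<eta>. of_real (\<eta> $ j) * h \<eta>) \<in> borel_measurable borel" using h by measurable
  have 1: "(LINT \<zeta>|lborel. kint x0 h (2 * l) \<zeta> * (of_real (2 * (\<zeta> - \<xi>) $ j) * kern x0 (2 * l) (\<zeta> - \<xi>))) =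
    (LINT \<eta>|lborel. h \<eta> * (of_real ((\<eta> - \<xi>) $ j) * kern x0 l (\<eta> - \<xi>)))"
    using conv_duality [OF l2 coord_kern_schwartz [OF l2, of \<xi> j x0] h B, of x0]
    unfolding conv_coord_kern [OF l] by (simp only: has_bochner_integral_iff kint_def)
  have "(LINT \<eta>|lborel. h \<eta> * (of_real ((\<eta> - \<xi>) $ j) * kern x0 l (\<eta> - \<xi>))) =
    (LINT \<eta>|lborel. (of_real (\<eta> $ j) * h \<eta>) * kern x0 l (\<eta> - \<xi>) - of_real (\<xi> $ j) * (h \<eta> * kern x0 l (\<eta> - \<xi>)))"
    by (simp add: algebra_simps)
  also have "\<dots> = kint x0 (\<lambda>\<eta>. of_real (\<eta> $ j) * h \<eta>) l \<xi> - of_real (\<xi> $ j) * kint x0 h l \<xi>"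
    unfolding kint_def
    by (subst Bochner_Integration.integral_diff)
      (intro integrable_mult_right kern_integrable l h hj p poly_bounded_coord_mult | simp only: integral_mult_right_zero)+
  finally show ?thesis using 1 by simp
qed

section \<open>Monomials as words and averages of monomial multiples\<close>

definition mfun :: "('n::finite) list \<Rightarrow> 'n cfun" where
  "mfun \<delta> \<eta> = of_real (prod_list (map (\<lambda>i. \<eta> $ i) \<delta>))"

lemma mfun_Nil [simp]: "mfun [] \<eta> = 1"
  and mfun_Cons: "mfun (i # \<delta>) \<eta> = of_real (\<eta> $ i) * mfun \<delta> \<eta>"
  by (simp_all add: mfun_def)

lemma norm_mfun_le: "cmod (mfun \<delta> \<eta>) \<le> jap \<eta> ^ length \<delta>"
proof (induction \<delta>)
  case (Cons i \<delta>)
  have "\<bar>\<eta> $ i\<bar> * cmod (mfun \<delta> \<eta>) \<le> jap \<eta> * jap \<eta> ^ length \<delta>"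
    using Cons jap_pos [of \<eta>] by (intro mult_mono order_trans [OF component_le_norm_cart norm_le_jap]) auto
  then show ?case by (simp add: mfun_Cons norm_mult)
qed simp

lemma mfun_measurable [measurable]: "mfun \<delta> \<in> borel_measurable borel"
  by (induction \<delta>) (simp_all add: mfun_Cons [abs_def])

lemma poly_bounded_mfun_mult: "poly_bounded h \<Longrightarrow> poly_bounded (\<lambda>\<eta>. mfun \<delta> \<eta> * h \<eta>)"
proof (induction \<delta>)
  case (Cons i \<delta>)
  from poly_bounded_coord_mult [OF Cons.IH [OF Cons.prems], of i]
  show ?case by (simp add: mfun_Cons mult.assoc)
qed simp

lemma poly_bounded_jap:
  assumes h: "\<And>\<eta>. cmod (h \<eta>) \<le> B * jap \<eta> ^ M"
  shows "poly_bounded h"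
  unfolding poly_bounded_def
proof (intro exI allI)
  fix \<eta> :: "real ^ 'a"
  have "0 \<le> B" using order_trans [OF norm_ge_zero h [of 0]] by (simp add: jap_def)
  then have "B * jap \<eta> ^ M \<le> B * (1 + norm \<eta>) ^ M"
    using jap_pos [of \<eta>] by (intro mult_left_mono power_mono jap_le) auto
  then show "cmod (h \<eta>) \<le> B * (1 + norm \<eta>) ^ M" using h [of \<eta>] by linarith
qed

lemma kint_sum:
  assumes "finite S" and l: "l > 0" and "\<And>a. a \<in> S \<Longrightarrow> h a \<in> borel_measurable borel" "\<And>a. a \<in> S \<Longrightarrow> poly_bounded (h a)"
  shows "kint x0 (\<lambda>\<eta>. \<Sum>a\<in>S. b a * h a \<eta>) l \<xi> = (\<Sum>a\<in>S. b a * kint x0 (h a) l \<xi>)"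
proof -
  have "kint x0 (\<lambda>\<eta>. \<Sum>a\<in>S. b a * h a \<eta>) l \<xi> = (LINT \<eta>|lborel. (\<Sum>a\<in>S. b a * (h a \<eta> * kern x0 l (\<eta> - \<xi>))))"
    by (simp add: kint_def sum_distrib_right mult.assoc)
  also have "\<dots> = (\<Sum>a\<in>S. (LINT \<eta>|lborel. b a * (h a \<eta> * kern x0 l (\<eta> - \<xi>))))"
    by (rule Bochner_Integration.integral_sum) (intro integrable_mult_right kern_integrable assms)
  finally show ?thesis by (simp add: kint_def)
qed

text \<open>The induction doubles \<open>N\<close> at every step, so that the losses \<open>exp (j\<^sup>2 / (4 N))\<close> of the
  Gaussian estimates sum up to \<open>exp (j\<^sup>2 / (2 N))\<close>, which is harmless for \<open>j \<le> N\<close>.\<close>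
lemma elliptic_recursion:
  fixes h :: "('n::finite) cfun" and w :: "real ^ 'n \<Rightarrow> real"
  assumes w1: "\<And>\<xi>. 1 \<le> w \<xi>" and w: "\<And>\<xi> \<zeta>. w \<xi> \<le> w \<zeta> * (1 + norm (\<zeta> - \<xi>))" and wj: "\<And>\<xi>. w \<xi> \<le> jap \<xi>"
    and h [measurable]: "h \<in> borel_measurable borel" and hB: "\<And>\<eta>. cmod (h \<eta>) \<le> B * jap \<eta> ^ M"
    and s: "0 \<le> s" and A: "1 \<le> A" and c: "0 < c" and R: "1 \<le> R" and N0: "2 \<le> N0"
    and S: "finite S" and len: "\<And>\<alpha>. \<alpha> \<in> S \<Longrightarrow> length (d \<alpha>) \<le> m"
    and V: "\<And>N n \<xi>. N0 \<le> N \<Longrightarrow> n \<le> N \<Longrightarrow> R < w \<xi> \<Longrightarrow>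
      cmod (kint x0 (\<lambda>\<eta>. (\<Sum>\<alpha>\<in>S. b \<alpha> * mfun (d \<alpha>) \<eta>) * h \<eta>) (real N) \<xi>) \<le> A ^ (n + 1) * gevrey_weight s n / w \<xi> ^ n"
    and ell: "\<And>\<xi>. R < w \<xi> \<Longrightarrow> c * jap \<xi> ^ m \<le> cmod (\<Sum>\<alpha>\<in>S. b \<alpha> * mfun (d \<alpha>) \<xi>)"
  shows "\<exists>D\<ge>1. \<forall>j N \<delta> \<xi>. N0 \<le> N \<longrightarrow> j \<le> N \<longrightarrow> length \<delta> \<le> m \<longrightarrow>
    cmod (kint x0 (\<lambda>\<eta>. mfun \<delta> \<eta> * h \<eta>) (real N) \<xi>) \<le>
    D ^ (j + 1) * gevrey_weight s j * exp ((real j)\<^sup>2 / (2 * real N)) * (jap \<xi> ^ (M + length \<delta>) / w \<xi> ^ j)"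
proof -
  define U where "U = (\<lambda>\<delta> (N :: nat). kint x0 (\<lambda>\<eta>. mfun \<delta> \<eta> * h \<eta>) (real N))"
  define W where "W = gevrey_weight s"
  have W1: "1 \<le> W j" for j unfolding W_def by (rule gevrey_weight_ge_1 [OF s])
  have WS: "W j \<le> W (Suc j)" for j unfolding W_def by (rule gevrey_weight_Suc [OF s])
  have wp: "w \<xi> > 0" for \<xi> using w1 [of \<xi>] by linarith
  have B: "0 \<le> B" using order_trans [OF norm_ge_zero hB [of 0]] by (simp add: jap_def)
  have pb: "poly_bounded h" by (rule poly_bounded_jap [OF hB])
  have Np: "real N > 0" if "N0 \<le> N" for N using that N0 by simp
  obtain K0 where K0: "K0 > 0" "gaussian_bound w (M + m) 0 K0" using gaussian_estimate [OF w1 w] by blast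
  obtain K where K: "K > 0" "gaussian_bound w (M + m) 1 K" using gaussian_estimate [OF w1 w] by blast
  define D0 where "D0 = K0 * B"
  have D0: "D0 \<ge> 0" using K0 B by (simp add: D0_def)
  have base: "cmod (U \<delta> N \<xi>) \<le> D0 * jap \<xi> ^ (M + length \<delta>)" if N: "N0 \<le> N" and \<delta>: "length \<delta> \<le> m" for \<delta> N \<xi>
  proof -
    have "cmod (LINT \<eta>|lborel. (mfun \<delta> \<eta> * h \<eta>) * kern x0 (real N) (\<eta> - \<xi>))
      \<le> K0 * exp ((real 0)\<^sup>2 / (4 * (real N / 2))) * B * (jap \<xi> ^ (M + length \<delta>) / w \<xi> ^ 0)"
    proof (rule gaussian_boundD [OF K0(2)])
      \<comment> \<open>The kernel at hand has parameter \<open>N\<close>, so the Gaussian estimate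
        is applied with \<open>N / 2\<close>; this is why \<open>N0\<close> is at least 2.\<close>
      show "real N / 2 \<ge> 1" using N N0 by simp
      fix \<zeta>
      have "cmod (mfun \<delta> \<zeta>) * cmod (h \<zeta>) \<le> jap \<zeta> ^ length \<delta> * (B * jap \<zeta> ^ M)"
        using jap_pos [of \<zeta>] by (intro mult_mono norm_mfun_le hB) auto
      from mult_right_mono [OF this, of "heat (real N) (\<zeta> - \<xi>)"]
      show "cmod ((mfun \<delta> \<zeta> * h \<zeta>) * kern x0 (real N) (\<zeta> - \<xi>)) \<le> B * (jap \<zeta> ^ (M + length \<delta>) / w \<zeta> ^ 0) *
        (1 + sqrt (real N / 2) * norm (\<zeta> - \<xi>)) ^ 0 * heat (2 * (real N / 2)) (\<zeta> - \<xi>)"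
        by (simp add: norm_mult norm_kern power_add mult_ac)
    qed (use \<delta> B in auto)
    then show ?thesis by (simp add: U_def kint_def D0_def)
  qed
  define b1 where "b1 = (\<Sum>\<alpha>\<in>S. cmod (b \<alpha>))"
  have b1: "b1 \<ge> 0" unfolding b1_def by (intro sum_nonneg) simp
  \<comment> \<open>The first three terms secure \<open>1\<close>, \<open>A\<close> and
    \<open>R\<close> below \<open>D\<close>. The others are the coefficients of the step from
    \<open>j\<close> to \<open>j + 1\<close>: the region where the weight is at most
    \<open>R\<close>, the decay of \<open>P h\<close>, the commutators divided by \<open>P\<close>,
    and the commutators that lead from the empty word to \<open>\<delta>\<close>.\<close>
  define D where "D = 1 + A + R + D0 + A / c + 2 * K * b1 * real m / c + 2 * K * real m"
  have D: "1 \<le> D" "A \<le> D" "R \<le> D" "D0 \<le> D"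
    unfolding D_def using A R D0 K(1) b1 c by (auto intro!: add_nonneg_nonneg)
  have D_sum: "D0 + A / c + 2 * K * b1 * real m / c + 2 * K * real m \<le> D"
    unfolding D_def using A R by simp
  have main: "\<forall>N \<delta> \<xi>. N0 \<le> N \<longrightarrow> j \<le> N \<longrightarrow> length \<delta> \<le> m \<longrightarrow>
    cmod (U \<delta> N \<xi>) \<le> D ^ (j + 1) * W j * exp ((real j)\<^sup>2 / (2 * real N)) * (jap \<xi> ^ (M + length \<delta>) / w \<xi> ^ j)" for j
  proof (induction j)
    case 0
    have "cmod (U \<delta> N \<xi>) \<le> D * W 0 * jap \<xi> ^ (M + length \<delta>)" if "N0 \<le> N" "length \<delta> \<le> m" for \<delta> N \<xi>
    proof -
      have "D0 * jap \<xi> ^ (M + length \<delta>) \<le> D * jap \<xi> ^ (M + length \<delta>)"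
        using D(4) jap_pos [of \<xi>] by (intro mult_right_mono) auto
      then show ?thesis using base [OF that, of \<xi>] by (simp add: W_def gevrey_weight_def)
    qed
    then show ?case by simp
  next
    case (Suc j)
    show ?case
    proof (intro allI impI)
      fix N and \<delta> :: "'n list" and \<xi> :: "real ^ 'n"
      assume N: "N0 \<le> N" and jN: "Suc j \<le> N" and \<delta>: "length \<delta> \<le> m"
      define E where "E = D ^ (j + 1) * W j * exp ((real j)\<^sup>2 / (2 * real N))"
      have E: "E \<ge> 0" unfolding E_def using D W1 [of j] by simp
      define Y where "Y = 2 * K * E / w \<xi> ^ j"
      have Y: "Y \<ge> 0" unfolding Y_def using K(1) E wp [of \<xi>] by simp
      define T where "T = (\<lambda>\<delta> i. (LINT \<zeta>|lborel. U \<delta> (2 * N) \<zeta> * (of_real (2 * (\<zeta> - \<xi>) $ i) * kern x0 (2 * real N) (\<zeta> - \<xi>))))"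
      have T: "cmod (T \<delta> i) \<le> Y * jap \<xi> ^ (M + length \<delta>)" if \<delta>: "length \<delta> \<le> m" for \<delta> i
      proof -
        define G where "G = D ^ (j + 1) * W j * exp ((real j)\<^sup>2 / (2 * real (2 * N)))"
        have G: "G \<ge> 0" unfolding G_def using D W1 [of j] by simp
        have "cmod (T \<delta> i) \<le> K * exp ((real j)\<^sup>2 / (4 * real N)) * (2 * G) * (jap \<xi> ^ (M + length \<delta>) / w \<xi> ^ j)"
          unfolding T_def
        proof (rule gaussian_boundD [OF K(2)])
          show N1: "real N \<ge> 1" using N N0 by simp
          have N2: "1 \<le> 2 * real N" using N1 by simp
          fix \<zeta>
          have 1: "cmod (U \<delta> (2 * N) \<zeta>) \<le> G * (jap \<zeta> ^ (M + length \<delta>) / w \<zeta> ^ j)"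
            unfolding G_def using Suc.IH N jN \<delta> by (auto dest!: spec [of _ "2 * N"])
          have "\<bar>(\<zeta> - \<xi>) $ i\<bar> \<le> 1 * norm (\<zeta> - \<xi>)" using component_le_norm_cart [of "\<zeta> - \<xi>" i] by simp
          also have "\<dots> \<le> sqrt (real N) * norm (\<zeta> - \<xi>)" using N1 by (intro mult_right_mono) auto
          finally have 2: "\<bar>2 * (\<zeta> - \<xi>) $ i\<bar> \<le> 2 * (1 + sqrt (real N) * norm (\<zeta> - \<xi>))" by (simp add: abs_mult)
          have "cmod (U \<delta> (2 * N) \<zeta>) * (\<bar>2 * (\<zeta> - \<xi>) $ i\<bar> * heat (2 * real N) (\<zeta> - \<xi>)) \<le>
            (G * (jap \<zeta> ^ (M + length \<delta>) / w \<zeta> ^ j)) * ((2 * (1 + sqrt (real N) * norm (\<zeta> - \<xi>))) * heat (2 * real N) (\<zeta> - \<xi>))"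
            using G jap_pos [of \<zeta>] wp [of \<zeta>] by (intro mult_mono 1 2 mult_right_mono) auto
          then show "cmod (U \<delta> (2 * N) \<zeta> * (of_real (2 * (\<zeta> - \<xi>) $ i) * kern x0 (2 * real N) (\<zeta> - \<xi>))) \<le>
            2 * G * (jap \<zeta> ^ (M + length \<delta>) / w \<zeta> ^ j) * (1 + sqrt (real N) * norm (\<zeta> - \<xi>)) ^ 1 * heat (2 * real N) (\<zeta> - \<xi>)"
            unfolding norm_mult norm_of_real norm_kern [OF order_trans [OF zero_le_one N2]] power_one_right
            by (simp only: mult_ac)
        qed (use \<delta> G in auto)
        also have "\<dots> = 2 * K * (D ^ (j + 1) * W j * (exp ((real j)\<^sup>2 / (4 * real N)) * exp ((real j)\<^sup>2 / (4 * real N)))) * (jap \<xi> ^ (M + length \<delta>) / w \<xi> ^ j)"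
          by (simp add: G_def mult_ac)
        also have "exp ((real j)\<^sup>2 / (4 * real N)) * exp ((real j)\<^sup>2 / (4 * real N)) = exp ((real j)\<^sup>2 / (2 * real N))"
          unfolding exp_add [symmetric] by simp
        finally show ?thesis by (simp add: Y_def E_def)
      qed
      have U_Cons: "U (i # \<delta>) N \<xi> = of_real (\<xi> $ i) * U \<delta> N \<xi> + T \<delta> i" for i \<delta>
        using kint_coord [OF Np [OF N], of "\<lambda>\<eta>. mfun \<delta> \<eta> * h \<eta>" x0 i \<xi>] poly_bounded_mfun_mult [OF pb, of \<delta>]
        by (simp add: U_def T_def mfun_Cons mult.assoc)
      \<comment> \<open>Taking the coordinates out of the average one by one leaves one commutator
        for each letter, of degree lower by one in \<open>\<xi>\<close>. The factor
        \<open>jap \<xi>\<close> on the left avoids the exponent \<open>length \<delta> - 1\<close>,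
        which would be truncated at the empty word.\<close>
      have diff: "cmod (U \<delta> N \<xi> - mfun \<delta> \<xi> * U [] N \<xi>) * jap \<xi> \<le> real (length \<delta>) * Y * jap \<xi> ^ (M + length \<delta>)"
        if "length \<delta> \<le> m" for \<delta> using that
      proof (induction \<delta>)
        case (Cons i \<delta>)
        define y where "y = U \<delta> N \<xi> - mfun \<delta> \<xi> * U [] N \<xi>"
        have y: "cmod y * jap \<xi> \<le> real (length \<delta>) * Y * jap \<xi> ^ (M + length \<delta>)" unfolding y_def using Cons by simp
        have "U (i # \<delta>) N \<xi> - mfun (i # \<delta>) \<xi> * U [] N \<xi> = of_real (\<xi> $ i) * y + T \<delta> i"
          by (simp add: U_Cons mfun_Cons y_def algebra_simps)
        then have "cmod (U (i # \<delta>) N \<xi> - mfun (i # \<delta>) \<xi> * U [] N \<xi>) \<le> \<bar>\<xi> $ i\<bar> * cmod y + cmod (T \<delta> i)"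
          using norm_triangle_ineq [of "of_real (\<xi> $ i) * y" "T \<delta> i"] by (simp add: norm_mult)
        also have "\<dots> \<le> jap \<xi> * cmod y + Y * jap \<xi> ^ (M + length \<delta>)"
          using Cons.prems by (intro add_mono mult_right_mono T order_trans [OF component_le_norm_cart norm_le_jap]) auto
        also have "\<dots> \<le> (real (length \<delta>) + 1) * Y * jap \<xi> ^ (M + length \<delta>)"
          using y by (simp add: algebra_simps)
        finally have "cmod (U (i # \<delta>) N \<xi> - mfun (i # \<delta>) \<xi> * U [] N \<xi>) * jap \<xi> \<le>
          ((real (length \<delta>) + 1) * Y * jap \<xi> ^ (M + length \<delta>)) * jap \<xi>"
          using jap_pos [of \<xi>] by (intro mult_right_mono) auto
        then show ?case by (simp add: mult_ac add.commute)
      qed simp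
      have diff': "cmod (U \<delta> N \<xi> - mfun \<delta> \<xi> * U [] N \<xi>) \<le> real m * (2 * K * E) * (jap \<xi> ^ (M + length \<delta>) / w \<xi> ^ Suc j)"
        if "length \<delta> \<le> m" for \<delta>
      proof -
        \<comment> \<open>The spare factor \<open>jap \<xi>\<close> dominates the weight and thus
          becomes one more power of it. This is the gain of one decay order.\<close>
        have "cmod (U \<delta> N \<xi> - mfun \<delta> \<xi> * U [] N \<xi>) * w \<xi> \<le> cmod (U \<delta> N \<xi> - mfun \<delta> \<xi> * U [] N \<xi>) * jap \<xi>"
          by (intro mult_left_mono wj) simp
        also note diff [OF that]
        also have "real (length \<delta>) * Y * jap \<xi> ^ (M + length \<delta>) \<le> real m * Y * jap \<xi> ^ (M + length \<delta>)"
          using that Y jap_pos [of \<xi>] by (intro mult_right_mono) auto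
        finally show ?thesis using wp [of \<xi>] by (simp add: Y_def field_simps)
      qed
      define Z where "Z = D0 * R ^ (j + 1) + A ^ (j + 2) * W (Suc j) / c + b1 * real m * (2 * K * E) / c"
      have Z0: "0 \<le> D0 * R ^ (j + 1)" "0 \<le> A ^ (j + 2) * W (Suc j) / c" "0 \<le> b1 * real m * (2 * K * E) / c"
        using D0 R A W1 [of "Suc j"] c b1 K(1) E by auto
      \<comment> \<open>Where the weight is at most \<open>R\<close>, its power \<open>j + 1\<close>
        is at most \<open>R^(j + 1)\<close> and the bound without decay suffices. Elsewhere
        ellipticity permits the division by \<open>P\<close>.\<close>
      have U0: "cmod (U [] N \<xi>) \<le> Z * (jap \<xi> ^ M / w \<xi> ^ Suc j)"
      proof (cases "R < w \<xi>")
        case False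
        have "w \<xi> ^ Suc j \<le> R ^ Suc j" using False wp [of \<xi>] by (intro power_mono) auto
        then have "D0 * jap \<xi> ^ M * w \<xi> ^ Suc j \<le> D0 * jap \<xi> ^ M * R ^ Suc j"
          using D0 jap_pos [of \<xi>] by (intro mult_left_mono) auto
        then have "D0 * jap \<xi> ^ M \<le> D0 * R ^ (j + 1) * (jap \<xi> ^ M / w \<xi> ^ Suc j)"
          using wp [of \<xi>] by (simp add: field_simps)
        also have "\<dots> \<le> Z * (jap \<xi> ^ M / w \<xi> ^ Suc j)"
          using Z0 jap_pos [of \<xi>] wp [of \<xi>] by (intro mult_right_mono) (auto simp: Z_def)
        finally show ?thesis using base [OF N, of "[]" \<xi>] by simp
      next
        case True
        define P where "P = (\<Sum>\<alpha>\<in>S. b \<alpha> * mfun (d \<alpha>) \<xi>)"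
        define V' where "V' = kint x0 (\<lambda>\<eta>. (\<Sum>\<alpha>\<in>S. b \<alpha> * mfun (d \<alpha>) \<eta>) * h \<eta>) (real N) \<xi>"
        have "V' = (\<Sum>\<alpha>\<in>S. b \<alpha> * U (d \<alpha>) N \<xi>)"
          using kint_sum [OF S Np [OF N], of "\<lambda>\<alpha> \<eta>. mfun (d \<alpha>) \<eta> * h \<eta>" x0 b \<xi>] poly_bounded_mfun_mult [OF pb]
          by (simp add: V'_def U_def sum_distrib_right mult.assoc)
        then have "P * U [] N \<xi> = V' - (\<Sum>\<alpha>\<in>S. b \<alpha> * (U (d \<alpha>) N \<xi> - mfun (d \<alpha>) \<xi> * U [] N \<xi>))"
          by (simp add: P_def right_diff_distrib sum_subtractf sum_distrib_right mult.assoc)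
        then have "cmod P * cmod (U [] N \<xi>) \<le> cmod V' + cmod (\<Sum>\<alpha>\<in>S. b \<alpha> * (U (d \<alpha>) N \<xi> - mfun (d \<alpha>) \<xi> * U [] N \<xi>))"
          using norm_triangle_ineq4 [of V' "\<Sum>\<alpha>\<in>S. b \<alpha> * (U (d \<alpha>) N \<xi> - mfun (d \<alpha>) \<xi> * U [] N \<xi>)"]
          by (simp only: norm_mult [symmetric])
        also have "cmod (\<Sum>\<alpha>\<in>S. b \<alpha> * (U (d \<alpha>) N \<xi> - mfun (d \<alpha>) \<xi> * U [] N \<xi>)) \<le>
          (\<Sum>\<alpha>\<in>S. cmod (b \<alpha>) * (real m * (2 * K * E) * (jap \<xi> ^ (M + m) / w \<xi> ^ Suc j)))"
        proof (rule order_trans [OF norm_sum sum_mono])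
          fix \<alpha> assume \<alpha>: "\<alpha> \<in> S"
          have "jap \<xi> ^ (M + length (d \<alpha>)) / w \<xi> ^ Suc j \<le> jap \<xi> ^ (M + m) / w \<xi> ^ Suc j"
            using len [OF \<alpha>] wp [of \<xi>] jap_ge_1 [of \<xi>] by (intro divide_right_mono power_increasing) auto
          then have "real m * (2 * K * E) * (jap \<xi> ^ (M + length (d \<alpha>)) / w \<xi> ^ Suc j) \<le> real m * (2 * K * E) * (jap \<xi> ^ (M + m) / w \<xi> ^ Suc j)"
            using K(1) E by (intro mult_left_mono) auto
          with diff' [OF len [OF \<alpha>]]
          have "cmod (U (d \<alpha>) N \<xi> - mfun (d \<alpha>) \<xi> * U [] N \<xi>) \<le> real m * (2 * K * E) * (jap \<xi> ^ (M + m) / w \<xi> ^ Suc j)"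
            by (rule order_trans)
          then show "cmod (b \<alpha> * (U (d \<alpha>) N \<xi> - mfun (d \<alpha>) \<xi> * U [] N \<xi>)) \<le> cmod (b \<alpha>) * (real m * (2 * K * E) * (jap \<xi> ^ (M + m) / w \<xi> ^ Suc j))"
            unfolding norm_mult [of "b \<alpha>"] by (rule mult_left_mono) simp
        qed
        also have "(\<Sum>\<alpha>\<in>S. cmod (b \<alpha>) * (real m * (2 * K * E) * (jap \<xi> ^ (M + m) / w \<xi> ^ Suc j))) =
          b1 * real m * (2 * K * E) * (jap \<xi> ^ (M + m) / w \<xi> ^ Suc j)"
          by (simp only: b1_def sum_distrib_right [symmetric] mult.assoc)
        also have "cmod V' \<le> A ^ (j + 2) * W (Suc j) * (jap \<xi> ^ (M + m) / w \<xi> ^ Suc j)"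
        proof -
          have "cmod V' \<le> A ^ (Suc j + 1) * W (Suc j) / w \<xi> ^ Suc j"
            unfolding V'_def W_def by (rule V [OF N jN True])
          also have "\<dots> = A ^ (j + 2) * W (Suc j) * (1 / w \<xi> ^ Suc j)" by simp
          also have "\<dots> \<le> A ^ (j + 2) * W (Suc j) * (jap \<xi> ^ (M + m) / w \<xi> ^ Suc j)"
            using A W1 [of "Suc j"] wp [of \<xi>] one_le_power [OF jap_ge_1 [of \<xi>]]
            by (intro mult_left_mono divide_right_mono) auto
          finally show ?thesis .
        qed
        finally have le: "cmod P * cmod (U [] N \<xi>) \<le> (A ^ (j + 2) * W (Suc j) + b1 * real m * (2 * K * E)) * (jap \<xi> ^ (M + m) / w \<xi> ^ Suc j)"
          by (simp only: distrib_right)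
        have "(c * jap \<xi> ^ m) * cmod (U [] N \<xi>) \<le> cmod P * cmod (U [] N \<xi>)"
          unfolding P_def by (intro mult_right_mono ell True) simp
        from order_trans [OF this le]
        have le': "(c * jap \<xi> ^ m) * cmod (U [] N \<xi>) \<le> (A ^ (j + 2) * W (Suc j) + b1 * real m * (2 * K * E)) * (jap \<xi> ^ (M + m) / w \<xi> ^ Suc j)" .
        have "(c * jap \<xi> ^ m) * cmod (U [] N \<xi>) \<le>
          (c * jap \<xi> ^ m) * ((A ^ (j + 2) * W (Suc j) / c + b1 * real m * (2 * K * E) / c) * (jap \<xi> ^ M / w \<xi> ^ Suc j))"
        proof -
          have "(x + y) * (p * q / v) = (c * q) * ((x / c + y / c) * (p / v))" if "v \<noteq> 0" for x y p q v :: real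
            using c that by (simp add: field_simps)
          note alg = this [of "w \<xi> ^ Suc j" "A ^ (j + 2) * W (Suc j)" "b1 * real m * (2 * K * E)" "jap \<xi> ^ M" "jap \<xi> ^ m"]
          have "w \<xi> ^ Suc j \<noteq> 0" using wp [of \<xi>] by simp
          from le' show ?thesis unfolding power_add [of "jap \<xi>" M m] alg [OF \<open>w \<xi> ^ Suc j \<noteq> 0\<close>] .
        qed
        then have "cmod (U [] N \<xi>) \<le> (A ^ (j + 2) * W (Suc j) / c + b1 * real m * (2 * K * E) / c) * (jap \<xi> ^ M / w \<xi> ^ Suc j)"
          using c jap_pos [of \<xi>] by (simp only: mult_le_cancel_left_pos mult_pos_pos zero_less_power)
        also have "\<dots> \<le> Z * (jap \<xi> ^ M / w \<xi> ^ Suc j)"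
          using Z0 jap_pos [of \<xi>] wp [of \<xi>] by (intro mult_right_mono) (auto simp: Z_def)
        finally show ?thesis .
      qed
      define E' where "E' = D ^ (j + 1) * (W (Suc j) * exp ((real (Suc j))\<^sup>2 / (2 * real N)))"
      have ex1: "1 \<le> exp ((real (Suc j))\<^sup>2 / (2 * real N))" by simp
      have WE1: "1 \<le> W (Suc j) * exp ((real (Suc j))\<^sup>2 / (2 * real N))"
        using mult_mono [OF W1 [of "Suc j"] ex1] W1 [of "Suc j"] by simp
      have DE: "D ^ (j + 1) \<le> E'" unfolding E'_def using mult_left_mono [OF WE1, of "D ^ (j + 1)"] D by simp
      have EE': "E \<le> E'"
        unfolding E_def E'_def mult.assoc using D W1 [of j] WS [of j]
        by (intro mult_left_mono mult_mono) (auto intro!: divide_right_mono power_mono)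
      have "D0 * R ^ (j + 1) \<le> D0 * E'"
        using D0 R D DE power_mono [of R D "j + 1"] by (intro mult_left_mono) auto
      moreover have "A ^ (j + 2) * W (Suc j) / c \<le> (A / c) * E'"
      proof -
        have "A ^ (j + 1) * W (Suc j) \<le> D ^ (j + 1) * (W (Suc j) * exp ((real (Suc j))\<^sup>2 / (2 * real N)))"
          using A D W1 [of "Suc j"] by (intro mult_mono power_mono) auto
        then have "(A / c) * (A ^ (j + 1) * W (Suc j)) \<le> (A / c) * E'"
          unfolding E'_def using A c by (intro mult_left_mono) auto
        then show ?thesis by simp
      qed
      moreover have "b1 * real m * (2 * K * E) / c \<le> (2 * K * b1 * real m / c) * E'"
        using mult_left_mono [OF EE', of "2 * K * b1 * real m / c"] K(1) b1 c by (simp add: mult_ac)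
      moreover have "real m * (2 * K * E) \<le> (2 * K * real m) * E'"
        using mult_left_mono [OF EE', of "2 * K * real m"] K(1) by (simp add: mult_ac)
      ultimately have "Z + real m * (2 * K * E) \<le> (D0 + A / c + 2 * K * b1 * real m / c + 2 * K * real m) * E'"
        unfolding Z_def distrib_right by linarith
      also have "\<dots> \<le> D * E'"
        using D DE one_le_power [of D "j + 1"] by (intro mult_right_mono D_sum) linarith
      finally have ZD: "Z + real m * (2 * K * E) \<le> D * E'" .
      have "cmod (U \<delta> N \<xi>) \<le> cmod (mfun \<delta> \<xi> * U [] N \<xi>) + cmod (U \<delta> N \<xi> - mfun \<delta> \<xi> * U [] N \<xi>)"
        using norm_triangle_ineq [of "mfun \<delta> \<xi> * U [] N \<xi>" "U \<delta> N \<xi> - mfun \<delta> \<xi> * U [] N \<xi>"] by simp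
      also have "\<dots> \<le> jap \<xi> ^ length \<delta> * (Z * (jap \<xi> ^ M / w \<xi> ^ Suc j)) + real m * (2 * K * E) * (jap \<xi> ^ (M + length \<delta>) / w \<xi> ^ Suc j)"
        unfolding norm_mult using jap_pos [of \<xi>] by (intro add_mono mult_mono norm_mfun_le U0 diff' \<delta>) auto
      also have "\<dots> = (Z + real m * (2 * K * E)) * (jap \<xi> ^ (M + length \<delta>) / w \<xi> ^ Suc j)"
      proof -
        have "a * (z * (p / v)) + y * (p * a / v) = (z + y) * (p * a / v)" for a z p v y :: real
          by (simp add: algebra_simps add_divide_distrib)
        then show ?thesis by (simp only: power_add [of "jap \<xi>"])
      qed
      also have "\<dots> \<le> (D * E') * (jap \<xi> ^ (M + length \<delta>) / w \<xi> ^ Suc j)"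
        using jap_pos [of \<xi>] wp [of \<xi>] by (intro mult_right_mono ZD) auto
      finally show "cmod (U \<delta> N \<xi>) \<le> D ^ (Suc j + 1) * W (Suc j) * exp ((real (Suc j))\<^sup>2 / (2 * real N)) * (jap \<xi> ^ (M + length \<delta>) / w \<xi> ^ Suc j)"
        by (simp add: E'_def mult_ac)
    qed
  qed
  show ?thesis using D(1) main unfolding U_def W_def by blast
qed

section \<open>Finite differences with a holomorphic remainder\<close>

text \<open>A finite difference formula, given by coefficients and nodes. Natural numbers as nodes
  make it one-sided.\<close>

definition node_sum :: "(real \<times> nat) list \<Rightarrow> (nat \<Rightarrow> 'a::real_vector) \<Rightarrow> 'a" where
  "node_sum cs f = (\<Sum>(c, l)\<leftarrow>cs. c *\<^sub>R f l)"

lemma node_sum_simps [simp]: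
  "node_sum [] f = 0" "node_sum ((c, l) # cs) f = c *\<^sub>R f l + node_sum cs f"
  "node_sum (as @ bs) f = node_sum as f + node_sum bs f"
  by (simp_all add: node_sum_def)

lemma norm_node_sum_le:
  fixes f :: "nat \<Rightarrow> 'a::real_normed_vector"
  assumes "\<And>c l. (c, l) \<in> set cs \<Longrightarrow> norm (f l) \<le> A"
  shows "norm (node_sum cs f) \<le> node_sum (map (\<lambda>(c, l). (\<bar>c\<bar>, l)) cs) (\<lambda>_. 1) * A"
  using assms
proof (induction cs)
  case (Cons x cs)
  obtain c l where x: "x = (c, l)" by fastforce
  have "norm (c *\<^sub>R f l + node_sum cs f) \<le> \<bar>c\<bar> * norm (f l) + norm (node_sum cs f)"
    using norm_triangle_ineq [of "c *\<^sub>R f l" "node_sum cs f"] by simp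
  also have "\<dots> \<le> \<bar>c\<bar> * A + node_sum (map (\<lambda>(c, l). (\<bar>c\<bar>, l)) cs) (\<lambda>_. 1) * A"
    using Cons.prems x by (intro add_mono mult_left_mono Cons.IH) auto
  finally show ?case by (simp add: x distrib_right)
qed simp

text \<open>Richardson extrapolation: step widths \<open>h\<close> and \<open>2 h\<close> are combined so that the next order cancels.\<close>
lemma differentiation_nodes:
  "\<exists>cs. \<forall>a\<le>Suc r. node_sum cs (\<lambda>l. real l ^ a) = (if a = 1 then 1 else 0)"
proof (induction r)
  case 0
  have "node_sum [(1, 1), (- 1, 0)] (\<lambda>l. real l ^ a) = (if a = 1 then 1 else 0)" if "a \<le> Suc 0" for a
    using that by (cases a) auto
  then show ?case by blast
next
  case (Suc r)
  then obtain cs where cs: "\<And>a. a \<le> Suc r \<Longrightarrow> node_sum cs (\<lambda>l. real l ^ a) = (if a = 1 then 1 else 0)" by blast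
  define q :: real where "q = 2 ^ Suc r - 1"
  have q: "q > 0" unfolding q_def using one_less_power [of "2::real" "Suc r"] by simp
  \<comment> \<open>On the power \<open>a\<close> the new formula multiplies the old value by
    \<open>(2^(r + 1) - 2^(a - 1)) / q\<close>. This factor is 1 for \<open>a = 1\<close> and 0 for
    \<open>a = r + 2\<close>; the orders in between vanish already.\<close>
  define cs' where "cs' = map (\<lambda>(c, l). (2 ^ Suc r / q * c, l)) cs @ map (\<lambda>(c, l). (- 1 / (2 * q) * c, 2 * l)) cs"
  have 1: "node_sum (map (\<lambda>(c, l). (k * c, l)) bs) f = k * node_sum bs f" for k bs and f :: "nat \<Rightarrow> real"
    by (induction bs) (auto simp: algebra_simps)
  have 2: "node_sum (map (\<lambda>(c, l). (k * c, 2 * l)) bs) f = k * node_sum bs (\<lambda>l. f (2 * l))" for k bs and f :: "nat \<Rightarrow> real"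
    by (induction bs) (auto simp: algebra_simps)
  have 3: "node_sum bs (\<lambda>l. k * f l) = k * node_sum bs f" for k bs and f :: "nat \<Rightarrow> real"
    by (induction bs) (auto simp: algebra_simps)
  have eq: "node_sum cs' (\<lambda>l. real l ^ a) = (2 ^ Suc r / q - 2 ^ a / (2 * q)) * node_sum cs (\<lambda>l. real l ^ a)" for a
    by (simp only: cs'_def node_sum_simps 1 2) (simp add: power_mult_distrib 3, simp add: algebra_simps)
  have "node_sum cs' (\<lambda>l. real l ^ a) = (if a = 1 then 1 else 0)" if a: "a \<le> Suc (Suc r)" for a
  proof (cases "a = Suc (Suc r)")
    case True
    then show ?thesis unfolding eq using q by (simp add: field_simps)
  next
    case False
    then have "a \<le> Suc r" using a by simp
    have "2 ^ Suc r / q - 2 ^ 1 / (2 * q) = (2 ^ Suc r - 1) / q" using q by (simp add: diff_divide_distrib)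
    also have "\<dots> = 1" using q unfolding q_def by simp
    finally show ?thesis unfolding eq cs [OF \<open>a \<le> Suc r\<close>] by simp
  qed
  then show ?case by blast
qed

text \<open>Cauchy's inequality on the circle of radius \<open>\<rho>\<close> bounds the Taylor
  coefficients. The nodes remove all terms up to order \<open>r + 1\<close> except the linear one,
  and the tail is dominated by a geometric series of ratio
  \<open>L * h / \<rho> \<le> 1 / 2\<close>, whence the factor 2.\<close>

lemma holomorphic_finite_difference:
  assumes cs: "\<And>a. a \<le> Suc r \<Longrightarrow> node_sum cs (\<lambda>l. real l ^ a) = (if a = 1 then 1 else 0)"
    and L: "\<And>c l. (c, l) \<in> set cs \<Longrightarrow> l \<le> L" and L1: "1 \<le> L"
    and C: "C = node_sum (map (\<lambda>(c, l). (\<bar>c\<bar>, l)) cs) (\<lambda>_. 1 :: real)"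
    and f: "f holomorphic_on UNIV" and \<rho>: "0 < \<rho>" and B: "\<And>z. cmod z = \<rho> \<Longrightarrow> cmod (f z) \<le> B"
    and h: "0 < h" "2 * (real L * h) \<le> \<rho>"
  shows "cmod (node_sum cs (\<lambda>l. f (of_real (real l * h))) - of_real h * deriv f 0) \<le> 2 * C * B * (real L * h / \<rho>) ^ (r + 2)"
proof -
  define u where "u = (\<lambda>a. (deriv ^^ a) f 0 / fact a * of_real h ^ a)"
  define S where "S = (\<lambda>a. node_sum cs (\<lambda>l. real l ^ a))"
  define q where "q = real L * h / \<rho>"
  have q: "0 \<le> q" "q \<le> 1 / 2" using h \<rho> by (auto simp: q_def field_simps)
  have f': "f holomorphic_on ball 0 s" for s using f holomorphic_on_subset by blast
  have B0: "0 \<le> B" using order_trans [OF norm_ge_zero B [of "of_real \<rho>"]] \<rho> by simp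
  have "C \<ge> 0" unfolding C by (induction cs) auto
  have u: "cmod (u a) \<le> B * (h / \<rho>) ^ a" for a
  proof -
    have "cmod ((deriv ^^ a) f 0) \<le> fact a * B / \<rho> ^ a"
      by (rule Cauchy_inequality [OF f' _ \<rho>]) (use f B in \<open>auto intro: holomorphic_on_imp_continuous_on holomorphic_on_subset\<close>)
    then have "cmod ((deriv ^^ a) f 0) / fact a * h ^ a \<le> (fact a * B / \<rho> ^ a) / fact a * h ^ a"
      using h by (intro mult_right_mono divide_right_mono) auto
    then show ?thesis using h by (simp add: u_def norm_mult norm_divide norm_power power_divide)
  qed
  have "(\<lambda>a. u a * of_real (real l) ^ a) sums f (of_real (real l * h))" for l
  proof -
    have "of_real (real l * h) \<in> ball (0::complex) (real l * h + 1)" using h by (simp add: norm_mult)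
    from holomorphic_power_series [OF f' this] show ?thesis by (simp add: u_def power_mult_distrib mult_ac)
  qed
  then have s: "(\<lambda>a. node_sum bs (\<lambda>l. u a * of_real (real l) ^ a)) sums node_sum bs (\<lambda>l. f (of_real (real l * h)))" for bs
    by (induction bs) (auto intro!: sums_add sums_scaleR_right)
  have "node_sum bs (\<lambda>l. u a * of_real (real l) ^ a) = u a * of_real (node_sum bs (\<lambda>l. real l ^ a))" for a bs
    by (induction bs) (auto simp: algebra_simps scaleR_conv_of_real)
  then have "(\<lambda>a. u a * of_real (S a)) sums node_sum cs (\<lambda>l. f (of_real (real l * h)))"
    using s [of cs] by (simp add: S_def)
  then have tail: "(\<lambda>a. u (a + (r + 2)) * of_real (S (a + (r + 2)))) sums
      (node_sum cs (\<lambda>l. f (of_real (real l * h))) - (\<Sum>a<r + 2. u a * of_real (S a)))"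
    by (subst sums_iff_shift)
      (simp add: algebra_simps)
  have "(\<Sum>a<r + 2. u a * of_real (S a)) = (\<Sum>a<r + 2. if a = 1 then u a else 0)"
    by (rule sum.cong) (auto simp: S_def cs)
  also have "\<dots> = of_real h * deriv f 0" by (simp add: u_def)
  finally have tail': "(\<lambda>a. u (a + (r + 2)) * of_real (S (a + (r + 2)))) sums
      (node_sum cs (\<lambda>l. f (of_real (real l * h))) - of_real h * deriv f 0)" using tail by simp
  have S: "\<bar>S a\<bar> \<le> C * real L ^ a" for a
  proof -
    have "norm (node_sum cs (\<lambda>l. real l ^ a)) \<le> C * real L ^ a"
      unfolding C by (rule norm_node_sum_le) (use L in \<open>auto intro!: power_mono\<close>)
    then show ?thesis by (simp add: S_def)
  qed
  have summand: "cmod (u a * of_real (S a)) \<le> C * B * q ^ a" for a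
  proof -
    have "cmod (u a) * \<bar>S a\<bar> \<le> (B * (h / \<rho>) ^ a) * (C * real L ^ a)"
      using u S B0 h \<rho> by (intro mult_mono) auto
    then show ?thesis by (simp add: norm_mult q_def power_mult_distrib power_divide mult_ac)
  qed
  have g: "(\<lambda>a. C * B * q ^ (r + 2) * q ^ a) sums (C * B * q ^ (r + 2) * (1 / (1 - q)))"
    using q by (intro sums_mult geometric_sums) simp
  have "cmod (node_sum cs (\<lambda>l. f (of_real (real l * h))) - of_real h * deriv f 0) \<le> C * B * q ^ (r + 2) * (1 / (1 - q))"
    unfolding sums_unique [OF tail'] sums_unique [OF g]
  proof (rule norm_suminf_le)
    show "cmod (u (a + (r + 2)) * of_real (S (a + (r + 2)))) \<le> C * B * q ^ (r + 2) * q ^ a" for a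
      using summand [of "a + (r + 2)"] by (simp add: power_add mult_ac)
  qed (rule sums_summable [OF g])
  also have "\<dots> \<le> C * B * q ^ (r + 2) * 2"
    using q \<open>C \<ge> 0\<close> B0 by (intro mult_left_mono) (auto simp: field_simps)
  finally show ?thesis by (simp add: q_def mult_ac)
qed

text \<open>Along \<open>v\<close> the kernel is an entire function of the displacement. The circle
  has radius \<open>1 / sqrt N\<close>, the width of the kernel: on it, the growth of the exponent
  is bounded once half of the decay is given up, so that \<open>heat N\<close> is left of
  \<open>heat (2 * N)\<close>. The derivative carries a factor \<open>4 * N\<close>, of which the
  step \<open>1 / N\<close> leaves 4.\<close>

lemma heat_finite_difference:
  assumes cs: "\<And>a. a \<le> Suc r \<Longrightarrow> node_sum cs (\<lambda>l. real l ^ a) = (if a = 1 then 1 else 0)"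
    and L: "\<And>c l. (c, l) \<in> set cs \<Longrightarrow> l \<le> L" and L1: "1 \<le> L"
    and C: "C = node_sum (map (\<lambda>(c, l). (\<bar>c\<bar>, l)) cs) (\<lambda>_. 1 :: real)"
    and N: "real N \<ge> 4 * (real L)\<^sup>2"
  shows "\<bar>node_sum cs (\<lambda>l. heat (2 * real N) (t - (real l / real N) *\<^sub>R v)) - 4 * (t \<bullet> v) * heat (2 * real N) t\<bar>
    \<le> 2 * C * exp (6 * (norm v)\<^sup>2) * sqrt 2 ^ CARD('n) * (real L / sqrt (real N)) ^ (r + 2) * heat (real N) (t :: real ^ 'n::finite)"
proof -
  have L2: "(real L)\<^sup>2 \<ge> 1" using L1 by (simp add: one_le_power)
  then have N1: "real N \<ge> 1" using N by linarith
  define S where "S = sqrt (2 * real N / pi) ^ CARD('n)"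
  have S: "S \<ge> 0" by (simp add: S_def)
  define f where "f = (\<lambda>z :: complex. exp (- of_real (2 * real N) * (of_real ((norm t)\<^sup>2) - 2 * z * of_real (t \<bullet> v) + z\<^sup>2 * of_real ((norm v)\<^sup>2))))"
  have hol: "f holomorphic_on UNIV" unfolding f_def by (intro holomorphic_intros)
  have real: "f (of_real x) = of_real (exp (- (2 * real N) * (norm (t - x *\<^sub>R v))\<^sup>2))" for x
  proof -
    have "(norm (t - x *\<^sub>R v))\<^sup>2 = (norm t)\<^sup>2 - 2 * x * (t \<bullet> v) + x\<^sup>2 * (norm v)\<^sup>2"
      unfolding power2_norm_eq_inner
      by (simp add: inner_diff_left inner_diff_right inner_commute algebra_simps) (simp add: power2_eq_square)
    then show ?thesis unfolding f_def by (simp flip: exp_of_real)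
  qed
  have "(f has_field_derivative f 0 * (of_real (4 * real N * (t \<bullet> v)))) (at 0)"
    unfolding f_def by (auto intro!: derivative_eq_intros simp: algebra_simps)
  then have der: "deriv f 0 = of_real (exp (- (2 * real N) * (norm t)\<^sup>2) * (4 * real N * (t \<bullet> v)))"
    using real [of 0] by (simp add: DERIV_imp_deriv)
  define \<tau> where "\<tau> = sqrt (real N) * norm t"
  have B: "cmod (f z) \<le> exp (6 * (norm v)\<^sup>2) * exp (- real N * (norm t)\<^sup>2)" if z: "cmod z = 1 / sqrt (real N)" for z
  proof -
    have "Re (- of_real (2 * real N) * (of_real ((norm t)\<^sup>2) - 2 * z * of_real (t \<bullet> v) + z\<^sup>2 * of_real ((norm v)\<^sup>2)))
      = - 2 * real N * (norm t)\<^sup>2 + 4 * real N * (Re z * (t \<bullet> v)) - 2 * real N * (Re (z\<^sup>2) * (norm v)\<^sup>2)"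
      by (simp add: algebra_simps)
    also have "\<dots> \<le> - 2 * real N * (norm t)\<^sup>2 + 4 * real N * (1 / sqrt (real N) * (norm t * norm v)) + 2 * real N * (1 / real N * (norm v)\<^sup>2)"
    proof -
      have "Re z * (t \<bullet> v) \<le> \<bar>Re z\<bar> * \<bar>t \<bullet> v\<bar>" by (metis abs_ge_self abs_mult)
      also have "\<dots> \<le> 1 / sqrt (real N) * (norm t * norm v)"
        using abs_Re_le_cmod [of z] z Cauchy_Schwarz_ineq2 [of t v] by (intro mult_mono) auto
      finally have 1: "4 * real N * (Re z * (t \<bullet> v)) \<le> 4 * real N * (1 / sqrt (real N) * (norm t * norm v))"
        by (intro mult_left_mono) auto
      have "- Re (z\<^sup>2) \<le> cmod (z\<^sup>2)" using abs_Re_le_cmod [of "z\<^sup>2"] by linarith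
      also have "\<dots> = 1 / real N" using z by (simp add: norm_power power_divide)
      finally have "- Re (z\<^sup>2) * (norm v)\<^sup>2 \<le> 1 / real N * (norm v)\<^sup>2" by (intro mult_right_mono) auto
      then have 2: "2 * real N * (- Re (z\<^sup>2) * (norm v)\<^sup>2) \<le> 2 * real N * (1 / real N * (norm v)\<^sup>2)"
        by (intro mult_left_mono) auto
      show ?thesis using 1 2 by simp
    qed
    also have "\<dots> = - 2 * \<tau>\<^sup>2 + 4 * \<tau> * norm v + 2 * (norm v)\<^sup>2"
      using N1 by (simp add: \<tau>_def power_mult_distrib real_div_sqrt field_simps flip: power2_eq_square)
    \<comment> \<open>Because
      \<open>4 * \<tau> * norm v \<le> \<tau>^2 + 4 * (norm v)^2\<close>.\<close>
    also have "\<dots> \<le> 6 * (norm v)\<^sup>2 + - real N * (norm t)\<^sup>2"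
      using zero_le_power2 [of "\<tau> - 2 * norm v"] by (simp add: power2_diff) (simp add: \<tau>_def power_mult_distrib)
    finally show ?thesis unfolding f_def norm_exp_eq_Re by (simp flip: exp_add)
  qed
  have h: "0 < 1 / real N" "2 * (real L * (1 / real N)) \<le> 1 / sqrt (real N)"
  proof -
    have "2 * real L \<le> sqrt (real N)" by (rule real_le_rsqrt) (use N in \<open>simp add: power_mult_distrib\<close>)
    then have "2 * real L * sqrt (real N) \<le> sqrt (real N) * sqrt (real N)" by (intro mult_right_mono) auto
    then show "2 * (real L * (1 / real N)) \<le> 1 / sqrt (real N)" using N1 by (simp add: field_simps)
  qed (use N1 in simp)
  have "0 < 1 / sqrt (real N)" using N1 by simp
  from holomorphic_finite_difference [OF cs L L1 C hol this B h]
  have fd: "cmod (node_sum cs (\<lambda>l. f (of_real (real l * (1 / real N)))) - of_real (1 / real N) * deriv f 0) \<le>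
    2 * C * (exp (6 * (norm v)\<^sup>2) * exp (- real N * (norm t)\<^sup>2)) * (real L * (1 / real N) / (1 / sqrt (real N))) ^ (r + 2)" by simp
  have q: "real L * (1 / real N) / (1 / sqrt (real N)) = real L / sqrt (real N)"
    using N1 by (simp add: field_simps)
  have ns: "node_sum bs (\<lambda>l. f (of_real (real l * (1 / real N)))) * of_real S = of_real (node_sum bs (\<lambda>l. heat (2 * real N) (t - (real l / real N) *\<^sub>R v)))" for bs
    unfolding real by (induction bs) (auto simp: S_def heat_def algebra_simps scaleR_conv_of_real)
  have "(node_sum cs (\<lambda>l. f (of_real (real l * (1 / real N)))) - of_real (1 / real N) * deriv f 0) * of_real S =
    of_real (node_sum cs (\<lambda>l. heat (2 * real N) (t - (real l / real N) *\<^sub>R v)) - 4 * (t \<bullet> v) * heat (2 * real N) t)"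
    unfolding left_diff_distrib ns der using N1 by (simp add: S_def heat_def mult_ac)
  from arg_cong [OF this, of cmod]
  have "\<bar>node_sum cs (\<lambda>l. heat (2 * real N) (t - (real l / real N) *\<^sub>R v)) - 4 * (t \<bullet> v) * heat (2 * real N) t\<bar> =
    cmod (node_sum cs (\<lambda>l. f (of_real (real l * (1 / real N)))) - of_real (1 / real N) * deriv f 0) * S"
    by (simp only: norm_mult norm_of_real abs_of_nonneg [OF S])
  also have "\<dots> \<le> (2 * C * (exp (6 * (norm v)\<^sup>2) * exp (- real N * (norm t)\<^sup>2)) * (real L / sqrt (real N)) ^ (r + 2)) * S"
    using fd S unfolding q by (intro mult_right_mono) auto
  also have "\<dots> = 2 * C * exp (6 * (norm v)\<^sup>2) * (real L / sqrt (real N)) ^ (r + 2) * (exp (- real N * (norm t)\<^sup>2) * S)"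
    by (simp only: mult_ac)
  also have "S = sqrt 2 ^ CARD('n) * sqrt (real N / pi) ^ CARD('n)"
    unfolding S_def by (simp flip: power_mult_distrib real_sqrt_mult)
  finally show ?thesis by (simp add: heat_def mult_ac)
qed

section \<open>Microlocal elliptic regularity\<close>

text \<open>The cone generated by the ball of radius \<open>\<epsilon>\<close> about
  \<open>\<xi>0\<close>. Being convex, it is stable under adding directions from that ball
  (\<open>cone_around_add\<close>), as an arbitrary open cone need not be.\<close>

definition cone_around :: "real ^ 'n::finite \<Rightarrow> real \<Rightarrow> (real ^ 'n) set" where
  "cone_around \<xi>0 \<epsilon> = {\<xi>. \<exists>t>0. norm (\<xi> - t *\<^sub>R \<xi>0) < t * \<epsilon>}"

lemma open_cone_around:
  assumes "0 < \<epsilon>" "\<epsilon> < norm \<xi>0"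
  shows "open_cone (cone_around \<xi>0 \<epsilon>)"
  unfolding open_cone_def
proof (intro conjI ballI allI impI)
  have "cone_around \<xi>0 \<epsilon> = (\<Union>t\<in>{0<..}. ball (t *\<^sub>R \<xi>0) (t * \<epsilon>))"
    by (auto simp: cone_around_def dist_norm norm_minus_commute)
  then show "open (cone_around \<xi>0 \<epsilon>)" by auto
  show "0 \<notin> cone_around \<xi>0 \<epsilon>" using assms by (auto simp: cone_around_def)
  fix \<xi> and r :: real assume "\<xi> \<in> cone_around \<xi>0 \<epsilon>" and r: "r > 0"
  then obtain t where t: "t > 0" "norm (\<xi> - t *\<^sub>R \<xi>0) < t * \<epsilon>" by (auto simp: cone_around_def)
  have "norm (r *\<^sub>R \<xi> - (r * t) *\<^sub>R \<xi>0) = r * norm (\<xi> - t *\<^sub>R \<xi>0)"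
    using r by (metis abs_of_pos norm_scaleR scaleR_right_diff_distrib scaleR_scaleR)
  also have "\<dots> < (r * t) * \<epsilon>" using t r by (simp add: mult.assoc)
  finally show "r *\<^sub>R \<xi> \<in> cone_around \<xi>0 \<epsilon>" using t r unfolding cone_around_def by (auto intro: exI [of _ "r * t"])
qed

lemma center_in_cone_around: "0 < \<epsilon> \<Longrightarrow> \<xi>0 \<in> cone_around \<xi>0 \<epsilon>"
  by (auto simp: cone_around_def intro: exI [of _ 1])

lemma cone_aroundE:
  assumes "\<xi> \<in> cone_around \<xi>0 \<epsilon>"
  obtains t y where "t > 0" "\<xi> = t *\<^sub>R y" "norm (y - \<xi>0) < \<epsilon>"
proof -
  obtain t where t: "t > 0" "norm (\<xi> - t *\<^sub>R \<xi>0) < t * \<epsilon>" using assms by (auto simp: cone_around_def)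
  have "norm ((1 / t) *\<^sub>R \<xi> - \<xi>0) = norm ((1 / t) *\<^sub>R (\<xi> - t *\<^sub>R \<xi>0))" using t by (simp add: scaleR_right_diff_distrib)
  also have "\<dots> = norm (\<xi> - t *\<^sub>R \<xi>0) / t" using t by simp
  also have "\<dots> < \<epsilon>" using t by (simp add: pos_divide_less_eq mult.commute)
  finally show ?thesis using t by (intro that [of t "(1 / t) *\<^sub>R \<xi>"]) auto
qed

lemma cone_around_subset:
  assumes "open_cone \<Gamma>" "ball \<xi>0 \<epsilon> \<subseteq> \<Gamma>"
  shows "cone_around \<xi>0 \<epsilon> \<subseteq> \<Gamma>"
proof
  fix \<xi> assume "\<xi> \<in> cone_around \<xi>0 \<epsilon>"
  then obtain t y where ty: "t > 0" "\<xi> = t *\<^sub>R y" "norm (y - \<xi>0) < \<epsilon>" by (rule cone_aroundE)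
  then have "y \<in> \<Gamma>" using assms(2) by (auto simp: dist_norm norm_minus_commute)
  then show "\<xi> \<in> \<Gamma>" using assms(1) ty unfolding open_cone_def by blast
qed

lemma cone_around_mono: "\<epsilon> \<le> \<delta> \<Longrightarrow> cone_around \<xi>0 \<epsilon> \<subseteq> cone_around \<xi>0 \<delta>"
  unfolding cone_around_def by (rule Collect_mono) (meson less_imp_le less_le_trans mult_left_mono)

lemma cone_around_add:
  assumes "\<xi> \<in> cone_around \<xi>0 \<epsilon>" "norm (v - \<xi>0) < \<epsilon>" "r \<ge> 0"
  shows "\<xi> + r *\<^sub>R v \<in> cone_around \<xi>0 \<epsilon>"
proof -
  obtain t where t: "t > 0" "norm (\<xi> - t *\<^sub>R \<xi>0) < t * \<epsilon>" using assms(1) by (auto simp: cone_around_def)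
  have "norm ((\<xi> + r *\<^sub>R v) - (t + r) *\<^sub>R \<xi>0) = norm ((\<xi> - t *\<^sub>R \<xi>0) + r *\<^sub>R (v - \<xi>0))"
    by (simp add: algebra_simps)
  also have "\<dots> \<le> norm (\<xi> - t *\<^sub>R \<xi>0) + r * norm (v - \<xi>0)"
    using norm_triangle_ineq [of "\<xi> - t *\<^sub>R \<xi>0" "r *\<^sub>R (v - \<xi>0)"] assms(3) by simp
  also have "\<dots> < (t + r) * \<epsilon>"
    using t mult_left_mono [OF less_imp_le [OF assms(2)] assms(3)] by (simp add: distrib_right)
  finally show ?thesis using t assms(3) unfolding cone_around_def by (auto intro!: exI [of _ "t + r"])
qed

text \<open>A point within \<open>t * \<epsilon> / 2\<close> of \<open>t *\<^sub>R \<xi>0\<close>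
  has distance at least \<open>t * \<epsilon> / 2\<close> from the complement of the wider cone, and
  norm at most \<open>2 * t * norm \<xi>0\<close>; the constant is the quotient.\<close>

lemma cone_around_infdist:
  assumes \<epsilon>: "0 < \<epsilon>" "\<epsilon> < norm \<xi>0" and \<xi>: "\<xi> \<in> cone_around \<xi>0 (\<epsilon> / 2)"
  shows "\<epsilon> / (4 * norm \<xi>0) * norm \<xi> \<le> infdist \<xi> (- cone_around \<xi>0 \<epsilon>)"
proof -
  obtain t where t: "t > 0" "norm (\<xi> - t *\<^sub>R \<xi>0) < t * (\<epsilon> / 2)" using \<xi> by (auto simp: cone_around_def)
  have ne: "- cone_around \<xi>0 \<epsilon> \<noteq> {}" using open_cone_around [OF \<epsilon>] by (auto simp: open_cone_def)
  have "t * (\<epsilon> / 2) \<le> dist \<xi> y" if "y \<in> - cone_around \<xi>0 \<epsilon>" for y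
  proof (rule ccontr)
    assume "\<not> ?thesis"
    then have "norm (y - t *\<^sub>R \<xi>0) < t * \<epsilon>"
      using norm_triangle_ineq [of "y - \<xi>" "\<xi> - t *\<^sub>R \<xi>0"] t by (simp add: dist_norm norm_minus_commute)
    then show False using that t by (auto simp: cone_around_def)
  qed
  then have 1: "t * (\<epsilon> / 2) \<le> infdist \<xi> (- cone_around \<xi>0 \<epsilon>)"
    unfolding infdist_notempty [OF ne] by (intro cINF_greatest ne)
  have "norm \<xi> \<le> norm (t *\<^sub>R \<xi>0) + norm (\<xi> - t *\<^sub>R \<xi>0)" by (rule norm_triangle_sub)
  also have "\<dots> \<le> 2 * t * norm \<xi>0"
  proof -
    have "t * (\<epsilon> / 2) \<le> t * norm \<xi>0" using t \<epsilon> by (intro mult_left_mono) auto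
    moreover have "norm (t *\<^sub>R \<xi>0) = t * norm \<xi>0" using t by simp
    ultimately show ?thesis using t by linarith
  qed
  finally have "\<epsilon> / (4 * norm \<xi>0) * norm \<xi> \<le> \<epsilon> / (4 * norm \<xi>0) * (2 * t * norm \<xi>0)"
    using \<epsilon> by (intro mult_left_mono) auto
  also have "\<dots> = t * (\<epsilon> / 2)" using \<epsilon> by (cases "\<xi>0 = 0") (auto simp: field_simps)
  finally show ?thesis using 1 by linarith
qed

text \<open>The exchange of \<open>p\<close> decay orders for a factor \<open>jap \<xi> ^ p\<close>.
  It works where the weight is comparable to the bracket, and \<open>gevrey_weight_add\<close> keeps
  the price geometric in \<open>n\<close>.\<close>

lemma decay_from_weight:
  assumes s: "0 \<le> s" "s \<le> 1" and w: "\<And>\<xi>. 0 < w \<xi>" and a: "0 \<le> a" "0 \<le> b"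
  shows "\<exists>C>0. \<forall>n \<xi>. jap \<xi> \<le> \<kappa> * w \<xi> \<longrightarrow>
    a * b ^ (n + p) * gevrey_weight s (n + p) * (jap \<xi> ^ p / w \<xi> ^ (n + p)) \<le> C ^ (n + 1) * gevrey_weight s n / jap \<xi> ^ n"
proof -
  obtain E where E: "E \<ge> 1" "\<And>n. gevrey_weight s (n + p) \<le> E ^ (n + 1) * gevrey_weight s n"
    using gevrey_weight_add [OF s] by blast
  define a' where "a' = max 1 a"
  define b' where "b' = max 1 (b * \<bar>\<kappa>\<bar>)"
  have ab: "1 \<le> a'" "1 \<le> b'" "a \<le> a'" "b * \<bar>\<kappa>\<bar> \<le> b'" by (auto simp: a'_def b'_def)
  define C where "C = a' * b' ^ (p + 1) * E"
  have C: "C > 0" unfolding C_def using ab E by (auto intro!: mult_pos_pos)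
  have "a * b ^ (n + p) * gevrey_weight s (n + p) * (jap \<xi> ^ p / w \<xi> ^ (n + p)) \<le> C ^ (n + 1) * gevrey_weight s n / jap \<xi> ^ n"
    if \<kappa>: "jap \<xi> \<le> \<kappa> * w \<xi>" for n \<xi>
  proof -
    have jp: "0 < jap \<xi>" by (rule jap_pos)
    have "jap \<xi> \<le> \<bar>\<kappa>\<bar> * w \<xi>" 
      using w [of \<xi>] by (intro order_trans [OF \<kappa>] mult_right_mono) auto
    then have "jap \<xi> ^ (n + p) \<le> (\<bar>\<kappa>\<bar> * w \<xi>) ^ (n + p)" using jp by (intro power_mono) auto
    then have "jap \<xi> ^ n * jap \<xi> ^ p \<le> \<bar>\<kappa>\<bar> ^ (n + p) * w \<xi> ^ (n + p)"
      by (simp only: power_mult_distrib power_add mult_ac)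
    then have 1: "jap \<xi> ^ p / w \<xi> ^ (n + p) \<le> \<bar>\<kappa>\<bar> ^ (n + p) / jap \<xi> ^ n"
      using jp w [of \<xi>] by (simp add: field_simps)
    have W: "1 \<le> gevrey_weight s n" "1 \<le> gevrey_weight s (n + p)" by (intro gevrey_weight_ge_1 s)+
    have "a * b ^ (n + p) * gevrey_weight s (n + p) * (jap \<xi> ^ p / w \<xi> ^ (n + p)) \<le>
      a * b ^ (n + p) * (E ^ (n + 1) * gevrey_weight s n) * (\<bar>\<kappa>\<bar> ^ (n + p) / jap \<xi> ^ n)"
      using a E W jp w [of \<xi>] by (intro mult_mono E 1 mult_left_mono) auto
    also have "\<dots> = a * (b * \<bar>\<kappa>\<bar>) ^ (n + p) * (E ^ (n + 1) * gevrey_weight s n) / jap \<xi> ^ n"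
      by (simp add: power_mult_distrib mult_ac)
    also have "\<dots> \<le> (a' * b' ^ (n + p)) * (E ^ (n + 1) * gevrey_weight s n) / jap \<xi> ^ n"
      using a ab E W jp by (intro divide_right_mono mult_right_mono mult_mono power_mono) auto
    also have "\<dots> \<le> ((a' * b' ^ (p + 1)) ^ (n + 1)) * (E ^ (n + 1) * gevrey_weight s n) / jap \<xi> ^ n"
      using E W jp by (intro divide_right_mono mult_right_mono absorb_power ab) auto
    finally show ?thesis unfolding C_def power_mult_distrib by (simp only: mult.assoc)
  qed
  then show ?thesis using C by blast
qed

text \<open>The essential bound becomes a pointwise one after setting the function to 0 on the null
  set where it fails, and the real exponent is rounded up to a natural number.\<close>

lemma fourier_poly_boundedE:
  assumes "fourier_poly_bounded g"
  obtains h B M where "is_function (fourier g) h" "\<And>\<eta>. cmod (h \<eta>) \<le> B * jap \<eta> ^ M"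
proof -
  obtain h0 Mr B where h0: "is_function (fourier g) h0" "AE \<xi> in lborel. cmod (h0 \<xi>) * jap \<xi> powr (- Mr) \<le> B"
    using assms unfolding fourier_poly_bounded_def by blast
  have [measurable]: "h0 \<in> borel_measurable borel" by (rule is_functionD(1) [OF h0(1)])
  define h where "h = (\<lambda>\<eta>. if cmod (h0 \<eta>) * jap \<eta> powr (- Mr) \<le> B then h0 \<eta> else 0)"
  have [measurable]: "h \<in> borel_measurable borel" unfolding h_def by measurable
  have AE: "AE \<eta> in lborel. h \<eta> = h0 \<eta>" using h0(2) by eventually_elim (simp add: h_def)
  have "is_function (fourier g) h"
    unfolding is_function_def
  proof (intro conjI ballI)
    fix \<phi> :: "'a cfun" assume \<phi>: "\<phi> \<in> schwartz_functions"
    have [measurable]: "\<phi> \<in> borel_measurable borel" by (rule schwartz_measurable [OF \<phi>])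
    have "has_bochner_integral lborel (\<lambda>x. h0 x * \<phi> x) (fourier g \<phi>)" using h0(1) \<phi> unfolding is_function_def by blast
    moreover have "AE x in lborel. h0 x * \<phi> x = h x * \<phi> x" using AE by eventually_elim simp
    ultimately show "has_bochner_integral lborel (\<lambda>x. h x * \<phi> x) (fourier g \<phi>)"
      by (subst has_bochner_integral_cong_AE [where g = "\<lambda>x. h0 x * \<phi> x"]) (auto elim: eventually_mono)
  qed simp
  moreover have "cmod (h \<eta>) \<le> \<bar>B\<bar> * jap \<eta> ^ nat \<lceil>Mr\<rceil>" for \<eta>
  proof (cases "cmod (h0 \<eta>) * jap \<eta> powr (- Mr) \<le> B")
    case True
    have jp: "jap \<eta> > 0" by (rule jap_pos)
    have "cmod (h0 \<eta>) = (cmod (h0 \<eta>) * jap \<eta> powr (- Mr)) * jap \<eta> powr Mr" using jp by (simp add: powr_minus)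
    also have "\<dots> \<le> \<bar>B\<bar> * jap \<eta> powr Mr" using True by (intro mult_right_mono) auto
    also have "\<dots> \<le> \<bar>B\<bar> * jap \<eta> powr (real (nat \<lceil>Mr\<rceil>))"
      using jap_ge_1 [of \<eta>] by (intro mult_left_mono powr_mono real_nat_ceiling_ge) auto
    finally show ?thesis using True jp by (simp add: h_def powr_realpow)
  qed (simp add: h_def less_imp_le [OF jap_pos])
  ultimately show ?thesis by (rule that)
qed

section \<open>The full symbol and its ellipticity\<close>

definition full_symbol :: "nat \<Rightarrow> (('n::finite) multi_index \<Rightarrow> complex) \<Rightarrow> 'n cfun" where
  "full_symbol m a \<xi> = (\<Sum>\<alpha> | mi_size \<alpha> \<le> m. a \<alpha> * mfun (mi_list \<alpha>) \<xi>)"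

lemma D_deriv_fourier_fun:
  assumes \<phi>: "\<phi> \<in> schwartz_functions"
  shows "(\<lambda>x. mfun (mi_list \<alpha>) x * \<phi> x) \<in> schwartz_functions"
    and "D_deriv \<alpha> (fourier_fun \<phi>) = fourier_fun (\<lambda>x. (- 1) ^ mi_size \<alpha> * (mfun (mi_list \<alpha>) x * \<phi> x))"
proof -
  show "(\<lambda>x. mfun (mi_list \<alpha>) x * \<phi> x) \<in> schwartz_functions"
    unfolding mfun_def using pdl_fourier_fun [OF \<phi>] by blast
  have "(- \<i>) ^ n * (- \<i>) ^ n = (- 1) ^ n" for n :: nat
    by (simp flip: power_mult_distrib)
  then have "(- \<i>) ^ n * ((- \<i>) ^ n * z) = (- 1) ^ n * z" for n :: nat and z :: complex
    by (simp flip: mult.assoc)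
  then show "D_deriv \<alpha> (fourier_fun \<phi>) = fourier_fun (\<lambda>x. (- 1) ^ mi_size \<alpha> * (mfun (mi_list \<alpha>) x * \<phi> x))"
    using pdl_fourier_fun [OF \<phi>, of "mi_list \<alpha>"]
    by (simp only: D_deriv_def [abs_def] mi_deriv_eq_pdl mfun_def length_mi_list fourier_fun_cmult [abs_def])
qed

text \<open>The sign \<open>(- 1) ^ mi_size \<alpha>\<close> from the transposition in
  \<open>D_dist\<close> cancels the one that \<open>D_deriv_fourier_fun\<close> produces, so that
  the symbol appears at \<open>\<xi>\<close> and not at \<open>- \<xi>\<close>.\<close>

lemma is_function_fourier_PD:
  assumes g: "is_function (fourier g) h"
  shows "is_function (fourier (PD m a g)) (\<lambda>\<xi>. full_symbol m a \<xi> * h \<xi>)"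
  unfolding is_function_def
proof (intro conjI ballI)
  have [measurable]: "h \<in> borel_measurable borel" by (rule is_functionD(1) [OF g])
  show "(\<lambda>\<xi>. full_symbol m a \<xi> * h \<xi>) \<in> borel_measurable lborel" unfolding full_symbol_def by measurable
  fix \<phi> :: "'a cfun" assume \<phi>: "\<phi> \<in> schwartz_functions"
  have gh: "has_bochner_integral lborel (\<lambda>x. h x * \<psi> x) (g (fourier_fun \<psi>))" if "\<psi> \<in> schwartz_functions" for \<psi>
    using g that unfolding is_function_def fourier_def by blast
  have "has_bochner_integral lborel (\<lambda>x. \<Sum>\<alpha> | mi_size \<alpha> \<le> m. a \<alpha> * ((- 1) ^ mi_size \<alpha> * (h x * ((- 1) ^ mi_size \<alpha> * (mfun (mi_list \<alpha>) x * \<phi> x)))))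
    (\<Sum>\<alpha> | mi_size \<alpha> \<le> m. a \<alpha> * ((- 1) ^ mi_size \<alpha> * g (fourier_fun (\<lambda>x. (- 1) ^ mi_size \<alpha> * (mfun (mi_list \<alpha>) x * \<phi> x)))))"
    by (intro has_bochner_integral_sum has_bochner_integral_mult_right gh schwartz_cmult D_deriv_fourier_fun(1) \<phi>)
  moreover have "a \<alpha> * ((- 1) ^ k * (h x * ((- 1) ^ k * (mfun (mi_list \<alpha>) x * \<phi> x)))) = a \<alpha> * mfun (mi_list \<alpha>) x * h x * \<phi> x" for \<alpha> k x
    by (cases "even k") (simp_all add: mult_ac)
  moreover have "fourier (PD m a g) \<phi> =
    (\<Sum>\<alpha> | mi_size \<alpha> \<le> m. a \<alpha> * ((- 1) ^ mi_size \<alpha> * g (fourier_fun (\<lambda>x. (- 1) ^ mi_size \<alpha> * (mfun (mi_list \<alpha>) x * \<phi> x)))))"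
    by (simp add: fourier_def PD_def D_dist_def D_deriv_fourier_fun(2) [OF \<phi>])
  ultimately show "has_bochner_integral lborel (\<lambda>x. full_symbol m a x * h x * \<phi> x) (fourier (PD m a g) \<phi>)"
    by (simp only: full_symbol_def sum_distrib_right)
qed

lemma mfun_scaleR: "mfun \<delta> (t *\<^sub>R \<xi>) = of_real (t ^ length \<delta>) * mfun \<delta> \<xi>"
  by (induction \<delta>) (simp_all add: mfun_Cons mult_ac)

lemma principal_symbol_eq: "principal_symbol m a \<xi> = (\<Sum>\<alpha> | mi_size \<alpha> = m. a \<alpha> * mfun (mi_list \<alpha>) \<xi>)"
  by (simp add: principal_symbol_def mfun_def monomial_eq_prod_list)

text \<open>The principal symbol stays away from 0 near \<open>\<xi>0\<close> by continuity,
  homogeneity carries this to the cone, and the lower order terms lose at least one power of the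
  bracket.\<close>

lemma full_symbol_elliptic:
  assumes nz: "principal_symbol m a \<xi>0 \<noteq> 0" and \<xi>0: "\<xi>0 \<noteq> 0"
  shows "\<exists>\<epsilon> c R. 0 < \<epsilon> \<and> 0 < c \<and> 1 \<le> R \<and>
    (\<forall>\<xi>\<in>cone_around \<xi>0 \<epsilon>. R \<le> norm \<xi> \<longrightarrow> c * jap \<xi> ^ m \<le> cmod (full_symbol m a \<xi>))"
proof -
  have "continuous_on UNIV (mfun \<delta>)" for \<delta> :: "'a list"
    by (induction \<delta>) (auto simp: mfun_Cons [abs_def] intro!: continuous_intros)
  then have cont: "continuous_on UNIV (principal_symbol m a)"
    unfolding principal_symbol_eq [abs_def] by (intro continuous_intros)
  define c0 where "c0 = cmod (principal_symbol m a \<xi>0) / 2"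
  have c0: "c0 > 0" using nz by (simp add: c0_def)
  obtain \<epsilon>' where \<epsilon>': "\<epsilon>' > 0" "\<And>y. dist y \<xi>0 < \<epsilon>' \<Longrightarrow> dist (principal_symbol m a y) (principal_symbol m a \<xi>0) < c0"
    using cont c0 unfolding continuous_on_iff by (meson UNIV_I)
  define \<epsilon> where "\<epsilon> = min \<epsilon>' (norm \<xi>0)"
  have \<epsilon>: "\<epsilon> > 0" "\<epsilon> \<le> norm \<xi>0" using \<epsilon>' \<xi>0 by (auto simp: \<epsilon>_def)
  \<comment> \<open>If \<open>\<xi> = t *\<^sub>R y\<close> with
    \<open>norm y \<le> 2 * norm \<xi>0\<close> and \<open>norm \<xi> \<ge> 1\<close>, then the
    bracket is at most \<open>2 * norm \<xi>\<close>, hence at most \<open>q * t\<close>.\<close>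
  define q where "q = 4 * norm \<xi>0"
  have q: "q > 0" using \<xi>0 by (simp add: q_def)
  define c1 where "c1 = c0 / q ^ m"
  have c1: "c1 > 0" using c0 q by (simp add: c1_def)
  have p: "c1 * jap \<xi> ^ m \<le> cmod (principal_symbol m a \<xi>)" if \<xi>: "\<xi> \<in> cone_around \<xi>0 \<epsilon>" and n1: "1 \<le> norm \<xi>" for \<xi>
  proof -
    obtain t y where ty: "t > 0" "\<xi> = t *\<^sub>R y" "norm (y - \<xi>0) < \<epsilon>" using \<xi> by (rule cone_aroundE)
    have "cmod (principal_symbol m a \<xi>0 - principal_symbol m a y) < c0"
      using \<epsilon>'(2) [of y] ty(3) by (simp add: dist_norm \<epsilon>_def norm_minus_commute)
    then have "c0 \<le> cmod (principal_symbol m a y)"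
      using norm_triangle_ineq2 [of "principal_symbol m a \<xi>0" "principal_symbol m a y"] by (simp add: c0_def)
    moreover have "principal_symbol m a \<xi> = of_real (t ^ m) * principal_symbol m a y"
      unfolding ty(2) principal_symbol_eq sum_distrib_left
      by (intro sum.cong) (auto simp: mfun_scaleR length_mi_list mult_ac)
    ultimately have 1: "t ^ m * c0 \<le> cmod (principal_symbol m a \<xi>)" using ty by (simp add: norm_mult norm_power)
    have "norm y \<le> norm \<xi>0 + norm (y - \<xi>0)" by norm
    then have "norm y \<le> 2 * norm \<xi>0" using ty \<epsilon> by simp
    then have "norm \<xi> \<le> t * (2 * norm \<xi>0)" using ty by (simp add: mult_left_mono)
    then have "jap \<xi> \<le> q * t" using jap_le [of \<xi>] n1 by (simp add: q_def mult_ac)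
    then have "jap \<xi> ^ m \<le> (q * t) ^ m" by (intro power_mono less_imp_le [OF jap_pos])
    then have "c1 * jap \<xi> ^ m \<le> c1 * (q * t) ^ m" using c1 by (intro mult_left_mono) auto
    also have "\<dots> = t ^ m * c0" using q by (simp add: c1_def power_mult_distrib)
    finally show ?thesis using 1 by linarith
  qed
  define A where "A = (\<Sum>\<alpha> | mi_size \<alpha> < m. cmod (a \<alpha>))"
  have A: "A \<ge> 0" unfolding A_def by (intro sum_nonneg) simp
  have split: "{\<alpha> :: 'a multi_index. mi_size \<alpha> \<le> m} = {\<alpha>. mi_size \<alpha> = m} \<union> {\<alpha>. mi_size \<alpha> < m}" by auto
  have fin: "finite {\<alpha> :: 'a multi_index. mi_size \<alpha> < m}" by (rule finite_subset [OF _ finite_mi_size [of m]]) auto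
  have low: "cmod (full_symbol m a \<xi> - principal_symbol m a \<xi>) * jap \<xi> \<le> A * jap \<xi> ^ m" for \<xi>
  proof -
    have "full_symbol m a \<xi> - principal_symbol m a \<xi> = (\<Sum>\<alpha> | mi_size \<alpha> < m. a \<alpha> * mfun (mi_list \<alpha>) \<xi>)"
      unfolding full_symbol_def principal_symbol_eq split
      by (subst sum.union_disjoint) (auto simp: finite_mi_size_eq fin)
    then have "cmod (full_symbol m a \<xi> - principal_symbol m a \<xi>) * jap \<xi> \<le> (\<Sum>\<alpha> | mi_size \<alpha> < m. cmod (a \<alpha> * mfun (mi_list \<alpha>) \<xi>)) * jap \<xi>"
      using norm_sum by (auto intro!: mult_right_mono less_imp_le [OF jap_pos])
    also have "\<dots> = (\<Sum>\<alpha> | mi_size \<alpha> < m. cmod (a \<alpha>) * (cmod (mfun (mi_list \<alpha>) \<xi>) * jap \<xi>))"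
      by (simp add: sum_distrib_right norm_mult mult.assoc)
    also have "\<dots> \<le> (\<Sum>\<alpha> | mi_size \<alpha> < m. cmod (a \<alpha>) * jap \<xi> ^ m)"
    proof (intro sum_mono mult_left_mono)
      fix \<alpha> :: "'a multi_index" assume "\<alpha> \<in> {\<alpha>. mi_size \<alpha> < m}"
      then have "Suc (mi_size \<alpha>) \<le> m" by simp
      have "cmod (mfun (mi_list \<alpha>) \<xi>) * jap \<xi> \<le> jap \<xi> ^ mi_size \<alpha> * jap \<xi>"
        using norm_mfun_le [of "mi_list \<alpha>" \<xi>] by (intro mult_right_mono) (auto simp: length_mi_list less_imp_le [OF jap_pos])
      also have "\<dots> = jap \<xi> ^ Suc (mi_size \<alpha>)" by simp
      also have "\<dots> \<le> jap \<xi> ^ m" by (intro power_increasing jap_ge_1) fact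
      finally show "cmod (mfun (mi_list \<alpha>) \<xi>) * jap \<xi> \<le> jap \<xi> ^ m" .
    qed simp
    finally show ?thesis by (simp add: A_def sum_distrib_right)
  qed
  \<comment> \<open>Beyond \<open>2 * A / c1\<close> the lower order terms amount to at most half of
    the lower bound for the principal symbol; beyond 1 that bound, the fact \<open>p\<close>, is
    available.\<close>
  define R where "R = max 1 (2 * A / c1)"
  have "c1 / 2 * jap \<xi> ^ m \<le> cmod (full_symbol m a \<xi>)" if \<xi>: "\<xi> \<in> cone_around \<xi>0 \<epsilon>" and R: "R \<le> norm \<xi>" for \<xi>
  proof -
    have "R \<le> jap \<xi>" using R norm_le_jap [of \<xi>] by linarith
    then have "2 * A / c1 \<le> jap \<xi>" by (simp add: R_def)
    then have "A \<le> c1 / 2 * jap \<xi>" using c1 by (simp add: field_simps)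
    then have "A * jap \<xi> ^ m \<le> (c1 / 2 * jap \<xi>) * jap \<xi> ^ m" by (intro mult_right_mono) (auto simp: less_imp_le [OF jap_pos])
    then have "cmod (full_symbol m a \<xi> - principal_symbol m a \<xi>) * jap \<xi> \<le> (c1 / 2 * jap \<xi> ^ m) * jap \<xi>"
      using low [of \<xi>] by (simp add: mult_ac)
    then have "cmod (full_symbol m a \<xi> - principal_symbol m a \<xi>) \<le> c1 / 2 * jap \<xi> ^ m"
      using jap_pos [of \<xi>] mult_right_le_imp_le by blast
    moreover have "c1 * jap \<xi> ^ m \<le> cmod (principal_symbol m a \<xi>)" using p [OF \<xi>] R by (simp add: R_def)
    ultimately show ?thesis
      using norm_triangle_ineq2 [of "principal_symbol m a \<xi>" "principal_symbol m a \<xi> - full_symbol m a \<xi>"] by (simp add: norm_minus_commute)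
  qed
  then show ?thesis using \<epsilon> c1 by (intro exI [of _ \<epsilon>] exI [of _ "c1 / 2"] exI [of _ R]) (auto simp: R_def)
qed

text \<open>The recursion yields decay in the weight with a loss \<open>jap \<xi> ^ M\<close> that
  stems from the growth of \<open>h\<close>. One further average, from \<open>2 * N\<close> to
  \<open>N\<close>, makes orders beyond \<open>N\<close> usable and so pays for this loss.\<close>

lemma gevrey_decay_elliptic:
  assumes fp: "fourier_poly_bounded g" and dec: "gevrey_decay s (PD m a g) x0 \<xi>0"
    and nz: "principal_symbol m a \<xi>0 \<noteq> 0" and \<xi>0: "\<xi>0 \<noteq> 0" and s: "0 \<le> s" "s \<le> 1"
  shows "gevrey_decay s g x0 (\<xi>0 :: real ^ 'n::finite)"
proof -
  obtain h B M where h: "is_function (fourier g) h" and hB: "\<And>\<eta>. cmod (h \<eta>) \<le> B * jap \<eta> ^ M"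
    using fp by (rule fourier_poly_boundedE) blast
  have hm [measurable]: "h \<in> borel_measurable borel" by (rule is_functionD(1) [OF h])
  have hp: "poly_bounded h" by (rule poly_bounded_jap [OF hB])
  obtain \<Gamma> C N0 where \<Gamma>: "open_cone \<Gamma>" "\<xi>0 \<in> \<Gamma>" and C: "C > 0"
    and dec': "\<And>N. N \<ge> N0 \<Longrightarrow> \<exists>k. continuous_on UNIV k \<and> is_function (fourier (mult_dist (PD m a g) (gauss x0 N))) k \<and>
      (\<forall>\<xi>\<in>\<Gamma>. \<forall>n\<le>N. cmod (k \<xi>) \<le> C ^ (n + 1) * gevrey_weight s n / jap \<xi> ^ n)"
    using dec unfolding gevrey_decay_def by blast
  obtain \<epsilon>1 c R where ell: "0 < \<epsilon>1" "0 < c" "1 \<le> R"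
    "\<And>\<xi>. \<xi> \<in> cone_around \<xi>0 \<epsilon>1 \<Longrightarrow> R \<le> norm \<xi> \<Longrightarrow> c * jap \<xi> ^ m \<le> cmod (full_symbol m a \<xi>)"
    using full_symbol_elliptic [OF nz \<xi>0] by blast
  obtain \<epsilon>2 where \<epsilon>2: "\<epsilon>2 > 0" "ball \<xi>0 \<epsilon>2 \<subseteq> \<Gamma>"
    using \<Gamma> unfolding open_cone_def by (meson openE)
  \<comment> \<open>Small enough for ellipticity, for the cone of the hypothesis, and for the origin
    to lie outside the cone.\<close>
  define \<epsilon> where "\<epsilon> = min (min \<epsilon>1 \<epsilon>2) (norm \<xi>0 / 2)"
  have \<epsilon>: "0 < \<epsilon>" "\<epsilon> < norm \<xi>0" using ell(1) \<epsilon>2 \<xi>0 by (auto simp: \<epsilon>_def min_def)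
  define K1 where "K1 = cone_around \<xi>0 \<epsilon>"
  have "ball \<xi>0 \<epsilon> \<subseteq> \<Gamma>" using \<epsilon>2(2) by (auto simp: \<epsilon>_def)
  then have K1\<Gamma>: "K1 \<subseteq> \<Gamma>" unfolding K1_def by (intro cone_around_subset \<Gamma>)
  have K1e: "K1 \<subseteq> cone_around \<xi>0 \<epsilon>1" unfolding K1_def by (rule cone_around_mono) (simp add: \<epsilon>_def)
  have K1o: "open_cone K1" unfolding K1_def by (rule open_cone_around [OF \<epsilon>])
  define w where "w = cone_weight K1"
  have wR: "\<xi> \<in> K1 \<and> R \<le> norm \<xi>" if "R < w \<xi>" for \<xi>
  proof
    show 1: "\<xi> \<in> K1" using that cone_weight_outside [of \<xi> K1] ell(3) by (auto simp: w_def)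
    have "infdist \<xi> (- K1) \<le> norm \<xi>" using infdist_le [of 0 "- K1" \<xi>] K1o by (simp add: open_cone_def)
    then show "R \<le> norm \<xi>" using that ell(3) by (auto simp: w_def cone_weight_def max_def split: if_splits)
  qed
  have wj: "w \<xi> \<le> jap \<xi>" for \<xi> unfolding w_def using K1o by (intro cone_weight_le_jap) (simp add: open_cone_def)
  define A where "A = max 1 C"
  define N1 where "N1 = max 2 N0"
  have fin: "finite {\<alpha> :: 'n multi_index. mi_size \<alpha> \<le> m}" by (rule finite_mi_size)
  have "\<exists>D\<ge>1. \<forall>j N \<delta> \<xi>. N1 \<le> N \<longrightarrow> j \<le> N \<longrightarrow> length \<delta> \<le> m \<longrightarrow>
    cmod (kint x0 (\<lambda>\<eta>. mfun \<delta> \<eta> * h \<eta>) (real N) \<xi>) \<le>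
    D ^ (j + 1) * gevrey_weight s j * exp ((real j)\<^sup>2 / (2 * real N)) * (jap \<xi> ^ (M + length \<delta>) / w \<xi> ^ j)"
  proof (rule elliptic_recursion [OF _ _ wj hm hB s(1) _ ell(2,3) _ fin, where d = mi_list and b = a and A = A])
    show "1 \<le> w \<xi>" for \<xi> unfolding w_def by (rule cone_weight_ge_1)
    show "w \<xi> \<le> w \<zeta> * (1 + norm (\<zeta> - \<xi>))" for \<xi> \<zeta> unfolding w_def by (rule cone_weight_triangle)
    show "length (mi_list \<alpha>) \<le> m" if "\<alpha> \<in> {\<alpha>. mi_size \<alpha> \<le> m}" for \<alpha> :: "'n multi_index" using that by (simp add: length_mi_list)
    show "c * jap \<xi> ^ m \<le> cmod (\<Sum>\<alpha> | mi_size \<alpha> \<le> m. a \<alpha> * mfun (mi_list \<alpha>) \<xi>)" if "R < w \<xi>" for \<xi>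
      using ell(4) [of \<xi>] wR [OF that] K1e by (auto simp: full_symbol_def)
    fix N n \<xi> assume N: "N1 \<le> N" and n: "n \<le> N" and R: "R < w \<xi>"
    have N': "N > 0" "real N > 0" "N0 \<le> N" using N by (auto simp: N1_def)
    obtain k where k: "continuous_on UNIV k" "is_function (fourier (mult_dist (PD m a g) (gauss x0 N))) k"
      "\<And>\<xi> n. \<xi> \<in> \<Gamma> \<Longrightarrow> n \<le> N \<Longrightarrow> cmod (k \<xi>) \<le> C ^ (n + 1) * gevrey_weight s n / jap \<xi> ^ n"
      using dec' [OF N'(3)] by blast
    have Pm: "(\<lambda>\<eta>. full_symbol m a \<eta> * h \<eta>) \<in> borel_measurable borel"
      by (rule is_functionD(1) [OF is_function_fourier_PD [OF h]])
    have Pp: "poly_bounded (\<lambda>\<eta>. full_symbol m a \<eta> * h \<eta>)"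
    proof (rule poly_bounded_jap)
      fix \<eta> :: "real ^ 'n"
      have "cmod (full_symbol m a \<eta>) \<le> (\<Sum>\<alpha> | mi_size \<alpha> \<le> m. cmod (a \<alpha>) * jap \<eta> ^ m)"
        unfolding full_symbol_def
      proof (rule order_trans [OF norm_sum sum_mono])
        fix \<alpha> :: "'n multi_index" assume "\<alpha> \<in> {\<alpha>. mi_size \<alpha> \<le> m}"
        then have "cmod (mfun (mi_list \<alpha>) \<eta>) \<le> jap \<eta> ^ m"
          using jap_ge_1 [of \<eta>] by (intro order_trans [OF norm_mfun_le] power_increasing) (auto simp: length_mi_list)
        then show "cmod (a \<alpha> * mfun (mi_list \<alpha>) \<eta>) \<le> cmod (a \<alpha>) * jap \<eta> ^ m" by (simp add: norm_mult mult_left_mono)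
      qed
      then have "cmod (full_symbol m a \<eta>) * cmod (h \<eta>) \<le> ((\<Sum>\<alpha> | mi_size \<alpha> \<le> m. cmod (a \<alpha>)) * jap \<eta> ^ m) * (B * jap \<eta> ^ M)"
        by (intro mult_mono hB) (auto simp: sum_distrib_right sum_nonneg less_imp_le [OF jap_pos])
      then show "cmod (full_symbol m a \<eta> * h \<eta>) \<le> ((\<Sum>\<alpha> | mi_size \<alpha> \<le> m. cmod (a \<alpha>)) * B) * jap \<eta> ^ (m + M)"
        by (simp add: norm_mult power_add mult_ac)
    qed
    \<comment> \<open>The hypothesis speaks of some continuous representative. By uniqueness it is
      the average of the symbol times \<open>h\<close>, which is what the recursion takes as
      input.\<close>
    have "k = kint x0 (\<lambda>\<eta>. full_symbol m a \<eta> * h \<eta>) N"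
      by (rule is_function_unique [OF k(2) is_function_gauss [OF is_function_fourier_PD [OF h] Pp N'(1)] k(1) kint_continuous [OF N'(2) Pm Pp]])
    then have "cmod (kint x0 (\<lambda>\<eta>. full_symbol m a \<eta> * h \<eta>) N \<xi>) \<le> C ^ (n + 1) * gevrey_weight s n / jap \<xi> ^ n"
      using k(3) [OF _ n, of \<xi>] wR [OF R] K1\<Gamma> by auto
    also have "\<dots> \<le> A ^ (n + 1) * gevrey_weight s n / w \<xi> ^ n"
      using C wj [of \<xi>] cone_weight_pos [of K1 \<xi>] gevrey_weight_ge_1 [OF s(1), of n]
      by (intro frac_le mult_right_mono power_mono mult_nonneg_nonneg) (auto simp: A_def w_def)
    finally show "cmod (kint x0 (\<lambda>\<eta>. (\<Sum>\<alpha> | mi_size \<alpha> \<le> m. a \<alpha> * mfun (mi_list \<alpha>) \<eta>) * h \<eta>) (real N) \<xi>)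
      \<le> A ^ (n + 1) * gevrey_weight s n / w \<xi> ^ n" by (simp add: full_symbol_def)
  qed (auto simp: A_def N1_def)
  then obtain D where D: "D \<ge> 1" and D': "\<And>j N \<delta> \<xi>. N1 \<le> N \<Longrightarrow> j \<le> N \<Longrightarrow> length \<delta> \<le> m \<Longrightarrow>
    cmod (kint x0 (\<lambda>\<eta>. mfun \<delta> \<eta> * h \<eta>) (real N) \<xi>) \<le>
    D ^ (j + 1) * gevrey_weight s j * exp ((real j)\<^sup>2 / (2 * real N)) * (jap \<xi> ^ (M + length \<delta>) / w \<xi> ^ j)"
    by blast
  obtain K where K: "K > 0" "gaussian_bound w M 0 K"
    using gaussian_estimate [of w M 0] cone_weight_ge_1 cone_weight_triangle unfolding w_def by blast
  define \<kappa> where "\<kappa> = 1 + 1 / (\<epsilon> / (4 * norm \<xi>0))"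
  obtain C' where C': "C' > 0" "\<And>n \<xi>. jap \<xi> \<le> \<kappa> * w \<xi> \<Longrightarrow>
    (K * D) * (D * exp 1) ^ (n + M) * gevrey_weight s (n + M) * (jap \<xi> ^ M / w \<xi> ^ (n + M)) \<le> C' ^ (n + 1) * gevrey_weight s n / jap \<xi> ^ n"
    using decay_from_weight [OF s, of w "K * D" "D * exp 1" \<kappa> M] cone_weight_pos K(1) D unfolding w_def by (auto simp del: of_nat_add)
  have main: "cmod (kint x0 h (real N) \<xi>) \<le> C' ^ (n + 1) * gevrey_weight s n / jap \<xi> ^ n"
    if N: "N \<ge> N1 + M" and \<xi>: "\<xi> \<in> cone_around \<xi>0 (\<epsilon> / 2)" and n: "n \<le> N" for N n \<xi>
  proof -
    \<comment> \<open>The \<open>M\<close> additional orders are admissible because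
      \<open>N \<ge> M\<close> gives \<open>n + M \<le> 2 * N\<close>, and the recursion is used at
      \<open>2 * N\<close>.\<close>
    define j where "j = n + M"
    have N': "real N > 0" "real N \<ge> 1" "N1 \<le> 2 * N" "j \<le> 2 * N" using N n by (auto simp: N1_def j_def)
    define G where "G = D ^ (j + 1) * gevrey_weight s j * exp ((real j)\<^sup>2 / (2 * real (2 * N)))"
    have G: "G \<ge> 0" unfolding G_def using D gevrey_weight_ge_1 [OF s(1), of j] by simp
    have "cmod (LINT \<zeta>|lborel. kint x0 h (2 * real N) \<zeta> * kern x0 (2 * real N) (\<zeta> - \<xi>)) \<le>
      K * exp ((real j)\<^sup>2 / (4 * real N)) * G * (jap \<xi> ^ M / w \<xi> ^ j)"
    proof (rule gaussian_boundD [OF K(2) N'(2) order_refl G])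
      fix \<zeta>
      have "cmod (kint x0 h (2 * real N) \<zeta>) \<le> G * (jap \<zeta> ^ M / w \<zeta> ^ j)"
        using D' [OF N'(3,4), of "[]" \<zeta>] by (simp add: G_def)
      from mult_right_mono [OF this, of "heat (2 * real N) (\<zeta> - \<xi>)"]
      show "cmod (kint x0 h (2 * real N) \<zeta> * kern x0 (2 * real N) (\<zeta> - \<xi>)) \<le>
        G * (jap \<zeta> ^ M / w \<zeta> ^ j) * (1 + sqrt (real N) * norm (\<zeta> - \<xi>)) ^ 0 * heat (2 * real N) (\<zeta> - \<xi>)"
        by (simp add: norm_mult norm_kern)
    qed
    then have 1: "cmod (kint x0 h (real N) \<xi>) \<le> K * exp ((real j)\<^sup>2 / (4 * real N)) * G * (jap \<xi> ^ M / w \<xi> ^ j)"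
      by (simp only: kint_half [OF N'(1) hm hp])
    have 2: "K * exp ((real j)\<^sup>2 / (4 * real N)) * G \<le> (K * D) * (D * exp 1) ^ j * gevrey_weight s j"
    proof -
      have "exp ((real j)\<^sup>2 / (4 * real N)) * exp ((real j)\<^sup>2 / (4 * real N)) = exp (real j * (real j / (2 * real N)))"
        using N' by (simp add: power2_eq_square field_simps flip: exp_add)
      also have "\<dots> \<le> exp (real j * 1)"
        using N' by (intro iffD2 [OF exp_le_cancel_iff] mult_left_mono) (auto simp: field_simps)
      also have "\<dots> = exp 1 ^ j" by (simp flip: exp_of_nat_mult)
      finally have "(K * D ^ (j + 1) * gevrey_weight s j) * (exp ((real j)\<^sup>2 / (4 * real N)) * exp ((real j)\<^sup>2 / (4 * real N))) \<le>
        (K * D ^ (j + 1) * gevrey_weight s j) * exp 1 ^ j"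
        using K(1) D gevrey_weight_ge_1 [OF s(1), of j] by (intro mult_left_mono) auto
      then show ?thesis by (simp add: G_def power_mult_distrib mult_ac)
    qed
    have "0 \<le> jap \<xi> ^ M / w \<xi> ^ j" using cone_weight_pos [of K1 \<xi>] jap_pos [of \<xi>] by (simp add: w_def)
    from order_trans [OF 1 mult_right_mono [OF 2 this]]
    have "cmod (kint x0 h (real N) \<xi>) \<le> (K * D) * (D * exp 1) ^ j * gevrey_weight s j * (jap \<xi> ^ M / w \<xi> ^ j)" .
    also have "\<dots> \<le> C' ^ (n + 1) * gevrey_weight s n / jap \<xi> ^ n"
      unfolding j_def
    proof (rule C'(2))
      show "jap \<xi> \<le> \<kappa> * w \<xi>"
        unfolding \<kappa>_def w_def K1_def using \<epsilon> \<xi>0 by (intro jap_le_cone_weight cone_around_infdist \<epsilon> \<xi>) auto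
    qed
    finally show ?thesis .
  qed
  show ?thesis
    unfolding gevrey_decay_def
  proof (rule exI [of _ "cone_around \<xi>0 (\<epsilon> / 2)"], rule exI [of _ C'], rule exI [of _ "N1 + M"], intro conjI allI impI)
    show "open_cone (cone_around \<xi>0 (\<epsilon> / 2))" using \<epsilon> by (intro open_cone_around) auto
    show "\<xi>0 \<in> cone_around \<xi>0 (\<epsilon> / 2)" using \<epsilon> by (intro center_in_cone_around) auto
    show "C' > 0" by (rule C')
    show "N1 + M > 0" by (simp add: N1_def max_def)
    fix N assume N: "N1 + M \<le> N"
    have N': "N > 0" "real N > 0" using N by (auto simp: N1_def)
    show "\<exists>k. continuous_on UNIV k \<and> is_function (fourier (mult_dist g (gauss x0 N))) k \<and>
      (\<forall>\<xi>\<in>cone_around \<xi>0 (\<epsilon> / 2). \<forall>n\<le>N. cmod (k \<xi>) \<le> C' ^ (n + 1) * gevrey_weight s n / jap \<xi> ^ n)"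
      using kint_continuous [OF N'(2) hm hp] is_function_gauss [OF h hp N'(1)] main [OF N]
      by (intro exI [of _ "kint x0 h (real N)"]) auto
  qed
qed

section \<open>The action of differential operators\<close>

text \<open>A Gaussian times the transform of a Schwartz function is a Schwartz function, so nothing
  but the values on such functions enters.\<close>

lemma gevrey_decay_cong:
  assumes "\<And>\<phi>. \<phi> \<in> schwartz_functions \<Longrightarrow> u \<phi> = v \<phi>" "gevrey_decay s u x0 \<xi>0"
  shows "gevrey_decay s v x0 \<xi>0"
proof -
  have E: "(\<lambda>x. gauss x0 N x * fourier_fun \<phi> x) \<in> schwartz_functions" if "N > 0" "\<phi> \<in> schwartz_functions" for N \<phi>
    unfolding gauss_eq_gse using that by (intro schwartz_mult gse_schwartz fourier_fun_moderate) auto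
  have "is_function (fourier (mult_dist u (gauss x0 N))) h \<longleftrightarrow> is_function (fourier (mult_dist v (gauss x0 N))) h" if "N > 0" for N h
    unfolding is_function_def fourier_def mult_dist_def using assms(1) [OF E [OF that]] by auto
  then show ?thesis
    using assms(2) unfolding gevrey_decay_def by (meson less_le_trans)
qed

lemma gevrey_decay_add:
  assumes s: "0 \<le> s" and u: "gevrey_decay s u x0 \<xi>0" and v: "gevrey_decay s v x0 \<xi>0"
  shows "gevrey_decay s (\<lambda>\<phi>. u \<phi> + v \<phi>) x0 \<xi>0"
proof -
  obtain \<Gamma>1 C1 N1 where 1: "open_cone \<Gamma>1" "\<xi>0 \<in> \<Gamma>1" "C1 > 0" "N1 > 0" "\<And>N. N \<ge> N1 \<Longrightarrow> \<exists>h. continuous_on UNIV h \<and> is_function (fourier (mult_dist u (gauss x0 N))) h \<and>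
           (\<forall>\<xi>\<in>\<Gamma>1. \<forall>n\<le>N. cmod (h \<xi>) \<le> C1 ^ (n + 1) * gevrey_weight s n / jap \<xi> ^ n)"
    using u unfolding gevrey_decay_def by blast
  obtain \<Gamma>2 C2 N2 where 2: "open_cone \<Gamma>2" "\<xi>0 \<in> \<Gamma>2" "C2 > 0" "N2 > 0" "\<And>N. N \<ge> N2 \<Longrightarrow> \<exists>h. continuous_on UNIV h \<and> is_function (fourier (mult_dist v (gauss x0 N))) h \<and>
           (\<forall>\<xi>\<in>\<Gamma>2. \<forall>n\<le>N. cmod (h \<xi>) \<le> C2 ^ (n + 1) * gevrey_weight s n / jap \<xi> ^ n)"
    using v unfolding gevrey_decay_def by blast
  show ?thesis
    unfolding gevrey_decay_def
  proof (rule exI [of _ "\<Gamma>1 \<inter> \<Gamma>2"], rule exI [of _ "C1 + C2"], rule exI [of _ "max N1 N2"], intro conjI allI impI)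
    show "open_cone (\<Gamma>1 \<inter> \<Gamma>2)" using 1(1) 2(1) unfolding open_cone_def by auto
    show "\<xi>0 \<in> \<Gamma>1 \<inter> \<Gamma>2" "C1 + C2 > 0" "max N1 N2 > 0" using 1 2 by auto
    fix N assume N: "max N1 N2 \<le> N"
    obtain h where h: "continuous_on UNIV h" "is_function (fourier (mult_dist u (gauss x0 N))) h"
      "\<And>\<xi> n. \<xi> \<in> \<Gamma>1 \<Longrightarrow> n \<le> N \<Longrightarrow> cmod (h \<xi>) \<le> C1 ^ (n + 1) * gevrey_weight s n / jap \<xi> ^ n"
      using 1(5) [of N] N by auto
    obtain k where k: "continuous_on UNIV k" "is_function (fourier (mult_dist v (gauss x0 N))) k"
      "\<And>\<xi> n. \<xi> \<in> \<Gamma>2 \<Longrightarrow> n \<le> N \<Longrightarrow> cmod (k \<xi>) \<le> C2 ^ (n + 1) * gevrey_weight s n / jap \<xi> ^ n"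
      using 2(5) [of N] N by auto
    have "is_function (fourier (mult_dist (\<lambda>\<phi>. u \<phi> + v \<phi>) (gauss x0 N))) (\<lambda>\<xi>. h \<xi> + k \<xi>)"
      unfolding is_function_def
    proof (intro conjI ballI)
      show "(\<lambda>\<xi>. h \<xi> + k \<xi>) \<in> borel_measurable lborel" using is_functionD(1) [OF h(2)] is_functionD(1) [OF k(2)] by simp
      fix \<phi> :: "'a cfun" assume "\<phi> \<in> schwartz_functions"
      then have "has_bochner_integral lborel (\<lambda>x. h x * \<phi> x + k x * \<phi> x)
        (fourier (mult_dist u (gauss x0 N)) \<phi> + fourier (mult_dist v (gauss x0 N)) \<phi>)"
        using h(2) k(2) unfolding is_function_def by (intro has_bochner_integral_add) auto
      then show "has_bochner_integral lborel (\<lambda>x. (h x + k x) * \<phi> x) (fourier (mult_dist (\<lambda>\<phi>. u \<phi> + v \<phi>) (gauss x0 N)) \<phi>)"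
        by (simp add: fourier_def mult_dist_def distrib_right)
    qed
    moreover have "cmod (h \<xi> + k \<xi>) \<le> (C1 + C2) ^ (n + 1) * gevrey_weight s n / jap \<xi> ^ n"
      if "\<xi> \<in> \<Gamma>1 \<inter> \<Gamma>2" "n \<le> N" for \<xi> n
    proof -
      have p: "C1 ^ (n + 1) + C2 ^ (n + 1) \<le> (C1 + C2) ^ (n + 1)"
      proof (induction n)
        case (Suc n)
        have "C1 * C1 ^ (n + 1) + C2 * C2 ^ (n + 1) \<le> (C1 + C2) * (C1 ^ (n + 1) + C2 ^ (n + 1))"
          using 1(3) 2(3) by (simp add: algebra_simps add_nonneg_nonneg)
        also have "\<dots> \<le> (C1 + C2) * (C1 + C2) ^ (n + 1)" using Suc 1(3) 2(3) by (intro mult_left_mono) auto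
        finally show ?case by simp
      qed simp
      have "cmod (h \<xi> + k \<xi>) \<le> C1 ^ (n + 1) * gevrey_weight s n / jap \<xi> ^ n + C2 ^ (n + 1) * gevrey_weight s n / jap \<xi> ^ n"
        using that by (intro order_trans [OF norm_triangle_ineq add_mono] h k) auto
      also have "\<dots> = (C1 ^ (n + 1) + C2 ^ (n + 1)) * gevrey_weight s n / jap \<xi> ^ n"
        by (simp only: add_divide_distrib distrib_right)
      also have "\<dots> \<le> (C1 + C2) ^ (n + 1) * gevrey_weight s n / jap \<xi> ^ n"
        using gevrey_weight_ge_1 [OF s, of n] by (intro divide_right_mono mult_right_mono p) (auto simp: less_imp_le [OF jap_pos])
      finally show ?thesis .
    qed
    ultimately show "\<exists>h. continuous_on UNIV h \<and> is_function (fourier (mult_dist (\<lambda>\<phi>. u \<phi> + v \<phi>) (gauss x0 N))) h \<and>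
           (\<forall>\<xi>\<in>\<Gamma>1 \<inter> \<Gamma>2. \<forall>n\<le>N. cmod (h \<xi>) \<le> (C1 + C2) ^ (n + 1) * gevrey_weight s n / jap \<xi> ^ n)"
      using h(1) k(1) by (intro exI [of _ "\<lambda>\<xi>. h \<xi> + k \<xi>"]) (auto intro: continuous_on_add)
  qed
qed

lemma gevrey_decay_cmult:
  assumes s: "0 \<le> s" and u: "gevrey_decay s u x0 \<xi>0"
  shows "gevrey_decay s (\<lambda>\<phi>. c * u \<phi>) x0 \<xi>0"
proof -
  obtain \<Gamma> C N0 where 1: "open_cone \<Gamma>" "\<xi>0 \<in> \<Gamma>" "C > 0" "N0 > 0" "\<And>N. N \<ge> N0 \<Longrightarrow> \<exists>h. continuous_on UNIV h \<and> is_function (fourier (mult_dist u (gauss x0 N))) h \<and>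
           (\<forall>\<xi>\<in>\<Gamma>. \<forall>n\<le>N. cmod (h \<xi>) \<le> C ^ (n + 1) * gevrey_weight s n / jap \<xi> ^ n)"
    using u unfolding gevrey_decay_def by blast
  \<comment> \<open>With \<open>cmod c\<close> itself the constant could be 0, and powers of a
    number below 1 would not dominate \<open>cmod c\<close>.\<close>
  define b where "b = max 1 (cmod c)"
  have b: "1 \<le> b" "cmod c \<le> b" by (auto simp: b_def)
  show ?thesis
    unfolding gevrey_decay_def
  proof (rule exI [of _ \<Gamma>], rule exI [of _ "b * C"], rule exI [of _ N0], intro conjI allI impI 1)
    show "b * C > 0" using b 1(3) by simp
    fix N assume N: "N0 \<le> N"
    obtain h where h: "continuous_on UNIV h" "is_function (fourier (mult_dist u (gauss x0 N))) h"
      "\<And>\<xi> n. \<xi> \<in> \<Gamma> \<Longrightarrow> n \<le> N \<Longrightarrow> cmod (h \<xi>) \<le> C ^ (n + 1) * gevrey_weight s n / jap \<xi> ^ n"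
      using 1(5) [of N] N by auto
    have "is_function (fourier (mult_dist (\<lambda>\<phi>. c * u \<phi>) (gauss x0 N))) (\<lambda>\<xi>. c * h \<xi>)"
      unfolding is_function_def
    proof (intro conjI ballI)
      show "(\<lambda>\<xi>. c * h \<xi>) \<in> borel_measurable lborel" using is_functionD(1) [OF h(2)] by simp
      fix \<phi> :: "'a cfun" assume "\<phi> \<in> schwartz_functions"
      then have "has_bochner_integral lborel (\<lambda>x. c * (h x * \<phi> x)) (c * fourier (mult_dist u (gauss x0 N)) \<phi>)"
        using h(2) unfolding is_function_def by (intro has_bochner_integral_mult_right) auto
      then show "has_bochner_integral lborel (\<lambda>x. c * h x * \<phi> x) (fourier (mult_dist (\<lambda>\<phi>. c * u \<phi>) (gauss x0 N)) \<phi>)"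
        by (simp add: fourier_def mult_dist_def mult.assoc)
    qed
    moreover have "cmod (c * h \<xi>) \<le> (b * C) ^ (n + 1) * gevrey_weight s n / jap \<xi> ^ n" if "\<xi> \<in> \<Gamma>" "n \<le> N" for \<xi> n
    proof -
      have "b ^ 1 \<le> b ^ (n + 1)" using b(1) by (intro power_increasing) auto
      with b(2) have "cmod c \<le> b ^ (n + 1)" by simp
      then have "cmod (c * h \<xi>) \<le> b ^ (n + 1) * (C ^ (n + 1) * gevrey_weight s n / jap \<xi> ^ n)"
        unfolding norm_mult using h(3) [OF that] b by (intro mult_mono) auto
      then show ?thesis by (simp only: power_mult_distrib times_divide_eq_right mult.assoc)
    qed
    ultimately show "\<exists>h. continuous_on UNIV h \<and> is_function (fourier (mult_dist (\<lambda>\<phi>. c * u \<phi>) (gauss x0 N))) h \<and>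
           (\<forall>\<xi>\<in>\<Gamma>. \<forall>n\<le>N. cmod (h \<xi>) \<le> (b * C) ^ (n + 1) * gevrey_weight s n / jap \<xi> ^ n)"
      using h(1) by (intro exI [of _ "\<lambda>\<xi>. c * h \<xi>"]) (auto intro: continuous_on_mult continuous_on_const)
  qed
qed

text \<open>Near the origin the decay estimate of the conclusion requires a bound that is uniform in \<open>N\<close>,
  whereas the Fourier transform outside the cone is only bounded by a power of \<open>N\<close>. Derivatives are
  therefore replaced by one-sided finite differences with step \<open>1 / N\<close>, which stay inside the cone.\<close>
lemma low_frequency_bound:
  fixes H :: "nat \<Rightarrow> ('n::finite) cfun"
  assumes meas: "\<And>N. N0 \<le> N \<Longrightarrow> H N \<in> borel_measurable borel"
    and B: "0 \<le> B" "\<And>N \<xi>. N0 \<le> N \<Longrightarrow> cmod (H N \<xi>) \<le> B * (real N * (1 + norm \<xi>)) ^ m"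
    and half: "\<And>N. N0 \<le> N \<Longrightarrow> H N = kint x0 (H (2 * N)) (2 * real N)"
    and C: "\<And>N \<xi>. N0 \<le> N \<Longrightarrow> \<xi> \<in> \<Gamma> \<Longrightarrow> cmod (H N \<xi>) \<le> C"
    and v: "\<And>\<xi> r. \<xi> \<in> \<Gamma> \<Longrightarrow> 0 \<le> r \<Longrightarrow> \<xi> + r *\<^sub>R v \<in> \<Gamma>"
  shows "\<exists>Q N1. \<forall>N\<ge>N1. \<forall>\<xi>\<in>\<Gamma>. norm \<xi> \<le> 1 \<longrightarrow>
    integrable lborel (\<lambda>\<eta>. H (2 * N) \<eta> * (of_real ((\<eta> - \<xi>) \<bullet> v) * kern x0 (2 * real N) (\<eta> - \<xi>))) \<and>
    cmod (LINT \<eta>|lborel. H (2 * N) \<eta> * (of_real ((\<eta> - \<xi>) \<bullet> v) * kern x0 (2 * real N) (\<eta> - \<xi>))) \<le> Q"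
proof -
  \<comment> \<open>Exactness up to order \<open>2 * m + 1\<close> leaves a remainder of relative
    size \<open>N^(- m - 1)\<close>, which beats the growth \<open>N^m\<close> of
    \<open>H N\<close>.\<close>
  obtain cs where cs: "\<And>a. a \<le> Suc (2 * m) \<Longrightarrow> node_sum cs (\<lambda>l. real l ^ a) = (if a = 1 then 1 else 0)"
    using differentiation_nodes by blast
  define L where "L = Max (insert 1 (snd ` set cs))"
  have L1: "1 \<le> L" unfolding L_def by (rule Max_ge) auto
  have L: "l \<le> L" if "(c, l) \<in> set cs" for c l
    unfolding L_def using that by (intro Max_ge) force+
  define Cs where "Cs = node_sum (map (\<lambda>(c, l). (\<bar>c\<bar>, l)) cs) (\<lambda>_. 1 :: real)"
  have "node_sum (map (\<lambda>(c, l). (\<bar>c\<bar>, l)) bs) (\<lambda>_. 1 :: real) \<ge> 0" for bs by (induction bs) auto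
  then have Cs: "Cs \<ge> 0" unfolding Cs_def .
  define R0 where "R0 = 2 * Cs * exp (6 * (norm v)\<^sup>2) * sqrt 2 ^ CARD('n)"
  have R0: "R0 \<ge> 0" using Cs by (simp add: R0_def)
  \<comment> \<open>The trivial weight: only polynomial growth, and no decay, has to pass through
    the kernel.\<close>
  have "\<exists>K>0. gaussian_bound (\<lambda>_ :: real ^ 'n. 1) m 0 K" by (rule gaussian_estimate) auto
  then obtain K where K: "K > 0" "gaussian_bound (\<lambda>_ :: real ^ 'n. 1) m 0 K" by blast
  define N1 where "N1 = max 2 (max N0 (4 * L\<^sup>2))"
  define Q where "Q = Cs * C + K * (R0 * real L ^ (2 * m + 2) * B * 4 ^ m) * 2 ^ m"
  have "integrable lborel (\<lambda>\<eta>. H (2 * N) \<eta> * (of_real ((\<eta> - \<xi>) \<bullet> v) * kern x0 (2 * real N) (\<eta> - \<xi>))) \<and>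
    cmod (LINT \<eta>|lborel. H (2 * N) \<eta> * (of_real ((\<eta> - \<xi>) \<bullet> v) * kern x0 (2 * real N) (\<eta> - \<xi>))) \<le> Q / 4"
    if N: "N1 \<le> N" and \<xi>: "\<xi> \<in> \<Gamma>" and n1: "norm \<xi> \<le> 1" for N \<xi>
  proof -
    have N': "N0 \<le> N" "N0 \<le> 2 * N" "real N \<ge> 2" using N by (auto simp: N1_def)
    have "4 * L\<^sup>2 \<le> N" using N by (simp add: N1_def)
    from of_nat_mono [OF this, where 'a = real] have NL: "4 * (real L)\<^sup>2 \<le> real N" by simp
    have N2: "2 * real N > 0" using N' by simp
    define h where "h = H (2 * N)"
    have hm [measurable]: "h \<in> borel_measurable borel" unfolding h_def by (rule meas [OF N'(2)])
    have hB: "cmod (h \<eta>) \<le> B * (4 * real N) ^ m * jap \<eta> ^ m" for \<eta>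
    proof -
      have "1 + norm \<eta> \<le> 2 * jap \<eta>" using norm_le_jap [of \<eta>] jap_ge_1 [of \<eta>] by linarith
      then have "real (2 * N) * (1 + norm \<eta>) \<le> (4 * real N) * jap \<eta>"
        using mult_left_mono [of "1 + norm \<eta>" "2 * jap \<eta>" "2 * real N"] by simp
      then have "(real (2 * N) * (1 + norm \<eta>)) ^ m \<le> ((4 * real N) * jap \<eta>) ^ m" by (intro power_mono) auto
      from order_trans [OF B(2) [OF N'(2), of \<eta>] mult_left_mono [OF this B(1)]]
      show ?thesis by (simp add: h_def power_mult_distrib mult_ac)
    qed
    have hp: "poly_bounded h" using hB by (rule poly_bounded_jap)
    \<comment> \<open>With the modulation inside \<open>F\<close>, the real difference formula for
      \<open>heat\<close> applies. Shifting the modulated kernel instead changes a factor of modulus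
      1 only.\<close>
    define F where "F = (\<lambda>\<eta>. h \<eta> * exp (\<i> * of_real (x0 \<bullet> (\<eta> - \<xi>))))"
    have [measurable]: "F \<in> borel_measurable borel" unfolding F_def by measurable
    have normF: "cmod (F \<eta>) = cmod (h \<eta>)" for \<eta> by (simp add: F_def norm_mult norm_exp_eq_Re)
    define d where "d = (\<lambda>l \<eta>. heat (2 * real N) (\<eta> - \<xi> - (real l / real N) *\<^sub>R v))"
    have shift: "F \<eta> * of_real (d l \<eta>) =
      exp (\<i> * of_real (x0 \<bullet> ((real l / real N) *\<^sub>R v))) * (h \<eta> * kern x0 (2 * real N) (\<eta> - (\<xi> + (real l / real N) *\<^sub>R v)))" for l \<eta>
    proof -
      have "exp (\<i> * complex_of_real (x0 \<bullet> (\<eta> - \<xi>))) = exp (\<i> * of_real (x0 \<bullet> ((real l / real N) *\<^sub>R v))) *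
        exp (\<i> * of_real (x0 \<bullet> (\<eta> - \<xi> - (real l / real N) *\<^sub>R v)))"
        by (simp add: inner_diff_right right_diff_distrib flip: exp_add)
      then show ?thesis by (simp add: F_def d_def kern_def diff_diff_eq mult_ac)
    qed
    have di: "integrable lborel (\<lambda>\<eta>. F \<eta> * of_real (d l \<eta>))" for l
      unfolding shift by (intro integrable_mult_right kern_integrable N2 hm hp)
    \<comment> \<open>A shifted kernel evaluates \<open>H N\<close> at a shifted point, and this
      point is still in the cone because the nodes are nonnegative.\<close>
    have dC: "cmod (LINT \<eta>|lborel. F \<eta> * of_real (d l \<eta>)) \<le> C" for l
    proof -
      have "cmod (LINT \<eta>|lborel. F \<eta> * of_real (d l \<eta>)) = cmod (kint x0 h (2 * real N) (\<xi> + (real l / real N) *\<^sub>R v))"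
        by (simp add: shift kint_def norm_mult norm_exp_eq_Re)
      also have "\<dots> = cmod (H N (\<xi> + (real l / real N) *\<^sub>R v))" using half [OF N'(1)] by (simp add: h_def)
      also have "\<dots> \<le> C" using N' by (intro C v \<xi>) auto
      finally show ?thesis .
    qed
    have nsi: "integrable lborel (\<lambda>\<eta>. F \<eta> * of_real (node_sum bs (\<lambda>l. d l \<eta>))) \<and>
      (LINT \<eta>|lborel. F \<eta> * of_real (node_sum bs (\<lambda>l. d l \<eta>))) = node_sum bs (\<lambda>l. (LINT \<eta>|lborel. F \<eta> * of_real (d l \<eta>)))" for bs
    proof (induction bs)
      case (Cons x bs)
      obtain c l where x: "x = (c, l)" by fastforce
      have "F \<eta> * of_real (node_sum (x # bs) (\<lambda>l. d l \<eta>)) = c *\<^sub>R (F \<eta> * of_real (d l \<eta>)) + F \<eta> * of_real (node_sum bs (\<lambda>l. d l \<eta>))" for \<eta>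
        by (simp add: x algebra_simps scaleR_conv_of_real)
      then show ?case using Cons.IH di [of l] by (simp add: x)
    qed simp
    define rem where "rem = (\<lambda>\<eta>. node_sum cs (\<lambda>l. d l \<eta>) - 4 * ((\<eta> - \<xi>) \<bullet> v) * heat (2 * real N) (\<eta> - \<xi>))"
    define A where "A = R0 * (real L / sqrt (real N)) ^ (2 * m + 2)"
    have rem: "\<bar>rem \<eta>\<bar> \<le> A * heat (real N) (\<eta> - \<xi>)" for \<eta>
      using heat_finite_difference [OF cs L L1 Cs_def NL, where v = v and t = "\<eta> - \<xi>"]
      by (simp add: rem_def d_def A_def R0_def)
    have A: "A \<ge> 0" using R0 by (simp add: A_def)
    have "(\<lambda>\<eta>. node_sum bs (\<lambda>l. d l \<eta>)) \<in> borel_measurable borel" for bs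
    proof (induction bs)
      case (Cons x bs)
      obtain c l where x: "x = (c, l)" by fastforce
      have "d l \<in> borel_measurable borel" unfolding d_def by measurable
      then show ?case using Cons by (simp add: x)
    qed simp
    then have [measurable]: "rem \<in> borel_measurable borel" unfolding rem_def by measurable
    have Frem: "cmod (F \<eta> * of_real (rem \<eta>)) \<le> A * (cmod (h \<eta>) * heat (real N) (\<eta> - \<xi>))" for \<eta>
      using mult_left_mono [OF rem [of \<eta>], of "cmod (h \<eta>)"] by (simp add: norm_mult normF mult_ac)
    have remi: "integrable lborel (\<lambda>\<eta>. F \<eta> * of_real (rem \<eta>))"
    proof (rule Bochner_Integration.integrable_bound [OF _ _ AE_I2])
      show "integrable lborel (\<lambda>\<eta>. A * (cmod (h \<eta>) * heat (real N) (\<eta> - \<xi>)))"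
        using N' by (intro integrable_mult_right heat_integrable_abs hm hp) auto
      show "cmod (F \<eta> * of_real (rem \<eta>)) \<le> norm (A * (cmod (h \<eta>) * heat (real N) (\<eta> - \<xi>)))" for \<eta>
        using order_trans [OF Frem abs_ge_self] by (simp only: real_norm_def)
    qed measurable
    have remle: "cmod (LINT \<eta>|lborel. F \<eta> * of_real (rem \<eta>)) \<le> K * (R0 * real L ^ (2 * m + 2) * B * 4 ^ m) * 2 ^ m"
    proof -
      have "cmod (LINT \<eta>|lborel. F \<eta> * of_real (rem \<eta>)) \<le> K * exp ((real 0)\<^sup>2 / (4 * (real N / 2))) * (A * (B * (4 * real N) ^ m)) * (jap \<xi> ^ m / 1 ^ 0)"
      proof (rule gaussian_boundD [OF K(2)])
        fix \<eta>
        have "A * (cmod (h \<eta>) * heat (real N) (\<eta> - \<xi>)) \<le> A * ((B * (4 * real N) ^ m * jap \<eta> ^ m) * heat (real N) (\<eta> - \<xi>))"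
          using A by (intro mult_left_mono mult_right_mono hB) auto
        from order_trans [OF Frem this]
        show "cmod (F \<eta> * of_real (rem \<eta>)) \<le> (A * (B * (4 * real N) ^ m)) * (jap \<eta> ^ m / 1 ^ 0) * (1 + sqrt (real N / 2) * norm (\<eta> - \<xi>)) ^ 0 * heat (2 * (real N / 2)) (\<eta> - \<xi>)"
          by (simp add: mult_ac)
      qed (use N' A B in auto)
      also have "\<dots> = K * (A * real N ^ m * (B * 4 ^ m)) * jap \<xi> ^ m" by (simp add: power_mult_distrib mult_ac)
      also have "\<dots> \<le> K * ((R0 * real L ^ (2 * m + 2)) * (B * 4 ^ m)) * 2 ^ m"
      proof -
        have e: "2 * m + 2 = 2 * (m + 1)" by simp
        have "sqrt (real N) ^ (2 * m + 2) = real N ^ (m + 1)" unfolding e power_mult by simp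
        then have "A * real N ^ m = R0 * real L ^ (2 * m + 2) * (real N ^ m / real N ^ (m + 1))"
          by (simp only: A_def power_divide) simp
        also have "\<dots> \<le> R0 * real L ^ (2 * m + 2) * 1"
          using R0 N' by (intro mult_left_mono) (auto simp: field_simps)
        finally have AN: "A * real N ^ m \<le> R0 * real L ^ (2 * m + 2)" by simp
        have J: "jap \<xi> ^ m \<le> 2 ^ m" using jap_le [of \<xi>] n1 jap_pos [of \<xi>] by (intro power_mono) auto
        have B4: "0 \<le> B * 4 ^ m" using B by simp
        have "K * (A * real N ^ m * (B * 4 ^ m)) \<le> K * ((R0 * real L ^ (2 * m + 2)) * (B * 4 ^ m))"
          using K(1) by (intro mult_left_mono mult_right_mono [OF AN B4]) auto
        then show ?thesis
          by (rule mult_mono [OF _ J]) (use K(1) R0 B4 jap_pos [of \<xi>] in auto)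
      qed
      finally show ?thesis by (simp add: mult_ac)
    qed
    have lin: "h \<eta> * (of_real ((\<eta> - \<xi>) \<bullet> v) * kern x0 (2 * real N) (\<eta> - \<xi>)) =
      (F \<eta> * of_real (node_sum cs (\<lambda>l. d l \<eta>)) - F \<eta> * of_real (rem \<eta>)) / 4" for \<eta>
      by (simp add: rem_def F_def kern_def algebra_simps)
    have "cmod (LINT \<eta>|lborel. h \<eta> * (of_real ((\<eta> - \<xi>) \<bullet> v) * kern x0 (2 * real N) (\<eta> - \<xi>))) =
      cmod (node_sum cs (\<lambda>l. (LINT \<eta>|lborel. F \<eta> * of_real (d l \<eta>))) - (LINT \<eta>|lborel. F \<eta> * of_real (rem \<eta>))) / 4"
      unfolding lin using nsi [of cs] remi by (simp add: norm_divide)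
    also have "\<dots> \<le> Q / 4"
    proof -
      have "cmod (node_sum cs (\<lambda>l. (LINT \<eta>|lborel. F \<eta> * of_real (d l \<eta>)))) \<le> Cs * C"
        unfolding Cs_def by (rule norm_node_sum_le) (rule dC)
      from order_trans [OF norm_triangle_ineq4 add_mono [OF this remle]]
      show ?thesis unfolding Q_def by (intro divide_right_mono) auto
    qed
    finally have "cmod (LINT \<eta>|lborel. h \<eta> * (of_real ((\<eta> - \<xi>) \<bullet> v) * kern x0 (2 * real N) (\<eta> - \<xi>))) \<le> Q / 4" .
    moreover have "integrable lborel (\<lambda>\<eta>. h \<eta> * (of_real ((\<eta> - \<xi>) \<bullet> v) * kern x0 (2 * real N) (\<eta> - \<xi>)))"
      unfolding lin using nsi [of cs] remi by simp
    ultimately show ?thesis unfolding h_def by blast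
  qed
  then show ?thesis by blast
qed

lemma gevrey_decay_partial_deriv:
  fixes u :: "('n::finite) functional"
  assumes u: "u \<in> tempered_distributions" and dec: "gevrey_decay s u x0 \<xi>0" and s: "0 \<le> s" "s \<le> 1"
  shows "gevrey_decay s (\<lambda>\<phi>. u (partial_deriv j \<phi>)) x0 \<xi>0"
proof -
  obtain \<Gamma> C N0 where \<Gamma>: "open_cone \<Gamma>" "\<xi>0 \<in> \<Gamma>" and C: "C > 0" and N0: "N0 > 0"
    and dec': "\<forall>N\<ge>N0. \<exists>k. continuous_on UNIV k \<and> is_function (fourier (mult_dist u (gauss x0 N))) k \<and>
      (\<forall>\<xi>\<in>\<Gamma>. \<forall>n\<le>N. cmod (k \<xi>) \<le> C ^ (n + 1) * gevrey_weight s n / jap \<xi> ^ n)"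
    using dec unfolding gevrey_decay_def by blast
  have "\<forall>N. \<exists>k. N0 \<le> N \<longrightarrow> continuous_on UNIV k \<and> is_function (fourier (mult_dist u (gauss x0 N))) k \<and>
      (\<forall>\<xi>\<in>\<Gamma>. \<forall>n\<le>N. cmod (k \<xi>) \<le> C ^ (n + 1) * gevrey_weight s n / jap \<xi> ^ n)"
  proof (rule allI)
    fix N
    show "\<exists>k. N0 \<le> N \<longrightarrow> continuous_on UNIV k \<and> is_function (fourier (mult_dist u (gauss x0 N))) k \<and>
      (\<forall>\<xi>\<in>\<Gamma>. \<forall>n\<le>N. cmod (k \<xi>) \<le> C ^ (n + 1) * gevrey_weight s n / jap \<xi> ^ n)"
      using spec [OF dec', of N] by (cases "N0 \<le> N") simp_all
  qed
  from choice [OF this] obtain H where H: "\<forall>N. N0 \<le> N \<longrightarrow> continuous_on UNIV (H N) \<and> is_function (fourier (mult_dist u (gauss x0 N))) (H N) \<and>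
      (\<forall>\<xi>\<in>\<Gamma>. \<forall>n\<le>N. cmod (H N \<xi>) \<le> C ^ (n + 1) * gevrey_weight s n / jap \<xi> ^ n)"
    ..
  have Hcont: "continuous_on UNIV (H N)" and Hfun: "is_function (fourier (mult_dist u (gauss x0 N))) (H N)" if "N0 \<le> N" for N
    using H that by blast+
  have Hdec: "cmod (H N \<xi>) \<le> C ^ (n + 1) * gevrey_weight s n / jap \<xi> ^ n" if "N0 \<le> N" "\<xi> \<in> \<Gamma>" "n \<le> N" for N \<xi> n
    using H that by blast
  obtain B m where B: "B \<ge> 0" "\<And>N h \<xi>. N > 0 \<Longrightarrow> continuous_on UNIV h \<Longrightarrow> is_function (fourier (mult_dist u (gauss x0 N))) h \<Longrightarrow>
    cmod (h \<xi>) \<le> B * (real N * (1 + norm \<xi>)) ^ m"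
    using tempered_pointwise_bound [OF u, of x0] by blast
  have HB: "cmod (H N \<xi>) \<le> B * (real N * (1 + norm \<xi>)) ^ m" if "N0 \<le> N" for N \<xi>
    using that N0 by (intro B(2) Hcont Hfun) auto
  have Hm: "H N \<in> borel_measurable borel" if "N0 \<le> N" for N by (rule is_functionD(1) [OF Hfun [OF that]])
  have Hp: "poly_bounded (H N)" if "N0 \<le> N" for N
    unfolding poly_bounded_def using HB [OF that]
    by (intro exI [of _ "B * real N ^ m"] exI [of _ m]) (simp add: power_mult_distrib mult.assoc)
  have half: "H N = kint x0 (H (2 * N)) (2 * real N)" if N: "N0 \<le> N" for N
  proof -
    have N': "N > 0" "2 * N > 0" "N0 \<le> 2 * N" "2 * real N > 0" using N N0 by auto
    \<comment> \<open>The Gaussian of parameter \<open>N\<close> is the square of that of parameter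
      \<open>2 * N\<close>; uniqueness of the continuous representative turns this into an identity
      of functions.\<close>
    have "mult_dist (mult_dist u (gauss x0 (2 * N))) (gauss x0 (2 * N)) = mult_dist u (gauss x0 N)"
      by (rule ext) (simp add: mult_dist_def gauss_half [OF N'(1), abs_def] mult.assoc)
    then have "is_function (fourier (mult_dist u (gauss x0 N))) (kint x0 (H (2 * N)) (2 * real N))"
      using is_function_gauss [OF Hfun [OF N'(3)] Hp [OF N'(3)] N'(2), of x0] by simp
    then show ?thesis
      by (rule is_function_unique [OF Hfun [OF N] _ Hcont [OF N] kint_continuous [OF N'(4) Hm [OF N'(3)] Hp [OF N'(3)]]])
  qed
  obtain \<epsilon>2 where \<epsilon>2: "\<epsilon>2 > 0" "ball \<xi>0 \<epsilon>2 \<subseteq> \<Gamma>"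
    using \<Gamma> unfolding open_cone_def by (meson openE)
  have \<xi>0: "\<xi>0 \<noteq> 0" using \<Gamma> by (auto simp: open_cone_def)
  define \<epsilon> where "\<epsilon> = min \<epsilon>2 (norm \<xi>0 / 2)"
  have \<epsilon>: "0 < \<epsilon>" "\<epsilon> < norm \<xi>0" using \<epsilon>2 \<xi>0 by (auto simp: \<epsilon>_def min_def)
  define K1 where "K1 = cone_around \<xi>0 \<epsilon>"
  have "ball \<xi>0 \<epsilon> \<subseteq> \<Gamma>" using \<epsilon>2(2) by (auto simp: \<epsilon>_def)
  then have K1\<Gamma>: "K1 \<subseteq> \<Gamma>" unfolding K1_def by (intro cone_around_subset \<Gamma>)
  have K1o: "open_cone K1" unfolding K1_def by (rule open_cone_around [OF \<epsilon>])
  have K1h: "cone_around \<xi>0 (\<epsilon> / 2) \<subseteq> K1" unfolding K1_def using \<epsilon> by (intro cone_around_mono) simp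
  define w where "w = cone_weight K1"
  have wp: "0 < w \<xi>" for \<xi> unfolding w_def by (rule cone_weight_pos)
  have wj: "w \<xi> \<le> jap \<xi>" for \<xi> unfolding w_def using K1o by (intro cone_weight_le_jap) (simp add: open_cone_def)
  define c where "c = \<epsilon> / (4 * norm \<xi>0)"
  have c: "c > 0" unfolding c_def using \<epsilon> \<xi>0 by simp
  have ci: "c * norm \<xi> \<le> infdist \<xi> (- K1)" if "\<xi> \<in> cone_around \<xi>0 (\<epsilon> / 2)" for \<xi>
    unfolding c_def K1_def by (rule cone_around_infdist [OF \<epsilon> that])
  define T where "T = (\<lambda>N \<xi>. LINT \<eta>|lborel. H (2 * N) \<eta> * (of_real ((\<eta> - \<xi>) $ j) * kern x0 (2 * real N) (\<eta> - \<xi>)))"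
  define H' where "H' = (\<lambda>N \<xi>. - \<i> * (2 * kint x0 (\<lambda>\<eta>. of_real (\<eta> $ j) * H (2 * N) \<eta>) (2 * real N) \<xi> -
    of_real (\<xi> $ j) * kint x0 (H (2 * N)) (2 * real N) \<xi>))"
  have Ti: "integrable lborel (\<lambda>\<eta>. H (2 * N) \<eta> * (of_real ((\<eta> - \<xi>) $ j) * kern x0 (2 * real N) (\<eta> - \<xi>)))"
    and T_eq: "kint x0 (\<lambda>\<eta>. of_real (\<eta> $ j) * H (2 * N) \<eta>) (2 * real N) \<xi> = T N \<xi> + of_real (\<xi> $ j) * H N \<xi>"
    if N: "N0 \<le> N" for N \<xi>
  proof -
    have N': "2 * real N > 0" "N0 \<le> 2 * N" using N N0 by auto
    have i1: "integrable lborel (\<lambda>\<eta>. of_real (\<eta> $ j) * H (2 * N) \<eta> * kern x0 (2 * real N) (\<eta> - \<xi>))"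
      using Hm [OF N'(2)] by (intro kern_integrable N' poly_bounded_coord_mult Hp) measurable
    have i2: "integrable lborel (\<lambda>\<eta>. of_real (\<xi> $ j) * (H (2 * N) \<eta> * kern x0 (2 * real N) (\<eta> - \<xi>)))"
      by (intro integrable_mult_right kern_integrable N' Hm Hp)
    have eq: "H (2 * N) \<eta> * (of_real ((\<eta> - \<xi>) $ j) * kern x0 (2 * real N) (\<eta> - \<xi>)) =
      of_real (\<eta> $ j) * H (2 * N) \<eta> * kern x0 (2 * real N) (\<eta> - \<xi>) - of_real (\<xi> $ j) * (H (2 * N) \<eta> * kern x0 (2 * real N) (\<eta> - \<xi>))" for \<eta>
      by (simp add: algebra_simps)
    show "integrable lborel (\<lambda>\<eta>. H (2 * N) \<eta> * (of_real ((\<eta> - \<xi>) $ j) * kern x0 (2 * real N) (\<eta> - \<xi>)))"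
      unfolding eq by (rule Bochner_Integration.integrable_diff [OF i1 i2])
    have "T N \<xi> = kint x0 (\<lambda>\<eta>. of_real (\<eta> $ j) * H (2 * N) \<eta>) (2 * real N) \<xi> - of_real (\<xi> $ j) * kint x0 (H (2 * N)) (2 * real N) \<xi>"
      unfolding T_def eq kint_def Bochner_Integration.integral_diff [OF i1 i2] by (simp only: integral_mult_right_zero)
    then show "kint x0 (\<lambda>\<eta>. of_real (\<eta> $ j) * H (2 * N) \<eta>) (2 * real N) \<xi> = T N \<xi> + of_real (\<xi> $ j) * H N \<xi>"
      using half [OF N] by simp
  qed
  have H'_eq: "H' N \<xi> = - \<i> * (of_real (\<xi> $ j) * H N \<xi> + 2 * T N \<xi>)" if N: "N0 \<le> N" for N \<xi>
    unfolding H'_def T_eq [OF N] using half [OF N] by (simp add: algebra_simps)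
  have norm_H': "cmod (H' N \<xi>) = cmod (of_real (\<xi> $ j) * H N \<xi> + 2 * T N \<xi>)" if N: "N0 \<le> N" for N \<xi>
    unfolding H'_eq [OF N] norm_mult [of "- \<i>"] by simp

  have low: "\<exists>Q N1. \<forall>N\<ge>N1. \<forall>\<xi>\<in>K1. norm \<xi> \<le> 1 \<longrightarrow> cmod (H' N \<xi>) \<le> Q"
  proof -
    have K1C: "cmod (H N \<xi>) \<le> C" if "N0 \<le> N" "\<xi> \<in> K1" for N \<xi>
      using Hdec [OF that(1), of \<xi> 0] that(2) K1\<Gamma> by (auto simp: gevrey_weight_def)
    have bound: "\<exists>Q N1. \<forall>N\<ge>N1. \<forall>\<xi>\<in>K1. norm \<xi> \<le> 1 \<longrightarrow>
      integrable lborel (\<lambda>\<eta>. H (2 * N) \<eta> * (of_real ((\<eta> - \<xi>) \<bullet> v) * kern x0 (2 * real N) (\<eta> - \<xi>))) \<and>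
      cmod (LINT \<eta>|lborel. H (2 * N) \<eta> * (of_real ((\<eta> - \<xi>) \<bullet> v) * kern x0 (2 * real N) (\<eta> - \<xi>))) \<le> Q"
      if v: "norm (v - \<xi>0) < \<epsilon>" for v
      by (rule low_frequency_bound [OF Hm B(1) HB half K1C]) (use v cone_around_add K1_def in auto)
    \<comment> \<open>Moments are controlled only along directions of the ball that generates the
      cone. Both \<open>\<xi>0\<close> and \<open>v\<close> are such directions, and their
      difference is a multiple of the \<open>j\<close>-th basis vector.\<close>
    define v where "v = \<xi>0 + (\<epsilon> / 2) *\<^sub>R axis j 1"
    have v: "norm (\<xi>0 - \<xi>0) < \<epsilon>" "norm (v - \<xi>0) < \<epsilon>" using \<epsilon> by (auto simp: v_def norm_axis_1)
    obtain Q0 M0 where Q0: "\<And>N \<xi>. M0 \<le> N \<Longrightarrow> \<xi> \<in> K1 \<Longrightarrow> norm \<xi> \<le> 1 \<Longrightarrow>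
      integrable lborel (\<lambda>\<eta>. H (2 * N) \<eta> * (of_real ((\<eta> - \<xi>) \<bullet> \<xi>0) * kern x0 (2 * real N) (\<eta> - \<xi>))) \<and>
      cmod (LINT \<eta>|lborel. H (2 * N) \<eta> * (of_real ((\<eta> - \<xi>) \<bullet> \<xi>0) * kern x0 (2 * real N) (\<eta> - \<xi>))) \<le> Q0"
      using bound [OF v(1)] by blast
    obtain Q1 M1 where Q1: "\<And>N \<xi>. M1 \<le> N \<Longrightarrow> \<xi> \<in> K1 \<Longrightarrow> norm \<xi> \<le> 1 \<Longrightarrow>
      integrable lborel (\<lambda>\<eta>. H (2 * N) \<eta> * (of_real ((\<eta> - \<xi>) \<bullet> v) * kern x0 (2 * real N) (\<eta> - \<xi>))) \<and>
      cmod (LINT \<eta>|lborel. H (2 * N) \<eta> * (of_real ((\<eta> - \<xi>) \<bullet> v) * kern x0 (2 * real N) (\<eta> - \<xi>))) \<le> Q1"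
      using bound [OF v(2)] by blast
    have "cmod (H' N \<xi>) \<le> C + 2 * (2 / \<epsilon> * (Q1 + Q0))"
      if N: "max N0 (max M0 M1) \<le> N" and \<xi>: "\<xi> \<in> K1" "norm \<xi> \<le> 1" for N \<xi>
    proof -
      have N': "N0 \<le> N" "M0 \<le> N" "M1 \<le> N" using N by auto
      have eq: "H (2 * N) \<eta> * (of_real ((\<eta> - \<xi>) $ j) * kern x0 (2 * real N) (\<eta> - \<xi>)) = of_real (2 / \<epsilon>) *
        (H (2 * N) \<eta> * (of_real ((\<eta> - \<xi>) \<bullet> v) * kern x0 (2 * real N) (\<eta> - \<xi>)) - H (2 * N) \<eta> * (of_real ((\<eta> - \<xi>) \<bullet> \<xi>0) * kern x0 (2 * real N) (\<eta> - \<xi>)))" for \<eta>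
      proof -
        have "(\<eta> - \<xi>) $ j = 2 / \<epsilon> * ((\<eta> - \<xi>) \<bullet> v - (\<eta> - \<xi>) \<bullet> \<xi>0)"
          using \<epsilon> by (simp add: v_def inner_add_right inner_axis)
        then show ?thesis by (simp only: of_real_mult of_real_diff) (simp add: algebra_simps)
      qed
      have "cmod (T N \<xi>) = 2 / \<epsilon> * cmod ((LINT \<eta>|lborel. H (2 * N) \<eta> * (of_real ((\<eta> - \<xi>) \<bullet> v) * kern x0 (2 * real N) (\<eta> - \<xi>))) -
        (LINT \<eta>|lborel. H (2 * N) \<eta> * (of_real ((\<eta> - \<xi>) \<bullet> \<xi>0) * kern x0 (2 * real N) (\<eta> - \<xi>))))"
        unfolding T_def eq using Q0 [OF N'(2) \<xi>] Q1 [OF N'(3) \<xi>] \<epsilon>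
        by (simp only: integral_mult_right_zero Bochner_Integration.integral_diff norm_mult norm_of_real) simp
      also have "\<dots> \<le> 2 / \<epsilon> * (Q1 + Q0)"
        using Q0 [OF N'(2) \<xi>] Q1 [OF N'(3) \<xi>] \<epsilon>
        by (intro mult_left_mono order_trans [OF norm_triangle_ineq4 add_mono]) auto
      finally have Tb: "cmod (T N \<xi>) \<le> 2 / \<epsilon> * (Q1 + Q0)" .
      have "cmod (of_real (\<xi> $ j) * H N \<xi>) \<le> 1 * C"
        unfolding norm_mult using \<xi> K1C [OF N'(1) \<xi>(1)] component_le_norm_cart [of \<xi> j]
        by (intro mult_mono) auto
      moreover have "cmod (2 * T N \<xi>) \<le> 2 * (2 / \<epsilon> * (Q1 + Q0))"
        using mult_left_mono [OF Tb, of 2] by (simp only: norm_mult norm_numeral)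
      ultimately show ?thesis
        unfolding norm_H' [OF N'(1)]
        using norm_triangle_ineq [of "of_real (\<xi> $ j) * H N \<xi>" "2 * T N \<xi>"] by linarith
    qed
    then show ?thesis by blast
  qed
  then obtain Q N1 where Q: "\<And>N \<xi>. N1 \<le> N \<Longrightarrow> \<xi> \<in> K1 \<Longrightarrow> norm \<xi> \<le> 1 \<Longrightarrow> cmod (H' N \<xi>) \<le> Q" by blast

  obtain K where K: "K > 0" "gaussian_bound w m (2 * m + 1) K"
    using gaussian_estimate [of w m "2 * m + 1"] cone_weight_ge_1 cone_weight_triangle unfolding w_def by blast
  \<comment> \<open>One constant for both cases of \<open>Hb\<close>: \<open>C\<close> in the cone,
    the constant of the polynomial bound off it.\<close>
  define C2 where "C2 = max 1 C + B * (4 / c\<^sup>2) ^ m"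
  have Bc: "0 \<le> B * (4 / c\<^sup>2) ^ m" using B(1) c by simp
  have C2: "1 \<le> C2" "C \<le> C2" "B * (4 / c\<^sup>2) ^ m \<le> C2" using Bc by (auto simp: C2_def)
  obtain C3 where C3: "C3 > 0" "\<And>n \<xi>. jap \<xi> \<le> (1 + 1 / c) * w \<xi> \<Longrightarrow>
    (2 * K * C2) * (C2 * exp 1) ^ (n + (m + 1)) * gevrey_weight s (n + (m + 1)) * (jap \<xi> ^ (m + 1) / w \<xi> ^ (n + (m + 1))) \<le> C3 ^ (n + 1) * gevrey_weight s n / jap \<xi> ^ n"
  proof -
    have "0 \<le> 2 * K * C2" "0 \<le> C2 * exp 1" using K(1) C2 by auto
    from decay_from_weight [of s w "2 * K * C2" "C2 * exp 1" "1 + 1 / c" "m + 1", OF s wp this] show ?thesis using that by blast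
  qed
  have high: "cmod (H' N \<xi>) \<le> C3 ^ (n + 1) * gevrey_weight s n / jap \<xi> ^ n"
    if N: "N0 + m + 1 \<le> N" and \<xi>: "\<xi> \<in> cone_around \<xi>0 (\<epsilon> / 2)" "1 \<le> norm \<xi>" and n: "n \<le> N" for N \<xi> n
  proof -
    \<comment> \<open>The growth of \<open>H (2 * N)\<close> costs \<open>m\<close> orders, the
      factor of size \<open>\<xi>\<close> brought by the derivative costs one more.\<close>
    define k where "k = n + (m + 1)"
    have N': "N0 \<le> N" "N0 \<le> 2 * N" "real N \<ge> 1" "k \<le> 2 * N" "2 * real N > 0" using N n by (auto simp: k_def)
    have W: "1 \<le> gevrey_weight s k" by (rule gevrey_weight_ge_1 [OF s(1)])
    define A0 where "A0 = C2 ^ (k + 1) * gevrey_weight s k"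
    have A0: "C2 \<le> A0" "0 \<le> A0"
    proof -
      have "C2 * 1 \<le> C2 ^ (k + 1) * gevrey_weight s k"
        using C2 W self_le_power [of C2 "k + 1"] by (intro mult_mono) auto
      then show "C2 \<le> A0" by (simp only: A0_def mult_1_right)
      with C2(1) show "0 \<le> A0" by linarith
    qed
    have Hb: "cmod (H (2 * N) \<eta>) \<le> A0 * (jap \<eta> ^ m / w \<eta> ^ k) * (1 + sqrt (real N) * norm (\<eta> - \<xi>)) ^ (2 * m)" for \<eta>
    proof (cases "\<eta> \<in> K1")
      case True
      have "cmod (H (2 * N) \<eta>) \<le> C ^ (k + 1) * gevrey_weight s k / jap \<eta> ^ k"
        using True K1\<Gamma> N' by (intro Hdec) auto
      also have "\<dots> \<le> A0 / w \<eta> ^ k"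
        unfolding A0_def using C C2 W wj [of \<eta>] wp [of \<eta>]
        by (intro frac_le mult_right_mono power_mono) (auto intro!: mult_nonneg_nonneg)
      also have "\<dots> = A0 * (1 / w \<eta> ^ k) * 1" by simp
      also have "\<dots> \<le> A0 * (jap \<eta> ^ m / w \<eta> ^ k) * (1 + sqrt (real N) * norm (\<eta> - \<xi>)) ^ (2 * m)"
        using A0 wp [of \<eta>] one_le_power [OF jap_ge_1 [of \<eta>], of m] one_le_power [of "1 + sqrt (real N) * norm (\<eta> - \<xi>)" "2 * m"]
        by (intro mult_mono mult_left_mono divide_right_mono) (auto intro!: mult_nonneg_nonneg)
      finally show ?thesis .
    next
      case False
      define \<tau> where "\<tau> = sqrt (real N) * norm (\<eta> - \<xi>)"
      have \<tau>: "\<tau> \<ge> 0" by (simp add: \<tau>_def)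
      \<comment> \<open>Here \<open>norm \<xi> \<ge> 1\<close> enters: \<open>\<eta>\<close> lies at
        distance at least \<open>c\<close> from \<open>\<xi>\<close>, so \<open>N\<close> is at most
        \<open>(1 + \<tau>)^2 / c^2\<close>. The \<open>m\<close>-th power of \<open>N\<close> is
        thus traded for a moment of order \<open>2 * m\<close>, which the kernel absorbs; the weight
        of \<open>\<eta>\<close> is 1, so no decay is asked for.\<close>
      have "c \<le> c * norm \<xi>" using c \<xi>(2) by simp
      also have "\<dots> \<le> infdist \<xi> (- K1)" by (rule ci [OF \<xi>(1)])
      also have "\<dots> \<le> norm (\<eta> - \<xi>)" using infdist_le [of \<eta> "- K1" \<xi>] False by (simp add: dist_norm norm_minus_commute)
      finally have "real N * c\<^sup>2 \<le> real N * (norm (\<eta> - \<xi>))\<^sup>2" using c by (intro mult_left_mono power_mono) auto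
      also have "\<dots> = \<tau>\<^sup>2" by (simp add: \<tau>_def power_mult_distrib)
      also have "\<dots> \<le> (1 + \<tau>)\<^sup>2" using \<tau> by (intro power_mono) auto
      finally have Nc: "real N \<le> (1 + \<tau>)\<^sup>2 / c\<^sup>2" using c by (simp add: pos_le_divide_eq)
      have "1 + norm \<eta> \<le> 2 * jap \<eta>" using norm_le_jap [of \<eta>] jap_ge_1 [of \<eta>] by linarith
      then have "real (2 * N) * (1 + norm \<eta>) \<le> 2 * ((1 + \<tau>)\<^sup>2 / c\<^sup>2) * (2 * jap \<eta>)"
        using Nc by (intro mult_mono) auto
      also have "\<dots> = (4 / c\<^sup>2) * jap \<eta> * (1 + \<tau>)\<^sup>2" by simp
      finally have "(real (2 * N) * (1 + norm \<eta>)) ^ m \<le> ((4 / c\<^sup>2) * jap \<eta> * (1 + \<tau>)\<^sup>2) ^ m" by (intro power_mono) auto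
      from order_trans [OF HB [OF N'(2), of \<eta>] mult_left_mono [OF this B(1)]]
      have "cmod (H (2 * N) \<eta>) \<le> (B * (4 / c\<^sup>2) ^ m) * (jap \<eta> ^ m * (1 + \<tau>) ^ (2 * m))"
        unfolding power_mult_distrib power_mult [symmetric] by (simp only: mult.assoc)
      also have "\<dots> \<le> A0 * (jap \<eta> ^ m * (1 + \<tau>) ^ (2 * m))"
        using C2 A0 \<tau> jap_pos [of \<eta>] by (intro mult_right_mono) auto
      finally show ?thesis using False by (simp add: w_def cone_weight_outside \<tau>_def mult.assoc)
    qed
    define g where "g = (\<lambda>\<eta>. H (2 * N) \<eta> * (of_real (\<xi> $ j + 2 * (\<eta> - \<xi>) $ j) * kern x0 (2 * real N) (\<eta> - \<xi>)))"
    have "g \<eta> = of_real (\<xi> $ j) * (H (2 * N) \<eta> * kern x0 (2 * real N) (\<eta> - \<xi>)) +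
      2 * (H (2 * N) \<eta> * (of_real ((\<eta> - \<xi>) $ j) * kern x0 (2 * real N) (\<eta> - \<xi>)))" for \<eta>
      by (simp add: g_def algebra_simps)
    then have "(LINT \<eta>|lborel. g \<eta>) = of_real (\<xi> $ j) * kint x0 (H (2 * N)) (2 * real N) \<xi> + 2 * T N \<xi>"
      using Ti [OF N'(1), of \<xi>] kern_integrable [OF N'(5) Hm [OF N'(2)] Hp [OF N'(2)], of x0 \<xi>]
      by (simp only: kint_def T_def Bochner_Integration.integral_add integrable_mult_right integral_mult_right_zero)
    then have "cmod (H' N \<xi>) = cmod (LINT \<eta>|lborel. g \<eta>)"
      unfolding norm_H' [OF N'(1)] using half [OF N'(1)] by simp
    also have "\<dots> \<le> K * exp ((real k)\<^sup>2 / (4 * real N)) * (A0 * (2 * jap \<xi>)) * (jap \<xi> ^ m / w \<xi> ^ k)"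
    proof (rule gaussian_boundD [OF K(2) N'(3) order_refl])
      show "0 \<le> A0 * (2 * jap \<xi>)" using A0 jap_pos [of \<xi>] by simp
      fix \<eta>
      define \<tau> where "\<tau> = sqrt (real N) * norm (\<eta> - \<xi>)"
      have t: "norm (\<eta> - \<xi>) \<le> \<tau>" "\<tau> \<ge> 0" using N'(3) mult_right_mono [of 1 "sqrt (real N)" "norm (\<eta> - \<xi>)"] by (auto simp: \<tau>_def)
      have "\<bar>\<xi> $ j + 2 * (\<eta> - \<xi>) $ j\<bar> \<le> norm \<xi> + 2 * norm (\<eta> - \<xi>)"
        using component_le_norm_cart [of \<xi> j] component_le_norm_cart [of "\<eta> - \<xi>" j] by linarith
      also have "\<dots> \<le> jap \<xi> + 2 * (jap \<xi> * \<tau>)"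
        using norm_le_jap [of \<xi>] t mult_right_mono [OF jap_ge_1 [of \<xi>] t(2)] by linarith
      also have "\<dots> \<le> (2 * jap \<xi>) * (1 + \<tau>)" using jap_pos [of \<xi>] by (simp add: distrib_left)
      finally have 1: "\<bar>\<xi> $ j + 2 * (\<eta> - \<xi>) $ j\<bar> \<le> (2 * jap \<xi>) * (1 + \<tau>)" .
      have "cmod (g \<eta>) = cmod (H (2 * N) \<eta>) * (\<bar>\<xi> $ j + 2 * (\<eta> - \<xi>) $ j\<bar> * heat (2 * real N) (\<eta> - \<xi>))"
        unfolding g_def norm_mult norm_of_real using N' by (simp add: norm_kern)
      also have "\<dots> \<le> (A0 * (jap \<eta> ^ m / w \<eta> ^ k) * (1 + \<tau>) ^ (2 * m)) * (((2 * jap \<xi>) * (1 + \<tau>)) * heat (2 * real N) (\<eta> - \<xi>))"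
        using Hb [of \<eta>] A0 t wp [of \<eta>] jap_pos [of \<eta>] N' unfolding \<tau>_def [symmetric]
        by (intro mult_mono mult_right_mono 1) auto
      also have "\<dots> = (A0 * (2 * jap \<xi>)) * (jap \<eta> ^ m / w \<eta> ^ k) * (1 + \<tau>) ^ (2 * m + 1) * heat (2 * real N) (\<eta> - \<xi>)"
        by (simp add: power_add mult_ac)
      finally show "cmod (g \<eta>) \<le> (A0 * (2 * jap \<xi>)) * (jap \<eta> ^ m / w \<eta> ^ k) * (1 + sqrt (real N) * norm (\<eta> - \<xi>)) ^ (2 * m + 1) * heat (2 * real N) (\<eta> - \<xi>)"
        unfolding \<tau>_def .
    qed
    also have "\<dots> = exp ((real k)\<^sup>2 / (4 * real N)) * ((2 * K * C2) * C2 ^ k * gevrey_weight s k * (jap \<xi> ^ (m + 1) / w \<xi> ^ k))"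
      by (simp add: A0_def mult_ac)
    also have "\<dots> \<le> exp 1 ^ k * ((2 * K * C2) * C2 ^ k * gevrey_weight s k * (jap \<xi> ^ (m + 1) / w \<xi> ^ k))"
    proof (intro mult_right_mono)
      have "(real k)\<^sup>2 / (4 * real N) = real k * (real k / (4 * real N))" by (simp add: power2_eq_square)
      also have "\<dots> \<le> real k * 1" using N' by (intro mult_left_mono) (auto simp: field_simps)
      finally have "exp ((real k)\<^sup>2 / (4 * real N)) \<le> exp (real k * 1)" by simp
      then show "exp ((real k)\<^sup>2 / (4 * real N)) \<le> exp 1 ^ k" by (simp only: exp_of_nat_mult)
      show "0 \<le> (2 * K * C2) * C2 ^ k * gevrey_weight s k * (jap \<xi> ^ (m + 1) / w \<xi> ^ k)"
        using K(1) C2 W jap_pos [of \<xi>] wp [of \<xi>] by simp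
    qed
    also have "\<dots> = (2 * K * C2) * (C2 * exp 1) ^ k * gevrey_weight s k * (jap \<xi> ^ (m + 1) / w \<xi> ^ k)"
      by (simp add: power_mult_distrib mult_ac)
    also have "\<dots> \<le> C3 ^ (n + 1) * gevrey_weight s n / jap \<xi> ^ n"
      unfolding k_def w_def [symmetric]
    proof (rule C3(2))
      show "jap \<xi> \<le> (1 + 1 / c) * w \<xi>" unfolding w_def by (rule jap_le_cone_weight [OF c ci [OF \<xi>(1)]])
    qed
    finally show ?thesis .
  qed

  define Q' where "Q' = max 1 Q"
  define C4 where "C4 = C3 + 2 * Q'"
  have Q': "1 \<le> Q'" "Q \<le> Q'" by (auto simp: Q'_def)
  have dec_H': "cmod (H' N \<xi>) \<le> C4 ^ (n + 1) * gevrey_weight s n / jap \<xi> ^ n"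
    if N: "N0 + N1 + m + 1 \<le> N" and \<xi>: "\<xi> \<in> cone_around \<xi>0 (\<epsilon> / 2)" and n: "n \<le> N" for N \<xi> n
  proof -
    have W: "1 \<le> gevrey_weight s n" by (rule gevrey_weight_ge_1 [OF s(1)])
    have mono: "D ^ (n + 1) * gevrey_weight s n / jap \<xi> ^ n \<le> C4 ^ (n + 1) * gevrey_weight s n / jap \<xi> ^ n" if "0 \<le> D" "D \<le> C4" for D
      using that W jap_pos [of \<xi>] by (intro divide_right_mono mult_right_mono power_mono) auto
    show ?thesis
    proof (cases "1 \<le> norm \<xi>")
      case True
      have "cmod (H' N \<xi>) \<le> C3 ^ (n + 1) * gevrey_weight s n / jap \<xi> ^ n" using high [OF _ \<xi> True n] N by simp
      then show ?thesis using mono [of C3] C3(1) Q' by (simp add: C4_def)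
    next
      case False
      \<comment> \<open>Where the bracket is at most 2, a bound uniform in \<open>N\<close> is a
        decay estimate of every order, with a constant geometric in \<open>n\<close>.\<close>
      have "jap \<xi> \<le> 2" using jap_le [of \<xi>] False by simp
      then have "jap \<xi> ^ n \<le> 2 ^ n" using jap_pos [of \<xi>] by (intro power_mono) auto
      then have 1: "1 \<le> 2 ^ n / jap \<xi> ^ n" using jap_pos [of \<xi>] by simp
      have "cmod (H' N \<xi>) \<le> Q" using Q [of N \<xi>] N \<xi> K1h False by auto
      also have "\<dots> \<le> Q' * 1 * 1" using Q' by simp
      also have "\<dots> \<le> Q' ^ (n + 1) * gevrey_weight s n * (2 ^ n / jap \<xi> ^ n)"
        using Q' W 1 self_le_power [of Q' "n + 1"] jap_pos [of \<xi>] by (intro mult_mono) auto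
      also have "\<dots> \<le> Q' ^ (n + 1) * gevrey_weight s n * (2 ^ (n + 1) / jap \<xi> ^ n)"
        using Q' W jap_pos [of \<xi>] by (intro mult_left_mono divide_right_mono power_increasing) auto
      also have "\<dots> = (2 * Q') ^ (n + 1) * gevrey_weight s n / jap \<xi> ^ n"
        by (simp only: power_mult_distrib times_divide_eq_right mult_ac)
      finally show ?thesis using mono [of "2 * Q'"] C3(1) Q' by (simp add: C4_def)
    qed
  qed
  show ?thesis
    unfolding gevrey_decay_def
  proof (rule exI [of _ "cone_around \<xi>0 (\<epsilon> / 2)"], rule exI [of _ C4], rule exI [of _ "N0 + N1 + m + 1"], intro conjI allI impI)
    show "open_cone (cone_around \<xi>0 (\<epsilon> / 2))" using \<epsilon> by (intro open_cone_around) auto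
    show "\<xi>0 \<in> cone_around \<xi>0 (\<epsilon> / 2)" using \<epsilon> by (intro center_in_cone_around) auto
    show "C4 > 0" using C3(1) Q' by (simp add: C4_def)
    show "N0 + N1 + m + 1 > 0" by simp
    fix N assume N: "N0 + N1 + m + 1 \<le> N"
    have N': "N > 0" "N0 \<le> 2 * N" "2 * real N > 0" using N by auto
    have cont: "continuous_on UNIV (H' N)"
      unfolding H'_def using Hm [OF N'(2)]
      by (intro continuous_intros kint_continuous N' Hm Hp poly_bounded_coord_mult) measurable
    have "is_function (fourier (mult_dist (\<lambda>\<phi>. u (partial_deriv j \<phi>)) (gauss x0 N))) (H' N)"
      unfolding H'_def by (rule is_function_gauss_partial_deriv [OF Hfun [OF N'(2)] Hp [OF N'(2)] N'(1)])
    then show "\<exists>k. continuous_on UNIV k \<and> is_function (fourier (mult_dist (\<lambda>\<phi>. u (partial_deriv j \<phi>)) (gauss x0 N))) k \<and>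
      (\<forall>\<xi>\<in>cone_around \<xi>0 (\<epsilon> / 2). \<forall>n\<le>N. cmod (k \<xi>) \<le> C4 ^ (n + 1) * gevrey_weight s n / jap \<xi> ^ n)"
      using cont dec_H' [OF N] by (intro exI [of _ "H' N"]) auto
  qed
qed

section \<open>Differential operators with constant coefficients\<close>

lemma tempered_pdl:
  "u \<in> tempered_distributions \<Longrightarrow> (\<lambda>\<phi>. u (pdl js \<phi>)) \<in> tempered_distributions"
proof (induction js arbitrary: u)
  case (Cons j js)
  from Cons.IH [OF tempered_partial_deriv [OF Cons.prems, of j]] show ?case by simp
qed simp

lemma gevrey_decay_pdl:
  "u \<in> tempered_distributions \<Longrightarrow> gevrey_decay s u x0 \<xi>0 \<Longrightarrow> 0 \<le> s \<Longrightarrow> s \<le> 1 \<Longrightarrow>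
    gevrey_decay s (\<lambda>\<phi>. u (pdl js \<phi>)) x0 \<xi>0"
proof (induction js arbitrary: u)
  case (Cons j js)
  from Cons.IH [OF tempered_partial_deriv [OF Cons.prems(1), of j] gevrey_decay_partial_deriv [OF Cons.prems] Cons.prems(3,4)]
  show ?case by simp
qed simp

lemma tempered_cong:
  assumes "\<And>\<phi>. \<phi> \<in> schwartz_functions \<Longrightarrow> u \<phi> = v \<phi>" "u \<in> tempered_distributions"
  shows "v \<in> tempered_distributions"
proof -
  have "linear_functional_on schwartz_functions v"
    using assms(2) unfolding tempered_iff linear_functional_on_def
    by (simp add: assms(1) [symmetric] schwartz_add schwartz_cmult)
  then show ?thesis using assms unfolding tempered_iff by auto
qed

lemma PD_eq_sum_pdl:
  assumes u: "u \<in> tempered_distributions" and \<phi>: "\<phi> \<in> schwartz_functions"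
  shows "PD m a u \<phi> = (\<Sum>\<alpha> | mi_size \<alpha> \<le> m. (a \<alpha> * \<i> ^ mi_size \<alpha>) * u (pdl (mi_list \<alpha>) \<phi>))"
proof -
  have lin: "u (\<lambda>x. c * \<psi> x) = c * u \<psi>" if "\<psi> \<in> schwartz_functions" for c \<psi>
    using u that unfolding tempered_distributions_def linear_functional_on_def by auto
  \<comment> \<open>The transposition sign and the factor of \<open>D_deriv\<close> combine to
    \<open>\<i>\<close> for each derivative.\<close>
  have "D_dist \<alpha> u \<phi> = \<i> ^ mi_size \<alpha> * u (pdl (mi_list \<alpha>) \<phi>)" for \<alpha>
    using lin [OF schwartz_pdl [OF \<phi>], of "(- \<i>) ^ mi_size \<alpha>" "mi_list \<alpha>"]
    by (simp add: D_dist_def D_deriv_def [abs_def] mi_deriv_eq_pdl flip: mult.assoc power_mult_distrib)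
  then show ?thesis by (simp add: PD_def mult.assoc)
qed

lemma PD_preserves:
  assumes u: "u \<in> tempered_distributions"
  shows tempered_PD: "PD m a u \<in> tempered_distributions"
    and gevrey_decay_PD: "gevrey_decay s u x0 \<xi>0 \<Longrightarrow> 0 \<le> s \<Longrightarrow> s \<le> 1 \<Longrightarrow> gevrey_decay s (PD m a u) x0 \<xi>0"
proof -
  \<comment> \<open>Sums over arbitrary finite sets of multi-indices admit an induction; the empty
    sum is the zero multiple of \<open>u\<close>.\<close>
  define v where "v = (\<lambda>S \<phi>. \<Sum>\<alpha>\<in>S. (a \<alpha> * \<i> ^ mi_size \<alpha>) * u (pdl (mi_list \<alpha>) \<phi>))"
  have eq: "v {\<alpha>. mi_size \<alpha> \<le> m} \<phi> = PD m a u \<phi>" if "\<phi> \<in> schwartz_functions" for \<phi>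
    unfolding v_def by (rule PD_eq_sum_pdl [OF u that, symmetric])
  have "v S \<in> tempered_distributions" if "finite S" for S
    using that
  proof induction
    case empty
    show ?case using tempered_cmult [OF u, of 0] by (simp add: v_def)
  next
    case (insert \<alpha> S)
    have "(\<lambda>\<phi>. (a \<alpha> * \<i> ^ mi_size \<alpha>) * u (pdl (mi_list \<alpha>) \<phi>) + v S \<phi>) \<in> tempered_distributions"
      by (intro tempered_add tempered_cmult tempered_pdl u insert.IH)
    then show ?case using insert.hyps by (simp add: v_def)
  qed
  from tempered_cong [OF eq this [OF finite_mi_size]]
  show "PD m a u \<in> tempered_distributions" .
  assume d: "gevrey_decay s u x0 \<xi>0" and s: "0 \<le> s" "s \<le> 1"
  have "gevrey_decay s (v S) x0 \<xi>0" if "finite S" for S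
    using that
  proof induction
    case empty
    show ?case using gevrey_decay_cmult [OF s(1) d, of 0] by (simp add: v_def)
  next
    case (insert \<alpha> S)
    have "gevrey_decay s (\<lambda>\<phi>. (a \<alpha> * \<i> ^ mi_size \<alpha>) * u (pdl (mi_list \<alpha>) \<phi>) + v S \<phi>) x0 \<xi>0"
      by (intro gevrey_decay_add gevrey_decay_cmult gevrey_decay_pdl u d s insert.IH)
    then show ?case using insert.hyps by (simp add: v_def)
  qed
  from gevrey_decay_cong [OF eq this [OF finite_mi_size]]
  show "gevrey_decay s (PD m a u) x0 \<xi>0" .
qed

section \<open>Locality of differential operators\<close>

lemma supp_partial_deriv: "supp (partial_deriv i \<phi>) \<subseteq> supp \<phi>"
  unfolding supp_def [of "partial_deriv i \<phi>"]
proof (rule closure_minimal)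
  show "closed (supp \<phi>)" by (simp add: supp_def)
  show "{x. partial_deriv i \<phi> x \<noteq> 0} \<subseteq> supp \<phi>"
  proof (clarify, rule ccontr)
    fix x assume ne: "partial_deriv i \<phi> x \<noteq> 0" and x: "x \<notin> supp \<phi>"
    have op: "open (- supp \<phi>)" by (simp add: supp_def open_Compl)
    have "\<phi> y = 0" if "y \<in> - supp \<phi>" for y
      using that closure_subset [of "{x. \<phi> x \<noteq> 0}"] by (auto simp: supp_def)
    then have "(\<phi> has_derivative (\<lambda>v. 0)) (at x)"
      using has_derivative_transform_within_open [OF has_derivative_const [of 0] op] x by (metis ComplI)
    then show False using ne partial_deriv_eq by blast
  qed
qed

lemma supp_pdl: "supp (pdl js \<phi>) \<subseteq> supp \<phi>"
  by (induction js) (auto dest: subsetD [OF supp_partial_deriv])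

lemma locally_equal_PD:
  assumes "locally_equal x0 f g"
  shows "locally_equal x0 (PD m a f) (PD m a g)"
proof -
  obtain U where U: "open U" "x0 \<in> U" "\<And>\<phi>. \<phi> \<in> test_functions \<Longrightarrow> supp \<phi> \<subseteq> U \<Longrightarrow> f \<phi> = g \<phi>"
    using assms unfolding locally_equal_def by blast
  have "PD m a f \<phi> = PD m a g \<phi>" if \<phi>: "\<phi> \<in> test_functions" "supp \<phi> \<subseteq> U" for \<phi>
  proof -
    have "f (D_deriv \<alpha> \<phi>) = g (D_deriv \<alpha> \<phi>)" for \<alpha>
    proof (rule U(3))
      have D: "D_deriv \<alpha> \<phi> = (\<lambda>x. (- \<i>) ^ mi_size \<alpha> * pdl (mi_list \<alpha>) \<phi> x)"
        by (simp add: D_deriv_def [abs_def] mi_deriv_eq_pdl)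
      have "supp (D_deriv \<alpha> \<phi>) \<subseteq> supp (pdl (mi_list \<alpha>) \<phi>)"
        unfolding supp_def D by (rule closure_mono) auto
      then have sub: "supp (D_deriv \<alpha> \<phi>) \<subseteq> supp \<phi>" using supp_pdl by blast
      show "supp (D_deriv \<alpha> \<phi>) \<subseteq> U" using sub \<phi>(2) by blast
      have "compact (supp \<phi> \<inter> supp (D_deriv \<alpha> \<phi>))"
        using \<phi>(1) by (intro compact_Int_closed) (auto simp: test_functions_def supp_def)
      then have "compact (supp (D_deriv \<alpha> \<phi>))" using sub by (simp add: Int_absorb1)
      moreover have "smooth (D_deriv \<alpha> \<phi>)"
        unfolding D using \<phi>(1) by (intro smooth_mult smooth_const smooth_pdl_closed) (simp add: test_functions_def)
      ultimately show "D_deriv \<alpha> \<phi> \<in> test_functions" by (simp add: test_functions_def)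
    qed
    then show ?thesis by (simp add: PD_def D_dist_def)
  qed
  then show ?thesis using U(1,2) unfolding locally_equal_def by blast
qed

theorem theorem4p3:
  fixes f :: "('n::finite) functional"
    and a :: "'n multi_index \<Rightarrow> complex"
    and m :: nat and s :: real
  assumes "f \<in> distributions" and "1 / 2 \<le> s" and "s < 1"
  shows "WF s (PD m a f) \<subseteq> WF s f \<and> WF s f \<subseteq> WF_P s m a f \<union> Char_set m a"
proof
  have s: "0 \<le> s" "s \<le> 1" using assms by auto
  \<comment> \<open>If \<open>g\<close> is a witness for \<open>f\<close>, then
    \<open>PD m a g\<close> is one for \<open>PD m a f\<close>: it is tempered, agrees near
    \<open>x0\<close>, and inherits the decay.\<close>
  have "gevrey_regular s (PD m a f) x0 \<xi>0" if "gevrey_regular s f x0 \<xi>0" for x0 \<xi>0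
    using that s tempered_PD locally_equal_PD gevrey_decay_PD unfolding gevrey_regular_def by blast
  then show "WF s (PD m a f) \<subseteq> WF s f" unfolding WF_def by blast
  \<comment> \<open>The \<open>g\<close> supplied by \<open>Reg_P\<close> is itself the witness; off
    the characteristic set its decay follows from that of \<open>PD m a g\<close>.\<close>
  have "gevrey_regular s f x0 \<xi>0" if "(x0, \<xi>0) \<in> Reg_P s m a f" "principal_symbol m a \<xi>0 \<noteq> 0" for x0 \<xi>0
    using that s gevrey_decay_elliptic unfolding Reg_P_def gevrey_regular_def by blast
  then show "WF s f \<subseteq> WF_P s m a f \<union> Char_set m a" unfolding WF_def WF_P_def Char_set_def by blast
qed

end
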